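(* Let $l\in\mathbb{N}$, $l\ge1$, and let $u_0\in W^{2l-1,\infty}(\mathbb{T})$. Let $T>0$ and $$u\in C\big((-T,T);(W^{2l-1,\infty}(\mathbb{T}),\sigma_{H^{2l-1}(\mathbb{T})})\big)\cap C^1\big((-T,T);(W^{2l-2,\infty}(\mathbb{T}),\sigma_{H^{2l-2}(\mathbb{T})})\big)$$ be the existence time and the unique solution, provided by the local well-posedness theorem recalled in the context, of $$\partial_t u+u\,\partial_x u=A_l^{-1}C_l(u),\qquad u(0,\cdot)=u_0 .$$ Let $\xi:(-T,T)\times\mathbb{T}\to\mathbb{T}$ be its flow map, defined by $$\xi(t,x)=x+\int_0^t u(s,\xi(s,x))\,ds .$$ Then $\xi$ belongs to the space $C^{\omega}((-T,T);W^{2l-1,\infty}(\mathbb{T}))$ of analytic functions from $(-T,T)$ to $W^{2l-1,\infty}(\mathbb{T})$, where $W^{2l-1,\infty}(\mathbb{T})$ carries its usual norm topology.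
   Context: $\mathbb{T}=\mathbb{R}/\mathbb{Z}$. For $k\in\mathbb{N}$, $(W^{k,\infty}(\mathbb{T}),\sigma_{H^{k}(\mathbb{T})})$ denotes the space $W^{k,\infty}(\mathbb{T})$ endowed with the topology of $H^k(\mathbb{T})$ (with $W^{0,\infty}=L^\infty$, $H^0=L^2$). The operators are $$A_l:=\sum_{j=0}^l(-1)^j\partial_x^{2j},\qquad C_l(u):=-u\,A_l\partial_x u+A_l(u\,\partial_x u)-2(\partial_x u)A_l u .$$ For $u$ of limited regularity the equation is understood in the equivalent form $\partial_t u+u\partial_x u+\partial_x P=0$, $A_lP=\mathcal{F}[u]$, where $\mathcal{F}[u]$ is the quadratic differential polynomial of order $2l-1$ in $u$, of the form $\mathcal{F}[u]=\sum \mathfrak{c}_{m_1,m_2}(\partial_x^{m_1}u)(\partial_x^{m_2}u)$ with real constants $\mathfrak{c}_{m_1,m_2}$ and $0\le m_1,m_2\le 2l-1$, $m_1+m_2\le 2l$, such that $C_l(u)=-\partial_x\mathcal{F}[u]$ for smooth $u$. (For $l=1$ this is the Camassa-Holm equation.) Local well-posedness theorem: for every $u_0\in W^{2l-1,\infty}(\mathbb{T})$ there exist $T>0$ and a unique solution $u$ of the equation $\partial_t u+u\,\partial_x u=A_l^{-1}C_l(u)$ in the class $C((-T,T);(W^{2l-1,\infty}(\mathbb{T}),\sigma_{H^{2l-1}(\mathbb{T})}))\cap C^1((-T,T);(W^{2l-2,\infty}(\mathbb{T}),\sigma_{H^{2l-2}(\mathbb{T})}))$ with initial data $u_0$; moreover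 its flow map $\xi$ is $C^1$ over $(-T,T)$ with values in $W^{2l-1,\infty}(\mathbb{T})$. Membership of $\xi$ in a space of functions with values in $W^{2l-1,\infty}(\mathbb{T})$ is understood through the displacement $x\mapsto\xi(t,x)-x$, which is a periodic function. *)

theory Defs
  imports "HOL-Probability.Essential_Supremum"
begin

text \<open>
  Functions on the circle are 1-periodic functions on the line; \<open>torus\<close> is Lebesgue measure on one
  period.  Elements of the function spaces below are representatives; the spaces and
  norms do not distinguish periodic functions that agree almost everywhere.
\<close>

definition periodic1 :: "(real \<Rightarrow> real) \<Rightarrow> bool" where
  "periodic1 f \<longleftrightarrow> (\<forall>x. f (x + 1) = f x)"

abbreviation torus :: "real measure" where
  "torus \<equiv> lebesgue_on {0..<1}"

abbreviation cderiv :: "nat \<Rightarrow> (real \<Rightarrow> real) \<Rightarrow> real \<Rightarrow> real" where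
  "cderiv m f \<equiv> (deriv ^^ m) f"

definition smooth_torus :: "(real \<Rightarrow> real) \<Rightarrow> bool" where
  "smooth_torus f \<longleftrightarrow> periodic1 f \<and> (\<forall>m x. cderiv m f field_differentiable at x)"

definition weak_deriv :: "nat \<Rightarrow> (real \<Rightarrow> real) \<Rightarrow> (real \<Rightarrow> real) \<Rightarrow> bool" where
  "weak_deriv m f g \<longleftrightarrow>
     periodic1 f \<and> periodic1 g \<and> integrable torus f \<and> integrable torus g \<and>
     (\<forall>\<phi>. smooth_torus \<phi> \<longrightarrow>
        (\<integral>x. f x * cderiv m \<phi> x \<partial>torus) = (-1) ^ m * (\<integral>x. g x * \<phi> x \<partial>torus))"

text \<open>The weak derivative is unique only almost everywhere; this picks a representative.\<close>

definition wderiv :: "nat \<Rightarrow> (real \<Rightarrow> real) \<Rightarrow> real \<Rightarrow> real" where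
  "wderiv m f = (SOME g. weak_deriv m f g)"


definition Linf :: "(real \<Rightarrow> real) set" where
  "Linf = {f. periodic1 f \<and> f \<in> borel_measurable torus \<and> (\<exists>B. AE x in torus. \<bar>f x\<bar> \<le> B)}"

definition L2 :: "(real \<Rightarrow> real) set" where
  "L2 = {f. periodic1 f \<and> f \<in> borel_measurable torus \<and> integrable torus (\<lambda>x. (f x)\<^sup>2)}"

definition Winf :: "nat \<Rightarrow> (real \<Rightarrow> real) set" where
  "Winf k = {f \<in> Linf. \<forall>j\<le>k. \<exists>g\<in>Linf. weak_deriv j f g}"

definition Hk :: "nat \<Rightarrow> (real \<Rightarrow> real) set" where
  "Hk k = {f \<in> L2. \<forall>j\<le>k. \<exists>g\<in>L2. weak_deriv j f g}"

definition Wnorm :: "nat \<Rightarrow> (real \<Rightarrow> real) \<Rightarrow> real" where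
  "Wnorm k f = (\<Sum>j\<le>k. real_of_ereal (esssup torus (\<lambda>x. ereal \<bar>wderiv j f x\<bar>)))"

definition Hnorm :: "nat \<Rightarrow> (real \<Rightarrow> real) \<Rightarrow> real" where
  "Hnorm k f = sqrt (\<Sum>j\<le>k. \<integral>x. (wderiv j f x)\<^sup>2 \<partial>torus)"


text \<open>
  Regularity of curves \<open>I \<rightarrow> V\<close>, where the linear space \<open>V\<close> of functions carries the topology of the
  seminorm \<open>N\<close>.  \<open>N\<close> need not be the norm that defines \<open>V\<close>; derivatives and Taylor coefficients
  are required to lie in \<open>V\<close>.
\<close>

definition C0_in :: "real set \<Rightarrow> (real \<Rightarrow> real) set \<Rightarrow> ((real \<Rightarrow> real) \<Rightarrow> real) \<Rightarrow>
    (real \<Rightarrow> real \<Rightarrow> real) \<Rightarrow> bool" where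
  "C0_in I V N u \<longleftrightarrow>
     (\<forall>t\<in>I. u t \<in> V \<and> ((\<lambda>s. N (\<lambda>x. u s x - u t x)) \<longlongrightarrow> 0) (at t within I))"

definition has_deriv_in :: "real set \<Rightarrow> (real \<Rightarrow> real) set \<Rightarrow> ((real \<Rightarrow> real) \<Rightarrow> real) \<Rightarrow>
    (real \<Rightarrow> real \<Rightarrow> real) \<Rightarrow> (real \<Rightarrow> real) \<Rightarrow> real \<Rightarrow> bool" where
  "has_deriv_in I V N u v t \<longleftrightarrow>
     v \<in> V \<and> ((\<lambda>s. N (\<lambda>x. (u s x - u t x) / (s - t) - v x)) \<longlongrightarrow> 0) (at t within I)"

definition C1_in :: "real set \<Rightarrow> (real \<Rightarrow> real) set \<Rightarrow> ((real \<Rightarrow> real) \<Rightarrow> real) \<Rightarrow>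
    (real \<Rightarrow> real \<Rightarrow> real) \<Rightarrow> bool" where
  "C1_in I V N u \<longleftrightarrow>
     C0_in I V N u \<and> (\<exists>v. (\<forall>t\<in>I. has_deriv_in I V N u (v t) t) \<and> C0_in I V N v)"

definition analytic_in :: "real set \<Rightarrow> (real \<Rightarrow> real) set \<Rightarrow> ((real \<Rightarrow> real) \<Rightarrow> real) \<Rightarrow>
    (real \<Rightarrow> real \<Rightarrow> real) \<Rightarrow> bool" where
  "analytic_in I V N u \<longleftrightarrow>
     (\<forall>t\<in>I. u t \<in> V) \<and>
     (\<forall>t\<in>I. \<exists>r>0. \<exists>a. (\<forall>n. a n \<in> V) \<and>
        (\<forall>s\<in>I. \<bar>s - t\<bar> < r \<longrightarrow>
           (\<lambda>n. N (\<lambda>x. u s x - (\<Sum>k<n. (s - t) ^ k * a k x))) \<longlonglongrightarrow> 0))"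


text \<open>
  The parameter \<open>D\<close> is the differentiation used: \<open>cderiv\<close> for smooth functions, \<open>wderiv\<close> for
  functions of limited regularity.
\<close>

definition A_op :: "(nat \<Rightarrow> (real \<Rightarrow> real) \<Rightarrow> real \<Rightarrow> real) \<Rightarrow> nat \<Rightarrow> (real \<Rightarrow> real) \<Rightarrow> real \<Rightarrow> real" where
  "A_op D l f x = (\<Sum>j\<le>l. (-1) ^ j * D (2 * j) f x)"

definition C_op :: "nat \<Rightarrow> (real \<Rightarrow> real) \<Rightarrow> real \<Rightarrow> real" where
  "C_op l u x =
     - u x * A_op cderiv l (deriv u) x
     + A_op cderiv l (\<lambda>y. u y * deriv u y) x
     - 2 * deriv u x * A_op cderiv l u x"

definition flux :: "(nat \<Rightarrow> (real \<Rightarrow> real) \<Rightarrow> real \<Rightarrow> real) \<Rightarrow> nat \<Rightarrow> (nat \<Rightarrow> nat \<Rightarrow> real) \<Rightarrow>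
    (real \<Rightarrow> real) \<Rightarrow> real \<Rightarrow> real" where
  "flux D l c u x =
     (\<Sum>(m, n)\<in>{(m, n). m \<le> 2 * l - 1 \<and> n \<le> 2 * l - 1 \<and> m + n \<le> 2 * l}. c m n * D m u x * D n u x)"

text \<open>
  The coefficients are determined by this up to the antisymmetric part of \<open>c\<close>, which does not
  contribute to \<open>flux\<close>.
\<close>

definition flux_coeffs :: "nat \<Rightarrow> (nat \<Rightarrow> nat \<Rightarrow> real) \<Rightarrow> bool" where
  "flux_coeffs l c \<longleftrightarrow>
     (\<forall>u. smooth_torus u \<longrightarrow> (\<forall>x. C_op l u x = - deriv (flux cderiv l c u) x))"


text \<open>
  Solutions of \<open>u\<^sub>t + u u\<^sub>x + P\<^sub>x = 0\<close>, \<open>A P = F[u]\<close>.  The operator \<open>A\<close> is an isomorphism from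
  \<open>H\<close> of order \<open>2l\<close> onto \<open>L2\<close>, so \<open>P\<close> is determined almost everywhere by \<open>u\<close>.
\<close>

definition solution :: "nat \<Rightarrow> (nat \<Rightarrow> nat \<Rightarrow> real) \<Rightarrow> real \<Rightarrow> (real \<Rightarrow> real) \<Rightarrow>
    (real \<Rightarrow> real \<Rightarrow> real) \<Rightarrow> bool" where
  "solution l c T u0 u \<longleftrightarrow>
     C0_in {-T<..<T} (Winf (2 * l - 1)) (Hnorm (2 * l - 1)) u \<and>
     C1_in {-T<..<T} (Winf (2 * l - 2)) (Hnorm (2 * l - 2)) u \<and>
     (\<forall>t\<in>{-T<..<T}. \<exists>v. \<exists>P\<in>Hk (2 * l).
        has_deriv_in {-T<..<T} (Winf (2 * l - 2)) (Hnorm (2 * l - 2)) u v t \<and>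
        (AE x in torus. A_op wderiv l P x = flux wderiv l c (u t) x) \<and>
        (AE x in torus. v x + u t x * wderiv 1 (u t) x + wderiv 1 P x = 0)) \<and>
     (AE x in torus. u 0 x = u0 x)"

text \<open>
  \<open>\<xi>\<close> is the lift to the line of the flow on the circle, so that \<open>\<xi> t x - x\<close> is the periodic
  displacement.  \<open>U t\<close> is the continuous representative of \<open>u t\<close>, needed for pointwise evaluation.
  Integrability is explicit because the integral of a non-integrable function is 0.
\<close>

definition flow_map :: "real \<Rightarrow> (real \<Rightarrow> real \<Rightarrow> real) \<Rightarrow> (real \<Rightarrow> real \<Rightarrow> real) \<Rightarrow> bool" where
  "flow_map T u \<xi> \<longleftrightarrow>
     (\<exists>U. (\<forall>t\<in>{-T<..<T}. periodic1 (U t) \<and> continuous_on UNIV (U t) \<and>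
                         (AE x in torus. U t x = u t x)) \<and>
          (\<forall>t\<in>{-T<..<T}. \<forall>x.
             \<xi> t (x + 1) = \<xi> t x + 1 \<and>
             interval_lebesgue_integrable lborel (ereal 0) (ereal t) (\<lambda>s. U s (\<xi> s x)) \<and>
             \<xi> t x = x + (LBINT s=ereal 0..ereal t. U s (\<xi> s x))))"

definition displacement :: "(real \<Rightarrow> real \<Rightarrow> real) \<Rightarrow> real \<Rightarrow> real \<Rightarrow> real" where
  "displacement \<xi> t x = \<xi> t x - x"

text \<open>
  \<open>T\<close> and \<open>u\<close> as provided by the local well-posedness theorem for the datum \<open>u0\<close>: \<open>u\<close> is the unique
  solution on \<open>(-T, T)\<close>, and its flow is continuously differentiable in time with values in
  \<open>W\<close> of order \<open>2l - 1\<close>, for the norm topology.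
\<close>

definition lwp_solution :: "nat \<Rightarrow> (nat \<Rightarrow> nat \<Rightarrow> real) \<Rightarrow> real \<Rightarrow> (real \<Rightarrow> real) \<Rightarrow>
    (real \<Rightarrow> real \<Rightarrow> real) \<Rightarrow> bool" where
  "lwp_solution l c T u0 u \<longleftrightarrow>
     T > 0 \<and> solution l c T u0 u \<and>
     (\<forall>v. solution l c T u0 v \<longrightarrow> (\<forall>t\<in>{-T<..<T}. AE x in torus. v t x = u t x)) \<and>
     (\<forall>\<xi>. flow_map T u \<xi> \<longrightarrow>
        C1_in {-T<..<T} (Winf (2 * l - 1)) (Wnorm (2 * l - 1)) (displacement \<xi>))"

end

theory Submission
  imports Defs "HOL-Real_Asymp.Real_Asymp" "HOL-Computational_Algebra.Fundamental_Theorem_Algebra"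
begin

text \<open>
  In Lagrangian coordinates the equation becomes an ordinary differential equation with polynomial
  right-hand side. The unknowns are the space derivatives of the displacement and of the velocity along
  the flow, the reciprocal of the Jacobian, and the functions \<open>exp (\<rho> * \<xi>)\<close> for the roots \<open>\<rho>\<close> of the
  symbol of \<open>A\<close>: along the flow, the inverse of \<open>A\<close> is a combination of integrals against such
  exponentials. All unknowns are curves in the Banach algebra of bounded functions on one period, and the
  quadratic, Cauchy-product form of the system propagates bounds \<open>C R\<^sup>k / (k + 1)\<^sup>2\<close> on the normalized time
  derivatives of order \<open>k\<close>, which give analyticity.

  The Jacobian has to be bounded below locally uniformly in time. For \<open>l \<ge> 2\<close> this is a Gronwall argument, as
  \<open>u\<^sub>x\<close> is continuous in time for the supremum norm. For \<open>l = 1\<close> only the \<open>L2\<close> norm of \<open>u\<^sub>x\<close> is continuous;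
  there the quantity \<open>J + J\<^sub>t\<^sup>2 / (4 J)\<close> satisfies a Gronwall inequality.
\<close>

section \<open>Taylor coefficients of curves\<close>

text \<open>The scheme closes because no derivative is lost. With n = 2l - 1, the flux involves at
  most n space derivatives of u, which along the flow are tame functions of the unknowns; inverting
  A gains 2l derivatives, so P_x along the flow has n tame space derivatives, as many as the
  velocity that it drives. The weight 1/(k+1)^2 is used because its convolution square is at most 8
  times itself: products keep the form of the bound with constants independent of k and R, and R is
  chosen only after the constants of the right-hand side are known. The obstacle is that u is
  differentiable in time only in H^(2l-2), while the unknowns need time derivatives in the essential
  supremum norm. Time derivatives are therefore first established for integrals over space
  intervals, where the change of variables by the flow applies, and then lifted to the norm by
  continuity of the candidate derivative. Comparing integrals over all intervals also stands in for
  pointwise differentiation almost everywhere.\<close>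

definition curve_bd :: "real set \<Rightarrow> nat \<Rightarrow> real \<Rightarrow> real \<Rightarrow> (real \<Rightarrow> 'a::real_normed_vector) \<Rightarrow> (nat \<Rightarrow> real \<Rightarrow> 'a) \<Rightarrow> bool" where
  "curve_bd I N C R f e \<longleftrightarrow>
     (\<forall>t\<in>I. e 0 t = f t) \<and>
     (\<forall>k<N. \<forall>t\<in>I. (e k has_vector_derivative real (Suc k) *\<^sub>R e (Suc k) t) (at t)) \<and>
     (\<forall>k\<le>N. continuous_on I (e k) \<and> (\<forall>t\<in>I. norm (e k t) \<le> C * R ^ k / (real k + 1)\<^sup>2))"

text \<open>The coefficient \<open>e k\<close> of \<open>curve_bd\<close> stands for the k-th time
  derivative divided by k!, so that the product rule becomes a Cauchy product without binomials. The
  order \<open>N\<close> is finite because differentiability is proved together with the bounds, one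
  order at a time.\<close>

definition curve_bounded :: "real set \<Rightarrow> nat \<Rightarrow> real \<Rightarrow> real \<Rightarrow> (real \<Rightarrow> 'a::real_normed_vector) \<Rightarrow> bool" where
  "curve_bounded I N C R f \<longleftrightarrow> (\<exists>e. curve_bd I N C R f e)"

text \<open>The constant \<open>C'\<close> must not depend on \<open>N\<close> or \<open>R\<close>.
  This uniformity lets \<open>autonomous_curve_bounded\<close> choose \<open>R\<close> from the
  constants \<open>C'\<close> and then keep the same \<open>R\<close> at every order.\<close>

definition tame :: "real set \<Rightarrow> real \<Rightarrow> (real \<Rightarrow> 'a::real_normed_vector) set \<Rightarrow> (real \<Rightarrow> 'b::real_normed_vector) \<Rightarrow> bool" where
  "tame I C S f \<longleftrightarrow>
     (\<exists>C'\<ge>0. \<forall>N R. R > 0 \<longrightarrow> (\<forall>X\<in>S. curve_bounded I N C R X) \<longrightarrow> curve_bounded I N C' R f)"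

lemma sum_inverse_squares_le: "(\<Sum>i\<le>k. 1 / (real i + 1)\<^sup>2) \<le> 2 - 1 / (real k + 1)"
proof (induction k)
  case (Suc k)
  have "1 / (real k + 2)\<^sup>2 \<le> 1 / ((real k + 1) * (real k + 2))"
    by (intro divide_left_mono) (auto simp: power2_eq_square mult_right_mono)
  also have "\<dots> = 1 / (real k + 1) - 1 / (real k + 2)"
    by (simp add: field_simps)
  finally show ?case
    using Suc by (simp add: add.commute)
qed simp

text \<open>With a + b = k + 2 one has 1/(ab) = (1/a + 1/b)/(a + b); squaring and (p + q)^2 \<le> 2
  (p^2 + q^2) decouple the two indices. Each of the two remaining sums is at most 2, which gives 8 =
  2 (2 + 2).\<close>

lemma convolution_inverse_squares_le:
  "(\<Sum>i\<le>k. (1 / (real i + 1)\<^sup>2) * (1 / (real (k - i) + 1)\<^sup>2)) \<le> 8 / (real k + 1)\<^sup>2"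
proof -
  have "(\<Sum>i\<le>k. (1 / (real i + 1)\<^sup>2) * (1 / (real (k - i) + 1)\<^sup>2))
      \<le> (\<Sum>i\<le>k. 2 / (real k + 1)\<^sup>2 * (1 / (real i + 1)\<^sup>2 + 1 / (real (k - i) + 1)\<^sup>2))"
  proof (rule sum_mono)
    fix i assume "i \<in> {..k}"
    define a b where "a = real i + 1" and "b = real (k - i) + 1"
    have ab: "a > 0" "b > 0" "a + b = real k + 2"
      using \<open>i \<in> {..k}\<close> by (auto simp: a_def b_def of_nat_diff)
    have "1 / a + 1 / b = (a + b) / (a * b)" using ab(1,2) by (simp add: field_simps)
    then have "(1 / a\<^sup>2) * (1 / b\<^sup>2) = (1 / (a + b)\<^sup>2) * (1 / a + 1 / b)\<^sup>2"
      using ab(1,2) by (simp add: power_divide power_mult_distrib)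
    also have "\<dots> \<le> (1 / (a + b)\<^sup>2) * (2 * (1 / a\<^sup>2 + 1 / b\<^sup>2))"
    proof (rule mult_left_mono)
      have "0 \<le> (1 / a - 1 / b)\<^sup>2" by simp
      then show "(1 / a + 1 / b)\<^sup>2 \<le> 2 * (1 / a\<^sup>2 + 1 / b\<^sup>2)"
        by (simp add: power2_eq_square algebra_simps)
    qed simp
    also have "\<dots> \<le> (1 / (real k + 1)\<^sup>2) * (2 * (1 / a\<^sup>2 + 1 / b\<^sup>2))"
      by (intro mult_right_mono divide_left_mono power_mono) (use ab in auto)
    finally show "(1 / (real i + 1)\<^sup>2) * (1 / (real (k - i) + 1)\<^sup>2)
        \<le> 2 / (real k + 1)\<^sup>2 * (1 / (real i + 1)\<^sup>2 + 1 / (real (k - i) + 1)\<^sup>2)"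
      by (simp add: a_def b_def)
  qed
  also have "\<dots> = 2 / (real k + 1)\<^sup>2 * ((\<Sum>i\<le>k. 1 / (real i + 1)\<^sup>2) + (\<Sum>i\<le>k. 1 / (real (k - i) + 1)\<^sup>2))"
    by (simp only: sum_distrib_left[symmetric] sum.distrib)
  also have "(\<Sum>i\<le>k. 1 / (real (k - i) + 1)\<^sup>2) = (\<Sum>i\<le>k. 1 / (real i + 1)\<^sup>2)"
    by (rule sum.reindex_bij_witness[of _ "\<lambda>i. k - i" "\<lambda>i. k - i"]) auto
  also have "2 / (real k + 1)\<^sup>2 * ((\<Sum>i\<le>k. 1 / (real i + 1)\<^sup>2) + (\<Sum>i\<le>k. 1 / (real i + 1)\<^sup>2))
      \<le> 2 / (real k + 1)\<^sup>2 * (2 + 2)"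
  proof (intro mult_left_mono add_mono)
    have "(\<Sum>i\<le>k. 1 / (real i + 1)\<^sup>2) \<le> 2 - 1 / (real k + 1)" by (rule sum_inverse_squares_le)
    also have "\<dots> \<le> 2" by simp
    finally show "(\<Sum>i\<le>k. 1 / (real i + 1)\<^sup>2) \<le> 2" by simp
    then show "(\<Sum>i\<le>k. 1 / (real i + 1)\<^sup>2) \<le> 2" .
  qed simp
  finally show ?thesis by simp
qed

section \<open>Arithmetic of the coefficient bounds\<close>

lemma curve_bounded_add:
  assumes "curve_bounded I N C1 R f" "curve_bounded I N C2 R g"
  shows "curve_bounded I N (C1 + C2) R (\<lambda>t. f t + g t)"
proof -
  from assms obtain e1 e2 where e: "curve_bd I N C1 R f e1" "curve_bd I N C2 R g e2"
    by (auto simp: curve_bounded_def)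
  have "curve_bd I N (C1 + C2) R (\<lambda>t. f t + g t) (\<lambda>k t. e1 k t + e2 k t)"
    unfolding curve_bd_def
  proof (intro conjI allI impI ballI)
    fix k t assume "k < N" "t \<in> I"
    then have "(e1 k has_vector_derivative real (Suc k) *\<^sub>R e1 (Suc k) t) (at t)"
         "(e2 k has_vector_derivative real (Suc k) *\<^sub>R e2 (Suc k) t) (at t)"
      using e by (auto simp: curve_bd_def)
    from has_vector_derivative_add[OF this]
    show "((\<lambda>t. e1 k t + e2 k t) has_vector_derivative real (Suc k) *\<^sub>R (e1 (Suc k) t + e2 (Suc k) t)) (at t)"
      by (simp add: scaleR_add_right)
  next
    fix k t assume "k \<le> N" "t \<in> I"
    then have "norm (e1 k t) \<le> C1 * R ^ k / (real k + 1)\<^sup>2" "norm (e2 k t) \<le> C2 * R ^ k / (real k + 1)\<^sup>2"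
      using e by (auto simp: curve_bd_def)
    then have "norm (e1 k t + e2 k t) \<le> C1 * R ^ k / (real k + 1)\<^sup>2 + C2 * R ^ k / (real k + 1)\<^sup>2"
      by (rule norm_triangle_mono)
    then show "norm (e1 k t + e2 k t) \<le> (C1 + C2) * R ^ k / (real k + 1)\<^sup>2"
      by (simp add: add_divide_distrib distrib_right)
  qed (use e in \<open>auto simp: curve_bd_def intro!: continuous_intros\<close>)
  then show ?thesis by (auto simp: curve_bounded_def)
qed

lemma curve_bounded_linear:
  assumes "curve_bounded I N C R f" "bounded_linear h" "\<And>x. norm (h x) \<le> norm x * K" "K \<ge> 0"
  shows "curve_bounded I N (C * K) R (\<lambda>t. h (f t))"
proof -
  interpret bounded_linear h by fact
  from assms obtain e where e: "curve_bd I N C R f e"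
    by (auto simp: curve_bounded_def)
  have "curve_bd I N (C * K) R (\<lambda>t. h (f t)) (\<lambda>k t. h (e k t))"
    unfolding curve_bd_def
  proof (intro conjI allI impI ballI)
    fix k t assume "k < N" "t \<in> I"
    then have "(e k has_vector_derivative real (Suc k) *\<^sub>R e (Suc k) t) (at t)"
      using e by (auto simp: curve_bd_def)
    from has_vector_derivative[OF this]
    show "((\<lambda>t. h (e k t)) has_vector_derivative real (Suc k) *\<^sub>R h (e (Suc k) t)) (at t)"
      by (simp add: scaleR)
  next
    fix k t assume "k \<le> N" "t \<in> I"
    then have "norm (e k t) \<le> C * R ^ k / (real k + 1)\<^sup>2"
      using e by (auto simp: curve_bd_def)
    from mult_right_mono[OF this \<open>K \<ge> 0\<close>] assms(3)[of "e k t"]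
    show "norm (h (e k t)) \<le> C * K * R ^ k / (real k + 1)\<^sup>2"
      by (simp add: mult_ac)
  qed (use e in \<open>auto simp: curve_bd_def intro!: continuous_on\<close>)
  then show ?thesis by (auto simp: curve_bounded_def)
qed

lemma curve_bounded_mult:
  fixes f g :: "real \<Rightarrow> 'a::real_normed_algebra"
  assumes "curve_bounded I N C1 R f" "curve_bounded I N C2 R g" "C1 \<ge> 0" "C2 \<ge> 0" "R > 0"
  shows "curve_bounded I N (8 * C1 * C2) R (\<lambda>t. f t * g t)"
proof -
  from assms obtain a b where e: "curve_bd I N C1 R f a" "curve_bd I N C2 R g b"
    by (auto simp: curve_bounded_def)
  define c where "c k t = (\<Sum>i\<le>k. a i t * b (k - i) t)" for k t
  have "curve_bd I N (8 * C1 * C2) R (\<lambda>t. f t * g t) c"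
    unfolding curve_bd_def
  proof (intro conjI allI impI ballI)
    fix k t assume k: "k < N" "t \<in> I"
    have "(c k has_vector_derivative
        (\<Sum>i\<le>k. a i t * (real (Suc (k - i)) *\<^sub>R b (Suc (k - i)) t) + (real (Suc i) *\<^sub>R a (Suc i) t) * b (k - i) t)) (at t)"
      unfolding c_def
      by (intro has_vector_derivative_sum has_vector_derivative_mult)
         (use k e in \<open>auto simp: curve_bd_def simp del: of_nat_Suc\<close>)
    \<comment> \<open>Both sums are extended to indices up to k + 1 by a term of weight 0; the
      weights k + 1 - i and i then add up to k + 1.\<close>
    also have "(\<Sum>i\<le>k. a i t * (real (Suc (k - i)) *\<^sub>R b (Suc (k - i)) t) + (real (Suc i) *\<^sub>R a (Suc i) t) * b (k - i) t)
      = (\<Sum>i\<le>k. real (Suc k - i) *\<^sub>R (a i t * b (Suc k - i) t)) + (\<Sum>i\<le>k. real (Suc i) *\<^sub>R (a (Suc i) t * b (Suc k - Suc i) t))"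
      unfolding sum.distrib[symmetric] by (intro sum.cong) (auto simp: Suc_diff_le)
    also have "(\<Sum>i\<le>k. real (Suc k - i) *\<^sub>R (a i t * b (Suc k - i) t)) = (\<Sum>i\<le>Suc k. real (Suc k - i) *\<^sub>R (a i t * b (Suc k - i) t))"
      by simp
    also have "(\<Sum>i\<le>k. real (Suc i) *\<^sub>R (a (Suc i) t * b (Suc k - Suc i) t)) = (\<Sum>i\<le>Suc k. real i *\<^sub>R (a i t * b (Suc k - i) t))"
      by (subst sum.atMost_Suc_shift) simp
    also have "(\<Sum>i\<le>Suc k. real (Suc k - i) *\<^sub>R (a i t * b (Suc k - i) t)) + (\<Sum>i\<le>Suc k. real i *\<^sub>R (a i t * b (Suc k - i) t))
       = (\<Sum>i\<le>Suc k. real (Suc k) *\<^sub>R (a i t * b (Suc k - i) t))"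
      unfolding sum.distrib[symmetric]
      by (intro sum.cong) (auto simp: scaleR_add_left[symmetric] of_nat_diff simp del: of_nat_Suc)
    also have "\<dots> = real (Suc k) *\<^sub>R c (Suc k) t"
      by (simp add: c_def scaleR_sum_right del: sum.atMost_Suc of_nat_Suc)
    finally show "(c k has_vector_derivative real (Suc k) *\<^sub>R c (Suc k) t) (at t)" .
  next
    fix k t assume k: "k \<le> N" "t \<in> I"
    have "norm (c k t) \<le> (\<Sum>i\<le>k. (C1 * R ^ i / (real i + 1)\<^sup>2) * (C2 * R ^ (k - i) / (real (k - i) + 1)\<^sup>2))"
      unfolding c_def
    proof (rule sum_norm_le)
      fix i assume "i \<in> {..k}"
      then have "norm (a i t) \<le> C1 * R ^ i / (real i + 1)\<^sup>2" "norm (b (k - i) t) \<le> C2 * R ^ (k - i) / (real (k - i) + 1)\<^sup>2"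
        using e k by (auto simp: curve_bd_def simp del: of_nat_diff)
      then show "norm (a i t * b (k - i) t) \<le> (C1 * R ^ i / (real i + 1)\<^sup>2) * (C2 * R ^ (k - i) / (real (k - i) + 1)\<^sup>2)"
        by (intro order_trans[OF norm_mult_ineq] mult_mono) (use assms in auto)
    qed
    also have "\<dots> = (C1 * C2 * R ^ k) * (\<Sum>i\<le>k. (1 / (real i + 1)\<^sup>2) * (1 / (real (k - i) + 1)\<^sup>2))"
      unfolding sum_distrib_left by (intro sum.cong) (auto simp: power_add[symmetric] mult_ac)
    also have "\<dots> \<le> (C1 * C2 * R ^ k) * (8 / (real k + 1)\<^sup>2)"
      by (intro mult_left_mono convolution_inverse_squares_le) (use assms in auto)
    finally show "norm (c k t) \<le> 8 * C1 * C2 * R ^ k / (real k + 1)\<^sup>2" by (simp add: mult_ac)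
  next
    fix k assume "k \<le> N"
    then show "continuous_on I (c k)" unfolding c_def
      by (intro continuous_intros) (use e in \<open>auto simp: curve_bd_def\<close>)
  qed (use e in \<open>auto simp: curve_bd_def c_def\<close>)
  then show ?thesis by (auto simp: curve_bounded_def)
qed

section \<open>Closure properties of tame functions\<close>

lemma tameI_member: "X \<in> S \<Longrightarrow> C \<ge> 0 \<Longrightarrow> tame I C S X"
  by (auto simp: tame_def)

lemma tame_add: "tame I C S f \<Longrightarrow> tame I C S g \<Longrightarrow> tame I C S (\<lambda>t. f t + g t)"
proof -
  assume "tame I C S f" "tame I C S g"
  then obtain C1 C2 where C: "C1 \<ge> 0" "C2 \<ge> 0"
      "\<And>N R. R > 0 \<Longrightarrow> (\<forall>X\<in>S. curve_bounded I N C R X) \<Longrightarrow> curve_bounded I N C1 R f"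
      "\<And>N R. R > 0 \<Longrightarrow> (\<forall>X\<in>S. curve_bounded I N C R X) \<Longrightarrow> curve_bounded I N C2 R g"
    unfolding tame_def by metis
  show ?thesis unfolding tame_def
    by (rule exI[of _ "C1 + C2"]) (use C in \<open>auto intro!: curve_bounded_add\<close>)
qed

lemma tame_mult:
  fixes f g :: "real \<Rightarrow> 'a::real_normed_algebra"
  assumes "tame I C S f" "tame I C S g" shows "tame I C S (\<lambda>t. f t * g t)"
proof -
  from assms obtain C1 C2 where C: "C1 \<ge> 0" "C2 \<ge> 0"
      "\<And>N R. R > 0 \<Longrightarrow> (\<forall>X\<in>S. curve_bounded I N C R X) \<Longrightarrow> curve_bounded I N C1 R f"
      "\<And>N R. R > 0 \<Longrightarrow> (\<forall>X\<in>S. curve_bounded I N C R X) \<Longrightarrow> curve_bounded I N C2 R g"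
    unfolding tame_def by metis
  show ?thesis unfolding tame_def
    by (rule exI[of _ "8 * C1 * C2"]) (use C in \<open>auto intro!: curve_bounded_mult\<close>)
qed

lemma tame_linear:
  assumes "tame I C S f" "bounded_linear h" shows "tame I C S (\<lambda>t. h (f t))"
proof -
  from assms obtain C1 where C: "C1 \<ge> 0"
      "\<And>N R. R > 0 \<Longrightarrow> (\<forall>X\<in>S. curve_bounded I N C R X) \<Longrightarrow> curve_bounded I N C1 R f"
    unfolding tame_def by metis
  obtain K where K: "K \<ge> 0" "\<And>x. norm (h x) \<le> norm x * K"
    using bounded_linear.nonneg_bounded[OF assms(2)] by blast
  show ?thesis unfolding tame_def
    by (rule exI[of _ "C1 * K"]) (use C K assms(2) in \<open>auto intro!: curve_bounded_linear[where f = f]\<close>)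
qed

lemma tame_const: "tame I C S (\<lambda>t. c)"
proof -
  have "curve_bd I N (norm c) R (\<lambda>t. c) (\<lambda>k t. if k = 0 then c else 0)" if "R > 0" for N R
    using that by (auto simp: curve_bd_def intro!: continuous_intros)
  then show ?thesis unfolding tame_def curve_bounded_def
    by (intro exI[of _ "norm c"]) auto
qed

lemma tame_sum:
  assumes "\<And>i. i \<in> A \<Longrightarrow> tame I C S (f i)" shows "tame I C S (\<lambda>t. \<Sum>i\<in>A. f i t)"
  using assms
  by (induction A rule: infinite_finite_induct) (auto intro: tame_add tame_const)

lemma tame_uminus: "tame I C S f \<Longrightarrow> tame I C S (\<lambda>t. - f t)"
  using tame_linear[OF _ bounded_linear_minus[OF bounded_linear_ident]] by blast

lemma tame_cong:
  assumes "tame I C S f" "\<And>t. t \<in> I \<Longrightarrow> f t = g t" shows "tame I C S g"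
proof -
  have "curve_bd I N C' R f e = curve_bd I N C' R g e" for N C' R e
    using assms(2) by (auto simp: curve_bd_def)
  then show ?thesis using assms(1) by (simp add: tame_def curve_bounded_def)
qed

lemma curve_bounded_0:
  assumes "continuous_on I X" "\<And>t. t \<in> I \<Longrightarrow> norm (X t) \<le> C"
  shows "curve_bounded I 0 C R X"
  using assms unfolding curve_bounded_def curve_bd_def by (intro exI[of _ "\<lambda>k. X"]) auto

text \<open>Order \<open>N = 0\<close> of the tameness condition already carries continuity and a
  bound, and it asks nothing about derivatives of the members of \<open>S\<close>.\<close>

lemma tame_continuous_bounded:
  assumes "tame I C S f" "\<And>X. X \<in> S \<Longrightarrow> continuous_on I X" "\<And>X t. X \<in> S \<Longrightarrow> t \<in> I \<Longrightarrow> norm (X t) \<le> C"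
  shows "continuous_on I f" "\<exists>B. \<forall>t\<in>I. norm (f t) \<le> B"
proof -
  from assms(1) obtain C' where "(\<forall>X\<in>S. curve_bounded I 0 C 1 X) \<longrightarrow> curve_bounded I 0 C' 1 f"
    unfolding tame_def using zero_less_one by blast
  moreover have "\<forall>X\<in>S. curve_bounded I 0 C 1 X" using assms(2,3) by (auto intro!: curve_bounded_0)
  ultimately have "curve_bounded I 0 C' 1 f" by blast
  then obtain e where e: "curve_bd I 0 C' 1 f e" by (auto simp: curve_bounded_def)
  then have *: "continuous_on I (e 0)" "\<And>t. t \<in> I \<Longrightarrow> e 0 t = f t" "\<And>t. t \<in> I \<Longrightarrow> norm (e 0 t) \<le> C'"
    by (auto simp: curve_bd_def)
  from *(1) show "continuous_on I f" by (rule continuous_on_eq) (use * in auto)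
  show "\<exists>B. \<forall>t\<in>I. norm (f t) \<le> B"
  proof (intro exI ballI)
    fix t assume "t \<in> I" then show "norm (f t) \<le> C'" using *(2,3)[of t] by simp
  qed
qed

text \<open>If all unknowns obey the bounds to order N, tameness gives bounds for the right-hand
  sides with possibly larger constants. The coefficient of order k = m + 1 of an unknown is that of
  order m of its derivative divided by k, and the additional power of R in the bound of order k
  absorbs the larger constant.\<close>

lemma autonomous_curve_bounded:
  fixes S :: "(real \<Rightarrow> 'a::real_normed_vector) set"
  assumes "finite S" "C > 0" "open I"
    and bd: "\<And>X t. X \<in> S \<Longrightarrow> t \<in> I \<Longrightarrow> norm (X t) \<le> C"
    and der: "\<And>X t. X \<in> S \<Longrightarrow> t \<in> I \<Longrightarrow> (X has_vector_derivative X' X t) (at t)"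
    and tame: "\<And>X. X \<in> S \<Longrightarrow> tame I C S (X' X)"
  shows "\<exists>R>0. \<forall>N. \<forall>X\<in>S. curve_bounded I N C R X"
proof -
  have "\<forall>X\<in>S. \<exists>C'\<ge>0. \<forall>N R. R > 0 \<longrightarrow> (\<forall>X\<in>S. curve_bounded I N C R X) \<longrightarrow> curve_bounded I N C' R (X' X)"
    using tame by (simp add: tame_def)
  then obtain D where D: "\<And>X. X \<in> S \<Longrightarrow> D X \<ge> 0"
     "\<And>X N R. X \<in> S \<Longrightarrow> R > 0 \<Longrightarrow> (\<forall>X\<in>S. curve_bounded I N C R X) \<Longrightarrow> curve_bounded I N (D X) R (X' X)"
    by metis
  \<comment> \<open>Chosen so that \<open>D X\<close> is at most C R / 4. The factor 4 pays for (k +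
    1)^2 \<le> (2 (m + 1))^2 when the order rises from m to k = m + 1; the summand 1 keeps R
    positive.\<close>
  define R where "R = 1 + 4 * (\<Sum>X\<in>S. D X) / C"
  have R: "R > 0" "\<And>X. X \<in> S \<Longrightarrow> D X \<le> C * R / 4"
  proof -
    have s: "(\<Sum>X\<in>S. D X) \<ge> 0" by (intro sum_nonneg D)
    then show "R > 0" using \<open>C > 0\<close> by (auto simp: R_def intro!: add_pos_nonneg)
    fix X assume "X \<in> S"
    then have "D X \<le> (\<Sum>X\<in>S. D X)" using D(1) \<open>finite S\<close> by (intro member_le_sum) auto
    then show "D X \<le> C * R / 4"
      using \<open>C > 0\<close> by (simp add: R_def distrib_left)
  qed
  have cont: "continuous_on I X" if "X \<in> S" for X
    using der[OF that] by (meson continuous_at_imp_continuous_on has_vector_derivative_continuous)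
  have "\<forall>X\<in>S. curve_bounded I N C R X" for N
  proof (induction N)
    case 0 show ?case using bd cont by (auto intro: curve_bounded_0)
  next
    case (Suc N)
    show ?case
    proof
      fix X assume X: "X \<in> S"
      from D(2)[OF X R(1) Suc] obtain e where e: "curve_bd I N (D X) R (X' X) e"
        by (auto simp: curve_bounded_def)
      define a where "a k t = (case k of 0 \<Rightarrow> X t | Suc k \<Rightarrow> e k t /\<^sub>R real (Suc k))" for k t
      have "curve_bd I (Suc N) C R X a" unfolding curve_bd_def
      proof (intro conjI allI impI ballI)
        fix k t assume k: "k < Suc N" "t \<in> I"
        show "(a k has_vector_derivative real (Suc k) *\<^sub>R a (Suc k) t) (at t)"
        proof (cases k)
          case 0
          then have "a k = X" "a (Suc k) t = X' X t" using e k by (auto simp: a_def curve_bd_def)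
          then show ?thesis using der[OF X k(2)] 0 by simp
        next
          case (Suc m)
          then have ak: "a k = (\<lambda>t. e m t /\<^sub>R real k)" by (auto simp: a_def)
          have "(e m has_vector_derivative real k *\<^sub>R e k t) (at t)"
            using e k Suc by (auto simp: curve_bd_def)
          from bounded_linear.has_vector_derivative[OF bounded_linear_scaleR_right[of "inverse (real k)"] this]
          show ?thesis unfolding ak using Suc by (simp add: a_def)
        qed
      next
        fix k t assume k: "k \<le> Suc N" "t \<in> I"
        show "norm (a k t) \<le> C * R ^ k / (real k + 1)\<^sup>2"
        proof (cases k)
          case 0 then show ?thesis using bd[OF X k(2)] by (simp add: a_def)
        next
          case (Suc m)
          have "norm (a k t) = norm (e m t) / real k" using Suc by (simp add: a_def divide_inverse mult.commute)
          also have "\<dots> \<le> (D X * R ^ m / (real m + 1)\<^sup>2) / real k"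
            using e k Suc by (intro divide_right_mono) (auto simp: curve_bd_def)
          also have "\<dots> \<le> (C * R / 4 * R ^ m / (real m + 1)\<^sup>2) / 1"
            using Suc R X D(1)[OF X] \<open>C > 0\<close> by (intro frac_le divide_right_mono mult_right_mono) auto
          also have "\<dots> = C * R ^ k / (2 * (real m + 1))\<^sup>2"
            using Suc by (simp add: power2_eq_square algebra_simps)
          also have "\<dots> \<le> C * R ^ k / (real k + 1)\<^sup>2"
            using Suc \<open>C > 0\<close> R(1) by (intro divide_left_mono power_mono) auto
          finally show ?thesis .
        qed
      next
        fix k assume k: "k \<le> Suc N"
        show "continuous_on I (a k)"
        proof (cases k)
          case 0 then show ?thesis using cont[OF X] by (simp add: a_def)
        next
          case (Suc m) then show ?thesis using e k
            by (auto simp: a_def curve_bd_def intro!: continuous_intros)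
        qed
      qed (simp add: a_def)
      then show "curve_bounded I (Suc N) C R X" by (auto simp: curve_bounded_def)
    qed
  qed
  with R(1) show ?thesis by blast
qed

text \<open>On an open set the coefficients are determined by successive differentiation, so the
  families obtained for different orders agree and the diagonal family serves all orders.\<close>

lemma curve_bounded_imp_smooth:
  assumes "open I" "\<And>N. curve_bounded I N C R X"
  shows "\<exists>e. \<forall>N. curve_bd I N C R X e"
proof -
  have "\<forall>N. \<exists>e. curve_bd I N C R X e" using assms(2) by (simp add: curve_bounded_def)
  then obtain E where E: "\<And>N. curve_bd I N C R X (E N)" by metis
  have uniq: "E N k t = E M k t" if "k \<le> N" "k \<le> M" "t \<in> I" for N M k t
    using that
  proof (induction k arbitrary: t)
    case 0 then show ?case using E[of N] E[of M] by (simp add: curve_bd_def)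
  next
    case (Suc k)
    have 1: "(E N k has_vector_derivative real (Suc k) *\<^sub>R E N (Suc k) t) (at t)"
      using E[of N] Suc.prems by (auto simp: curve_bd_def)
    have 2: "(E M k has_vector_derivative real (Suc k) *\<^sub>R E M (Suc k) t) (at t)"
      using E[of M] Suc.prems by (auto simp: curve_bd_def)
    have "(E N k has_vector_derivative real (Suc k) *\<^sub>R E M (Suc k) t) (at t)"
      by (rule has_vector_derivative_transform_within_open[OF 2 \<open>open I\<close> \<open>t \<in> I\<close>])
         (use Suc in auto)
    from vector_derivative_unique_at[OF 1 this] show ?case by simp
  qed
  have "curve_bd I N C R X (\<lambda>k. E k k)" for N
    unfolding curve_bd_def
  proof (intro conjI allI impI ballI)
    fix t assume "t \<in> I" then show "E 0 0 t = X t" using E[of 0] by (simp add: curve_bd_def)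
  next
    fix k t assume "k < N" "t \<in> I"
    have 1: "(E N k has_vector_derivative real (Suc k) *\<^sub>R E N (Suc k) t) (at t)"
      using E[of N] \<open>k < N\<close> \<open>t \<in> I\<close> by (auto simp: curve_bd_def)
    have "(E k k has_vector_derivative real (Suc k) *\<^sub>R E N (Suc k) t) (at t)"
      by (rule has_vector_derivative_transform_within_open[OF 1 \<open>open I\<close> \<open>t \<in> I\<close>])
         (use \<open>k < N\<close> in \<open>auto intro: uniq\<close>)
    moreover have "E N (Suc k) t = E (Suc k) (Suc k) t" using \<open>k < N\<close> \<open>t \<in> I\<close> by (intro uniq) auto
    ultimately show "(E k k has_vector_derivative real (Suc k) *\<^sub>R E (Suc k) (Suc k) t) (at t)" by simp
  next
    fix k assume "k \<le> N" show "continuous_on I (E k k)" using E[of k] by (simp add: curve_bd_def)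
  next
    fix k t assume "k \<le> N" "t \<in> I" then show "norm (E k k t) \<le> C * R ^ k / (real k + 1)\<^sup>2"
      using E[of k] by (simp add: curve_bd_def)
  qed
  then show ?thesis by blast
qed

text \<open>Taylor's theorem, by applying the mean value inequality to the Taylor polynomial at \<open>s\<close>
  with moving centre \<open>\<tau>\<close>, whose derivative in \<open>\<tau>\<close> telescopes.\<close>

lemma curve_bd_taylor:
  fixes X :: "real \<Rightarrow> 'a::real_normed_vector"
  assumes "is_interval I" "\<And>N. curve_bd I N C R X e" "C \<ge> 0" "R > 0" "s \<in> I" "t \<in> I"
  shows "norm (X s - (\<Sum>k<N. (s - t) ^ k *\<^sub>R e k t)) \<le> C * (R * \<bar>s - t\<bar>) ^ N"
proof (cases N)
  case 0
  have "norm (e 0 s) \<le> C * R ^ 0 / (real 0 + 1)\<^sup>2" "e 0 s = X s"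
    using assms(2)[of 0] \<open>s \<in> I\<close> unfolding curve_bd_def by blast+
  then show ?thesis using 0 by simp
next
  case (Suc M)
  define h where "h \<tau> = (\<Sum>k<N. (s - \<tau>) ^ k *\<^sub>R e k \<tau>)" for \<tau>
  have sub: "closed_segment t s \<subseteq> I"
    using assms(1,5,6) by (simp add: closed_segment_subset is_interval_convex)
  have der: "(h has_vector_derivative real N *\<^sub>R (s - \<tau>) ^ M *\<^sub>R e N \<tau>) (at \<tau>)" if "\<tau> \<in> I" for \<tau>
  proof -
    have ek: "(e k has_vector_derivative real (Suc k) *\<^sub>R e (Suc k) \<tau>) (at \<tau>)" for k
      using assms(2)[of "Suc k"] that by (auto simp: curve_bd_def)
    have "(h has_vector_derivative
       (\<Sum>k<N. (s - \<tau>) ^ k *\<^sub>R (real (Suc k) *\<^sub>R e (Suc k) \<tau>) + (real k * (s - \<tau>) ^ (k - 1) * -1) *\<^sub>R e k \<tau>)) (at \<tau>)"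
      unfolding h_def
    proof (intro has_vector_derivative_sum has_vector_derivative_scaleR ek)
      fix k show "((\<lambda>x. (s - x) ^ k) has_real_derivative real k * (s - \<tau>) ^ (k - 1) * - 1) (at \<tau>)"
        by (auto intro!: derivative_eq_intros)
    qed
    also have "(\<Sum>k<n. (s - \<tau>) ^ k *\<^sub>R (real (Suc k) *\<^sub>R e (Suc k) \<tau>) + (real k * (s - \<tau>) ^ (k - 1) * -1) *\<^sub>R e k \<tau>)
        = (real n * (s - \<tau>) ^ (n - 1)) *\<^sub>R e n \<tau>" for n
      by (induction n) (auto simp: algebra_simps)
    finally show ?thesis using Suc by simp
  qed
  have B: "norm (real N *\<^sub>R (s - \<tau>) ^ M *\<^sub>R e N \<tau> - 0) \<le> C * R ^ N * \<bar>s - t\<bar> ^ M" if "\<tau> \<in> closed_segment t s" for \<tau>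
  proof -
    have "norm (e N \<tau>) \<le> C * R ^ N / (real N + 1)\<^sup>2"
      using assms(2)[of N] sub that unfolding curve_bd_def by blast
    moreover have "\<bar>s - \<tau>\<bar> ^ M \<le> \<bar>s - t\<bar> ^ M"
      using that by (intro power_mono) (auto simp: closed_segment_eq_real_ivl split: if_splits)
    ultimately have "real N * (\<bar>s - \<tau>\<bar> ^ M * norm (e N \<tau>)) \<le> real N * (\<bar>s - t\<bar> ^ M * (C * R ^ N / (real N + 1)\<^sup>2))"
      using assms by (intro mult_left_mono mult_mono) auto
    also have "\<dots> = (C * R ^ N * \<bar>s - t\<bar> ^ M) * (real N / (real N + 1)\<^sup>2)" by simp
    also have "\<dots> \<le> (C * R ^ N * \<bar>s - t\<bar> ^ M) * 1"
    proof (intro mult_left_mono)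
      have "real N \<le> (real N + 1)\<^sup>2" by (simp add: power2_eq_square algebra_simps)
      then show "real N / (real N + 1)\<^sup>2 \<le> 1" by (simp add: divide_le_eq_1)
    qed (use assms in auto)
    finally show ?thesis by (simp add: abs_mult power_abs)
  qed
  have "norm (h s - h t - (s - t) *\<^sub>R 0) \<le> norm (s - t) * (C * R ^ N * \<bar>s - t\<bar> ^ M)"
  proof -
    have "norm (h s - h t) \<le> (C * R ^ N * \<bar>s - t\<bar> ^ M) * norm (s - t)"
    proof (rule differentiable_bound[where S = "closed_segment t s" and f' = "\<lambda>\<tau> x. x *\<^sub>R (real N *\<^sub>R (s - \<tau>) ^ M *\<^sub>R e N \<tau>)"])
      fix \<tau> assume \<tau>: "\<tau> \<in> closed_segment t s"
      show "(h has_derivative (\<lambda>x. x *\<^sub>R (real N *\<^sub>R (s - \<tau>) ^ M *\<^sub>R e N \<tau>))) (at \<tau> within closed_segment t s)"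
        using der[of \<tau>] sub \<tau> by (auto simp: has_vector_derivative_def intro: has_derivative_at_withinI)
      show "onorm (\<lambda>x. x *\<^sub>R (real N *\<^sub>R (s - \<tau>) ^ M *\<^sub>R e N \<tau>)) \<le> C * R ^ N * \<bar>s - t\<bar> ^ M"
      proof (rule onorm_le)
        fix x :: real
        have "norm (x *\<^sub>R (real N *\<^sub>R (s - \<tau>) ^ M *\<^sub>R e N \<tau>)) = norm x * norm (real N *\<^sub>R (s - \<tau>) ^ M *\<^sub>R e N \<tau> - 0)"
          by (simp only: norm_scaleR diff_0_right real_norm_def)
        then show "norm (x *\<^sub>R (real N *\<^sub>R (s - \<tau>) ^ M *\<^sub>R e N \<tau>)) \<le> C * R ^ N * \<bar>s - t\<bar> ^ M * norm x"
          using mult_left_mono[OF B[OF \<tau>], of "norm x"] by (simp only: mult.commute norm_ge_zero)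
      qed
    qed auto
    then show ?thesis by (simp add: mult.commute)
  qed
  have "h s = X s"
  proof -
    have "h s = (\<Sum>k<Suc M. 0 ^ k *\<^sub>R e k s)" by (simp add: h_def Suc)
    also have "\<dots> = e 0 s" by (subst sum.lessThan_Suc_shift) simp
    finally show ?thesis using assms(2)[of 0] \<open>s \<in> I\<close> by (simp add: curve_bd_def)
  qed
  then show ?thesis
    using \<open>norm (h s - h t - (s - t) *\<^sub>R 0) \<le> norm (s - t) * (C * R ^ N * \<bar>s - t\<bar> ^ M)\<close> Suc
    by (simp add: h_def power_mult_distrib mult_ac)
qed

section \<open>Primitives of locally bounded Borel functions\<close>

text \<open>Borel measurability and bounds at every point of a compact interval, instead of Lebesgue
  measurability and essential bounds, make the class stable under composition with continuous maps,
  in particular with the flow.\<close>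

definition lbb :: "(real \<Rightarrow> 'b::euclidean_space) \<Rightarrow> bool" where
  "lbb f \<longleftrightarrow> f \<in> borel_measurable borel \<and> (\<forall>a b. \<exists>B. \<forall>x\<in>{a..b}. norm (f x) \<le> B)"

text \<open>Absolute continuity with a chosen derivative \<open>g\<close>, expressed by the integral
  identity alone. Pointwise differentiability does not enter, and \<open>g\<close> may be changed on
  null sets by \<open>ac_transfer\<close>.\<close>

definition ac :: "(real \<Rightarrow> 'b::euclidean_space) \<Rightarrow> (real \<Rightarrow> 'b) \<Rightarrow> bool" where
  "ac f g \<longleftrightarrow> (\<forall>a b. g absolutely_integrable_on {a..b}) \<and>
     (\<forall>x y. x \<le> y \<longrightarrow> f y - f x = integral {x..y} g)"

section \<open>Locally bounded Borel functions\<close>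

lemma borel_measurable_lebesgue_onI: "f \<in> borel_measurable borel \<Longrightarrow> f \<in> borel_measurable (lebesgue_on S)"
  by (rule measurable_restrict_space1, rule measurable_completion) simp

lemma lbb_absolutely_integrable: "lbb g \<Longrightarrow> g absolutely_integrable_on {a..b}"
proof -
  assume g: "lbb g"
  then obtain B where B: "\<And>x. x \<in> {a..b} \<Longrightarrow> norm (g x) \<le> B" unfolding lbb_def by meson
  show ?thesis
    by (rule measurable_bounded_by_integrable_imp_absolutely_integrable[where g = "\<lambda>_. B"])
       (use g B in \<open>auto simp: lbb_def intro: borel_measurable_lebesgue_onI\<close>)
qed

lemma lbb_measurable [measurable_dest]: "lbb f \<Longrightarrow> f \<in> borel_measurable borel"
  by (simp add: lbb_def)

lemma lbb_boundE:
  assumes "lbb f" obtains B where "B > 0" "\<And>x. x \<in> {a..b} \<Longrightarrow> norm (f x) \<le> B"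
proof -
  obtain B where "\<And>x. x \<in> {a..b} \<Longrightarrow> norm (f x) \<le> B" using assms unfolding lbb_def by meson
  then show thesis by (intro that[of "\<bar>B\<bar> + 1"]) force+
qed

lemma lbbI:
  assumes "f \<in> borel_measurable borel" "\<And>x. norm (f x) \<le> B" shows "lbb f"
  using assms by (auto simp: lbb_def)

lemma lbb_continuous: "continuous_on UNIV f \<Longrightarrow> lbb f"
  unfolding lbb_def
proof (intro conjI allI)
  fix a b :: real assume c: "continuous_on UNIV f"
  then show "f \<in> borel_measurable borel" by (rule borel_measurable_continuous_onI)
  have "compact (f ` {a..b})" by (intro compact_continuous_image continuous_on_subset[OF c]) auto
  then show "\<exists>B. \<forall>x\<in>{a..b}. norm (f x) \<le> B"
    by (auto dest!: compact_imp_bounded simp: bounded_iff)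
qed

lemma lbb_const [intro, simp]: "lbb (\<lambda>x. c)"
  by (intro lbb_continuous continuous_intros)

lemma lbb_add: assumes "lbb f" "lbb g" shows "lbb (\<lambda>x. f x + g x)"
  unfolding lbb_def
proof (intro conjI allI)
  fix a b
  obtain A where "\<And>x. x \<in> {a..b} \<Longrightarrow> norm (f x) \<le> A" using lbb_boundE[OF assms(1)] by metis
  moreover obtain B where "\<And>x. x \<in> {a..b} \<Longrightarrow> norm (g x) \<le> B" using lbb_boundE[OF assms(2)] by metis
  ultimately show "\<exists>B. \<forall>x\<in>{a..b}. norm (f x + g x) \<le> B"
    by (meson norm_triangle_mono)
qed (use assms in measurable)

lemma lbb_mult:
  fixes f g :: "real \<Rightarrow> 'b::{euclidean_space, real_normed_algebra}"
  assumes "lbb f" "lbb g" shows "lbb (\<lambda>x. f x * g x)"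
  unfolding lbb_def
proof (intro conjI allI)
  fix a b
  obtain A where A: "\<And>x. x \<in> {a..b} \<Longrightarrow> norm (f x) \<le> A" "A > 0" using lbb_boundE[OF assms(1)] by metis
  obtain B where B: "\<And>x. x \<in> {a..b} \<Longrightarrow> norm (g x) \<le> B" using lbb_boundE[OF assms(2)] by metis
  have "norm (f x * g x) \<le> A * B" if "x \<in> {a..b}" for x
    using A B that by (intro order_trans[OF norm_mult_ineq] mult_mono) auto
  then show "\<exists>B. \<forall>x\<in>{a..b}. norm (f x * g x) \<le> B" by blast
qed (use assms in measurable)

lemma lbb_bounded_linear:
  assumes "lbb f" "bounded_linear h" shows "lbb (\<lambda>x. h (f x))"
  unfolding lbb_def
proof (intro conjI allI)
  interpret bounded_linear h by fact
  have "h \<in> borel_measurable borel"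
    using assms(2) by (intro borel_measurable_continuous_onI linear_continuous_on)
  then show "(\<lambda>x. h (f x)) \<in> borel_measurable borel" using assms(1) by measurable
  fix a b
  obtain A where A: "\<And>x. x \<in> {a..b} \<Longrightarrow> norm (f x) \<le> A" using lbb_boundE[OF assms(1)] by metis
  obtain K where K: "K > 0" "\<And>x. norm (h x) \<le> norm x * K" using pos_bounded by blast
  have "norm (h (f x)) \<le> A * K" if "x \<in> {a..b}" for x
    using A[OF that] K by (meson mult_le_cancel_right_pos order_trans)
  then show "\<exists>B. \<forall>x\<in>{a..b}. norm (h (f x)) \<le> B" by blast
qed

lemma lbb_scaleR: "lbb f \<Longrightarrow> lbb (\<lambda>x. c *\<^sub>R f x)"
  by (rule lbb_bounded_linear[of f "\<lambda>x. c *\<^sub>R x"]) (auto intro: bounded_linear_scaleR_right)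

lemma lbb_uminus: "lbb f \<Longrightarrow> lbb (\<lambda>x. - f x)"
  using lbb_scaleR[of f "-1"] by simp

lemma lbb_diff: "lbb f \<Longrightarrow> lbb g \<Longrightarrow> lbb (\<lambda>x. f x - g x)"
  using lbb_add[of f "\<lambda>x. - g x"] by (simp add: lbb_uminus)

lemma lbb_sum: "(\<And>i. i \<in> A \<Longrightarrow> lbb (f i)) \<Longrightarrow> lbb (\<lambda>x. \<Sum>i\<in>A. f i x)"
  by (induction A rule: infinite_finite_induct) (auto intro: lbb_add)

lemma lbb_power:
  fixes f :: "real \<Rightarrow> 'b::{euclidean_space, real_normed_algebra_1}"
  shows "lbb f \<Longrightarrow> lbb (\<lambda>x. f x ^ n)"
  by (induction n) (auto intro: lbb_mult)

lemma lbb_complex_of_real: "lbb f \<Longrightarrow> lbb (\<lambda>x. complex_of_real (f x))"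
  by (rule lbb_bounded_linear[OF _ bounded_linear_of_real])

lemma lbb_compose:
  assumes "lbb f" "continuous_on UNIV h" shows "lbb (\<lambda>x. f (h x))"
  unfolding lbb_def
proof (intro conjI allI)
  show "(\<lambda>x. f (h x)) \<in> borel_measurable borel"
    by (rule measurable_compose[OF borel_measurable_continuous_onI[OF assms(2)] lbb_measurable[OF assms(1)]])
  fix a b :: real
  obtain M where M: "\<And>x. x \<in> {a..b} \<Longrightarrow> norm (h x) \<le> M" using lbb_boundE[OF lbb_continuous[OF assms(2)]] by metis
  obtain B where "\<And>x. x \<in> {-M..M} \<Longrightarrow> norm (f x) \<le> B" using lbb_boundE[OF assms(1)] by metis
  moreover have "h x \<in> {-M..M}" if "x \<in> {a..b}" for x using M[OF that] by (auto simp: abs_le_iff)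
  ultimately show "\<exists>B. \<forall>x\<in>{a..b}. norm (f (h x)) \<le> B" by blast
qed

lemma lbb_inverse:
  fixes f :: "real \<Rightarrow> real"
  assumes "lbb f" "d > 0" "\<And>x. f x \<ge> d" shows "lbb (\<lambda>x. 1 / f x)"
proof (rule lbbI)
  show "(\<lambda>x. 1 / f x) \<in> borel_measurable borel" using assms(1) by measurable
  fix x show "norm (1 / f x) \<le> 1 / d"
    using assms(2) assms(3)[of x] by (auto intro!: divide_left_mono simp: field_simps)
qed

section \<open>Calculus of primitives\<close>

lemma acD: "ac f g \<Longrightarrow> x \<le> y \<Longrightarrow> f y - f x = integral {x..y} g"
  by (auto simp: ac_def)

lemma ac_integrable: "ac f g \<Longrightarrow> g absolutely_integrable_on {a..b}"
  by (auto simp: ac_def)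

lemma absint_integrable: "g absolutely_integrable_on S \<Longrightarrow> g integrable_on S"
  for g :: "real \<Rightarrow> 'b::euclidean_space"
  by (rule set_lebesgue_integral_eq_integral)

lemma ac_lbb: "lbb g \<Longrightarrow> (\<And>x y. x \<le> y \<Longrightarrow> f y - f x = integral {x..y} g) \<Longrightarrow> ac f g"
  by (simp add: ac_def lbb_absolutely_integrable)

lemma ac_continuous: assumes "ac f g" shows "continuous_on UNIV f"
proof -
  have "continuous_on {-n<..<n} f" for n
  proof -
    have "continuous_on {-n..n} (\<lambda>x. f (-n) + integral {-n..x} g)"
      by (intro continuous_intros indefinite_integral_continuous_1 absint_integrable ac_integrable[OF assms])
    then have "continuous_on {-n<..<n} (\<lambda>x. f (-n) + integral {-n..x} g)"
      by (rule continuous_on_subset) auto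
    then show ?thesis
    proof (rule continuous_on_eq)
      fix x assume "x \<in> {-n<..<n}"
      then show "f (-n) + integral {-n..x} g = f x" using acD[OF assms, of "-n" x] by (simp add: diff_eq_eq add.commute)
    qed
  qed
  then have "continuous_on (\<Union>n\<in>UNIV. {-n<..<n}) f"
    by (intro continuous_on_open_UN) auto
  moreover have "(\<Union>n\<in>UNIV. {-n<..<n}) = (UNIV::real set)"
  proof safe
    fix x :: real show "x \<in> (\<Union>n\<in>UNIV. {-n<..<n})" by (intro UN_I[of "\<bar>x\<bar> + 1"]) auto
  qed auto
  ultimately show ?thesis by simp
qed

lemma ac_lbb_fun: "ac f g \<Longrightarrow> lbb f"
  by (intro lbb_continuous ac_continuous)

lemma ac_add: assumes "ac f f'" "ac g g'" shows "ac (\<lambda>x. f x + g x) (\<lambda>x. f' x + g' x)"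
  unfolding ac_def
proof (intro conjI allI impI)
  fix a b show "(\<lambda>x. f' x + g' x) absolutely_integrable_on {a..b}"
    using assms by (intro set_integral_add ac_integrable)
next
  fix x y :: real assume "x \<le> y"
  have "f y + g y - (f x + g x) = (f y - f x) + (g y - g x)" by simp
  also have "\<dots> = integral {x..y} f' + integral {x..y} g'"
    using assms \<open>x \<le> y\<close> by (simp add: acD)
  also have "\<dots> = integral {x..y} (\<lambda>x. f' x + g' x)"
    by (intro Henstock_Kurzweil_Integration.integral_add[symmetric] absint_integrable ac_integrable[OF assms(1)] ac_integrable[OF assms(2)])
  finally show "f y + g y - (f x + g x) = integral {x..y} (\<lambda>x. f' x + g' x)" .
qed

lemma ac_linear: assumes "ac f f'" "bounded_linear h" shows "ac (\<lambda>x. h (f x)) (\<lambda>x. h (f' x))"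
  unfolding ac_def
proof (intro conjI allI impI)
  interpret bounded_linear h by fact
  fix a b show "(\<lambda>x. h (f' x)) absolutely_integrable_on {a..b}"
    using absolutely_integrable_linear[OF ac_integrable[OF assms(1)] assms(2)] by (simp add: o_def)
next
  interpret bounded_linear h by fact
  fix x y :: real assume "x \<le> y"
  have "h (f y) - h (f x) = h (integral {x..y} f')"
    using acD[OF assms(1) \<open>x \<le> y\<close>] by (simp add: diff[symmetric])
  also have "\<dots> = integral {x..y} (h \<circ> f')"
    using integral_linear[OF absint_integrable[OF ac_integrable[OF assms(1)]] assms(2)] by simp
  finally show "h (f y) - h (f x) = integral {x..y} (\<lambda>x. h (f' x))" by (simp add: o_def)
qed

lemma ac_const: "ac (\<lambda>x. c) (\<lambda>x. 0)" by (auto simp: ac_def)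

lemma ac_ident: "ac (\<lambda>x. x) (\<lambda>x. 1::real)"
  by (rule ac_lbb) auto

lemma ac_scaleR: "ac f f' \<Longrightarrow> ac (\<lambda>x. c *\<^sub>R f x) (\<lambda>x. c *\<^sub>R f' x)"
  using ac_linear[OF _ bounded_linear_scaleR_right] by blast

lemma ac_sum: "(\<And>i. i \<in> A \<Longrightarrow> ac (f i) (g i)) \<Longrightarrow> ac (\<lambda>x. \<Sum>i\<in>A. f i x) (\<lambda>x. \<Sum>i\<in>A. g i x)"
  by (induction A rule: infinite_finite_induct) (auto intro: ac_add ac_const)

lemma ac_uminus: "ac f f' \<Longrightarrow> ac (\<lambda>x. - f x) (\<lambda>x. - f' x)"
  using ac_scaleR[of f f' "-1"] by simp

lemma ac_diff: "ac f f' \<Longrightarrow> ac g g' \<Longrightarrow> ac (\<lambda>x. f x - g x) (\<lambda>x. f' x - g' x)"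
  using ac_add[of f f' "\<lambda>x. - g x" "\<lambda>x. - g' x"] by (simp add: ac_uminus)

lemma ac_cmult: fixes c :: "'b::{euclidean_space,real_normed_algebra}"
  shows "ac f f' \<Longrightarrow> ac (\<lambda>x. c * f x) (\<lambda>x. c * f' x)"
  using ac_linear[OF _ bounded_linear_mult_right] by blast

lemma ac_complex_of_real: "ac f f' \<Longrightarrow> ac (\<lambda>x. complex_of_real (f x)) (\<lambda>x. complex_of_real (f' x))"
  by (rule ac_linear[OF _ bounded_linear_of_real])

lemma ac_transfer:
  assumes "ac f g" "AE x in lborel. g x = h x" shows "ac f h"
proof -
  from assms(2) have "AE x in lebesgue. g x = h x" by (rule AE_completion)
  then obtain N where N: "{x. g x \<noteq> h x} \<subseteq> N" "negligible N"
    by (auto simp: eventually_ae_filter negligible_iff_null_sets)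
  have "h absolutely_integrable_on {a..b}" for a b
    by (rule absolutely_integrable_spike[OF ac_integrable[OF assms(1)] N(2)]) (use N in force)
  moreover have "integral {x..y} g = integral {x..y} h" for x y
    by (rule integral_spike[OF N(2)]) (use N in force)
  ultimately show ?thesis using assms(1) by (simp add: ac_def)
qed

text \<open>Since H is continuous, the increment of \<Phi> is o(y - x) at every point, so \<Phi> is
  differentiable with derivative 0.\<close>

lemma superlinear_increments_imp_constant:
  fixes \<Phi> :: "real \<Rightarrow> 'b::real_normed_vector" and H :: "real \<Rightarrow> real"
  assumes le: "\<And>x y. a \<le> x \<Longrightarrow> x \<le> y \<Longrightarrow> y \<le> b \<Longrightarrow> norm (\<Phi> y - \<Phi> x) \<le> (y - x) * (H y - H x)"
    and H: "continuous_on {a..b} H" and x: "x \<in> {a..b}" "y \<in> {a..b}"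
  shows "\<Phi> x = \<Phi> y"
proof (rule has_derivative_zero_unique[OF convex_real_interval(5)[of a b] _ x(1,2)])
  fix z assume z: "z \<in> {a..b}"
  have bd: "norm (\<Phi> w - \<Phi> z) \<le> \<bar>w - z\<bar> * \<bar>H w - H z\<bar>" if "w \<in> {a..b}" for w
  proof (cases "z \<le> w")
    case True
    then have "norm (\<Phi> w - \<Phi> z) \<le> (w - z) * (H w - H z)" using le z that by auto
    also have "\<dots> \<le> \<bar>w - z\<bar> * \<bar>H w - H z\<bar>" using abs_ge_self[of "(w - z) * (H w - H z)"] by (simp add: abs_mult)
    finally show ?thesis .
  next
    case False
    then have "norm (\<Phi> z - \<Phi> w) \<le> (z - w) * (H z - H w)" using le z that by auto
    also have "\<dots> \<le> \<bar>w - z\<bar> * \<bar>H w - H z\<bar>"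
      using abs_ge_self[of "(z - w) * (H z - H w)"] by (simp add: abs_mult abs_minus_commute)
    finally show ?thesis by (simp add: norm_minus_commute)
  qed
  have lim: "((\<lambda>w. \<bar>H w - H z\<bar>) \<longlongrightarrow> 0) (at z within {a..b})"
  proof -
    have "(H \<longlongrightarrow> H z) (at z within {a..b})" using H z by (simp add: continuous_on_def)
    from tendsto_rabs[OF tendsto_diff[OF this tendsto_const[of "H z"]]] show ?thesis by simp
  qed
  have "((\<lambda>w. norm (\<Phi> w - \<Phi> z) / norm (w - z)) \<longlongrightarrow> 0) (at z within {a..b})"
  proof (rule Lim_null_comparison[OF _ lim])
    have "norm (norm (\<Phi> w - \<Phi> z) / norm (w - z)) \<le> \<bar>H w - H z\<bar>" if "w \<in> {a..b}" "w \<noteq> z" for w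
      using bd[OF that(1)] that(2) by (simp add: divide_le_eq mult.commute)
    then show "\<forall>\<^sub>F w in at z within {a..b}. norm (norm (\<Phi> w - \<Phi> z) / norm (w - z)) \<le> \<bar>H w - H z\<bar>"
      by (auto simp: eventually_at_filter intro!: always_eventually)
  qed
  then show "(\<Phi> has_derivative (\<lambda>_. 0)) (at z within {a..b})"
    by (simp add: has_derivative_iff_norm)
qed

text \<open>The discrepancy between f and the primitive of g has superlinear increments and is
  therefore constant. Product and reciprocal rules reduce to estimating such an error on small
  intervals.\<close>

lemma ac_if_superlinear_error:
  assumes g: "\<And>a b. g absolutely_integrable_on {a..b}"
    and le: "\<And>a b. \<exists>H. continuous_on {a..b} H \<and> (\<forall>x y. a \<le> x \<longrightarrow> x \<le> y \<longrightarrow> y \<le> b \<longrightarrow>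
          norm (f y - f x - integral {x..y} g) \<le> (y - x) * (H y - H x))"
  shows "ac f g"
  unfolding ac_def
proof (intro conjI allI impI g)
  fix a b :: real assume "a \<le> b"
  obtain H where H: "continuous_on {a..b} H" "\<And>x y. a \<le> x \<Longrightarrow> x \<le> y \<Longrightarrow> y \<le> b \<Longrightarrow>
          norm (f y - f x - integral {x..y} g) \<le> (y - x) * (H y - H x)" using le by meson
  define \<Phi> where "\<Phi> x = f x - integral {a..x} g" for x
  have "\<Phi> a = \<Phi> b"
  proof (rule superlinear_increments_imp_constant[OF _ H(1)])
    fix x y assume xy: "a \<le> x" "x \<le> y" "y \<le> b"
    have e: "integral {a..x} g + integral {x..y} g = integral {a..y} g"
      using xy by (intro Henstock_Kurzweil_Integration.integral_combine absint_integrable g) auto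
    have "\<Phi> y - \<Phi> x = f y - f x - integral {x..y} g" unfolding \<Phi>_def e[symmetric] by simp
    then show "norm (\<Phi> y - \<Phi> x) \<le> (y - x) * (H y - H x)" using H(2) xy by simp
  qed (use \<open>a \<le> b\<close> in auto)
  then show "f b - f a = integral {a..b} g" by (simp add: \<Phi>_def)
qed

text \<open>A product of an integrable and a bounded derivative contributes only a superlinear error,
  so the product rule holds without differentiability almost everywhere.\<close>

lemma ac_mult:
  fixes f g :: "real \<Rightarrow> 'b::{euclidean_space, real_normed_algebra}"
  assumes f: "ac f f'" and g: "ac g g'" and b: "lbb g'"
  shows "ac (\<lambda>x. f x * g x) (\<lambda>x. f' x * g x + f x * g' x)"
proof (rule ac_if_superlinear_error)
  have int1: "(\<lambda>x. f' x * h x) absolutely_integrable_on {a..b}" if "lbb h" for a b h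
  proof (rule absolutely_integrable_bounded_measurable_product[where h = "\<lambda>x y. y * x" and f = h and g = f'])
    show "bilinear (\<lambda>x y. y * x :: 'b)" by (auto simp: bilinear_def linear_iff algebra_simps)
    show "h \<in> borel_measurable (lebesgue_on {a..b})"
      using that by (auto simp: lbb_def intro: borel_measurable_lebesgue_onI)
    show "bounded (h ` {a..b})" using lbb_boundE[OF that, of a b] unfolding bounded_iff by (metis imageE)
    show "f' absolutely_integrable_on {a..b}" by (rule ac_integrable[OF f])
    show "{a..b} \<in> sets lebesgue" by simp
  qed
  have int2: "(\<lambda>x. f x * g' x) absolutely_integrable_on {a..b}" for a b
    by (intro lbb_absolutely_integrable lbb_mult ac_lbb_fun[OF f] b)
  show int: "(\<lambda>x. f' x * g x + f x * g' x) absolutely_integrable_on {a..b}" for a b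
    by (intro set_integral_add int1 int2 ac_lbb_fun[OF g])
  fix a b :: real
  obtain B where B: "B > 0" "\<And>x. x \<in> {a..b} \<Longrightarrow> norm (g' x) \<le> B" using lbb_boundE[OF b] by metis
  \<comment> \<open>The two error terms below are each at most (y - x) times the integral of B |f'|:
    in one g varies by at most B (y - x), in the other f varies by at most the integral of |f'|.
    Hence the factor 2.\<close>
  define H where "H x = 2 * B * integral {a..x} (\<lambda>x. norm (f' x))" for x
  have nf: "(\<lambda>x. norm (f' x)) integrable_on {x..y}" for x y
    using absolutely_integrable_on_def ac_integrable[OF f] by blast
  have "norm (f y * g y - f x * g x - integral {x..y} (\<lambda>x. f' x * g x + f x * g' x)) \<le> (y - x) * (H y - H x)"
    if xy: "a \<le> x" "x \<le> y" "y \<le> b" for x y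
  proof -
    define N where "N = integral {x..y} (\<lambda>x. norm (f' x))"
    have HN: "H y - H x = 2 * B * N"
    proof -
      have e: "integral {a..x} (\<lambda>x. norm (f' x)) + N = integral {a..y} (\<lambda>x. norm (f' x))"
        unfolding N_def using xy by (intro Henstock_Kurzweil_Integration.integral_combine nf) auto
      show ?thesis unfolding H_def e[symmetric] by (simp add: distrib_left)
    qed
    have gl: "norm (g y - g z) \<le> B * (y - x)" if z: "z \<in> {x..y}" for z
    proof -
      have "norm (g y - g z) = norm (integral {z..y} g')" using z acD[OF g, of z y] by simp
      also have "\<dots> \<le> integral {z..y} (\<lambda>_. B)"
        using z xy by (intro Henstock_Kurzweil_Integration.integral_norm_bound_integral absint_integrable ac_integrable[OF g] B) auto
      also have "\<dots> \<le> B * (y - x)" using z B(1) by simp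
      finally show ?thesis .
    qed
    have fl: "norm (f z - f x) \<le> N" if z: "z \<in> {x..y}" for z
    proof -
      have "norm (f z - f x) = norm (integral {x..z} f')" using z acD[OF f, of x z] by simp
      also have "\<dots> \<le> integral {x..z} (\<lambda>x. norm (f' x))"
        by (intro Henstock_Kurzweil_Integration.integral_norm_bound_integral absint_integrable ac_integrable[OF f] nf) auto
      also have "\<dots> \<le> N" unfolding N_def using z by (intro integral_subset_le nf) auto
      finally show ?thesis .
    qed
    have "(f' has_integral f y - f x) {x..y}" "(g' has_integral g y - g x) {x..y}"
      using acD[OF f xy(2)] acD[OF g xy(2)] absint_integrable[OF ac_integrable[OF f]] absint_integrable[OF ac_integrable[OF g]]
      by (simp_all add: has_integral_integral)
    then have h12: "((\<lambda>z. f' z * g y) has_integral (f y - f x) * g y) {x..y}" "((\<lambda>z. f x * g' z) has_integral f x * (g y - g x)) {x..y}"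
      by (auto intro: has_integral_mult_left has_integral_mult_right)
    have h3: "((\<lambda>x. f' x * g x + f x * g' x) has_integral integral {x..y} (\<lambda>x. f' x * g x + f x * g' x)) {x..y}"
      using absint_integrable[OF int] by (simp add: has_integral_integral)
    have "f y * g y - f x * g x - integral {x..y} (\<lambda>x. f' x * g x + f x * g' x)
       = integral {x..y} (\<lambda>z. (f' z * g y + f x * g' z) - (f' z * g z + f z * g' z))"
      using integral_unique[OF has_integral_diff[OF has_integral_add[OF h12] h3]] by (simp add: algebra_simps)
    also have "\<dots> = integral {x..y} (\<lambda>z. f' z * (g y - g z) - (f z - f x) * g' z)"
      by (simp add: algebra_simps)
    also have "norm \<dots> \<le> integral {x..y} (\<lambda>z. B * (y - x) * norm (f' z) + N * B)"
    proof (intro Henstock_Kurzweil_Integration.integral_norm_bound_integral)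
      have "(\<lambda>z. f' z * (g y - g z) - (f z - f x) * g' z) absolutely_integrable_on {x..y}"
        by (intro set_integral_diff int1 lbb_absolutely_integrable lbb_mult lbb_diff ac_lbb_fun[OF f] ac_lbb_fun[OF g] b lbb_const)
      then show "(\<lambda>z. f' z * (g y - g z) - (f z - f x) * g' z) integrable_on {x..y}" by (rule absint_integrable)
      show "(\<lambda>z. B * (y - x) * norm (f' z) + N * B) integrable_on {x..y}"
        by (intro integrable_add integrable_on_mult_right nf integrable_const_ivl)
      fix z assume z: "z \<in> {x..y}"
      have "norm (f' z * (g y - g z) - (f z - f x) * g' z) \<le> norm (f' z) * norm (g y - g z) + norm (f z - f x) * norm (g' z)"
        by (intro order_trans[OF norm_triangle_ineq4] add_mono norm_mult_ineq)
      also have "\<dots> \<le> norm (f' z) * (B * (y - x)) + N * B"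
        using z xy by (intro add_mono mult_mono gl fl B) (auto intro: order_trans[OF norm_ge_zero fl])
      finally show "norm (f' z * (g y - g z) - (f z - f x) * g' z) \<le> B * (y - x) * norm (f' z) + N * B"
        by (simp add: mult_ac)
    qed
    also have "\<dots> = B * (y - x) * N + (y - x) * (N * B)"
    proof (rule integral_unique)
      have "((\<lambda>z. norm (f' z)) has_integral N) {x..y}"
        unfolding N_def using nf by (simp add: has_integral_integral[symmetric])
      from has_integral_add[OF has_integral_mult_right[OF this, of "B * (y - x)"] has_integral_const_real[of "N * B" x y]]
      show "((\<lambda>z. B * (y - x) * norm (f' z) + N * B) has_integral B * (y - x) * N + (y - x) * (N * B)) {x..y}"
        using xy by simp
    qed
    also have "\<dots> = (y - x) * (H y - H x)"
      unfolding HN by (simp add: mult_ac)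
    finally show ?thesis .
  qed
  moreover have "continuous_on {a..b} H" unfolding H_def
    by (intro continuous_intros indefinite_integral_continuous_1 nf)
  ultimately show "\<exists>H. continuous_on {a..b} H \<and> (\<forall>x y. a \<le> x \<longrightarrow> x \<le> y \<longrightarrow> y \<le> b \<longrightarrow>
      norm (f y * g y - f x * g x - integral {x..y} (\<lambda>x. f' x * g x + f x * g' x)) \<le> (y - x) * (H y - H x))"
    by blast
qed

text \<open>With both factors frozen at the endpoints, 1/J y - 1/J x = - (1/J x) (1/J y) (J y - J x)
  is exact. Letting the factors vary under the integral costs an error quadratic in y - x, because
  1/J is Lipschitz on bounded intervals.\<close>

lemma ac_reciprocal:
  fixes J :: "real \<Rightarrow> real"
  assumes J: "ac J J'" "lbb J'" and d: "d > 0" "\<And>x. J x \<ge> d"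
  shows "ac (\<lambda>x. 1 / J x) (\<lambda>x. - (1 / J x * (1 / J x)) * J' x)"
proof (rule ac_if_superlinear_error)
  have lK: "lbb (\<lambda>x. 1 / J x)" by (rule lbb_inverse[OF ac_lbb_fun[OF J(1)] d])
  have lbb: "lbb (\<lambda>x. - (1 / J x * (1 / J x)) * J' x)"
    by (intro lbb_mult lbb_uminus lK J(2))
  then show "(\<lambda>x. - (1 / J x * (1 / J x)) * J' x) absolutely_integrable_on {a..b}" for a b
    by (rule lbb_absolutely_integrable)
  fix a b :: real
  obtain B where B: "B > 0" "\<And>x. x \<in> {a..b} \<Longrightarrow> norm (J' x) \<le> B" using lbb_boundE[OF J(2)] by metis
  have K: "0 < 1 / J x" "1 / J x \<le> 1 / d" for x
    using d(1) d(2)[of x] by (auto intro: divide_left_mono)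
  have KL: "\<bar>1 / J z - 1 / J x\<bar> \<le> (1 / d) * (1 / d) * B * (z - x)" if "a \<le> x" "x \<le> z" "z \<le> b" for x z
  proof -
    have "\<bar>J z - J x\<bar> = \<bar>integral {x..z} J'\<bar>" using that acD[OF J(1), of x z] by simp
    also have "\<dots> \<le> integral {x..z} (\<lambda>_. B)" unfolding real_norm_def[symmetric]
      using that by (intro Henstock_Kurzweil_Integration.integral_norm_bound_integral absint_integrable ac_integrable[OF J(1)] B) auto
    also have "\<dots> = B * (z - x)" using that by simp
    finally have JL: "\<bar>J z - J x\<bar> \<le> B * (z - x)" .
    have "1 / J z - 1 / J x = (1 / J z) * (1 / J x) * (J x - J z)"
      using K(1)[of x] K(1)[of z] by (simp add: field_simps)
    then have "\<bar>1 / J z - 1 / J x\<bar> = (1 / J z) * (1 / J x) * \<bar>J z - J x\<bar>"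
      using K(1)[of x] K(1)[of z] by (simp add: abs_mult abs_minus_commute)
    also have "\<dots> \<le> (1 / d) * (1 / d) * (B * (z - x))"
      using JL d(1) K less_imp_le[OF K(1)] by (intro mult_mono) auto
    finally show ?thesis by (simp add: mult_ac)
  qed
  define C where "C = (1 / d) * (1 / d) * B"
  define H where "H x = 2 * (1 / d) * C * B * x" for x
  have "norm (1 / J y - 1 / J x - integral {x..y} (\<lambda>x. - (1 / J x * (1 / J x)) * J' x)) \<le> (y - x) * (H y - H x)"
    if xy: "a \<le> x" "x \<le> y" "y \<le> b" for x y
  proof -
    have i1: "((\<lambda>z. - (1 / J x * (1 / J y)) * J' z) has_integral - (1 / J x * (1 / J y)) * (J y - J x)) {x..y}"
      using acD[OF J(1) xy(2)] absint_integrable[OF ac_integrable[OF J(1), of x y]]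
      by (intro has_integral_mult_right) (simp add: has_integral_integral)
    have i2: "((\<lambda>z. - (1 / J z * (1 / J z)) * J' z) has_integral integral {x..y} (\<lambda>x. - (1 / J x * (1 / J x)) * J' x)) {x..y}"
      by (rule integrable_integral[OF absint_integrable[OF lbb_absolutely_integrable[OF lbb]]])
    have "- (1 / J x * (1 / J y)) * (J y - J x) = 1 / J y - 1 / J x"
      using K(1)[of x] K(1)[of y] by (simp add: field_simps)
    with has_integral_diff[OF i1 i2]
    have i3: "((\<lambda>z. - (1 / J x * (1 / J y)) * J' z - - (1 / J z * (1 / J z)) * J' z) has_integral
       1 / J y - 1 / J x - integral {x..y} (\<lambda>x. - (1 / J x * (1 / J x)) * J' x)) {x..y}" by (simp only:)
    have "norm (1 / J y - 1 / J x - integral {x..y} (\<lambda>x. - (1 / J x * (1 / J x)) * J' x)) \<le> 2 * (1 / d) * C * (y - x) * B * measure lborel {x..y}"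
    proof (rule has_integral_bound_real[OF _ finite.emptyI i3])
      show "0 \<le> 2 * (1 / d) * C * (y - x) * B" using d B xy by (auto simp: C_def)
      fix z assume "z \<in> {x..y} - {}"
      then have z: "x \<le> z" "z \<le> y" by auto
      have "- (1 / J x * (1 / J y)) * J' z - - (1 / J z * (1 / J z)) * J' z
        = ((1 / J z) * (1 / J z - 1 / J x) + (1 / J x) * (- (1 / J y - 1 / J z))) * J' z"
        by (simp add: algebra_simps)
      also have "norm \<dots> \<le> ((1 / d) * (C * (y - x)) + (1 / d) * (C * (y - x))) * B"
        unfolding norm_mult
      proof (rule mult_mono[OF order_trans[OF norm_triangle_ineq] B(2)])
        have *: "\<bar>1 / J z - 1 / J x\<bar> \<le> C * (y - x)" "\<bar>1 / J y - 1 / J z\<bar> \<le> C * (y - x)"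
          using KL[of x z] KL[of z y] z xy d B
          by (auto simp: C_def elim!: order_trans intro!: mult_left_mono divide_right_mono)
        have "\<bar>1 / J z\<bar> \<le> 1 / d" "\<bar>1 / J x\<bar> \<le> 1 / d"
          using K(2)[of z] K(2)[of x] K(1)[of z] K(1)[of x] by linarith+
        then have "\<bar>1 / J z\<bar> * \<bar>1 / J z - 1 / J x\<bar> + \<bar>1 / J x\<bar> * \<bar>1 / J y - 1 / J z\<bar>
            \<le> 1 / d * (C * (y - x)) + 1 / d * (C * (y - x))"
          using * d by (intro add_mono mult_mono) auto
        then show "norm (1 / J z * (1 / J z - 1 / J x)) + norm (1 / J x * - (1 / J y - 1 / J z)) \<le> 1 / d * (C * (y - x)) + 1 / d * (C * (y - x))"
          by (simp only: real_norm_def abs_mult abs_minus_cancel)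
        show "0 \<le> 1 / d * (C * (y - x)) + 1 / d * (C * (y - x))" using d B xy by (auto simp: C_def)
      qed (use z xy in auto)
      also have "(1 / d * (C * (y - x)) + 1 / d * (C * (y - x))) * B = 2 * (1 / d) * C * (y - x) * B" by simp
      finally show "norm (- (1 / J x * (1 / J y)) * J' z - - (1 / J z * (1 / J z)) * J' z) \<le> 2 * (1 / d) * C * (y - x) * B" .
    qed
    also have "\<dots> = (y - x) * (2 * (1 / d) * C * B * (y - x))" using xy by simp
    also have "2 * (1 / d) * C * B * (y - x) = H y - H x" by (simp only: H_def right_diff_distrib)
    finally show ?thesis .
  qed
  moreover have "continuous_on {a..b} H" unfolding H_def by (intro continuous_intros)
  ultimately show "\<exists>H. continuous_on {a..b} H \<and> (\<forall>x y. a \<le> x \<longrightarrow> x \<le> y \<longrightarrow> y \<le> b \<longrightarrow>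
      norm (1 / J y - 1 / J x - integral {x..y} (\<lambda>x. - (1 / J x * (1 / J x)) * J' x)) \<le> (y - x) * (H y - H x))"
    by blast
qed

section \<open>Change of variables by bi-Lipschitz maps\<close>

lemma set_integrable_lborel_iff:
  fixes g :: "real \<Rightarrow> 'b::euclidean_space"
  assumes "g \<in> borel_measurable borel" "A \<in> sets borel"
  shows "set_integrable lborel A g \<longleftrightarrow> g absolutely_integrable_on A"
proof -
  have "(\<lambda>x. indicator A x *\<^sub>R g x) \<in> borel_measurable lborel" using assms by simp
  then show ?thesis unfolding set_integrable_def by (rule integrable_completion[symmetric])
qed

lemma lbb_set_integrable: "lbb g \<Longrightarrow> set_integrable lborel {a..b} g"
  by (subst set_integrable_lborel_iff) (auto intro: lbb_absolutely_integrable lbb_measurable)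

text \<open>A primitive of a function bounded below by d > 0 grows at least at rate d; the
  intermediate value theorem then gives surjectivity.\<close>

lemma bilipschitz_bij:
  fixes \<xi> :: "real \<Rightarrow> real"
  assumes ac: "ac \<xi> J" and d: "d > 0" "\<And>x. J x \<ge> d"
  shows "strict_mono \<xi>" "surj \<xi>" "\<And>x y. x \<le> y \<Longrightarrow> \<xi> y - \<xi> x \<ge> d * (y - x)"
proof -
  show lower: "\<xi> y - \<xi> x \<ge> d * (y - x)" if "x \<le> y" for x y
  proof -
    have "integral {x..y} (\<lambda>_. d) \<le> integral {x..y} J"
      by (intro integral_le absint_integrable[OF ac_integrable[OF ac]] d integrable_const_ivl)
    then show ?thesis using acD[OF ac that] that by (simp add: mult.commute)
  qed
  show "strict_mono \<xi>"
  proof (rule strict_monoI)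
    fix x y :: real assume "x < y"
    then have "0 < d * (y - x)" using d(1) by (intro mult_pos_pos) auto
    then show "\<xi> x < \<xi> y" using lower[of x y] \<open>x < y\<close> by linarith
  qed
  have "\<exists>x. \<xi> x = y" for y
  proof -
    define M where "M = \<bar>y - \<xi> 0\<bar> / d"
    have "M \<ge> 0" "d * M = \<bar>y - \<xi> 0\<bar>" using d(1) by (auto simp: M_def)
    then have "\<xi> (-M) \<le> y" "y \<le> \<xi> M" using lower[of "-M" 0] lower[of 0 M] by auto
    moreover have "continuous_on {-M..M} \<xi>" by (rule continuous_on_subset[OF ac_continuous[OF ac]]) auto
    ultimately show ?thesis using IVT'[of \<xi> "-M" y M] \<open>M \<ge> 0\<close> by auto
  qed
  then show "surj \<xi>" by (metis surjI surj_def)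
qed

text \<open>Change of variables as an identity of measures: the preimage of the interval from \<xi>
  a to \<xi> b is the interval from a to b, whose mass, the integral of J, is \<xi> b - \<xi> a by
  \<open>ac\<close>. Agreement on bounded open intervals determines Lebesgue measure.\<close>

lemma distr_density_bilipschitz:
  fixes \<xi> :: "real \<Rightarrow> real"
  assumes ac: "ac \<xi> J" and J: "lbb J" and d: "d > 0" "\<And>x. J x \<ge> d"
  shows "distr (density lborel J) borel \<xi> = lborel"
proof (rule lborel_eqI[symmetric])
  note bij = bilipschitz_bij[OF ac d]
  have \<xi>m: "\<xi> \<in> borel_measurable borel" by (rule borel_measurable_continuous_onI[OF ac_continuous[OF ac]])
  have Jm: "J \<in> borel_measurable borel" by (rule lbb_measurable[OF J])
  fix l u :: real assume lu: "\<And>b. b \<in> Basis \<Longrightarrow> l \<bullet> b \<le> u \<bullet> b"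
  then have "l \<le> u" by simp
  obtain a b where ab: "\<xi> a = l" "\<xi> b = u" using bij(2) by (metis surjD)
  then have "a \<le> b" using \<open>l \<le> u\<close> strict_mono_less_eq[OF bij(1)] by blast
  have pre: "\<xi> -` box l u = {a<..<b}"
    using strict_mono_less[OF bij(1)] by (auto simp: ab[symmetric])
  have si: "set_integrable lborel {a<..<b} J"
    by (rule set_integrable_subset[OF lbb_set_integrable[OF J, of a b]]) auto
  have "emeasure (distr (density lborel J) borel \<xi>) (box l u) = (\<integral>\<^sup>+x. ennreal (J x) * indicator {a<..<b} x \<partial>lborel)"
  proof -
    have "emeasure (distr (density lborel J) borel \<xi>) (box l u) = emeasure (density lborel J) {a<..<b}"
      using \<xi>m by (subst emeasure_distr) (simp_all add: pre del: box_real)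
    then show ?thesis using Jm by (simp add: emeasure_density)
  qed
  also have "\<dots> = (\<integral>\<^sup>+x. ennreal (indicator {a<..<b} x *\<^sub>R J x) \<partial>lborel)"
    by (intro nn_integral_cong) (auto split: split_indicator)
  also have "\<dots> = ennreal (LINT x:{a<..<b}|lborel. J x)"
    unfolding set_lebesgue_integral_def
    using si d(1) order_trans[OF less_imp_le[OF d(1)] d(2)]
    by (intro nn_integral_eq_integral) (auto simp: set_integrable_def intro!: always_eventually split: split_indicator)
  also have "(LINT x:{a<..<b}|lborel. J x) = integral {a..b} J"
    using set_borel_integral_eq_integral(2)[OF si] by (simp add: integral_open_interval_real)
  also have "\<dots> = u - l" using acD[OF ac \<open>a \<le> b\<close>] ab by simp
  finally show "emeasure (distr (density lborel J) borel \<xi>) (box l u) = (\<Prod>b\<in>Basis. (u - l) \<bullet> b)" by simp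
qed simp

text \<open>The measure with density J is mapped to Lebesgue measure by \<xi>, and it has the
  Lebesgue null sets because J > 0; so null sets pull back to null sets.\<close>

lemma AE_compose_bilipschitz:
  fixes \<xi> :: "real \<Rightarrow> real"
  assumes ac: "ac \<xi> J" and J: "lbb J" and d: "d > 0" "\<And>x. J x \<ge> d"
    and P: "AE y in lborel. P y"
  shows "AE x in lborel. P (\<xi> x)"
proof -
  have \<xi>m: "\<xi> \<in> measurable (density lborel J) borel"
    using borel_measurable_continuous_onI[OF ac_continuous[OF ac]] by simp
  have "AE y in distr (density lborel J) borel \<xi>. P y"
    unfolding distr_density_bilipschitz[OF assms(1-4)] by (rule P)
  from AE_distrD[OF \<xi>m this] have "AE x in density lborel J. P (\<xi> x)" .
  then have "AE x in lborel. 0 < J x \<longrightarrow> P (\<xi> x)"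
    using lbb_measurable[OF J] by (simp add: AE_density)
  moreover have "J x > 0" for x using d(1) d(2)[of x] by linarith
  ultimately show ?thesis by simp
qed

lemma integral_bilipschitz:
  fixes \<xi> :: "real \<Rightarrow> real" and g :: "real \<Rightarrow> 'b::euclidean_space"
  assumes ac: "ac \<xi> J" and J: "lbb J" and d: "d > 0" "\<And>x. J x \<ge> d" and g: "lbb g" and "a \<le> b"
  shows "integral {\<xi> a..\<xi> b} g = integral {a..b} (\<lambda>x. J x *\<^sub>R g (\<xi> x))"
proof -
  note bij = bilipschitz_bij[OF ac d]
  have \<xi>m[measurable]: "\<xi> \<in> borel_measurable borel" by (rule borel_measurable_continuous_onI[OF ac_continuous[OF ac]])
  have [measurable]: "J \<in> borel_measurable borel" "g \<in> borel_measurable borel" by (auto intro: lbb_measurable J g)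
  have l: "lbb (\<lambda>x. J x *\<^sub>R g (\<xi> x))"
  proof -
    have gx: "lbb (\<lambda>x. g (\<xi> x))" by (rule lbb_compose[OF g ac_continuous[OF ac]])
    show ?thesis unfolding lbb_def
    proof (intro conjI allI)
      fix a b
      obtain A where A: "\<And>x. x \<in> {a..b} \<Longrightarrow> norm (J x) \<le> A" "A > 0" using lbb_boundE[OF J] by metis
      obtain B where B: "\<And>x. x \<in> {a..b} \<Longrightarrow> norm (g (\<xi> x)) \<le> B" using lbb_boundE[OF gx] by metis
      have "norm (J x *\<^sub>R g (\<xi> x)) \<le> A * B" if "x \<in> {a..b}" for x
        unfolding norm_scaleR using A B that by (intro mult_mono) auto
      then show "\<exists>B. \<forall>x\<in>{a..b}. norm (J x *\<^sub>R g (\<xi> x)) \<le> B" by blast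
    qed measurable
  qed
  have "integral {\<xi> a..\<xi> b} g = (LINT y:{\<xi> a..\<xi> b}|lborel. g y)"
    by (rule set_borel_integral_eq_integral(2)[OF lbb_set_integrable[OF g], symmetric])
  also have "\<dots> = (\<integral>y. indicator {\<xi> a..\<xi> b} y *\<^sub>R g y \<partial>distr (density lborel J) borel \<xi>)"
    unfolding distr_density_bilipschitz[OF assms(1-4)] by (simp add: set_lebesgue_integral_def)
  also have "\<dots> = (\<integral>x. indicator {\<xi> a..\<xi> b} (\<xi> x) *\<^sub>R g (\<xi> x) \<partial>density lborel J)"
    by (rule integral_distr) auto
  also have "\<dots> = (\<integral>x. J x *\<^sub>R (indicator {\<xi> a..\<xi> b} (\<xi> x) *\<^sub>R g (\<xi> x)) \<partial>lborel)"
    using order_trans[OF less_imp_le[OF d(1)] d(2)] by (intro integral_density) auto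
  also have "\<dots> = (LINT x:{a..b}|lborel. J x *\<^sub>R g (\<xi> x))"
    unfolding set_lebesgue_integral_def
    by (intro Bochner_Integration.integral_cong) (auto split: split_indicator simp: strict_mono_less_eq[OF bij(1)])
  also have "\<dots> = integral {a..b} (\<lambda>x. J x *\<^sub>R g (\<xi> x))"
    by (rule set_borel_integral_eq_integral(2)[OF lbb_set_integrable[OF l]])
  finally show ?thesis .
qed

lemma ac_compose_bilipschitz:
  fixes \<xi> :: "real \<Rightarrow> real" and g :: "real \<Rightarrow> 'b::euclidean_space"
  assumes ac: "ac \<xi> J" and J: "lbb J" and d: "d > 0" "\<And>x. J x \<ge> d" and f: "ac f g" and g: "lbb g"
  shows "ac (\<lambda>x. f (\<xi> x)) (\<lambda>x. J x *\<^sub>R g (\<xi> x))" "lbb (\<lambda>x. J x *\<^sub>R g (\<xi> x))"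
proof -
  have gx: "lbb (\<lambda>x. g (\<xi> x))" by (rule lbb_compose[OF g ac_continuous[OF ac]])
  show l: "lbb (\<lambda>x. J x *\<^sub>R g (\<xi> x))" unfolding lbb_def
  proof (intro conjI allI)
    fix a b
    obtain A where A: "\<And>x. x \<in> {a..b} \<Longrightarrow> norm (J x) \<le> A" "A > 0" using lbb_boundE[OF J] by metis
    obtain B where B: "\<And>x. x \<in> {a..b} \<Longrightarrow> norm (g (\<xi> x)) \<le> B" using lbb_boundE[OF gx] by metis
    have "norm (J x *\<^sub>R g (\<xi> x)) \<le> A * B" if "x \<in> {a..b}" for x
      unfolding norm_scaleR using A B that by (intro mult_mono) auto
    then show "\<exists>B. \<forall>x\<in>{a..b}. norm (J x *\<^sub>R g (\<xi> x)) \<le> B" by blast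
  qed (use lbb_measurable[OF J] lbb_measurable[OF gx] in simp)
  show "ac (\<lambda>x. f (\<xi> x)) (\<lambda>x. J x *\<^sub>R g (\<xi> x))"
  proof (rule ac_lbb[OF l])
    fix x y :: real assume "x \<le> y"
    then have "\<xi> x \<le> \<xi> y" using strict_mono_less_eq[OF bilipschitz_bij(1)[OF ac d]] by blast
    then show "f (\<xi> y) - f (\<xi> x) = integral {x..y} (\<lambda>x. J x *\<^sub>R g (\<xi> x))"
      using integral_bilipschitz[OF assms(1-4) g \<open>x \<le> y\<close>] acD[OF f] by simp
  qed
qed

text \<open>Plays the role of the Lebesgue differentiation theorem. The primitive is monotone and
  defines a Stieltjes measure \<nu>, which agrees with integration of f on half-open intervals and
  hence, by a pi-lambda induction, on Borel subsets of (0, 1]. The integral over the set where f < 0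
  is then nonnegative, which forces this set to be null.\<close>

lemma nonneg_if_integrals_nonneg:
  fixes f :: "real \<Rightarrow> real"
  assumes m[measurable]: "f \<in> borel_measurable borel" and f: "f absolutely_integrable_on {0..1}"
    and nn: "\<And>x y. 0 \<le> x \<Longrightarrow> x \<le> y \<Longrightarrow> y \<le> 1 \<Longrightarrow> integral {x..y} f \<ge> 0"
  shows "AE x in lborel. x \<in> {0..1} \<longrightarrow> f x \<ge> 0"
proof -
  define g where "g x = indicator {0<..1} x * f x" for x
  have [measurable]: "g \<in> borel_measurable borel" unfolding g_def by simp
  have si: "set_integrable lborel {0<..1} f"
    by (subst set_integrable_lborel_iff) (auto intro: set_integrable_subset[OF f])
  then have gi: "integrable lborel g" by (simp add: set_integrable_def g_def[abs_def])
  then have gsi: "set_integrable lborel A g" if "A \<in> sets borel" for A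
    using that integrable_mult_indicator[of A lborel g] by (simp add: set_integrable_def)
  \<comment> \<open>Clamping extends the primitive to a monotone continuous function on the whole
    line, as needed for the value of \<open>interval_measure\<close> on half-open intervals.\<close>
  define cl :: "real \<Rightarrow> real" where "cl x = max 0 (min 1 x)" for x
  define F where "F x = integral {0..cl x} f" for x
  have fi: "f integrable_on {0..1}" by (rule absint_integrable[OF f])
  have Fd: "F y - F x = integral {cl x..cl y} f" if "x \<le> y" for x y
  proof -
    have "f integrable_on {0..cl y}" by (rule integrable_subinterval_real[OF fi]) (auto simp: cl_def)
    then have "integral {0..cl x} f + integral {cl x..cl y} f = integral {0..cl y} f"
      using that by (intro Henstock_Kurzweil_Integration.integral_combine) (auto simp: cl_def)
    then show ?thesis by (simp add: F_def)
  qed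
  have Fmono: "F x \<le> F y" if "x \<le> y" for x y
  proof -
    have "0 \<le> cl x" "cl x \<le> cl y" "cl y \<le> 1" using that by (auto simp: cl_def)
    from nn[OF this] show ?thesis using Fd[OF that] by simp
  qed
  have "continuous_on UNIV (\<lambda>x. integral {0..cl x} f)"
    by (rule continuous_on_compose2[OF indefinite_integral_continuous_1[OF fi]])
       (auto simp: cl_def intro!: continuous_intros)
  then have "continuous (at x within S) F" for x S unfolding F_def
    by (meson continuous_on_eq_continuous_within continuous_within_subset subset_UNIV UNIV_I)
  note eF = emeasure_interval_measure_Ioc[OF _ Fmono this]
  define \<nu> where "\<nu> = interval_measure F"
  have sets\<nu>[measurable_cong]: "sets \<nu> = sets borel" by (simp add: \<nu>_def)
  have fin: "emeasure \<nu> (A \<inter> {0<..1}) \<noteq> \<infinity>" if "A \<in> sets borel" for A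
  proof -
    have "emeasure \<nu> (A \<inter> {0<..1}) \<le> emeasure \<nu> {0<..1}" by (intro emeasure_mono) auto
    also have "\<dots> < \<infinity>" using eF[of 0 1] by (simp add: \<nu>_def)
    finally show ?thesis by simp
  qed
  have \<nu>I: "measure \<nu> {a<..b} = F b - F a" if "a \<le> b" for a b
    unfolding measure_def \<nu>_def using eF[OF that] Fmono[OF that] by simp
  let ?P = "\<lambda>A. (LINT x:A|lborel. g x) = measure \<nu> (A \<inter> {0<..1})"
  have st: "Int_stable (range (\<lambda>(a, b). {a<..b::real}))"
    proof (rule Int_stableI)
      fix A B assume "A \<in> range (\<lambda>(a, b). {a<..b::real})" "B \<in> range (\<lambda>(a, b). {a<..b::real})"
      then obtain a b c d where "A = {a<..b}" "B = {c<..d}" by auto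
      then have "A \<inter> B = {max a c<..min b d}" by auto
      then show "A \<inter> B \<in> range (\<lambda>(a, b). {a<..b::real})" by (intro image_eqI[of _ _ "(max a c, min b d)"]) auto
    qed
  have sub: "range (\<lambda>(a, b). {a<..b::real}) \<subseteq> Pow UNIV" by simp
  have P: "?P A" if "A \<in> sigma_sets UNIV (range (\<lambda>(a, b). {a<..b::real}))" for A
    using st sub that
  proof (induction rule: sigma_sets_induct_disjoint)
    case (basic A)
    then obtain a b where A: "A = {a<..b}" by auto
    have I: "A \<inter> {0<..1} = {max a 0<..min b 1}" by (auto simp: A)
    have L: "(LINT x:A|lborel. g x) = (LINT x:{max a 0<..min b 1}|lborel. f x)"
      unfolding set_lebesgue_integral_def g_def A by (intro Bochner_Integration.integral_cong) (auto split: split_indicator)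
    show ?case
    proof (cases "max a 0 \<le> min b 1")
      case True
      have "set_integrable lborel {max a 0<..min b 1} f" by (rule set_integrable_subset[OF si]) auto
      then have "(LINT x:{max a 0<..min b 1}|lborel. f x) = integral {max a 0<..min b 1} f"
        by (rule set_borel_integral_eq_integral)
      also have "\<dots> = integral {max a 0..min b 1} f"
        by (rule integral_subset_negligible) (auto intro!: negligible_subset[OF negligible_sing[of "max a 0"]])
      also have "\<dots> = F (min b 1) - F (max a 0)" using Fd[OF True] True by (auto simp: cl_def max_def min_def)
      finally show ?thesis using \<nu>I[OF True] I L by simp
    next
      case False
      then have e: "{max a 0<..min b 1} = {}" by auto
      show ?thesis unfolding I L e by (simp add: set_lebesgue_integral_def)
    qed
  next
    case empty show ?case by (simp add: set_lebesgue_integral_def)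
  next
    case (compl A)
    then have A: "A \<in> sets borel" by (simp add: borel_sigma_sets_Ioc)
    have "(LINT x:UNIV|lborel. g x) = (LINT x:A \<union> (UNIV - A)|lborel. g x)" by simp
    also have "\<dots> = (LINT x:A|lborel. g x) + (LINT x:UNIV - A|lborel. g x)"
      by (intro set_integral_Un gsi) (use A in auto)
    finally have 1: "(LINT x:UNIV - A|lborel. g x) = (LINT x:UNIV|lborel. g x) - (LINT x:A|lborel. g x)" by simp
    have "(LINT x:UNIV|lborel. g x) = (LINT x:{0<..1}|lborel. f x)"
      unfolding set_lebesgue_integral_def g_def by (intro Bochner_Integration.integral_cong) auto
    also have "\<dots> = integral {0<..1} f" by (rule set_borel_integral_eq_integral[OF si])
    also have "\<dots> = integral {0..1} f"
      by (rule integral_subset_negligible) (auto intro!: negligible_subset[OF negligible_sing[of 0]])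
    also have "\<dots> = measure \<nu> {0<..1}" using \<nu>I[of 0 1] Fd[of 0 1] by (simp add: cl_def)
    finally have 2: "(LINT x:UNIV|lborel. g x) = measure \<nu> {0<..1}" .
    have "(UNIV - A) \<inter> {0<..1} = {0<..1} - (A \<inter> {0<..1})" by auto
    then have "measure \<nu> ((UNIV - A) \<inter> {0<..1}) = measure \<nu> {0<..1} - measure \<nu> (A \<inter> {0<..1})"
      using A fin[of UNIV] by (simp add: measure_Diff)
    then show ?case using 1 2 compl by simp
  next
    case (union A)
    then have A: "A i \<in> sets borel" for i by (auto simp: borel_sigma_sets_Ioc)
    have "(LINT x:(\<Union>i. A i)|lborel. g x) = (\<Sum>i. (LINT x:(A i)|lborel. g x))"
      using union(1) A by (intro lebesgue_integral_countable_add gsi) (auto simp: disjoint_family_on_def)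
    also have "\<dots> = (\<Sum>i. measure \<nu> (A i \<inter> {0<..1}))" using union by simp
    also have "\<dots> = measure \<nu> (\<Union>i. A i \<inter> {0<..1})"
    proof (rule sums_unique[symmetric, OF measure_UNION])
      show "range (\<lambda>i. A i \<inter> {0<..1}) \<subseteq> sets \<nu>" using A by auto
      show "disjoint_family (\<lambda>i. A i \<inter> {0<..1})" using union(1) by (auto simp: disjoint_family_on_def)
      have "emeasure \<nu> ((\<Union>i. A i) \<inter> {0<..1}) \<noteq> \<infinity>" using A by (intro fin) auto
      then show "emeasure \<nu> (\<Union>i. A i \<inter> {0<..1}) \<noteq> \<infinity>" by simp
    qed
    finally show ?case by simp
  qed
  define N where "N = {x. g x < 0}"
  have N: "N \<in> sets borel" unfolding N_def by measurable
  then have "?P N" by (intro P) (simp add: borel_sigma_sets_Ioc)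
  then have i0: "(\<integral>x. - (indicator N x * g x) \<partial>lborel) \<le> 0" by (simp add: set_lebesgue_integral_def)
  have ig: "integrable lborel (\<lambda>x. - (indicator N x * g x))" using gsi[OF N] by (simp add: set_integrable_def)
  have nn': "AE x in lborel. 0 \<le> - (indicator N x * g x)" by (auto simp: N_def split: split_indicator)
  have "(\<integral>x. - (indicator N x * g x) \<partial>lborel) = 0" using i0 integral_nonneg_AE[OF nn'] by simp
  then have "AE x in lborel. - (indicator N x * g x) = 0"
    using integral_nonneg_eq_0_iff_AE[OF ig nn'] by simp
  moreover have "AE x in lborel. x \<noteq> (0::real)" by (rule AE_lborel_singleton)
  ultimately show ?thesis
    by eventually_elim (auto simp: N_def g_def split: split_indicator_asm if_splits)
qed

section \<open>The Banach algebra of essentially bounded functions on the unit interval\<close>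

definition ae01 :: "(real \<Rightarrow> bool) \<Rightarrow> bool" where
  "ae01 P \<longleftrightarrow> (AE x in lborel. x \<in> {0..<1} \<longrightarrow> P x)"

lemma ae01_mono: "ae01 P \<Longrightarrow> (\<And>x. P x \<Longrightarrow> Q x) \<Longrightarrow> ae01 Q"
  unfolding ae01_def by (rule AE_mp) (auto intro!: always_eventually)

lemma ae01_conj: "ae01 P \<Longrightarrow> ae01 Q \<Longrightarrow> ae01 (\<lambda>x. P x \<and> Q x)"
  unfolding ae01_def by (rule AE_mp) (auto elim: eventually_mono)

lemma ae01_mp2: "ae01 P \<Longrightarrow> ae01 Q \<Longrightarrow> (\<And>x. P x \<Longrightarrow> Q x \<Longrightarrow> R x) \<Longrightarrow> ae01 R"
  by (drule (1) ae01_conj, erule ae01_mono) blast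

lemma ae01_always: "(\<And>x. x \<in> {0..<1} \<Longrightarrow> P x) \<Longrightarrow> ae01 P"
  unfolding ae01_def by (auto intro!: always_eventually)

lemma ae01_all_nat: "(\<And>n::nat. ae01 (P n)) \<Longrightarrow> ae01 (\<lambda>x. \<forall>n. P n x)"
proof -
  assume "\<And>n::nat. ae01 (P n)"
  then have "AE x in lborel. \<forall>n. x \<in> {0..<1} \<longrightarrow> P n x" unfolding AE_all_countable ae01_def by blast
  then show ?thesis unfolding ae01_def by eventually_elim auto
qed

lemma ae01_negligible: "ae01 P \<longleftrightarrow> negligible {x\<in>{0..<1}. \<not> P x}"
proof -
  have "ae01 P \<longleftrightarrow> (AE x in lebesgue. x \<in> {0..<1} \<longrightarrow> P x)"
    unfolding ae01_def by (simp add: AE_completion_iff)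
  also have "\<dots> \<longleftrightarrow> negligible {x\<in>{0..<1}. \<not> P x}"
    unfolding negligible_iff_null_sets eventually_ae_filter
    by (auto intro: null_sets_completion_subset)
  finally show ?thesis .
qed

lemma ae01_integral_eq:
  assumes "ae01 (\<lambda>x. f x = g x)" "0 \<le> a" "b \<le> 1" shows "integral {a..b} f = integral {a..b} g"
proof (rule integral_spike)
  show "negligible (insert 1 {x\<in>{0..<1}. \<not> f x = g x})"
    using assms(1) by (simp add: ae01_negligible)
qed (use assms in auto)

lemma ae01_ex: "ae01 P \<Longrightarrow> \<exists>x\<in>{0..<1}. P x"
proof (rule ccontr)
  assume "ae01 P" "\<not> (\<exists>x\<in>{0..<1}. P x)"
  then have "{x\<in>{0..<1}. \<not> P x} = {0..<1}" by auto
  with \<open>ae01 P\<close> have "negligible {0..<1::real}" by (simp add: ae01_negligible)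
  then have "negligible {0<..<1::real}" by (rule negligible_subset) auto
  then show False using negligible_imp_measure0 by fastforce
qed

text \<open>A closed set that contains almost every point of (0, 1) contains all of them, and then
  also the closure; this covers the endpoint 1, which \<open>ae01\<close> leaves out.\<close>

lemma ae01_continuous_closed:
  assumes "ae01 (\<lambda>x. f x \<in> C)" "continuous_on UNIV f" "closed C" "x \<in> {0..1}"
  shows "f x \<in> C"
proof -
  have cl: "closed {x. f x \<in> C}"
    using closed_vimage[OF assms(3,2)] by (simp add: vimage_def)
  have "AE x\<in>{0<..<1} in lebesgue. x \<in> {x. f x \<in> C}"
    using assms(1) unfolding ae01_def
    by (intro AE_completion) (auto elim!: eventually_mono)
  then have "x \<in> {x. f x \<in> C}" if "x \<in> {0<..<1}" for x
    by (rule mem_closed_if_AE_lebesgue_open[OF open_greaterThanLessThan cl _ that])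
  then have "closure {0<..<1} \<subseteq> {x. f x \<in> C}" by (intro closure_minimal cl) auto
  then show ?thesis using assms(4) by auto
qed

quotient_type linf = "real \<Rightarrow> complex" / partial: "\<lambda>f g. lbb f \<and> lbb g \<and> ae01 (\<lambda>x. f x = g x)"
  morphisms rep_linf cls
proof (rule part_equivpI)
  show "\<exists>f. lbb f \<and> lbb f \<and> ae01 (\<lambda>x. f x = f x)" by (rule exI[of _ "\<lambda>_. 0"]) (auto intro: ae01_always)
  show "symp (\<lambda>f g. lbb f \<and> lbb g \<and> ae01 (\<lambda>x. f x = g x))"
    by (rule sympI) (auto elim: ae01_mono)
  show "transp (\<lambda>f g. lbb f \<and> lbb g \<and> ae01 (\<lambda>x. f x = g x))"
    by (rule transpI) (auto elim: ae01_mp2)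
qed

definition ess_norm :: "(real \<Rightarrow> complex) \<Rightarrow> real" where
  "ess_norm f = Inf {B. 0 \<le> B \<and> ae01 (\<lambda>x. norm (f x) \<le> B)}"

text \<open>The infimum is itself an essential bound: the exceptional sets for
  \<open>ess_norm f + 1 / Suc n\<close> are countably many null sets.\<close>

lemma ess_norm:
  assumes "lbb f" shows "0 \<le> ess_norm f" "ae01 (\<lambda>x. norm (f x) \<le> ess_norm f)"
    "0 \<le> B \<Longrightarrow> ae01 (\<lambda>x. norm (f x) \<le> B) \<Longrightarrow> ess_norm f \<le> B"
proof -
  let ?S = "{B. 0 \<le> B \<and> ae01 (\<lambda>x. norm (f x) \<le> B)}"
  obtain B0 where "B0 > 0" "\<And>x. x \<in> {0..1} \<Longrightarrow> norm (f x) \<le> B0" using lbb_boundE[OF assms] by metis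
  then have ne: "B0 \<in> ?S" by (auto intro!: ae01_always)
  have bdd: "bdd_below ?S" by (auto intro: bdd_belowI[of _ 0])
  show "0 \<le> ess_norm f" unfolding ess_norm_def using ne by (intro cInf_greatest) auto
  show "ess_norm f \<le> B" if "0 \<le> B" "ae01 (\<lambda>x. norm (f x) \<le> B)"
    unfolding ess_norm_def using bdd that by (intro cInf_lower) auto
  have "ae01 (\<lambda>x. norm (f x) \<le> ess_norm f + 1 / real (Suc n))" for n
  proof -
    have "\<exists>B\<in>?S. B < ess_norm f + 1 / real (Suc n)"
      using ne by (intro cInf_lessD) (auto simp: ess_norm_def)
    then show ?thesis by (auto elim: ae01_mono)
  qed
  then have "ae01 (\<lambda>x. \<forall>n. norm (f x) \<le> ess_norm f + 1 / real (Suc n))" by (rule ae01_all_nat)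
  then show "ae01 (\<lambda>x. norm (f x) \<le> ess_norm f)"
  proof (rule ae01_mono)
    fix x assume "\<forall>n. norm (f x) \<le> ess_norm f + 1 / real (Suc n)"
    moreover have "(\<lambda>n. ess_norm f + 1 / real (Suc n)) \<longlonglongrightarrow> ess_norm f + 0"
      by (intro tendsto_add tendsto_const LIMSEQ_Suc lim_1_over_n)
    ultimately show "norm (f x) \<le> ess_norm f" by (intro LIMSEQ_le_const) auto
  qed
qed

instantiation linf :: real_normed_algebra_1
begin
lift_definition zero_linf :: linf is "\<lambda>x. 0" by (auto intro: ae01_always)
lift_definition one_linf :: linf is "\<lambda>x. 1" by (auto intro: ae01_always)
lift_definition plus_linf :: "linf \<Rightarrow> linf \<Rightarrow> linf" is "\<lambda>f g x. f x + g x"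
  by (auto intro: lbb_add elim: ae01_mp2)
lift_definition minus_linf :: "linf \<Rightarrow> linf \<Rightarrow> linf" is "\<lambda>f g x. f x - g x"
  by (auto intro: lbb_diff elim: ae01_mp2)
lift_definition uminus_linf :: "linf \<Rightarrow> linf" is "\<lambda>f x. - f x"
  by (auto intro: lbb_uminus elim: ae01_mono)
lift_definition times_linf :: "linf \<Rightarrow> linf \<Rightarrow> linf" is "\<lambda>f g x. f x * g x"
  by (auto intro: lbb_mult elim: ae01_mp2)
lift_definition scaleR_linf :: "real \<Rightarrow> linf \<Rightarrow> linf" is "\<lambda>r f x. r *\<^sub>R f x"
  by (auto intro: lbb_scaleR elim: ae01_mono)
lift_definition norm_linf :: "linf \<Rightarrow> real" is ess_norm
proof -
  fix f g :: "real \<Rightarrow> complex" assume *: "lbb f \<and> lbb g \<and> ae01 (\<lambda>x. f x = g x)"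
  then have "ae01 (\<lambda>x. norm (f x) \<le> B) \<longleftrightarrow> ae01 (\<lambda>x. norm (g x) \<le> B)" for B
    by (auto elim: ae01_mp2)
  then show "ess_norm f = ess_norm g" by (simp add: ess_norm_def)
qed
definition dist_linf :: "linf \<Rightarrow> linf \<Rightarrow> real" where "dist_linf f g = norm (f - g)"
definition sgn_linf :: "linf \<Rightarrow> linf" where "sgn_linf f = inverse (norm f) *\<^sub>R f"
definition uniformity_linf :: "(linf \<times> linf) filter" where
  "uniformity_linf = (INF e\<in>{0<..}. principal {(x, y). dist x y < e})"
definition open_linf :: "linf set \<Rightarrow> bool" where
  "open_linf U \<longleftrightarrow> (\<forall>x\<in>U. \<forall>\<^sub>F (x', y) in uniformity. x' = x \<longrightarrow> y \<in> U)"
instance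
proof
  fix f g h :: linf and a b :: real
  show "f + g + h = f + (g + h)" by transfer (auto intro: ae01_always lbb_add)
  show "f + g = g + f" by transfer (auto intro: ae01_always lbb_add)
  show "0 + f = f" by transfer (auto intro: ae01_always)
  show "- f + f = 0" by transfer (auto intro: ae01_always lbb_add lbb_uminus)
  show "f - g = f + - g" by transfer (auto intro: ae01_always lbb_add lbb_uminus lbb_diff)
  show "a *\<^sub>R (f + g) = a *\<^sub>R f + a *\<^sub>R g" by transfer (auto intro: ae01_always lbb_add lbb_scaleR simp: scaleR_add_right)
  show "(a + b) *\<^sub>R f = a *\<^sub>R f + b *\<^sub>R f" by transfer (auto intro: ae01_always lbb_add lbb_scaleR simp: scaleR_add_left)
  show "a *\<^sub>R b *\<^sub>R f = (a * b) *\<^sub>R f" by transfer (auto intro: ae01_always lbb_scaleR)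
  show "1 *\<^sub>R f = f" by transfer (auto intro: ae01_always)
  show "f * g * h = f * (g * h)" by transfer (auto intro: ae01_always lbb_mult)
  show "(f + g) * h = f * h + g * h" by transfer (auto intro: ae01_always lbb_mult lbb_add simp: distrib_right)
  show "f * (g + h) = f * g + f * h" by transfer (auto intro: ae01_always lbb_mult lbb_add simp: distrib_left)
  show "a *\<^sub>R f * g = a *\<^sub>R (f * g)" by transfer (auto intro: ae01_always lbb_mult lbb_scaleR)
  show "f * a *\<^sub>R g = a *\<^sub>R (f * g)" by transfer (auto intro: ae01_always lbb_mult lbb_scaleR)
  show "1 * f = f" "f * 1 = f" by (transfer, auto intro: ae01_always)+
  show "(0::linf) \<noteq> 1" by transfer (auto dest: ae01_ex)
  show "dist f g = norm (f - g)" by (rule dist_linf_def)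
  show "sgn f = inverse (norm f) *\<^sub>R f" by (rule sgn_linf_def)
  show "uniformity = (INF e\<in>{0<..}. principal {(x, y::linf). dist x y < e})" by (rule uniformity_linf_def)
  show "open U \<longleftrightarrow> (\<forall>x\<in>U. \<forall>\<^sub>F (x', y) in uniformity. x' = x \<longrightarrow> y \<in> U)" for U :: "linf set" by (rule open_linf_def)
  show "norm f = 0 \<longleftrightarrow> f = 0"
  proof transfer
    fix f assume "lbb f \<and> lbb f \<and> ae01 (\<lambda>x. f x = (f x :: complex))"
    then have f: "lbb f" by blast
    show "ess_norm f = 0 \<longleftrightarrow> lbb f \<and> lbb (\<lambda>x. 0::complex) \<and> ae01 (\<lambda>x. f x = 0)"
    proof
      assume "ess_norm f = 0"
      with ess_norm(2)[OF f] have "ae01 (\<lambda>x. f x = 0)" by (auto elim: ae01_mono)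
      with f show "lbb f \<and> lbb (\<lambda>x. 0::complex) \<and> ae01 (\<lambda>x. f x = 0)" by auto
    next
      assume "lbb f \<and> lbb (\<lambda>x. 0::complex) \<and> ae01 (\<lambda>x. f x = 0)"
      then have "ess_norm f \<le> 0" by (intro ess_norm(3)[OF f]) (auto elim: ae01_mono)
      with ess_norm(1)[OF f] show "ess_norm f = 0" by simp
    qed
  qed
  show "norm (f + g) \<le> norm f + norm g"
  proof transfer
    fix f g :: "real \<Rightarrow> complex"
    assume "lbb f \<and> lbb f \<and> ae01 (\<lambda>x. f x = f x)" "lbb g \<and> lbb g \<and> ae01 (\<lambda>x. g x = g x)"
    then have fg: "lbb f" "lbb g" by auto
    show "ess_norm (\<lambda>x. f x + g x) \<le> ess_norm f + ess_norm g"
      using fg by (intro ess_norm(3) lbb_add add_nonneg_nonneg ess_norm(1) ae01_mp2[OF ess_norm(2)[OF fg(1)] ess_norm(2)[OF fg(2)]])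
        (auto intro: norm_triangle_mono)
  qed
  show "norm (f * g) \<le> norm f * norm g"
  proof transfer
    fix f g :: "real \<Rightarrow> complex"
    assume "lbb f \<and> lbb f \<and> ae01 (\<lambda>x. f x = f x)" "lbb g \<and> lbb g \<and> ae01 (\<lambda>x. g x = g x)"
    then have fg: "lbb f" "lbb g" by auto
    show "ess_norm (\<lambda>x. f x * g x) \<le> ess_norm f * ess_norm g"
      using fg by (intro ess_norm(3) lbb_mult mult_nonneg_nonneg ess_norm(1) ae01_mp2[OF ess_norm(2)[OF fg(1)] ess_norm(2)[OF fg(2)]])
        (auto simp: norm_mult intro!: mult_mono ess_norm(1))
  qed
  show "norm (a *\<^sub>R f) = \<bar>a\<bar> * norm f"
  proof transfer
    fix a :: real and f assume "lbb f \<and> lbb f \<and> ae01 (\<lambda>x. f x = (f x :: complex))"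
    then have f: "lbb f" by blast
    have le: "ess_norm (\<lambda>x. a *\<^sub>R f x) \<le> \<bar>a\<bar> * ess_norm f" if f: "lbb f" for a f
      using f by (intro ess_norm(3) lbb_scaleR mult_nonneg_nonneg ess_norm(1) ae01_mono[OF ess_norm(2)[OF f]])
        (auto intro: mult_left_mono)
    show "ess_norm (\<lambda>x. a *\<^sub>R f x) = \<bar>a\<bar> * ess_norm f"
    proof (cases "a = 0")
      case True
      then show ?thesis using le[OF f, of a] ess_norm(1)[OF lbb_scaleR[OF f, of a]] by simp
    next
      case False
      have "ess_norm f \<le> \<bar>inverse a\<bar> * ess_norm (\<lambda>x. a *\<^sub>R f x)"
        using le[OF lbb_scaleR[OF f, of a], of "inverse a"] False by simp
      then have "\<bar>a\<bar> * ess_norm f \<le> ess_norm (\<lambda>x. a *\<^sub>R f x)"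
        using False by (simp add: field_simps)
      with le[OF f, of a] show ?thesis by simp
    qed
  qed
  show "norm (1::linf) = 1"
  proof transfer
    have "ess_norm (\<lambda>x. 1) \<le> 1" by (intro ess_norm(3)) (auto intro: ae01_always)
    moreover have "1 \<le> ess_norm (\<lambda>x. 1)" using ae01_ex[OF ess_norm(2)[OF lbb_const, of 1]] by simp
    ultimately show "ess_norm (\<lambda>x. 1) = 1" by simp
  qed
qed
end

instance linf :: comm_ring_1
proof
  fix f g h :: linf
  show "f * g = g * f" by transfer (auto intro: ae01_always lbb_mult)
qed (auto simp: distrib_right)

lemma cls_eq_iff: "lbb f \<Longrightarrow> lbb g \<Longrightarrow> cls f = cls g \<longleftrightarrow> ae01 (\<lambda>x. f x = g x)"
  using Quotient3_rel[OF Quotient3_linf, of f g] by (simp add: ae01_always)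

lemma linf_cases: obtains f where "F = cls f" "lbb f"
  using linf.abs_induct[of "\<lambda>F. \<exists>f. F = cls f \<and> lbb f" F] by auto

lemma cls_simps:
  "cls (\<lambda>x. 0) = 0" "cls (\<lambda>x. 1) = 1"
  "lbb f \<Longrightarrow> lbb g \<Longrightarrow> cls (\<lambda>x. f x + g x) = cls f + cls g"
  "lbb f \<Longrightarrow> lbb g \<Longrightarrow> cls (\<lambda>x. f x - g x) = cls f - cls g"
  "lbb f \<Longrightarrow> lbb g \<Longrightarrow> cls (\<lambda>x. f x * g x) = cls f * cls g"
  "lbb f \<Longrightarrow> cls (\<lambda>x. - f x) = - cls f"
  "lbb f \<Longrightarrow> cls (\<lambda>x. r *\<^sub>R f x) = r *\<^sub>R cls f"
  by (auto simp: zero_linf_def one_linf_def plus_linf.abs_eq minus_linf.abs_eq times_linf.abs_eq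
      uminus_linf.abs_eq scaleR_linf.abs_eq ae01_always)

lemma cls_sum: "(\<And>i. i \<in> A \<Longrightarrow> lbb (f i)) \<Longrightarrow> cls (\<lambda>x. \<Sum>i\<in>A. f i x) = (\<Sum>i\<in>A. cls (f i))"
  by (induction A rule: infinite_finite_induct) (auto simp: cls_simps lbb_sum)

lemma norm_cls: "lbb f \<Longrightarrow> norm (cls f) = ess_norm f"
  by (simp add: norm_linf.abs_eq ae01_always)

lemma norm_cls_le_iff: "lbb f \<Longrightarrow> 0 \<le> B \<Longrightarrow> norm (cls f) \<le> B \<longleftrightarrow> ae01 (\<lambda>x. norm (f x) \<le> B)"
  unfolding norm_cls using ess_norm(2,3)[of f] by (auto elim!: ae01_mono)

lemma norm_cls_ae: "lbb f \<Longrightarrow> ae01 (\<lambda>x. norm (f x) \<le> norm (cls f))"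
  unfolding norm_cls by (rule ess_norm)

text \<open>Integration from 0 to x respects equality almost everywhere on [0, 1) when x lies in
  [0, 1]; the value 0 elsewhere makes the lifting well defined. These functionals separate points,
  see \<open>pint_eqD\<close>.\<close>

lift_definition pint :: "real \<Rightarrow> linf \<Rightarrow> complex" is
  "\<lambda>x f. if x \<in> {0..1} then integral {0..x} f else 0"
  by (auto intro: ae01_integral_eq)

lemma pint_cls: "lbb f \<Longrightarrow> x \<in> {0..1} \<Longrightarrow> pint x (cls f) = integral {0..x} f"
  by (subst pint.abs_eq) (auto intro: ae01_always)

lemma lbb_integrable: "lbb f \<Longrightarrow> f integrable_on {a..b}"
  by (intro absint_integrable lbb_absolutely_integrable)

lemma pint_diff_cls:
  assumes "lbb f" "0 \<le> x" "x \<le> y" "y \<le> 1"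
  shows "pint y (cls f) - pint x (cls f) = integral {x..y} f"
proof -
  have "integral {0..x} f + integral {x..y} f = integral {0..y} f"
    using assms by (intro Henstock_Kurzweil_Integration.integral_combine lbb_integrable) auto
  then show ?thesis using assms by (simp add: pint_cls eq_diff_eq add.commute diff_eq_eq)
qed

lemma norm_pint_diff_le:
  assumes "0 \<le> x" "x \<le> y" "y \<le> 1" shows "norm (pint y F - pint x F) \<le> (y - x) * norm F"
proof -
  obtain f where f: "F = cls f" "lbb f" by (rule linf_cases)
  have *: "ae01 (\<lambda>x. norm (f x) \<le> norm F)" using norm_cls_ae[OF f(2)] f(1) by simp
  \<comment> \<open>Truncation at the essential norm turns the almost everywhere bound into a
    pointwise one.\<close>
  define g where "g x = (if norm (f x) \<le> norm F then f x else 0)" for x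
  have "integral {x..y} f = integral {x..y} g"
    using assms * by (intro ae01_integral_eq) (auto simp: g_def elim: ae01_mono)
  moreover have "lbb g"
  proof (rule lbbI)
    show "g \<in> borel_measurable borel" unfolding g_def using lbb_measurable[OF f(2)] by measurable
  qed (auto simp: g_def)
  then have "norm (integral {x..y} g) \<le> integral {x..y} (\<lambda>_. norm F)"
    by (intro Henstock_Kurzweil_Integration.integral_norm_bound_integral lbb_integrable) (auto simp: g_def)
  ultimately show ?thesis using assms pint_diff_cls[OF f(2) assms] f(1) by simp
qed

lemma pint_0 [simp]: "pint 0 F = 0"
  by (cases F rule: linf_cases) (simp add: pint_cls)

lemma bounded_linear_pint: "bounded_linear (pint x)"
proof (cases "x \<in> {0..1}")
  case True
  show ?thesis
  proof (rule bounded_linear_intro[where K = 1])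
    fix F G :: linf and r :: real
    obtain f g where f: "F = cls f" "lbb f" "G = cls g" "lbb g" by (metis linf_cases)
    show "pint x (F + G) = pint x F + pint x G"
      using f True by (simp add: cls_simps[symmetric] pint_cls lbb_add Henstock_Kurzweil_Integration.integral_add lbb_integrable)
    show "pint x (r *\<^sub>R F) = r *\<^sub>R pint x F"
      using f True by (simp add: cls_simps[symmetric] pint_cls lbb_scaleR lbb_integrable)
    have "norm (pint x F) \<le> x * norm F" using norm_pint_diff_le[of 0 x F] True by simp
    also have "\<dots> \<le> 1 * norm F" using True by (intro mult_right_mono) auto
    finally show "norm (pint x F) \<le> norm F * 1" by simp
  qed
next
  case False
  have "pint x F = 0" for F
    by (cases F rule: linf_cases) (use False in \<open>auto simp: pint.abs_eq ae01_always\<close>)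
  then have "pint x = (\<lambda>F. 0)" by auto
  then show ?thesis by simp
qed

definition clamp01 :: "real \<Rightarrow> real" where "clamp01 x = max 0 (min 1 x)"

lemma clamp01 [simp]: "x \<in> {0..1} \<Longrightarrow> clamp01 x = x" "clamp01 x \<in> {0..1}" "0 \<le> clamp01 x" "clamp01 x \<le> 1"
  by (auto simp: clamp01_def)

lemma continuous_pint: "continuous_on UNIV (\<lambda>x. pint (clamp01 x) F)"
proof -
  have "continuous_on {0..1} (\<lambda>x. pint x F)"
    unfolding continuous_on_iff
  proof (intro ballI allI impI)
    fix x e :: real assume x: "x \<in> {0..1}" and "0 < e"
    show "\<exists>d>0. \<forall>x'\<in>{0..1}. dist x' x < d \<longrightarrow> dist (pint x' F) (pint x F) < e"
    proof (intro exI[of _ "e / (norm F + 1)"] conjI ballI impI)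
      show "0 < e / (norm F + 1)" using \<open>0 < e\<close> by (intro divide_pos_pos) (auto intro: add_nonneg_pos)
      fix y assume y: "y \<in> {0..1}" "dist y x < e / (norm F + 1)"
      have "dist (pint y F) (pint x F) \<le> dist y x * norm F"
        using norm_pint_diff_le[of x y F] norm_pint_diff_le[of y x F] x y
        by (cases "x \<le> y") (auto simp: dist_norm norm_minus_commute)
      also have "\<dots> \<le> dist y x * (norm F + 1)" by (intro mult_left_mono) auto
      also have "\<dots> < e" using y(2) by (simp add: pos_less_divide_eq add_nonneg_pos)
      finally show "dist (pint y F) (pint x F) < e" .
    qed
  qed
  then show ?thesis
    by (rule continuous_on_compose2) (auto simp: clamp01_def intro!: continuous_intros)
qed

text \<open>The Volterra operator of integration from 0, with \<open>cL\<close> below as the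
  embedding of constants. That G is the space derivative of F is expressed in the algebra by
  \<open>F = cL c + I0 G\<close> for some c.\<close>

definition I0 :: "linf \<Rightarrow> linf" where "I0 F = cls (\<lambda>x. pint (clamp01 x) F)"

definition cL :: "complex \<Rightarrow> linf" where "cL c = cls (\<lambda>_. c)"

lemma lbb_pint [simp]: "lbb (\<lambda>x. pint (clamp01 x) F)"
  by (rule lbb_continuous[OF continuous_pint])

lemma bounded_linear_I0: "bounded_linear I0"
proof (rule bounded_linear_intro[where K = 1])
  fix F G :: linf and r :: real
  show "I0 (F + G) = I0 F + I0 G"
    by (simp add: I0_def cls_simps[symmetric] linear_add[OF bounded_linear.linear[OF bounded_linear_pint]])
  show "I0 (r *\<^sub>R F) = r *\<^sub>R I0 F"
    by (simp add: I0_def cls_simps[symmetric] linear_cmul[OF bounded_linear.linear[OF bounded_linear_pint]])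
  have "norm (pint (clamp01 x) F) \<le> norm F" for x
  proof -
    have "norm (pint (clamp01 x) F) \<le> clamp01 x * norm F" using norm_pint_diff_le[of 0 "clamp01 x" F] by simp
    also have "\<dots> \<le> 1 * norm F" by (intro mult_right_mono) auto
    finally show ?thesis by simp
  qed
  then show "norm (I0 F) \<le> norm F * 1" by (auto simp: I0_def norm_cls_le_iff intro: ae01_always)
qed

lemma bounded_linear_cL: "bounded_linear cL"
proof (rule bounded_linear_intro[where K = 1])
  fix c d :: complex and r :: real
  show "cL (c + d) = cL c + cL d" "cL (r *\<^sub>R c) = r *\<^sub>R cL c"
    by (auto simp: cL_def cls_simps[symmetric])
  show "norm (cL c) \<le> norm c * 1" by (auto simp: cL_def norm_cls_le_iff intro: ae01_always)
qed

lemma cls_ac: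
  assumes "ac f g" "lbb g" shows "cls f = cL (f 0) + I0 (cls g)"
proof -
  have *: "f x = f 0 + pint (clamp01 x) (cls g)" if "x \<in> {0..<1}" for x
    using that acD[OF assms(1), of 0 x] by (simp add: pint_cls[OF assms(2)] diff_eq_eq add.commute)
  have "cls f = cls (\<lambda>x. f 0 + pint (clamp01 x) (cls g))"
    by (subst cls_eq_iff[OF ac_lbb_fun[OF assms(1)] lbb_add[OF lbb_const lbb_pint]]) (rule ae01_always, rule *)
  then show ?thesis unfolding cL_def I0_def by (simp add: cls_simps)
qed

lemma norm_le_norm_cls:
  assumes "continuous_on UNIV f" "x \<in> {0..1}" shows "norm (f x) \<le> norm (cls f)"
proof -
  have "f x \<in> cball 0 (norm (cls f))"
    by (rule ae01_continuous_closed[OF _ assms(1) _ assms(2)])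
       (use norm_cls_ae[OF lbb_continuous[OF assms(1)]] in simp_all)
  then show ?thesis by simp
qed

text \<open>The class on the right has a continuous representative with value c at 0 and c +
  \<open>pint x G\<close> at x. Its norm bounds both values, hence their difference, whatever c
  is.\<close>

lemma norm_pint_le_primitive:
  assumes "x \<in> {0..1}" shows "norm (pint x G) \<le> 2 * norm (cL c + I0 G)"
proof -
  define h where "h x = c + pint (clamp01 x) G" for x
  have h: "continuous_on UNIV h" unfolding h_def by (intro continuous_intros continuous_pint)
  have "cls h = cL c + I0 G" unfolding h_def cL_def I0_def by (simp add: cls_simps)
  then have "norm (h y) \<le> norm (cL c + I0 G)" if "y \<in> {0..1}" for y
    using norm_le_norm_cls[OF h that] by simp
  then have "norm (h x) \<le> norm (cL c + I0 G)" "norm (h 0) \<le> norm (cL c + I0 G)" using assms by auto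
  then have "norm (h x - h 0) \<le> norm (cL c + I0 G) + norm (cL c + I0 G)"
    by (meson add_mono norm_triangle_ineq4 order_trans)
  then show ?thesis using assms by (simp add: h_def)
qed

lemma ae01_nonneg_if_integrals:
  assumes f: "lbb f" and nn: "\<And>x y. 0 \<le> x \<Longrightarrow> x \<le> y \<Longrightarrow> y \<le> 1 \<Longrightarrow> integral {x..y} f \<ge> (0::real)"
  shows "ae01 (\<lambda>x. f x \<ge> 0)"
  using nonneg_if_integrals_nonneg[OF lbb_measurable[OF f] lbb_absolutely_integrable[OF f] nn]
  unfolding ae01_def by (auto elim!: eventually_mono)

text \<open>The factor 2 comes from treating real and imaginary part separately.\<close>

lemma norm_le_if_averages_le:
  assumes "\<And>x y. 0 \<le> x \<Longrightarrow> x \<le> y \<Longrightarrow> y \<le> 1 \<Longrightarrow> norm (pint y F - pint x F) \<le> M * (y - x)"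
  shows "norm F \<le> 2 * M"
proof -
  obtain f where f: "F = cls f" "lbb f" by (rule linf_cases)
  have "M \<ge> 0" using assms[of 0 1] by (auto intro: order_trans[OF norm_ge_zero])
  have 1: "ae01 (\<lambda>x. h (f x) \<le> M)" if h: "bounded_linear h" "\<And>z. \<bar>h z\<bar> \<le> norm z" for h :: "complex \<Rightarrow> real"
  proof -
    have hl: "lbb (\<lambda>x. h (f x))" by (rule lbb_bounded_linear[OF f(2) h(1)])
    have "ae01 (\<lambda>x. M - h (f x) \<ge> 0)"
    proof (rule ae01_nonneg_if_integrals)
      fix x y :: real assume xy: "0 \<le> x" "x \<le> y" "y \<le> 1"
      have "integral {x..y} (\<lambda>x. h (f x)) = h (integral {x..y} f)"
        using integral_linear[OF lbb_integrable[OF f(2)] h(1)] by (simp add: o_def)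
      also have "\<dots> \<le> norm (integral {x..y} f)" using h(2)[of "integral {x..y} f"] by linarith
      also have "\<dots> \<le> M * (y - x)" using assms[OF xy] pint_diff_cls[OF f(2) xy] f(1) by simp
      finally show "integral {x..y} (\<lambda>x. M - h (f x)) \<ge> 0"
        using xy by (subst Henstock_Kurzweil_Integration.integral_diff) (auto intro: lbb_integrable[OF hl] simp: mult.commute)
    qed (intro lbb_diff lbb_const hl)
    then show ?thesis by (rule ae01_mono) simp
  qed
  have "ae01 (\<lambda>x. Re (f x) \<le> M)" "ae01 (\<lambda>x. - Re (f x) \<le> M)" "ae01 (\<lambda>x. Im (f x) \<le> M)" "ae01 (\<lambda>x. - Im (f x) \<le> M)"
    by (rule 1; simp add: bounded_linear_Re bounded_linear_Im bounded_linear_minus abs_Re_le_cmod abs_Im_le_cmod)+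
  then have "ae01 (\<lambda>x. (Re (f x) \<le> M \<and> - Re (f x) \<le> M) \<and> (Im (f x) \<le> M \<and> - Im (f x) \<le> M))"
    by (intro ae01_conj)
  then have "ae01 (\<lambda>x. norm (f x) \<le> 2 * M)"
  proof (rule ae01_mono)
    fix x assume "(Re (f x) \<le> M \<and> - Re (f x) \<le> M) \<and> (Im (f x) \<le> M \<and> - Im (f x) \<le> M)"
    then have "\<bar>Re (f x)\<bar> + \<bar>Im (f x)\<bar> \<le> M + M" by (intro add_mono) auto
    then show "norm (f x) \<le> 2 * M" using cmod_le[of "f x"] by linarith
  qed
  then show ?thesis using \<open>M \<ge> 0\<close> f by (simp add: norm_cls_le_iff)
qed

section \<open>Elements and time derivatives recovered from integrals over intervals\<close>

lemma pint_eqD: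
  assumes "\<And>x. x \<in> {0..1} \<Longrightarrow> pint x F = pint x G" shows "F = G"
proof -
  have "pint x (F - G) = 0" if "x \<in> {0..1}" for x
    using assms[OF that] linear_diff[OF bounded_linear.linear[OF bounded_linear_pint]] by simp
  then have "norm (F - G) \<le> 2 * 0" by (intro norm_le_if_averages_le) simp
  then show ?thesis by simp
qed

text \<open>Mean value inequality for the functional \<open>pint y - pint x\<close>, whose norm is
  at most y - x. The resulting error is proportional to y - x with a constant that does not depend
  on x and y, by continuity of Z, and \<open>norm_le_if_averages_le\<close> turns this into a norm
  estimate.\<close>

lemma has_vector_derivative_if_pint:
  assumes I: "open I" and t: "t \<in> I" and Z: "continuous_on I Z"
    and der: "\<And>x s. x \<in> {0..1} \<Longrightarrow> s \<in> I \<Longrightarrow> ((\<lambda>s. pint x (f s)) has_vector_derivative pint x (Z s)) (at s)"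
  shows "(f has_vector_derivative Z t) (at t)"
  unfolding has_vector_derivative_def has_derivative_at_alt
proof (intro conjI allI impI)
  show "bounded_linear (\<lambda>x. x *\<^sub>R Z t)" by (rule bounded_linear_scaleR_left)
  fix e :: real assume "e > 0"
  obtain d1 where d1: "d1 > 0" "ball t d1 \<subseteq> I" using I t openE by blast
  \<comment> \<open>Half of e compensates the factor 2 in
    \<open>norm_le_if_averages_le\<close>.\<close>
  obtain d2 where d2: "d2 > 0" "\<And>s. s \<in> I \<Longrightarrow> dist s t < d2 \<Longrightarrow> dist (Z s) (Z t) < e / 2"
    using Z t \<open>e > 0\<close> unfolding continuous_on_iff by (metis half_gt_zero)
  define d where "d = min d1 d2"
  show "\<exists>d>0. \<forall>s. norm (s - t) < d \<longrightarrow> norm (f s - f t - (s - t) *\<^sub>R Z t) \<le> e * norm (s - t)"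
  proof (intro exI[of _ d] conjI allI impI)
    show "d > 0" using d1 d2 by (simp add: d_def)
    fix s assume s: "norm (s - t) < d"
    have sub: "closed_segment t s \<subseteq> ball t d"
      using s \<open>d > 0\<close> by (intro closed_segment_subset) (auto simp: dist_norm norm_minus_commute)
    have "norm (f s - f t - (s - t) *\<^sub>R Z t) \<le> 2 * (e / 2 * norm (s - t))"
    proof (rule norm_le_if_averages_le)
      fix x y :: real assume xy: "0 \<le> x" "x \<le> y" "y \<le> 1"
      define p where "p F = pint y F - pint x F" for F
      have bl: "bounded_linear p" unfolding p_def by (intro bounded_linear_sub bounded_linear_pint)
      have "norm (p (f s) - p (f t) - (s - t) *\<^sub>R p (Z t)) \<le> norm (s - t) * ((y - x) * (e / 2))"
      proof (rule vector_differentiable_bound_linearization[where S = "ball t d" and f' = "\<lambda>s. p (Z s)"])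
        fix r assume r: "r \<in> ball t d"
        then have rI: "r \<in> I" "dist r t < d2" using d1 d2 by (auto simp: d_def dist_commute)
        have "((\<lambda>s. p (f s)) has_vector_derivative p (Z r)) (at r)"
          unfolding p_def using der[of _ r] rI xy by (intro has_vector_derivative_diff) auto
        then show "((\<lambda>s. p (f s)) has_vector_derivative p (Z r)) (at r within ball t d)"
          by (rule has_vector_derivative_at_within)
        have "norm (p (Z r) - p (Z t)) = norm (p (Z r - Z t))"
          using linear_diff[OF bounded_linear.linear[OF bl]] by simp
        also have "\<dots> \<le> (y - x) * norm (Z r - Z t)" unfolding p_def by (rule norm_pint_diff_le[OF xy])
        also have "\<dots> \<le> (y - x) * (e / 2)"
          using d2(2)[OF rI] xy by (intro mult_left_mono) (auto simp: dist_norm)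
        finally show "norm (p (Z r) - p (Z t)) \<le> (y - x) * (e / 2)" .
      qed (use sub \<open>d > 0\<close> in auto)
      moreover have "p (f s - f t - (s - t) *\<^sub>R Z t) = p (f s) - p (f t) - (s - t) *\<^sub>R p (Z t)"
        using linear_diff[OF bounded_linear.linear[OF bl]] linear_cmul[OF bounded_linear.linear[OF bl]] by simp
      ultimately show "norm (pint y (f s - f t - (s - t) *\<^sub>R Z t) - pint x (f s - f t - (s - t) *\<^sub>R Z t))
          \<le> e / 2 * norm (s - t) * (y - x)"
        unfolding p_def by (simp add: mult_ac)
    qed
    then show "norm (f s - f t - (s - t) *\<^sub>R Z t) \<le> e * norm (s - t)" by simp
  qed
qed

text \<open>Time differentiability passes from a function to its space derivative: the Taylor
  remainder of \<open>v0\<close> dominates that of each \<open>pint x (v1 s)\<close> up to a factor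
  2, whatever the constants of integration do. Continuity of \<open>z1\<close> then lifts this to
  the norm.\<close>

lemma has_vector_derivative_primitive:
  fixes v0 v1 z0 z1 :: "real \<Rightarrow> linf"
  assumes I: "open I" and t: "t \<in> I" and Z: "continuous_on I z1"
    and der: "\<And>s. s \<in> I \<Longrightarrow> (v0 has_vector_derivative z0 s) (at s)"
    and v: "\<And>s. s \<in> I \<Longrightarrow> v0 s = cL (c s) + I0 (v1 s)"
    and z: "\<And>s. s \<in> I \<Longrightarrow> z0 s = cL (d s) + I0 (z1 s)"
  shows "(v1 has_vector_derivative z1 t) (at t)"
proof (rule has_vector_derivative_if_pint[OF I t Z])
  fix x s :: real assume x: "x \<in> {0..1}" and s: "s \<in> I"
  note lI = bounded_linear.linear[OF bounded_linear_I0] and lc = bounded_linear.linear[OF bounded_linear_cL]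
    and lp = bounded_linear.linear[OF bounded_linear_pint]
  show "((\<lambda>s. pint x (v1 s)) has_vector_derivative pint x (z1 s)) (at s)"
    unfolding has_vector_derivative_def has_derivative_within_alt2
  proof (intro conjI allI impI)
    show "bounded_linear (\<lambda>r. r *\<^sub>R pint x (z1 s))" by (rule bounded_linear_scaleR_left)
    fix e :: real assume "e > 0"
    then have "\<forall>\<^sub>F r in at s. norm (v0 r - v0 s - (r - s) *\<^sub>R z0 s) \<le> e / 2 * norm (r - s)"
      using der[OF s] unfolding has_vector_derivative_def has_derivative_within_alt2 by (metis half_gt_zero)
    moreover have "\<forall>\<^sub>F r in at s. r \<in> I" using I s by (simp add: eventually_at_in_open')
    ultimately show "\<forall>\<^sub>F r in at s. norm (pint x (v1 r) - pint x (v1 s) - (r - s) *\<^sub>R pint x (z1 s)) \<le> e * norm (r - s)"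
    proof eventually_elim
      case (elim r)
      have "v0 r - v0 s - (r - s) *\<^sub>R z0 s
          = cL (c r - c s - (r - s) *\<^sub>R d s) + I0 (v1 r - v1 s - (r - s) *\<^sub>R z1 s)"
        using v[OF elim(2)] v[OF s] z[OF s]
        by (simp add: linear_diff[OF lI] linear_cmul[OF lI] linear_diff[OF lc] linear_cmul[OF lc] scaleR_add_right)
      then have "norm (pint x (v1 r - v1 s - (r - s) *\<^sub>R z1 s)) \<le> 2 * norm (v0 r - v0 s - (r - s) *\<^sub>R z0 s)"
        using norm_pint_le_primitive[OF x, of "v1 r - v1 s - (r - s) *\<^sub>R z1 s" "c r - c s - (r - s) *\<^sub>R d s"] by simp
      then show ?case using elim(1) by (simp add: linear_diff[OF lp] linear_cmul[OF lp])
    qed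
  qed
qed

text \<open>The relation between a function and its space derivative is the vanishing of a bounded
  linear expression, so it survives differentiation in time.\<close>

lemma has_vector_derivative_wdl:
  fixes f g :: "real \<Rightarrow> linf"
  assumes I: "open I" and t: "t \<in> I"
    and f: "(f has_vector_derivative f') (at t)" and g: "(g has_vector_derivative g') (at t)"
    and fg: "\<And>s. s \<in> I \<Longrightarrow> \<exists>c. f s = cL c + I0 (g s)"
  shows "\<exists>c. f' = cL c + I0 g'"
proof -
  note lI = bounded_linear.linear[OF bounded_linear_I0] and lc = bounded_linear.linear[OF bounded_linear_cL]
    and lp = bounded_linear.linear[OF bounded_linear_pint]
  \<comment> \<open>Subtraction of the mean: a bounded operator whose kernel consists of the
    constants.\<close>
  define L where "L F = F - cL (pint 1 F)" for F
  have L: "bounded_linear L" unfolding L_def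
    by (intro bounded_linear_sub bounded_linear_ident bounded_linear_compose[OF bounded_linear_cL bounded_linear_pint])
  have L0: "L (cL c) = 0" for c by (simp add: L_def cL_def pint_cls)
  have "((\<lambda>s. L (f s - I0 (g s))) has_vector_derivative L (f' - I0 g')) (at t)"
    by (intro bounded_linear.has_vector_derivative[OF L] has_vector_derivative_diff f
        bounded_linear.has_vector_derivative[OF bounded_linear_I0] g)
  moreover have "L (f s - I0 (g s)) = 0" if "s \<in> I" for s
    using fg[OF that] L0 by auto
  then have "((\<lambda>s. L (f s - I0 (g s))) has_vector_derivative 0) (at t)"
    by (intro has_vector_derivative_transform_within_open[OF has_vector_derivative_const I t]) auto
  ultimately have "L (f' - I0 g') = 0" by (rule vector_derivative_unique_at)
  then have "f' = cL (pint 1 (f' - I0 g')) + I0 g'" by (simp add: L_def algebra_simps)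
  then show ?thesis by blast
qed

section \<open>Tame jets\<close>

text \<open>A jet of order k is a tame time-dependent function whose first k space derivatives are
  tame as well. The derivative is quantified at every level because different constructions produce
  different representatives of it.\<close>

fun jet :: "real set \<Rightarrow> real \<Rightarrow> (real \<Rightarrow> linf) set \<Rightarrow> nat \<Rightarrow> (real \<Rightarrow> real \<Rightarrow> complex) \<Rightarrow> bool" where
  "jet I C S 0 f \<longleftrightarrow> (\<forall>t\<in>I. lbb (f t)) \<and> tame I C S (\<lambda>t. cls (f t))"
| "jet I C S (Suc k) f \<longleftrightarrow> (\<forall>t\<in>I. lbb (f t)) \<and> tame I C S (\<lambda>t. cls (f t)) \<and>
     (\<exists>g. (\<forall>t\<in>I. ac (f t) (g t)) \<and> jet I C S k g)"

lemma jet_0: "jet I C S k f \<Longrightarrow> jet I C S 0 f" by (cases k) auto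

lemma jetD: "jet I C S k f \<Longrightarrow> t \<in> I \<Longrightarrow> lbb (f t)" "jet I C S k f \<Longrightarrow> tame I C S (\<lambda>t. cls (f t))"
  by (cases k; auto)+

lemma jet_Suc: "jet I C S 0 f \<Longrightarrow> (\<And>t. t \<in> I \<Longrightarrow> ac (f t) (g t)) \<Longrightarrow> jet I C S k g \<Longrightarrow> jet I C S (Suc k) f"
  by auto

lemma jet_mono: "jet I C S k f \<Longrightarrow> j \<le> k \<Longrightarrow> jet I C S j f"
proof (induction k arbitrary: f j)
  case (Suc k) then show ?case by (cases j) (auto dest: jet_0)
qed simp

lemma jet_add: "jet I C S k f \<Longrightarrow> jet I C S k g \<Longrightarrow> jet I C S k (\<lambda>t x. f t x + g t x)"
proof (induction k arbitrary: f g)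
  case 0
  have "tame I C S (\<lambda>t. cls (f t) + cls (g t))" using 0 by (auto intro: tame_add)
  then have "tame I C S (\<lambda>t. cls (\<lambda>x. f t x + g t x))"
    by (rule tame_cong) (use 0 in \<open>auto simp: cls_simps\<close>)
  then show ?case using 0 by (auto intro: lbb_add)
next
  case (Suc k)
  then obtain f' g' where *: "\<forall>t\<in>I. ac (f t) (f' t)" "jet I C S k f'" "\<forall>t\<in>I. ac (g t) (g' t)" "jet I C S k g'"
    by auto
  have "tame I C S (\<lambda>t. cls (f t) + cls (g t))" using Suc.prems by (auto intro: tame_add)
  then have "tame I C S (\<lambda>t. cls (\<lambda>x. f t x + g t x))"
    by (rule tame_cong) (use Suc.prems in \<open>auto simp: cls_simps\<close>)
  then show ?case using Suc.prems * Suc.IH[OF *(2,4)]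
    by (auto intro: lbb_add ac_add intro!: exI[of _ "\<lambda>t x. f' t x + g' t x"])
qed

lemma jet_mult: "jet I C S k f \<Longrightarrow> jet I C S k g \<Longrightarrow> jet I C S k (\<lambda>t x. f t x * g t x)"
proof (induction k arbitrary: f g)
  case 0
  have "tame I C S (\<lambda>t. cls (f t) * cls (g t))" using 0 by (auto intro: tame_mult)
  then have "tame I C S (\<lambda>t. cls (\<lambda>x. f t x * g t x))"
    by (rule tame_cong) (use 0 in \<open>auto simp: cls_simps\<close>)
  then show ?case using 0 by (auto intro: lbb_mult)
next
  case (Suc k)
  then obtain f' g' where *: "\<forall>t\<in>I. ac (f t) (f' t)" "jet I C S k f'" "\<forall>t\<in>I. ac (g t) (g' t)" "jet I C S k g'"
    by auto
  have "jet I C S k f" "jet I C S k g" using jet_mono[OF Suc.prems(1), of k] jet_mono[OF Suc.prems(2), of k] by simp_all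
  then have d: "jet I C S k (\<lambda>t x. f' t x * g t x + f t x * g' t x)" using * by (intro jet_add Suc.IH)
  have "tame I C S (\<lambda>t. cls (f t) * cls (g t))" using Suc.prems by (auto intro: tame_mult)
  then have "tame I C S (\<lambda>t. cls (\<lambda>x. f t x * g t x))"
    by (rule tame_cong) (use Suc.prems in \<open>auto simp: cls_simps\<close>)
  moreover have "ac (\<lambda>x. f t x * g t x) (\<lambda>x. f' t x * g t x + f t x * g' t x)" if "t \<in> I" for t
    using * that jetD(1)[OF *(4) that] by (intro ac_mult) auto
  ultimately show ?case using Suc.prems d by (auto intro!: lbb_mult exI[of _ "\<lambda>t x. f' t x * g t x + f t x * g' t x"])
qed

lemma jet_const: "jet I C S k (\<lambda>t x. c)"
proof (induction k arbitrary: c)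
  case 0 show ?case by (auto intro: tame_const)
next
  case (Suc k) show ?case using Suc by (auto intro: tame_const ac_const intro!: exI[of _ "\<lambda>t x. 0"])
qed

lemma jet_sequence:
  assumes "jet I C S k f"
  obtains F where "\<And>t x. F 0 t x = f t x" "\<And>i t. i < k \<Longrightarrow> t \<in> I \<Longrightarrow> ac (F i t) (F (Suc i) t)"
    "\<And>i t. i \<le> k \<Longrightarrow> t \<in> I \<Longrightarrow> lbb (F i t)" "\<And>i. i \<le> k \<Longrightarrow> tame I C S (\<lambda>t. cls (F i t))"
proof -
  have "\<exists>F. F 0 = f \<and> (\<forall>i<k. \<forall>t\<in>I. ac (F i t) (F (Suc i) t)) \<and> (\<forall>i\<le>k. jet I C S 0 (F i))"
    using assms
  proof (induction k arbitrary: f)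
    case 0 then show ?case by (intro exI[of _ "\<lambda>i. f"]) auto
  next
    case (Suc k)
    then obtain g where g: "\<forall>t\<in>I. ac (f t) (g t)" "jet I C S k g" by auto
    from Suc.IH[OF g(2)] obtain G where G: "G 0 = g" "\<forall>i<k. \<forall>t\<in>I. ac (G i t) (G (Suc i) t)" "\<forall>i\<le>k. jet I C S 0 (G i)"
      by blast
    show ?case
    proof (intro exI[of _ "case_nat f G"] conjI allI impI ballI)
      fix i t assume "i < Suc k" "t \<in> I"
      then show "ac (case_nat f G i t) (case_nat f G (Suc i) t)" using g G by (cases i) auto
    next
      fix i assume "i \<le> Suc k"
      then show "jet I C S 0 (case_nat f G i)" using jet_0[OF Suc.prems] G(3) by (cases i) auto
    qed simp
  qed
  then obtain F where "F 0 = f" "\<forall>i<k. \<forall>t\<in>I. ac (F i t) (F (Suc i) t)" "\<forall>i\<le>k. jet I C S 0 (F i)" by blast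
  then show thesis by (intro that[of F]) auto
qed

section \<open>Weak derivatives and primitives\<close>

lemma AE_torus_iff: "(AE x in torus. P x) \<longleftrightarrow> ae01 P"
  unfolding ae01_def by (subst AE_restrict_space_iff) (auto simp: AE_completion_iff)

lemma integrable_torus_iff:
  fixes f :: "real \<Rightarrow> real"
  shows "integrable torus f \<longleftrightarrow> f absolutely_integrable_on {0..1}"
proof -
  have "integrable torus f \<longleftrightarrow> f absolutely_integrable_on {0..<1}"
    unfolding set_integrable_def by (subst integrable_restrict_space) auto
  also have "\<dots> \<longleftrightarrow> f absolutely_integrable_on {0..1}"
    by (rule absolutely_integrable_spike_set_eq) (auto intro: negligible_subset[OF negligible_sing[of 1]])
  finally show ?thesis .
qed

lemma integral_torus:
  fixes f :: "real \<Rightarrow> real"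
  assumes "f absolutely_integrable_on {0..1}" shows "(\<integral>x. f x \<partial>torus) = integral {0..1} f"
proof -
  have "(\<integral>x. f x \<partial>torus) = integral {0..<1} f"
    using assms by (intro lebesgue_integral_eq_integral) (auto simp: integrable_torus_iff)
  also have "\<dots> = integral {0..1} f"
    by (rule integral_spike_set) (auto intro: negligible_subset[OF negligible_sing[of 1]])
  finally show ?thesis .
qed

lemma absint_mult_lbb:
  fixes f g :: "real \<Rightarrow> real"
  assumes "f absolutely_integrable_on {a..b}" "lbb g" shows "(\<lambda>x. f x * g x) absolutely_integrable_on {a..b}"
proof -
  have "(\<lambda>x. g x * f x) absolutely_integrable_on {a..b}"
  proof (rule absolutely_integrable_bounded_measurable_product_real)
    show "bounded (g ` {a..b})" using lbb_boundE[OF assms(2), of a b] unfolding bounded_iff by (metis imageE)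
  qed (use assms in \<open>auto intro: borel_measurable_lebesgue_onI lbb_measurable\<close>)
  then show ?thesis by (simp add: mult.commute)
qed

lemma ac_if_derivative:
  fixes f g :: "real \<Rightarrow> real"
  assumes "\<And>x. (f has_real_derivative g x) (at x)" "continuous_on UNIV g" shows "ac f g"
proof (rule ac_lbb)
  show "lbb g" by (rule lbb_continuous[OF assms(2)])
  fix x y :: real assume "x \<le> y"
  then have "(g has_integral f y - f x) {x..y}"
    by (intro fundamental_theorem_of_calculus)
       (auto simp: has_real_derivative_iff_has_vector_derivative[symmetric] intro: has_field_derivative_at_within assms(1))
  then show "f y - f x = integral {x..y} g" by (simp add: integral_unique)
qed

lemma ac_primitive_exists:
  assumes "\<And>a b. g absolutely_integrable_on {a..b}"
  obtains F where "ac F g" "F 0 = c"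
proof -
  define F where "F x = c + (if 0 \<le> x then integral {0..x} g else - integral {x..0} g)" for x
  have comb: "integral {x..y} g + integral {y..z} g = integral {x..z} g" if "x \<le> y" "y \<le> z" for x y z
    using that by (intro Henstock_Kurzweil_Integration.integral_combine absint_integrable assms)
  have "F y - F x = integral {x..y} g" if "x \<le> y" for x y
    using that comb[of 0 x y] comb[of x y 0] comb[of x 0 y] by (auto simp: F_def algebra_simps)
  then have "ac F g" using assms by (simp add: ac_def)
  moreover have "F 0 = c" by (simp add: F_def)
  ultimately show thesis by (rule that)
qed

text \<open>A set closed under differentiation contains all iterated derivatives of its members, so
  no formula for them is needed.\<close>

lemma smooth_torus_family:
  assumes "f \<in> S" and "\<And>f. f \<in> S \<Longrightarrow> periodic1 f \<and> (\<exists>g\<in>S. \<forall>x. (f has_real_derivative g x) (at x))"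
  shows "smooth_torus f"
proof -
  have m: "cderiv m f \<in> S" for m
  proof (induction m)
    case (Suc m)
    then obtain g where g: "g \<in> S" "\<forall>x. (cderiv m f has_real_derivative g x) (at x)" using assms(2) by blast
    then have "deriv (cderiv m f) = g" by (intro ext DERIV_imp_deriv) auto
    then show ?case using g(1) by simp
  qed (simp add: assms(1))
  have "cderiv m f field_differentiable at x" for m x
    using assms(2)[OF m[of m]] by (auto simp: field_differentiable_def)
  then show ?thesis using assms by (auto simp: smooth_torus_def)
qed

lemma smooth_torusD:
  assumes "smooth_torus f"
  shows "periodic1 f" "\<And>x. (f has_real_derivative deriv f x) (at x)" "smooth_torus (deriv f)" "continuous_on UNIV f"
    "cderiv (Suc m) f = cderiv m (deriv f)"
proof -
  show p: "periodic1 f" using assms by (simp add: smooth_torus_def)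
  have fd: "f field_differentiable at x" for x using assms unfolding smooth_torus_def by (metis funpow_0)
  then show d: "(f has_real_derivative deriv f x) (at x)" for x by (simp add: DERIV_deriv_iff_field_differentiable)
  show "continuous_on UNIV f" using d by (meson DERIV_isCont continuous_at_imp_continuous_on)
  show e: "cderiv (Suc m) f = cderiv m (deriv f)" for m by (simp add: funpow_swap1)
  have "deriv f (x + 1) = deriv f x" for x
  proof -
    have "((\<lambda>y. f (y + 1)) has_real_derivative deriv f (x + 1)) (at x)"
      using d[of "x + 1"] by (simp add: DERIV_shift)
    moreover have "(\<lambda>y. f (y + 1)) = f" using p by (auto simp: periodic1_def)
    ultimately show ?thesis using d DERIV_unique by metis
  qed
  moreover have "cderiv m (deriv f) field_differentiable at x" for m x
    using assms e[of m] unfolding smooth_torus_def by metis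
  ultimately show "smooth_torus (deriv f)" by (simp add: smooth_torus_def periodic1_def)
qed

lemma smooth_cderiv: "smooth_torus f \<Longrightarrow> smooth_torus (cderiv m f)"
  by (induction m) (simp_all add: smooth_torusD(3))

lemma ac_smooth: "smooth_torus f \<Longrightarrow> ac f (deriv f)"
  by (intro ac_if_derivative smooth_torusD)

lemma lbb_smooth: "smooth_torus f \<Longrightarrow> lbb f"
  by (intro lbb_continuous smooth_torusD)

text \<open>Trigonometric polynomials with one more generator s. If the derivative of s belongs to
  the algebra, the algebra is closed under differentiation and consists of smooth functions.\<close>

inductive_set testalg :: "(real \<Rightarrow> real) \<Rightarrow> (real \<Rightarrow> real) set" for s where
  const: "(\<lambda>x. c) \<in> testalg s"
| sin: "(\<lambda>x. sin (2 * pi * x)) \<in> testalg s"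
| cos: "(\<lambda>x. cos (2 * pi * x)) \<in> testalg s"
| base: "s \<in> testalg s"
| add: "f \<in> testalg s \<Longrightarrow> g \<in> testalg s \<Longrightarrow> (\<lambda>x. f x + g x) \<in> testalg s"
| mult: "f \<in> testalg s \<Longrightarrow> g \<in> testalg s \<Longrightarrow> (\<lambda>x. f x * g x) \<in> testalg s"

lemma smooth_testalg:
  assumes s: "periodic1 s" "\<And>x. (s has_real_derivative s' x) (at x)" "s' \<in> testalg s" and f: "f \<in> testalg s"
  shows "smooth_torus f"
proof (rule smooth_torus_family[OF f])
  fix f assume "f \<in> testalg s"
  then show "periodic1 f \<and> (\<exists>g\<in>testalg s. \<forall>x. (f has_real_derivative g x) (at x))"
  proof induction
    case (const c) show ?case by (auto simp: periodic1_def intro!: bexI[OF _ testalg.const[of 0]])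
  next
    case sin
    have "periodic1 (\<lambda>x. sin (2 * pi * x))" by (auto simp: periodic1_def distrib_left sin_add)
    moreover have "(\<lambda>x. (2 * pi) * cos (2 * pi * x)) \<in> testalg s"
      by (intro testalg.mult[of "\<lambda>x. 2 * pi"] testalg.const testalg.cos)
    ultimately show ?case by (auto intro!: bexI[of _ "\<lambda>x. (2 * pi) * cos (2 * pi * x)"] derivative_eq_intros)
  next
    case cos
    have "periodic1 (\<lambda>x. cos (2 * pi * x))" by (auto simp: periodic1_def distrib_left cos_add)
    moreover have "(\<lambda>x. (- 2 * pi) * sin (2 * pi * x)) \<in> testalg s"
      by (intro testalg.mult[of "\<lambda>x. - 2 * pi"] testalg.const testalg.sin)
    ultimately show ?case by (auto intro!: bexI[of _ "\<lambda>x. (- 2 * pi) * sin (2 * pi * x)"] derivative_eq_intros)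
  next
    case base show ?case using s by auto
  next
    case (add f g)
    then obtain f' g' where "f' \<in> testalg s" "g' \<in> testalg s" "\<forall>x. (f has_real_derivative f' x) (at x)"
      "\<forall>x. (g has_real_derivative g' x) (at x)" by auto
    then show ?case using add
      by (auto simp: periodic1_def intro!: bexI[of _ "\<lambda>x. f' x + g' x"] testalg.add DERIV_add)
  next
    case (mult f g)
    then obtain f' g' where *: "f' \<in> testalg s" "g' \<in> testalg s" "\<forall>x. (f has_real_derivative f' x) (at x)"
      "\<forall>x. (g has_real_derivative g' x) (at x)" by auto
    have "(\<lambda>x. f' x * g x + g' x * f x) \<in> testalg s" using * mult by (intro testalg.add testalg.mult)
    then show ?case using * mult
      by (auto simp: periodic1_def intro!: bexI[of _ "\<lambda>x. f' x * g x + g' x * f x"] DERIV_mult)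
  qed
qed

lemma smooth_const: "smooth_torus (\<lambda>x. c)"
  by (rule smooth_testalg[of "\<lambda>x. 0" "\<lambda>x. 0"]) (auto simp: periodic1_def intro: testalg.intros)

text \<open>Logistic functions of \<open>N (cos (2 \<pi> (x - m)) - cos (2 \<pi> r))\<close> are smooth, periodic and bounded and tend
  to the indicator of the interval of radius \<open>r\<close> around \<open>m\<close>.\<close>

definition bump :: "real \<Rightarrow> real \<Rightarrow> real \<Rightarrow> real \<Rightarrow> real" where
  "bump N m r x = 1 / (1 + exp (- N * (cos (2 * pi * (x - m)) - cos (2 * pi * r))))"

text \<open>A logistic function b satisfies b' = b (1 - b) times the derivative of its argument,
  here a trigonometric polynomial; so b' lies in the algebra generated by b.\<close>

lemma smooth_bump: "smooth_torus (bump N m r)"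
proof (rule smooth_testalg[of "bump N m r" "\<lambda>x. bump N m r x * (1 + - 1 * bump N m r x)
      * (- N * (2 * pi) * (cos (2 * pi * m) * sin (2 * pi * x) + (- sin (2 * pi * m)) * cos (2 * pi * x)))"])
  have "2 * pi * (x + 1 - m) = 2 * pi * (x - m) + 2 * pi" for x by (simp add: algebra_simps)
  then have "cos (2 * pi * (x + 1 - m)) = cos (2 * pi * (x - m))" for x by (simp only: cos_periodic)
  then show "periodic1 (bump N m r)" by (simp add: periodic1_def bump_def)
  show "bump N m r \<in> testalg (bump N m r)" by (rule testalg.base)
  show "(\<lambda>x. bump N m r x * (1 + - 1 * bump N m r x) * (- N * (2 * pi) * (cos (2 * pi * m) * sin (2 * pi * x) + (- sin (2 * pi * m)) * cos (2 * pi * x))))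
    \<in> testalg (bump N m r)"
    by (intro testalg.mult testalg.add testalg.base testalg.const testalg.sin testalg.cos)
  fix x
  have p: "1 + exp (- N * (cos (2 * pi * (x - m)) - cos (2 * pi * r))) > 0"
    by (intro add_pos_pos) auto
  have s: "sin (2 * pi * (x - m)) = cos (2 * pi * m) * sin (2 * pi * x) + (- sin (2 * pi * m)) * cos (2 * pi * x)"
    unfolding right_diff_distrib sin_diff by simp
  show "(bump N m r has_real_derivative bump N m r x * (1 + - 1 * bump N m r x) * (- N * (2 * pi) * (cos (2 * pi * m) * sin (2 * pi * x) + (- sin (2 * pi * m)) * cos (2 * pi * x)))) (at x)"
    unfolding s[symmetric] bump_def
    using p by (auto intro!: derivative_eq_intros simp: field_simps power2_eq_square)
qed

lemma bump_bounds: "0 \<le> bump N m r x" "bump N m r x \<le> 1"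
proof -
  have "exp (- N * (cos (2 * pi * (x - m)) - cos (2 * pi * r))) > 0" by simp
  then show "0 \<le> bump N m r x" "bump N m r x \<le> 1" unfolding bump_def
    by (auto simp only: divide_le_eq_1 zero_le_divide_iff)
qed

lemma bump_limit:
  assumes "0 < r" "r < 1/2" "\<bar>x - m\<bar> \<le> 1 - r" "\<bar>x - m\<bar> \<noteq> r" "\<bar>x - m\<bar> \<noteq> 1 - r"
  shows "(\<lambda>n. bump (real n) m r x) \<longlonglongrightarrow> (if \<bar>x - m\<bar> < r then 1 else 0)"
proof -
  define c where "c = cos (2 * pi * (x - m)) - cos (2 * pi * r)"
  have "cos (2 * pi * y) = cos (2 * pi * \<bar>y\<bar>)" for y by (cases "y \<ge> 0") (auto simp: abs_if)
  note cabs = this[of "x - m"]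
  have b: "(\<lambda>n. bump (real n) m r x) = (\<lambda>n. 1 / (1 + exp (- c * real n)))"
    unfolding bump_def c_def[symmetric] by (simp add: mult.commute)
  show ?thesis
  proof (cases "\<bar>x - m\<bar> < r")
    case True
    have "cos (2 * pi * r) < cos (2 * pi * \<bar>x - m\<bar>)"
      using True assms by (intro cos_monotone_0_pi) auto
    then have "c > 0" using cabs by (simp add: c_def)
    then have "(\<lambda>n. 1 / (1 + exp (- c * real n))) \<longlonglongrightarrow> 1" by real_asymp
    then show ?thesis using True b by simp
  next
    case False
    have "cos (2 * pi * \<bar>x - m\<bar>) < cos (2 * pi * r)"
    proof (cases "\<bar>x - m\<bar> \<le> 1/2")
      case True then show ?thesis using False assms by (intro cos_monotone_0_pi) auto
    next
      case F: False
      \<comment> \<open>Beyond half a period the cosine increases again; reflecting |x - m| to 1 -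
        |x - m| returns to the range where it decreases.\<close>
      have "cos (2 * pi * (1 - \<bar>x - m\<bar>)) < cos (2 * pi * r)"
      proof (rule cos_monotone_0_pi)
        show "2 * pi * r < 2 * pi * (1 - \<bar>x - m\<bar>)" using F assms by (intro mult_strict_left_mono) auto
      qed (use F assms in auto)
      moreover have "cos (2 * pi * (1 - \<bar>x - m\<bar>)) = cos (2 * pi * \<bar>x - m\<bar>)"
        by (simp add: right_diff_distrib cos_diff)
      ultimately show ?thesis by simp
    qed
    then have "c < 0" using cabs by (simp add: c_def)
    then have "(\<lambda>n. 1 / (1 + exp (- c * real n))) \<longlonglongrightarrow> 0" by real_asymp
    then show ?thesis using False b by simp
  qed
qed

text \<open>Dominated convergence along the bumps of midpoint m and radius r. These require 0 < r <
  1/2; the full period is treated with the constant test function, and one-point intervals are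
  trivial.\<close>

lemma integral_zero_if_orthogonal_smooth:
  fixes h :: "real \<Rightarrow> real"
  assumes h: "h absolutely_integrable_on {0..1}"
    and orth: "\<And>\<phi>. smooth_torus \<phi> \<Longrightarrow> integral {0..1} (\<lambda>x. h x * \<phi> x) = 0"
    and ab: "0 \<le> a" "a \<le> b" "b \<le> 1"
  shows "integral {a..b} h = 0"
proof (cases "a = b \<or> (a = 0 \<and> b = 1)")
  case True
  have "integral {0..1} (\<lambda>x. h x * 1) = 0" by (rule orth[OF smooth_const])
  then show ?thesis using True by auto
next
  case False
  define m r where "m = (a + b) / 2" and "r = (b - a) / 2"
  have r: "0 < r" "r < 1/2" using False ab by (auto simp: r_def)
  \<comment> \<open>The points where the bumps need not tend to 0 or 1: the two ends of the interval
    and the nearest ends of its two neighbouring periodic copies.\<close>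
  define N where "N = {a, b, m + 1 - r, m - 1 + r}"
  have lim: "((\<lambda>n. integral {0..1} (\<lambda>x. h x * bump (real n) m r x)) \<longlongrightarrow>
      integral {0..1} (\<lambda>x. if x \<in> {a..b} then h x else 0)) sequentially"
  proof -
    have "(\<lambda>x. if x \<in> N then 0 else h x * bump (real n) m r x) integrable_on {0..1}" for n
      by (rule integrable_spike[OF absint_integrable[OF absint_mult_lbb[OF h lbb_smooth[OF smooth_bump]]], of N])
         (auto simp: N_def)
    moreover have "(\<lambda>x. norm (h x)) integrable_on {0..1}" using h absolutely_integrable_on_def by blast
    moreover have "norm (if x \<in> N then 0 else h x * bump (real n) m r x) \<le> norm (h x)" for x n
      using bump_bounds[of "real n" m r x] mult_left_mono[of "bump (real n) m r x" 1 "\<bar>h x\<bar>"] by (auto simp: abs_mult)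
    moreover have "(\<lambda>n. if x \<in> N then 0 else h x * bump (real n) m r x) \<longlonglongrightarrow> (if x \<in> N then 0 else if x \<in> {a..b} then h x else 0)" if "x \<in> {0..1}" for x
    proof (cases "x \<in> N")
      case False
      have "(\<lambda>n. bump (real n) m r x) \<longlonglongrightarrow> (if \<bar>x - m\<bar> < r then 1 else 0)"
      proof (rule bump_limit[OF r])
        show "\<bar>x - m\<bar> \<le> 1 - r" using that ab by (auto simp: m_def r_def abs_le_iff field_simps)
        show "\<bar>x - m\<bar> \<noteq> r" "\<bar>x - m\<bar> \<noteq> 1 - r" using False by (auto simp: N_def m_def r_def abs_if field_simps split: if_splits)
      qed
      from tendsto_mult[OF tendsto_const[of "h x"] this]
      have "(\<lambda>n. h x * bump (real n) m r x) \<longlonglongrightarrow> h x * (if \<bar>x - m\<bar> < r then 1 else 0)" .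
      moreover have "\<bar>x - m\<bar> < r \<longleftrightarrow> x \<in> {a..b}"
        using False by (auto simp: N_def m_def r_def abs_if field_simps split: if_splits)
      ultimately show ?thesis using False by (cases "x \<in> {a..b}") auto
    qed simp
    ultimately have "((\<lambda>n. integral {0..1} (\<lambda>x. if x \<in> N then 0 else h x * bump (real n) m r x)) \<longlongrightarrow>
      integral {0..1} (\<lambda>x. if x \<in> N then 0 else if x \<in> {a..b} then h x else 0)) sequentially"
      by (intro dominated_convergence(2)[where h = "\<lambda>x. norm (h x)"]) auto
    moreover have "integral {0..1} (\<lambda>x. if x \<in> N then 0 else f x) = integral {0..1} f" for f :: "real \<Rightarrow> real"
      by (rule integral_spike[of N]) (auto simp: N_def)
    ultimately show ?thesis by simp
  qed
  then have "integral {0..1} (\<lambda>x. if x \<in> {a..b} then h x else 0) = 0"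
    unfolding orth[OF smooth_bump] LIMSEQ_const_iff by simp
  moreover have "integral {0..1} (\<lambda>x. if x \<in> {a..b} then h x else 0) = integral {a..b} h"
  proof -
    have e: "{a..b} \<inter> {0..1} = {a..b}" "{0..1} \<inter> {a..b} = {a..b}" using ab by auto
    from integral_restrict_Int[of "{0..1}" "{a..b}" h] show ?thesis unfolding e .
  qed
  ultimately show ?thesis by simp
qed

text \<open>\<open>nonneg_if_integrals_nonneg\<close> is applied to a Borel representative and to
  its negative.\<close>

lemma ae_zero_if_integrals_zero:
  fixes h :: "real \<Rightarrow> real"
  assumes h: "h absolutely_integrable_on {0..1}"
    and i0: "\<And>a b. 0 \<le> a \<Longrightarrow> a \<le> b \<Longrightarrow> b \<le> 1 \<Longrightarrow> integral {a..b} h = 0"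
  shows "ae01 (\<lambda>x. h x = 0)"
proof -
  have "integrable torus h" using h by (simp add: integrable_torus_iff)
  then have "h \<in> borel_measurable torus" by simp
  then have "(\<lambda>x. indicator {0..<1} x * h x) \<in> borel_measurable lebesgue"
    using borel_measurable_restrict_space_iff[of "{0..<1}" lebesgue h] by simp
  from completion_ex_borel_measurable_real[OF this]
  obtain g where g: "g \<in> borel_measurable borel" "AE x in lborel. indicator {0..<1} x * h x = g x" by auto
  have e: "ae01 (\<lambda>x. h x = g x)" unfolding ae01_def using g(2) by eventually_elim (auto simp: indicator_def)
  have "g absolutely_integrable_on {0..1}"
  proof (rule absolutely_integrable_spike[OF h])
    show "negligible (insert 1 {x\<in>{0..<1}. \<not> h x = g x})" using e by (simp add: ae01_negligible)
  qed auto
  note gi = this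
  have gz: "integral {a..b} g = 0" if "0 \<le> a" "a \<le> b" "b \<le> 1" for a b
    using i0[OF that] ae01_integral_eq[OF e that(1,3)] by simp
  have 1: "AE x in lborel. x \<in> {0..1} \<longrightarrow> g x \<ge> 0"
    by (rule nonneg_if_integrals_nonneg[OF g(1) gi]) (simp add: gz)
  have "(\<lambda>x. - g x) absolutely_integrable_on {0..1}"
    using set_integrable_mult_right[of "-1::real" lebesgue "{0..1}" g] gi by simp
  then have 2: "AE x in lborel. x \<in> {0..1} \<longrightarrow> - g x \<ge> 0"
    by (intro nonneg_if_integrals_nonneg) (use g gz in auto)
  have "ae01 (\<lambda>x. g x = 0)" unfolding ae01_def using 1 2 by eventually_elim auto
  with e show ?thesis by (rule ae01_mp2) simp
qed

section \<open>Calculus of weak derivatives\<close>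

lemma weak_derivD:
  assumes "weak_deriv m f g"
  shows "periodic1 f" "periodic1 g" "f absolutely_integrable_on {0..1}" "g absolutely_integrable_on {0..1}"
    "smooth_torus \<phi> \<Longrightarrow> integral {0..1} (\<lambda>x. f x * cderiv m \<phi> x) = (-1) ^ m * integral {0..1} (\<lambda>x. g x * \<phi> x)"
proof -
  show *: "periodic1 f" "periodic1 g" "f absolutely_integrable_on {0..1}" "g absolutely_integrable_on {0..1}"
    using assms by (auto simp: weak_deriv_def integrable_torus_iff)
  assume \<phi>: "smooth_torus \<phi>"
  have "smooth_torus (cderiv m \<phi>)" by (rule smooth_cderiv[OF \<phi>])
  then show "integral {0..1} (\<lambda>x. f x * cderiv m \<phi> x) = (-1) ^ m * integral {0..1} (\<lambda>x. g x * \<phi> x)"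
    using assms \<phi> unfolding weak_deriv_def
    by (simp flip: integral_torus[OF absint_mult_lbb[OF *(3) lbb_smooth[OF smooth_cderiv[OF \<phi>]]]]
        integral_torus[OF absint_mult_lbb[OF *(4) lbb_smooth[OF \<phi>]]])
qed

lemma weak_derivI:
  assumes "periodic1 f" "periodic1 g" "f absolutely_integrable_on {0..1}" "g absolutely_integrable_on {0..1}"
    "\<And>\<phi>. smooth_torus \<phi> \<Longrightarrow> integral {0..1} (\<lambda>x. f x * cderiv m \<phi> x) = (-1) ^ m * integral {0..1} (\<lambda>x. g x * \<phi> x)"
  shows "weak_deriv m f g"
proof -
  have "(\<integral>x. f x * cderiv m \<phi> x \<partial>torus) = (-1) ^ m * (\<integral>x. g x * \<phi> x \<partial>torus)" if "smooth_torus \<phi>" for \<phi>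
    using assms(5)[OF that] by (simp add: integral_torus[OF absint_mult_lbb[OF assms(3) lbb_smooth[OF smooth_cderiv[OF that]]]]
        integral_torus[OF absint_mult_lbb[OF assms(4) lbb_smooth[OF that]]])
  then show ?thesis using assms(1-4) by (simp add: weak_deriv_def integrable_torus_iff)
qed

lemma ae_zero_if_orthogonal_smooth:
  fixes h :: "real \<Rightarrow> real"
  assumes "h absolutely_integrable_on {0..1}"
    and "\<And>\<phi>. smooth_torus \<phi> \<Longrightarrow> integral {0..1} (\<lambda>x. h x * \<phi> x) = 0"
  shows "ae01 (\<lambda>x. h x = 0)"
  by (rule ae_zero_if_integrals_zero[OF assms(1)]) (rule integral_zero_if_orthogonal_smooth[OF assms])

lemma integral_diff_mult:
  fixes f g \<phi> :: "real \<Rightarrow> real"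
  assumes "f absolutely_integrable_on {0..1}" "g absolutely_integrable_on {0..1}" "lbb \<phi>"
  shows "integral {0..1} (\<lambda>x. (f x - g x) * \<phi> x) = integral {0..1} (\<lambda>x. f x * \<phi> x) - integral {0..1} (\<lambda>x. g x * \<phi> x)"
  unfolding left_diff_distrib
  by (intro Henstock_Kurzweil_Integration.integral_diff absint_integrable absint_mult_lbb assms)

lemma weak_deriv_unique:
  assumes "weak_deriv m f g" "weak_deriv m f h" shows "ae01 (\<lambda>x. g x = h x)"
proof -
  have "ae01 (\<lambda>x. g x - h x = 0)"
  proof (rule ae_zero_if_orthogonal_smooth)
    show "(\<lambda>x. g x - h x) absolutely_integrable_on {0..1}"
      by (intro set_integral_diff weak_derivD(4)[OF assms(1)] weak_derivD(4)[OF assms(2)])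
    fix \<phi> assume \<phi>: "smooth_torus \<phi>"
    show "integral {0..1} (\<lambda>x. (g x - h x) * \<phi> x) = 0"
      using weak_derivD(5)[OF assms(1) \<phi>] weak_derivD(5)[OF assms(2) \<phi>]
        integral_diff_mult[OF weak_derivD(4)[OF assms(1)] weak_derivD(4)[OF assms(2)] lbb_smooth[OF \<phi>]] by simp
  qed
  then show ?thesis by (rule ae01_mono) simp
qed

lemma weak_deriv_ae_cong:
  assumes "weak_deriv m f g" "ae01 (\<lambda>x. f x = f' x)" "ae01 (\<lambda>x. g x = g' x)" "periodic1 f'" "periodic1 g'"
  shows "weak_deriv m f' g'"
proof (rule weak_derivI)
  have sp: "h' absolutely_integrable_on {0..1}" if "h absolutely_integrable_on {0..1}" "ae01 (\<lambda>x. h x = h' x)" for h h' :: "real \<Rightarrow> real"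
  proof (rule absolutely_integrable_spike[OF that(1)])
    show "negligible (insert 1 {x\<in>{0..<1}. \<not> h x = h' x})" using that(2) by (simp add: ae01_negligible)
  qed auto
  show "f' absolutely_integrable_on {0..1}" "g' absolutely_integrable_on {0..1}"
    using sp weak_derivD(3,4)[OF assms(1)] assms(2,3) by blast+
  fix \<phi> assume \<phi>: "smooth_torus \<phi>"
  have "integral {0..1} (\<lambda>x. f x * cderiv m \<phi> x) = integral {0..1} (\<lambda>x. f' x * cderiv m \<phi> x)"
    by (rule ae01_integral_eq[OF ae01_mono[OF assms(2)]]) auto
  moreover have "integral {0..1} (\<lambda>x. g x * \<phi> x) = integral {0..1} (\<lambda>x. g' x * \<phi> x)"
    by (rule ae01_integral_eq[OF ae01_mono[OF assms(3)]]) auto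
  ultimately show "integral {0..1} (\<lambda>x. f' x * cderiv m \<phi> x) = (-1) ^ m * integral {0..1} (\<lambda>x. g' x * \<phi> x)"
    using weak_derivD(5)[OF assms(1) \<phi>] by simp
qed (use assms in auto)

lemma weak_deriv_add_scale:
  assumes "weak_deriv m f g" "weak_deriv m f2 g2"
  shows "weak_deriv m (\<lambda>x. f x + c * f2 x) (\<lambda>x. g x + c * g2 x)"
proof (rule weak_derivI)
  note * = weak_derivD(3,4)[OF assms(1)] weak_derivD(3,4)[OF assms(2)]
  show "(\<lambda>x. f x + c * f2 x) absolutely_integrable_on {0..1}" "(\<lambda>x. g x + c * g2 x) absolutely_integrable_on {0..1}"
    using * by (auto intro!: set_integral_add set_integrable_mult_right)
  show "periodic1 (\<lambda>x. f x + c * f2 x)" "periodic1 (\<lambda>x. g x + c * g2 x)"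
    using weak_derivD(1,2)[OF assms(1)] weak_derivD(1,2)[OF assms(2)] by (auto simp: periodic1_def)
  fix \<phi> assume \<phi>: "smooth_torus \<phi>"
  then have sm: "smooth_torus (cderiv m \<phi>)" by (rule smooth_cderiv)
  have lin: "integral {0..1} (\<lambda>x. (p x + c * q x) * \<psi> x) = integral {0..1} (\<lambda>x. p x * \<psi> x) + c * integral {0..1} (\<lambda>x. q x * \<psi> x)"
    if "p absolutely_integrable_on {0..1}" "q absolutely_integrable_on {0..1}" "lbb \<psi>" for p q \<psi> :: "real \<Rightarrow> real"
  proof -
    have "integral {0..1} (\<lambda>x. (p x + c * q x) * \<psi> x) = integral {0..1} (\<lambda>x. p x * \<psi> x + c * (q x * \<psi> x))"
      by (simp add: algebra_simps)
    also have "\<dots> = integral {0..1} (\<lambda>x. p x * \<psi> x) + integral {0..1} (\<lambda>x. c * (q x * \<psi> x))"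
      using that by (intro Henstock_Kurzweil_Integration.integral_add absint_integrable set_integrable_mult_right absint_mult_lbb) auto
    finally show ?thesis by simp
  qed
  show "integral {0..1} (\<lambda>x. (f x + c * f2 x) * cderiv m \<phi> x) = (-1) ^ m * integral {0..1} (\<lambda>x. (g x + c * g2 x) * \<phi> x)"
    unfolding lin[OF *(1,3) lbb_smooth[OF sm]] lin[OF *(2,4) lbb_smooth[OF \<phi>]]
      weak_derivD(5)[OF assms(1) \<phi>] weak_derivD(5)[OF assms(2) \<phi>] by (simp add: distrib_left)
qed

text \<open>Order j tested with the derivative of \<phi> and order j + 1 tested with \<phi> have the
  same left-hand side.\<close>

lemma weak_deriv_step:
  assumes "weak_deriv j f g" "weak_deriv (Suc j) f h" shows "weak_deriv 1 g h"
proof (rule weak_derivI)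
  fix \<phi> assume \<phi>: "smooth_torus \<phi>"
  show "integral {0..1} (\<lambda>x. g x * cderiv 1 \<phi> x) = (-1) ^ 1 * integral {0..1} (\<lambda>x. h x * \<phi> x)"
    using weak_derivD(5)[OF assms(1) smooth_torusD(3)[OF \<phi>]] weak_derivD(5)[OF assms(2) \<phi>]
    unfolding smooth_torusD(5)[OF \<phi>] by (simp add: minus_one_power_iff split: if_splits)
qed (use weak_derivD[OF assms(1)] weak_derivD[OF assms(2)] in auto)

lemma weak_deriv_compose:
  assumes "weak_deriv j f g" "weak_deriv 1 g h" shows "weak_deriv (Suc j) f h"
proof (rule weak_derivI)
  fix \<phi> assume \<phi>: "smooth_torus \<phi>"
  show "integral {0..1} (\<lambda>x. f x * cderiv (Suc j) \<phi> x) = (-1) ^ Suc j * integral {0..1} (\<lambda>x. h x * \<phi> x)"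
    using weak_derivD(5)[OF assms(1) smooth_torusD(3)[OF \<phi>]] weak_derivD(5)[OF assms(2) \<phi>]
    unfolding smooth_torusD(5)[OF \<phi>] by simp
qed (use weak_derivD[OF assms(1)] weak_derivD[OF assms(2)] in auto)

lemma weak_deriv_0: "periodic1 f \<Longrightarrow> f absolutely_integrable_on {0..1} \<Longrightarrow> weak_deriv 0 f f"
  by (rule weak_derivI) auto

section \<open>Periodic functions and their representatives\<close>

lemma periodic1_shift: assumes "periodic1 f" shows "f (x + of_int n) = f x"
proof (induction n rule: int_induct[where k = 0])
  case (step1 i)
  have "f (x + of_int (i + 1)) = f ((x + of_int i) + 1)" by (simp add: add.assoc)
  then show ?case using step1 assms by (simp add: periodic1_def)
next
  case (step2 i)
  have "f (x + of_int i) = f ((x + of_int (i - 1)) + 1)" by simp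
  also have "\<dots> = f (x + of_int (i - 1))" using assms by (simp only: periodic1_def)
  finally show ?case using step2 by simp
qed simp

lemma periodic1_frac: "periodic1 f \<Longrightarrow> f (frac x) = f x"
  using periodic1_shift[of f x "- floor x"] by (simp add: frac_def)

text \<open>The exceptional set is covered by the integer translates of a null set in one
  period.\<close>

lemma AE_lborel_if_periodic:
  assumes "ae01 P" "\<And>x. P (frac x) \<Longrightarrow> P x" shows "AE x in lborel. P x"
proof -
  let ?N = "{x\<in>{0..<1}. \<not> P x}"
  have "negligible (\<Union>n::int. (\<lambda>x. of_int n + x) ` ?N)"
    using assms(1) unfolding ae01_negligible
    by (intro negligible_countable_Union) (auto simp del: atLeastLessThan_iff intro: negligible_translation)
  moreover have "{x. \<not> P x} \<subseteq> (\<Union>n::int. (\<lambda>x. of_int n + x) ` ?N)"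
  proof safe
    fix x assume "\<not> P x"
    then have "frac x \<in> ?N" using assms(2) by (auto simp: frac_lt_1)
    moreover have "x = of_int (floor x) + frac x" by (simp add: frac_def)
    ultimately show "x \<in> (\<Union>n::int. (\<lambda>x. of_int n + x) ` ?N)" by blast
  qed
  ultimately have "negligible {x. \<not> P x}" by (rule negligible_subset)
  then have "AE x in lebesgue. P x" unfolding negligible_iff_null_sets
    by (auto simp: eventually_ae_filter)
  then show ?thesis by (simp add: AE_completion_iff)
qed

lemma periodic_ae01_eq:
  assumes "ae01 (\<lambda>x. f x = g x)" "periodic1 f" "periodic1 g" shows "AE x in lborel. f x = g x"
  using assms(1) by (rule AE_lborel_if_periodic) (simp add: periodic1_frac assms)

lemma lbb_frac: assumes "lbb f" shows "lbb (\<lambda>x. f (frac x))"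
proof -
  obtain B where "\<And>x. x \<in> {0..1} \<Longrightarrow> norm (f x) \<le> B" using lbb_boundE[OF assms] by metis
  then have "norm (f (frac x)) \<le> B" for x by (simp add: frac_lt_1 less_imp_le)
  moreover have "(\<lambda>x. frac x :: real) \<in> borel_measurable borel" unfolding frac_def by measurable
  then have "(\<lambda>x. f (frac x)) \<in> borel_measurable borel"
    by (rule measurable_compose[OF _ lbb_measurable[OF assms]])
  ultimately show ?thesis by (rule lbbI[rotated])
qed

lemma periodic1_frac_comp: "periodic1 (\<lambda>x. f (frac x))"
  by (auto simp: periodic1_def frac_1_eq)

lemma periodic_lbb_bounded:
  fixes f :: "real \<Rightarrow> real"
  assumes "lbb f" "periodic1 f" obtains B where "B > 0" "\<And>x. \<bar>f x\<bar> \<le> B"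
proof -
  obtain B where B: "B > 0" "\<And>x. x \<in> {0..1} \<Longrightarrow> norm (f x) \<le> B" using lbb_boundE[OF assms(1)] by metis
  have "\<bar>f x\<bar> \<le> B" for x
    using B(2)[of "frac x"] periodic1_frac[OF assms(2), of x] by (simp add: frac_lt_1 less_imp_le)
  then show thesis using B(1) by (rule that[rotated])
qed

text \<open>F (x + 1) - F x is a primitive of g (x + 1) - g x = 0.\<close>

lemma periodic_integral_shift:
  fixes g :: "real \<Rightarrow> real"
  assumes F: "ac F g" and p: "periodic1 g"
  shows "F (x + 1) - F x = F 1 - F 0"
proof -
  have "ac (\<lambda>x. F (x + 1)) g" unfolding ac_def
  proof (intro conjI allI impI ac_integrable[OF F])
    fix x y :: real assume "x \<le> y"
    have "integral {x+1..y+1} g = integral {x..y} (\<lambda>x. g (x + 1))"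
      using integral_shift_Icc_real[of x y g 1] by (simp add: o_def add.commute)
    also have "(\<lambda>x. g (x + 1)) = g" using p by (auto simp: periodic1_def)
    finally show "F (y + 1) - F (x + 1) = integral {x..y} g"
      using acD[OF F, of "x+1" "y+1"] \<open>x \<le> y\<close> by simp
  qed
  from ac_diff[OF this F] have z: "ac (\<lambda>x. F (x + 1) - F x) (\<lambda>x. 0)" by simp
  show ?thesis
  proof (cases "x \<le> 0")
    case True
    from acD[OF z this] show ?thesis unfolding integral_0 add_0 by linarith
  next
    case False
    then have "0 \<le> x" by simp
    from acD[OF z this] show ?thesis unfolding integral_0 add_0 by linarith
  qed
qed

text \<open>A Borel modification on one period is truncated at B, so that the bound holds
  everywhere, and then extended by \<open>frac\<close>.\<close>

lemma periodic_rep: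
  assumes f: "f \<in> borel_measurable torus" "ae01 (\<lambda>x. \<bar>f x\<bar> \<le> B)" "B \<ge> 0"
  obtains F where "lbb F" "periodic1 F" "\<And>x. \<bar>F x\<bar> \<le> B" "ae01 (\<lambda>x. f x = F x)"
proof -
  have "(\<lambda>x. indicator {0..<1} x * f x) \<in> borel_measurable lebesgue"
    using f(1) borel_measurable_restrict_space_iff[of "{0..<1}" lebesgue f] by simp
  from completion_ex_borel_measurable_real[OF this]
  obtain g where g: "g \<in> borel_measurable borel" "AE x in lborel. indicator {0..<1} x * f x = g x" by auto
  define h where "h x = (if \<bar>g x\<bar> \<le> B then g x else 0)" for x
  have h: "lbb h"
  proof (rule lbbI)
    show "h \<in> borel_measurable borel" unfolding h_def using g(1) by measurable
    show "norm (h x) \<le> B" for x using f(3) by (simp add: h_def)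
  qed
  have "ae01 (\<lambda>x. f x = g x)" unfolding ae01_def using g(2) by eventually_elim (auto simp: indicator_def)
  then have e: "ae01 (\<lambda>x. f x = h x)" using f(2) by (rule ae01_mp2) (simp add: h_def)
  show thesis
  proof (rule that[of "\<lambda>x. h (frac x)"])
    show "lbb (\<lambda>x. h (frac x))" by (rule lbb_frac[OF h])
    show "periodic1 (\<lambda>x. h (frac x))" by (rule periodic1_frac_comp)
    show "\<bar>h (frac x)\<bar> \<le> B" for x using f(3) by (simp add: h_def)
    show "ae01 (\<lambda>x. f x = h (frac x))"
      using ae01_conj[OF e ae01_always[of "\<lambda>x. x \<in> {0..<1}"]] by (auto elim!: ae01_mono simp: frac_eq[THEN iffD2])
  qed
qed

text \<open>A test function of mean zero is the derivative of a test function, so an integrable function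
  whose weak derivative vanishes is constant.\<close>

lemma smooth_primitive:
  assumes "smooth_torus \<psi>" obtains \<phi> where "smooth_torus \<phi>" "deriv \<phi> = (\<lambda>x. \<psi> x - integral {0..1} \<psi>)"
proof -
  define m where "m = integral {0..1} \<psi>"
  define q where "q x = \<psi> x - m" for x
  have q: "continuous_on UNIV q" unfolding q_def by (intro continuous_intros smooth_torusD assms)
  obtain \<phi> where \<phi>: "ac \<phi> q" "\<phi> 0 = 0"
    using ac_primitive_exists[OF lbb_absolutely_integrable[OF lbb_continuous[OF q]]] by blast
  have d: "(\<phi> has_real_derivative q x) (at x)" for x
  proof -
    have "((\<lambda>u. integral {x - 1..u} q) has_vector_derivative q x) (at x within {x - 1..x + 1})"
      by (intro integral_has_vector_derivative continuous_on_subset[OF q]) auto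
    then have "((\<lambda>u. integral {x - 1..u} q) has_vector_derivative q x) (at x)"
      by (subst (asm) at_within_interior) auto
    then have "((\<lambda>u. \<phi> (x - 1) + integral {x - 1..u} q) has_vector_derivative 0 + q x) (at x)"
      by (intro has_vector_derivative_add has_vector_derivative_const)
    then have "(\<phi> has_vector_derivative 0 + q x) (at x)"
    proof (rule has_vector_derivative_transform_within_open[where S = "{x - 1<..}"])
      fix u assume "u \<in> {x - 1<..}"
      then show "\<phi> (x - 1) + integral {x - 1..u} q = \<phi> u" using acD[OF \<phi>(1), of "x - 1" u] by simp
    qed auto
    then show ?thesis by (simp add: has_real_derivative_iff_has_vector_derivative)
  qed
  then have dq: "deriv \<phi> = q" by (intro ext DERIV_imp_deriv)
  have pq: "periodic1 q" using smooth_torusD(1)[OF assms] by (simp add: q_def periodic1_def)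
  have "\<phi> 1 - \<phi> 0 = integral {0..1} q" using acD[OF \<phi>(1), of 0 1] by simp
  also have "\<dots> = 0" unfolding q_def m_def
    by (subst Henstock_Kurzweil_Integration.integral_diff) (auto intro: lbb_integrable lbb_smooth assms)
  finally have "periodic1 \<phi>" using periodic_integral_shift[OF \<phi>(1) pq] by (simp add: periodic1_def)
  moreover have "cderiv n \<phi> field_differentiable at x" for n x
  proof (cases n)
    case 0 then show ?thesis using d by (auto simp: field_differentiable_def)
  next
    case (Suc k)
    have qm: "cderiv (Suc j) q = cderiv (Suc j) \<psi>" for j
    proof -
      have "deriv q = deriv \<psi>" unfolding q_def
      proof (intro ext DERIV_imp_deriv)
        fix x have "((\<lambda>x. \<psi> x - m) has_real_derivative deriv \<psi> x - 0) (at x)"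
          by (intro DERIV_diff smooth_torusD assms DERIV_const)
        then show "((\<lambda>x. \<psi> x - m) has_real_derivative deriv \<psi> x) (at x)" by simp
      qed
      then show ?thesis by (simp only: funpow_Suc_right o_apply)
    qed
    have "cderiv n \<phi> = cderiv k q" using dq Suc by (simp only: funpow_Suc_right o_apply)
    moreover have "cderiv k q field_differentiable at x"
    proof (cases k)
      case 0
      have "((\<lambda>x. \<psi> x - m) has_real_derivative deriv \<psi> x - 0) (at x)"
        by (intro DERIV_diff smooth_torusD assms DERIV_const)
      then show ?thesis using 0 by (auto simp: field_differentiable_def q_def[abs_def])
    next
      case (Suc j)
      show ?thesis unfolding Suc qm using assms unfolding smooth_torus_def by blast
    qed
    ultimately show ?thesis by simp
  qed
  ultimately have "smooth_torus \<phi>" by (simp add: smooth_torus_def)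
  moreover have "deriv \<phi> = (\<lambda>x. \<psi> x - integral {0..1} \<psi>)" unfolding dq by (simp add: q_def[abs_def] m_def)
  ultimately show thesis by (rule that)
qed

text \<open>Integration by parts; the boundary terms cancel by periodicity.\<close>

lemma weak_deriv_if_ac:
  assumes F: "ac F G" and p: "periodic1 F" "periodic1 G"
  shows "weak_deriv 1 F G"
proof (rule weak_derivI[OF p])
  show "F absolutely_integrable_on {0..1}" "G absolutely_integrable_on {0..1}"
    by (intro lbb_absolutely_integrable ac_lbb_fun[OF F] ac_integrable[OF F])+
  fix \<phi> assume \<phi>: "smooth_torus \<phi>"
  have "lbb (deriv \<phi>)" by (rule lbb_smooth[OF smooth_torusD(3)[OF \<phi>]])
  from ac_mult[OF F ac_smooth[OF \<phi>] this]
  have "F 1 * \<phi> 1 - F 0 * \<phi> 0 = integral {0..1} (\<lambda>x. G x * \<phi> x + F x * deriv \<phi> x)" by (rule acD) simp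
  also have "\<dots> = integral {0..1} (\<lambda>x. G x * \<phi> x) + integral {0..1} (\<lambda>x. F x * deriv \<phi> x)"
    by (intro Henstock_Kurzweil_Integration.integral_add absint_integrable absint_mult_lbb ac_integrable[OF F]
        lbb_smooth[OF \<phi>] \<open>lbb (deriv \<phi>)\<close> lbb_absolutely_integrable[OF ac_lbb_fun[OF F]])
  finally have calc: "F 1 * \<phi> 1 - F 0 * \<phi> 0 = integral {0..1} (\<lambda>x. G x * \<phi> x) + integral {0..1} (\<lambda>x. F x * deriv \<phi> x)" .
  show "integral {0..1} (\<lambda>x. F x * cderiv 1 \<phi> x) = (-1) ^ 1 * integral {0..1} (\<lambda>x. G x * \<phi> x)"
  proof -
    have "F 1 = F 0" "\<phi> 1 = \<phi> 0" using p(1) smooth_torusD(1)[OF \<phi>] unfolding periodic1_def by (metis add_0)+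
    then have "0 = integral {0..1} (\<lambda>x. G x * \<phi> x) + integral {0..1} (\<lambda>x. F x * deriv \<phi> x)"
      using calc by simp
    then show ?thesis by simp
  qed
qed

text \<open>Testing with the constant 1 shows that g has mean zero, so its primitive G takes the
  same value at 0 and 1. Integration by parts makes f - G orthogonal to all derivatives of test
  functions, that is to all test functions of mean zero; hence f - G is constant.\<close>

lemma weak_deriv_1_primitive:
  assumes w: "weak_deriv 1 f g"
  shows "integral {0..1} g = 0" "\<exists>c. ae01 (\<lambda>x. f x = c + integral {0..x} g)"
proof -
  note fg = weak_derivD(3,4)[OF w]
  show g0: "integral {0..1} g = 0" using weak_derivD(5)[OF w smooth_const[of 1]] by simp
  \<comment> \<open>Extension by 0: integrability is at hand on [0, 1], whereas \<open>ac\<close>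
    asks for it on every interval.\<close>
  define g1 where "g1 x = (if x \<in> {0..1} then g x else 0)" for x
  have g1: "g1 absolutely_integrable_on {a..b}" for a b
  proof -
    have "(\<lambda>x. indicator {0..1} x *\<^sub>R g x) = g1" by (auto simp: g1_def indicator_def)
    then have "g1 absolutely_integrable_on UNIV" using fg(2) by (simp add: set_integrable_def)
    then show ?thesis by (rule set_integrable_subset) auto
  qed
  obtain G where G: "ac G g1" "G 0 = 0" using ac_primitive_exists[OF g1] by blast
  have Gx: "G x = integral {0..x} g" if "x \<in> {0..1}" for x
  proof -
    have "integral {0..x} g1 = integral {0..x} g" by (rule Henstock_Kurzweil_Integration.integral_cong) (use that in \<open>auto simp: g1_def\<close>)
    then show ?thesis using acD[OF G(1), of 0 x] G(2) that by simp
  qed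
  have fG: "(\<lambda>x. f x - G x) absolutely_integrable_on {0..1}"
    by (intro set_integral_diff fg lbb_absolutely_integrable ac_lbb_fun[OF G(1)])
  define c where "c = integral {0..1} (\<lambda>x. f x - G x)"
  have "ae01 (\<lambda>x. (f x - G x) - c = 0)"
  proof (rule ae_zero_if_orthogonal_smooth)
    show "(\<lambda>x. f x - G x - c) absolutely_integrable_on {0..1}"
      by (intro set_integral_diff fG lbb_absolutely_integrable lbb_const)
    fix \<psi> assume \<psi>: "smooth_torus \<psi>"
    define m where "m = integral {0..1} \<psi>"
    obtain \<phi> where \<phi>: "smooth_torus \<phi>" "deriv \<phi> = (\<lambda>x. \<psi> x - m)" using smooth_primitive[OF \<psi>] m_def by metis
    have l: "lbb (deriv \<phi>)" by (rule lbb_smooth[OF smooth_torusD(3)[OF \<phi>(1)]])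
    from ac_mult[OF G(1) ac_smooth[OF \<phi>(1)] l]
    have "G 1 * \<phi> 1 - G 0 * \<phi> 0 = integral {0..1} (\<lambda>x. g1 x * \<phi> x + G x * deriv \<phi> x)" by (rule acD) simp
    also have "\<dots> = integral {0..1} (\<lambda>x. g1 x * \<phi> x) + integral {0..1} (\<lambda>x. G x * deriv \<phi> x)"
      by (intro Henstock_Kurzweil_Integration.integral_add absint_integrable absint_mult_lbb g1
          lbb_smooth[OF \<phi>(1)] l lbb_absolutely_integrable[OF ac_lbb_fun[OF G(1)]])
    also have "integral {0..1} (\<lambda>x. g1 x * \<phi> x) = integral {0..1} (\<lambda>x. g x * \<phi> x)"
      by (rule Henstock_Kurzweil_Integration.integral_cong) (auto simp: g1_def)
    finally have "integral {0..1} (\<lambda>x. G x * deriv \<phi> x) = - integral {0..1} (\<lambda>x. g x * \<phi> x)"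
      using Gx[of 1] g0 G(2) by simp
    then have z: "integral {0..1} (\<lambda>x. (f x - G x) * deriv \<phi> x) = 0"
      using weak_derivD(5)[OF w \<phi>(1)] integral_diff_mult[OF fg(1) lbb_absolutely_integrable[OF ac_lbb_fun[OF G(1)]] l] by simp
    have "integral {0..1} (\<lambda>x. (f x - G x) * deriv \<phi> x) = integral {0..1} (\<lambda>x. (f x - G x) * \<psi> x - m * (f x - G x))"
      unfolding \<phi>(2) by (simp add: algebra_simps)
    also have "\<dots> = integral {0..1} (\<lambda>x. (f x - G x) * \<psi> x) - integral {0..1} (\<lambda>x. m * (f x - G x))"
      by (intro Henstock_Kurzweil_Integration.integral_diff absint_integrable absint_mult_lbb fG lbb_smooth[OF \<psi>] set_integrable_mult_right)
    finally have 1: "integral {0..1} (\<lambda>x. (f x - G x) * \<psi> x) = m * c" using z by (simp add: c_def)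
    have "integral {0..1} (\<lambda>x. (f x - G x - c) * \<psi> x) = integral {0..1} (\<lambda>x. (f x - G x) * \<psi> x) - integral {0..1} (\<lambda>x. c * \<psi> x)"
      by (intro integral_diff_mult fG lbb_absolutely_integrable lbb_const lbb_smooth \<psi>)
    then show "integral {0..1} (\<lambda>x. (f x - G x - c) * \<psi> x) = 0" using 1 by (simp add: m_def)
  qed
  then have "ae01 (\<lambda>x. f x = c + G x)" by (rule ae01_mono) simp
  moreover have "ae01 (\<lambda>x. G x = integral {0..x} g)" by (rule ae01_always) (simp add: Gx)
  ultimately have "ae01 (\<lambda>x. f x = c + integral {0..x} g)" by (rule ae01_mp2) simp
  then show "\<exists>c. ae01 (\<lambda>x. f x = c + integral {0..x} g)" by blast
qed

text \<open>Each derivative below the top one is replaced by a primitive of a bounded Borel periodic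
  representative of the next one. The next derivative has mean zero, so the primitive is periodic;
  the top order keeps its Borel representative.\<close>

lemma weak_deriv_chain_representatives:
  assumes w: "\<And>j. j \<le> k \<Longrightarrow> weak_deriv j f (g j)" and b: "\<And>j. j \<le> k \<Longrightarrow> \<exists>B. ae01 (\<lambda>x. \<bar>g j x\<bar> \<le> B)"
  obtains F where "\<And>j. j \<le> k \<Longrightarrow> lbb (F j)" "\<And>j. j \<le> k \<Longrightarrow> periodic1 (F j)"
    "\<And>j. j \<le> k \<Longrightarrow> ae01 (\<lambda>x. g j x = F j x)" "\<And>j. j < k \<Longrightarrow> ac (F j) (F (Suc j))"
proof -
  have "\<exists>G. lbb G \<and> periodic1 G \<and> ae01 (\<lambda>x. g j x = G x)" if j: "j \<le> k" for j
  proof -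
    obtain B where "ae01 (\<lambda>x. \<bar>g j x\<bar> \<le> B)" using b[OF j] by blast
    then have "ae01 (\<lambda>x. \<bar>g j x\<bar> \<le> \<bar>B\<bar>)" by (rule ae01_mono) simp
    moreover have "g j \<in> borel_measurable torus"
      using w[OF j] unfolding weak_deriv_def by (blast intro: borel_measurable_integrable)
    ultimately show ?thesis using periodic_rep[of "g j" "\<bar>B\<bar>"] by (metis abs_ge_zero)
  qed
  then obtain G where G: "\<And>j. j \<le> k \<Longrightarrow> lbb (G j)" "\<And>j. j \<le> k \<Longrightarrow> periodic1 (G j)"
    "\<And>j. j \<le> k \<Longrightarrow> ae01 (\<lambda>x. g j x = G j x)" by metis
  have "\<exists>P. ac P (G (Suc j)) \<and> periodic1 P \<and> ae01 (\<lambda>x. g j x = P x)" if jk: "j < k" for j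
  proof -
    have w1: "weak_deriv 1 (g j) (g (Suc j))" using that by (intro weak_deriv_step[OF w w]) auto
    obtain c where c: "ae01 (\<lambda>x. g j x = c + integral {0..x} (g (Suc j)))" using weak_deriv_1_primitive(2)[OF w1] by blast
    have eq: "integral {0..x} (g (Suc j)) = integral {0..x} (G (Suc j))" if "x \<le> 1" for x
      using G(3)[of "Suc j"] \<open>j < k\<close> that by (intro ae01_integral_eq) auto
    obtain P where P: "ac P (G (Suc j))" "P 0 = c"
      using ac_primitive_exists[OF lbb_absolutely_integrable[OF G(1)[of "Suc j"]]] jk by (metis Suc_leI)
    have Px: "P x = c + integral {0..x} (g (Suc j))" if "x \<in> {0..1}" for x
      using acD[OF P(1), of 0 x] that P(2) eq[of x] by simp
    have "P 1 = P 0" using Px[of 1] Px[of 0] weak_deriv_1_primitive(1)[OF w1] by simp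
    then have "periodic1 P"
      using periodic_integral_shift[OF P(1) G(2)] that by (simp add: periodic1_def)
    moreover have "ae01 (\<lambda>x. P x = c + integral {0..x} (g (Suc j)))" by (rule ae01_always) (simp add: Px)
    with c have "ae01 (\<lambda>x. g j x = P x)" by (rule ae01_mp2) simp
    ultimately show ?thesis using P(1) by blast
  qed
  then obtain P where P: "\<And>j. j < k \<Longrightarrow> ac (P j) (G (Suc j))" "\<And>j. j < k \<Longrightarrow> periodic1 (P j)"
    "\<And>j. j < k \<Longrightarrow> ae01 (\<lambda>x. g j x = P j x)" by metis
  define F where "F j = (if j < k then P j else G j)" for j
  show thesis
  proof (rule that[of F])
    fix j
    show "j \<le> k \<Longrightarrow> lbb (F j)" "j \<le> k \<Longrightarrow> periodic1 (F j)" and e: "j \<le> k \<Longrightarrow> ae01 (\<lambda>x. g j x = F j x)" for j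
      using ac_lbb_fun[OF P(1)[of j]] G[of j] P[of j] by (auto simp: F_def)
    assume j: "j < k"
    \<comment> \<open>The function integrated to obtain \<open>P j\<close> and the member of the
      chain that follows it agree only almost everywhere, which suffices for
      \<open>ac_transfer\<close>.\<close>
    have "AE x in lborel. G (Suc j) x = F (Suc j) x"
    proof (rule periodic_ae01_eq)
      show "ae01 (\<lambda>x. G (Suc j) x = F (Suc j) x)"
        by (rule ae01_mp2[OF G(3)[of "Suc j"] e[of "Suc j"]]) (use j in auto)
      show "periodic1 (G (Suc j))" "periodic1 (F (Suc j))" using j G(2) P(2) by (auto simp: F_def)
    qed
    with P(1)[OF j] show "ac (F j) (F (Suc j))" using j by (auto simp: F_def intro: ac_transfer)
  qed
qed

lemma weak_deriv_if_chain:
  assumes "\<And>j. j \<le> k \<Longrightarrow> lbb (F j)" "\<And>j. j \<le> k \<Longrightarrow> periodic1 (F j)" "\<And>j. j < k \<Longrightarrow> ac (F j) (F (Suc j))" "j \<le> k"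
  shows "weak_deriv j (F 0) (F j)"
  using assms(4)
proof (induction j)
  case 0 show ?case using assms(1,2)[of 0] by (auto intro: weak_deriv_0 lbb_absolutely_integrable)
next
  case (Suc j)
  have "weak_deriv 1 (F j) (F (Suc j))" using Suc.prems assms by (intro weak_deriv_if_ac) auto
  then show ?case using Suc by (intro weak_deriv_compose[of j _ "F j"]) auto
qed

section \<open>The spaces and norms of the statement in terms of representatives\<close>

lemma Linf_iff: "f \<in> Linf \<longleftrightarrow> periodic1 f \<and> f \<in> borel_measurable torus \<and> (\<exists>B. ae01 (\<lambda>x. \<bar>f x\<bar> \<le> B))"
  by (simp add: Linf_def AE_torus_iff)

lemma lbb_in_Linf: assumes "lbb F" "periodic1 F" shows "F \<in> Linf"
proof -
  obtain B where "\<And>x. \<bar>F x\<bar> \<le> B" using periodic_lbb_bounded[OF assms] by metis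
  then show ?thesis using assms unfolding Linf_iff
    by (auto intro: ae01_always borel_measurable_lebesgue_onI lbb_measurable)
qed

lemma Winf_representatives:
  assumes "f \<in> Winf k"
  obtains F where "\<And>j. j \<le> k \<Longrightarrow> lbb (F j)" "\<And>j. j \<le> k \<Longrightarrow> periodic1 (F j)" "\<And>j. j < k \<Longrightarrow> ac (F j) (F (Suc j))"
    "\<And>j. j \<le> k \<Longrightarrow> weak_deriv j f (F j)" "ae01 (\<lambda>x. f x = F 0 x)"
proof -
  have "\<forall>j\<le>k. \<exists>g. weak_deriv j f g \<and> (\<exists>B. ae01 (\<lambda>x. \<bar>g x\<bar> \<le> B))"
  proof (intro allI impI)
    fix j assume "j \<le> k"
    then obtain h where "h \<in> Linf" "weak_deriv j f h" using assms unfolding Winf_def by blast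
    then show "\<exists>g. weak_deriv j f g \<and> (\<exists>B. ae01 (\<lambda>x. \<bar>g x\<bar> \<le> B))" unfolding Linf_iff by blast
  qed
  then obtain g where g: "\<And>j. j \<le> k \<Longrightarrow> weak_deriv j f (g j)" "\<And>j. j \<le> k \<Longrightarrow> \<exists>B. ae01 (\<lambda>x. \<bar>g j x\<bar> \<le> B)" by metis
  obtain F where F: "\<And>j. j \<le> k \<Longrightarrow> lbb (F j)" "\<And>j. j \<le> k \<Longrightarrow> periodic1 (F j)"
    "\<And>j. j \<le> k \<Longrightarrow> ae01 (\<lambda>x. g j x = F j x)" "\<And>j. j < k \<Longrightarrow> ac (F j) (F (Suc j))"
    using weak_deriv_chain_representatives[where f = f and g = g and k = k] g by blast
  have w: "weak_deriv j f (F j)" if "j \<le> k" for j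
    using g(1)[OF that] by (rule weak_deriv_ae_cong) (use F that weak_derivD(1)[OF g(1)[OF that]] in \<open>auto intro: ae01_always\<close>)
  have "weak_deriv 0 f f" using weak_derivD(1,3)[OF w[of 0]] by (auto intro: weak_deriv_0)
  then have "ae01 (\<lambda>x. f x = F 0 x)" using weak_deriv_unique w by blast
  with F w show thesis by (intro that[of F])
qed

lemma Winf_if_chain:
  assumes "\<And>j. j \<le> k \<Longrightarrow> lbb (F j)" "\<And>j. j \<le> k \<Longrightarrow> periodic1 (F j)" "\<And>j. j < k \<Longrightarrow> ac (F j) (F (Suc j))"
  shows "F 0 \<in> Winf k"
  using weak_deriv_if_chain[of k F, OF assms] lbb_in_Linf[OF assms(1,2)] by (auto simp: Winf_def)

lemma weak_deriv_wderiv: "weak_deriv j f g \<Longrightarrow> weak_deriv j f (wderiv j f)"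
  unfolding wderiv_def by (rule someI[of "weak_deriv j f"])

lemma wderiv_ae: "weak_deriv j f g \<Longrightarrow> ae01 (\<lambda>x. wderiv j f x = g x)"
  using weak_deriv_unique weak_deriv_wderiv by blast

lemma esssup_torus:
  assumes "f \<in> borel_measurable torus" "ae01 (\<lambda>x. \<bar>f x\<bar> \<le> B)"
  shows "0 \<le> real_of_ereal (esssup torus (\<lambda>x. ereal \<bar>f x\<bar>))" "real_of_ereal (esssup torus (\<lambda>x. ereal \<bar>f x\<bar>)) \<le> B"
    "ae01 (\<lambda>x. \<bar>f x\<bar> \<le> real_of_ereal (esssup torus (\<lambda>x. ereal \<bar>f x\<bar>)))"
proof -
  let ?E = "esssup torus (\<lambda>x. ereal \<bar>f x\<bar>)"
  have m: "(\<lambda>x. ereal \<bar>f x\<bar>) \<in> borel_measurable torus" using assms(1) by measurable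
  have ae: "ae01 (\<lambda>x. ereal \<bar>f x\<bar> \<le> ?E)" using esssup_AE[of "\<lambda>x. ereal \<bar>f x\<bar>" torus] by (simp add: AE_torus_iff)
  have le: "?E \<le> ereal B"
    by (rule esssup_I[OF m]) (use assms(2) in \<open>simp add: AE_torus_iff\<close>)
  obtain x where "ereal \<bar>f x\<bar> \<le> ?E" using ae01_ex[OF ae] by blast
  then have ge: "0 \<le> ?E" by (meson abs_ge_zero ereal_less_eq(5) order_trans)
  then obtain e where e: "?E = ereal e" using le by (cases ?E) auto
  show "0 \<le> real_of_ereal ?E" "real_of_ereal ?E \<le> B" using ge le e by auto
  show "ae01 (\<lambda>x. \<bar>f x\<bar> \<le> real_of_ereal ?E)" using ae by (rule ae01_mono) (simp add: e)
qed

lemma Wnorm_bounds: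
  assumes w: "\<And>j. j \<le> k \<Longrightarrow> weak_deriv j f (g j)" and b: "\<And>j. j \<le> k \<Longrightarrow> ae01 (\<lambda>x. \<bar>g j x\<bar> \<le> B j)"
  shows "0 \<le> Wnorm k f" "Wnorm k f \<le> (\<Sum>j\<le>k. B j)" "\<And>j. j \<le> k \<Longrightarrow> ae01 (\<lambda>x. \<bar>g j x\<bar> \<le> Wnorm k f)"
proof -
  let ?e = "\<lambda>j. real_of_ereal (esssup torus (\<lambda>x. ereal \<bar>wderiv j f x\<bar>))"
  have *: "0 \<le> ?e j" "?e j \<le> B j" "ae01 (\<lambda>x. \<bar>wderiv j f x\<bar> \<le> ?e j)" if "j \<le> k" for j
  proof -
    have m: "wderiv j f \<in> borel_measurable torus"
      using weak_deriv_wderiv[OF w[OF that]] unfolding weak_deriv_def by (blast intro: borel_measurable_integrable)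
    have bd: "ae01 (\<lambda>x. \<bar>wderiv j f x\<bar> \<le> B j)" by (rule ae01_mp2[OF wderiv_ae[OF w[OF that]] b[OF that]]) simp
    show "0 \<le> ?e j" "?e j \<le> B j" "ae01 (\<lambda>x. \<bar>wderiv j f x\<bar> \<le> ?e j)" using esssup_torus[OF m bd] .
  qed
  show "0 \<le> Wnorm k f" "Wnorm k f \<le> (\<Sum>j\<le>k. B j)" unfolding Wnorm_def using * by (auto intro: sum_nonneg sum_mono)
  fix j assume j: "j \<le> k"
  have "?e j \<le> Wnorm k f" unfolding Wnorm_def by (rule member_le_sum) (use * j in auto)
  then show "ae01 (\<lambda>x. \<bar>g j x\<bar> \<le> Wnorm k f)"
    by (intro ae01_mp2[OF wderiv_ae[OF w[OF j]] *(3)[OF j], of "\<lambda>x. \<bar>g j x\<bar> \<le> Wnorm k f"]) simp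
qed

lemma Hnorm_bound:
  assumes w: "\<And>j. j \<le> k \<Longrightarrow> weak_deriv j f (g j)" and l: "lbb (g j)" and j: "j \<le> k"
  shows "0 \<le> Hnorm k f" "integral {0..1} (\<lambda>x. (g j x)\<^sup>2) \<le> (Hnorm k f)\<^sup>2"
proof -
  have nn: "0 \<le> (\<integral>x. (wderiv j f x)\<^sup>2 \<partial>torus)" for j by simp
  then have s: "0 \<le> (\<Sum>j\<le>k. \<integral>x. (wderiv j f x)\<^sup>2 \<partial>torus)" by (intro sum_nonneg) auto
  then show "0 \<le> Hnorm k f" by (simp add: Hnorm_def)
  have "integral {0..1} (\<lambda>x. (g j x)\<^sup>2) = (\<integral>x. (g j x)\<^sup>2 \<partial>torus)"
    by (rule integral_torus[symmetric]) (intro lbb_absolutely_integrable lbb_power l)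
  also have "\<dots> = (\<integral>x. (wderiv j f x)\<^sup>2 \<partial>torus)"
  proof (rule integral_cong_AE)
    show "(\<lambda>x. (g j x)\<^sup>2) \<in> borel_measurable torus"
      by (intro borel_measurable_lebesgue_onI lbb_measurable lbb_power l)
    have "wderiv j f \<in> borel_measurable torus"
      using weak_deriv_wderiv[OF w[OF j]] unfolding weak_deriv_def by (blast intro: borel_measurable_integrable)
    then show "(\<lambda>x. (wderiv j f x)\<^sup>2) \<in> borel_measurable torus" by measurable
    show "AE x in torus. (g j x)\<^sup>2 = (wderiv j f x)\<^sup>2"
      unfolding AE_torus_iff by (rule ae01_mono[OF wderiv_ae[OF w[OF j]]]) simp
  qed
  also have "\<dots> \<le> (\<Sum>j\<le>k. \<integral>x. (wderiv j f x)\<^sup>2 \<partial>torus)"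
    by (rule member_le_sum) (use nn j in auto)
  also have "\<dots> = (Hnorm k f)\<^sup>2" using s by (simp add: Hnorm_def)
  finally show "integral {0..1} (\<lambda>x. (g j x)\<^sup>2) \<le> (Hnorm k f)\<^sup>2" .
qed

text \<open>The Cauchy-Schwarz inequality on the unit interval, obtained from the nonnegative
  variance of |g|.\<close>

lemma integral_abs_le_sqrt:
  fixes g :: "real \<Rightarrow> real"
  assumes "lbb g" "integral {0..1} (\<lambda>x. (g x)\<^sup>2) \<le> h\<^sup>2" "h \<ge> 0"
  shows "integral {0..1} (\<lambda>x. \<bar>g x\<bar>) \<le> h"
proof -
  have l: "lbb (\<lambda>x. \<bar>g x\<bar>)"
  proof -
    have "(\<lambda>x. \<bar>g x\<bar>) \<in> borel_measurable borel" by (intro borel_measurable_abs lbb_measurable assms(1))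
    then show ?thesis using assms(1) by (auto simp: lbb_def)
  qed
  define m where "m = integral {0..1} (\<lambda>x. \<bar>g x\<bar>)"
  have "0 \<le> integral {0..1} (\<lambda>x. (\<bar>g x\<bar> - m)\<^sup>2)"
    by (intro integral_nonneg lbb_integrable lbb_power lbb_diff l lbb_const) auto
  also have "\<dots> = integral {0..1} (\<lambda>x. (g x)\<^sup>2 + (m\<^sup>2 - 2 * m * \<bar>g x\<bar>))"
    by (rule Henstock_Kurzweil_Integration.integral_cong) (simp add: power2_eq_square algebra_simps)
  also have "\<dots> = integral {0..1} (\<lambda>x. (g x)\<^sup>2) + (m\<^sup>2 - 2 * m * m)"
  proof (rule integral_unique)
    have 1: "((\<lambda>x. (g x)\<^sup>2) has_integral integral {0..1} (\<lambda>x. (g x)\<^sup>2)) {0..1}"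
      by (rule integrable_integral[OF lbb_integrable[OF lbb_power[OF assms(1)]]])
    have 2: "((\<lambda>x. \<bar>g x\<bar>) has_integral m) {0..1}"
      unfolding m_def by (rule integrable_integral[OF lbb_integrable[OF l]])
    have 3: "((\<lambda>x. m\<^sup>2) has_integral m\<^sup>2) {0..1::real}" using has_integral_const_real[of "m\<^sup>2" 0 1] by simp
    show "((\<lambda>x. (g x)\<^sup>2 + (m\<^sup>2 - 2 * m * \<bar>g x\<bar>)) has_integral integral {0..1} (\<lambda>x. (g x)\<^sup>2) + (m\<^sup>2 - 2 * m * m)) {0..1}"
      by (intro has_integral_add 1 has_integral_diff 3 has_integral_mult_right 2)
  qed
  finally have "m\<^sup>2 \<le> h\<^sup>2" using assms(2) by (simp add: power2_eq_square)
  then show ?thesis using assms(3) unfolding m_def[symmetric] by (rule power2_le_imp_le)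
qed

section \<open>Partial fractions for the inverse of the elliptic operator\<close>

text \<open>The symbol of A with the derivative replaced by z; its roots are the exponents of the
  exponential solutions of A P = 0.\<close>

definition symb :: "nat \<Rightarrow> complex poly" where
  "symb l = (\<Sum>j\<le>l. monom ((-1) ^ j) (2 * j))"

abbreviation symb_roots :: "nat \<Rightarrow> complex set" where
  "symb_roots l \<equiv> {z. poly (symb l) z = 0}"

lemma coeff_symb: "coeff (symb l) (2 * j) = (if j \<le> l then (-1) ^ j else 0)" "odd k \<Longrightarrow> coeff (symb l) k = 0"
proof -
  show "coeff (symb l) (2 * j) = (if j \<le> l then (-1) ^ j else 0)"
    unfolding symb_def by (auto simp: coeff_sum if_distrib cong: if_cong)
  assume "odd k"
  then have "2 * j \<noteq> k" for j by auto
  then show "coeff (symb l) k = 0" unfolding symb_def by (simp add: coeff_sum)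
qed

lemma degree_symb: "degree (symb l) = 2 * l"
proof (rule antisym)
  show "degree (symb l) \<le> 2 * l" unfolding symb_def
    by (rule degree_sum_le) (auto intro: order_trans[OF degree_monom_le])
  show "2 * l \<le> degree (symb l)" by (rule le_degree) (simp add: coeff_symb)
qed

text \<open>Finite geometric series with ratio - z^2.\<close>

lemma symb_telescope: "(1 + z\<^sup>2) * poly (symb l) z = 1 + (-1) ^ l * z ^ (2 * l + 2)"
proof (induction l)
  case (Suc l)
  have "poly (symb (Suc l)) z = poly (symb l) z + (-1) ^ Suc l * z ^ (2 * l + 2)"
    by (simp add: symb_def poly_monom)
  then have 1: "(1 + z\<^sup>2) * poly (symb (Suc l)) z = (1 + z\<^sup>2) * poly (symb l) z + (1 + z\<^sup>2) * ((-1) ^ Suc l * z ^ (2 * l + 2))"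
    by (simp only: distrib_left)
  have 2: "z ^ (2 * Suc l + 2) = z\<^sup>2 * z ^ (2 * l + 2)" by (simp flip: power_add)
  have 3: "1 + s * w + (1 + z\<^sup>2) * (-1 * s * w) = 1 + -1 * s * (z\<^sup>2 * w)" for s w by (simp add: algebra_simps)
  show ?case unfolding 1 2 Suc power_Suc[of "-1"] by (rule 3)
qed (simp add: symb_def poly_monom power2_eq_square)

text \<open>By \<open>symb_telescope\<close> the power \<rho>^(2l+2) is 1 or -1, hence |\<rho>| = 1.
  The solutions of exp z = 1 are the integer multiples of 2 pi i, whose modulus is 0 or greater than
  1; so no root is among them, and the periodic first order equations are solvable.\<close>

lemma symb_roots_properties:
  assumes "\<rho> \<in> symb_roots l" shows "norm \<rho> = 1" "exp \<rho> \<noteq> 1" "- \<rho> \<in> symb_roots l"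
proof -
  have "1 + (-1) ^ l * \<rho> ^ (2 * l + 2) = 0" using assms symb_telescope[of \<rho> l] by simp
  then have "(-1) ^ l * \<rho> ^ (2 * l + 2) = -1" by (simp add: eq_neg_iff_add_eq_0 add.commute)
  then have "norm ((-1) ^ l * \<rho> ^ (2 * l + 2)) = norm (-1 :: complex)" by (rule arg_cong)
  then have "norm \<rho> ^ (2 * l + 2) = 1" by (simp add: norm_mult norm_power)
  then show n: "norm \<rho> = 1" using power_eq_1_iff[of "norm \<rho>" "2 * l + 2"] by simp
  show "exp \<rho> \<noteq> 1"
  proof
    assume "exp \<rho> = 1"
    then obtain k :: int where k: "Re \<rho> = 0" "Im \<rho> = of_int (2 * k) * pi" using exp_eq_1 by auto
    then have "norm \<rho> = \<bar>Im \<rho>\<bar>" by (simp add: cmod_def)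
    then have e: "2 * pi * \<bar>of_int k\<bar> = (1::real)" using n k by (simp add: abs_mult mult_ac)
    show False
    proof (cases "k = 0")
      case False
      then have "1 \<le> \<bar>of_int k :: real\<bar>" by linarith
      then have "2 * pi * 1 \<le> 2 * pi * \<bar>of_int k :: real\<bar>" by (intro mult_left_mono) auto
      then show False using e pi_gt3 by linarith
    qed (use e in simp)
  qed
  have "poly (symb l) (- \<rho>) = poly (symb l) \<rho>" by (simp add: symb_def poly_sum poly_monom)
  then show "- \<rho> \<in> symb_roots l" using assms by simp
qed

text \<open>A double root would also be one of (1 + z^2) times the symbol, that is of 1 + (-1)^l
  z^(2l+2), whose derivative vanishes only at 0, where the symbol is 1. Simplicity of the roots is
  what interpolation at the roots requires.\<close>

lemma symb_factorization:
  "finite (symb_roots l)" "card (symb_roots l) = 2 * l"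
  "symb l = smult ((-1) ^ l) (\<Prod>\<rho>\<in>symb_roots l. [:- \<rho>, 1:])"
proof -
  have nz: "symb l \<noteq> 0" using coeff_symb(1)[of l 0] by auto
  show fin: "finite (symb_roots l)" by (rule poly_roots_finite[OF nz])
  have "rsquarefree (symb l)" unfolding rsquarefree_roots
  proof (intro allI notI)
    fix a assume a: "poly (symb l) a = 0 \<and> poly (pderiv (symb l)) a = 0"
    define q where "q = [:1, 0, 1:] * symb l"
    have q: "q = 1 + monom ((-1) ^ l) (2 * l + 2)"
    proof -
      have "poly q z = poly (1 + monom ((-1) ^ l) (2 * l + 2)) z" for z
        using symb_telescope[of z l] unfolding q_def poly_mult poly_add poly_monom poly_1 by (simp add: power2_eq_square)
      then show ?thesis by (simp add: poly_eq_poly_eq_iff[symmetric] fun_eq_iff)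
    qed
    have "pderiv q = [:1, 0, 1:] * pderiv (symb l) + symb l * pderiv [:1, 0, 1:]" unfolding q_def by (rule pderiv_mult)
    then have "poly (pderiv q) a = 0" using a by simp
    then have "of_nat (2 * l + 2) * ((-1) ^ l * a ^ (2 * l + 1)) = 0"
      unfolding q by (simp add: pderiv_add pderiv_monom poly_monom)
    moreover have "(of_nat (2 * l + 2) :: complex) \<noteq> 0" by (simp only: of_nat_eq_0_iff)
    ultimately have "a = 0" by auto
    then have "poly (symb l) 0 = 0" using a by simp
    then show False using coeff_symb(1)[of l 0] by (simp add: poly_0_coeff_0)
  qed
  from complex_poly_decompose_rsquarefree[OF this]
  show f: "symb l = smult ((-1) ^ l) (\<Prod>\<rho>\<in>symb_roots l. [:- \<rho>, 1:])"
    by (simp add: degree_symb coeff_symb)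
  have "degree (symb l) = degree (\<Prod>\<rho>\<in>symb_roots l. [:- \<rho>, 1:])" by (subst f) simp
  also have "\<dots> = (\<Sum>\<rho>\<in>symb_roots l. degree [:- \<rho>, 1:])" by (rule degree_prod_eq_sum_degree) simp
  finally show "card (symb_roots l) = 2 * l" by (simp add: degree_symb)
qed

text \<open>This is (-1)^l times the symbol, divided by z - \<rho>.\<close>

definition cofactor :: "nat \<Rightarrow> complex \<Rightarrow> complex poly" where
  "cofactor l \<rho> = (\<Prod>\<mu>\<in>symb_roots l - {\<rho>}. [:- \<mu>, 1:])"

lemma cofactor:
  assumes "\<rho> \<in> symb_roots l"
  shows "degree (cofactor l \<rho>) = 2 * l - 1" "[:- \<rho>, 1:] * cofactor l \<rho> = smult ((-1) ^ l) (symb l)"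
    "poly (cofactor l \<rho>) \<rho> \<noteq> 0" "\<mu> \<in> symb_roots l \<Longrightarrow> \<mu> \<noteq> \<rho> \<Longrightarrow> poly (cofactor l \<rho>) \<mu> = 0"
proof -
  note fin = symb_factorization(1)[of l]
  have "degree (cofactor l \<rho>) = (\<Sum>\<mu>\<in>symb_roots l - {\<rho>}. degree [:- \<mu>, 1:])"
    unfolding cofactor_def by (rule degree_prod_eq_sum_degree) simp
  then show "degree (cofactor l \<rho>) = 2 * l - 1" using symb_factorization(1,2)[of l] assms by simp
  have "[:- \<rho>, 1:] * cofactor l \<rho> = (\<Prod>\<rho>\<in>symb_roots l. [:- \<rho>, 1:])"
    unfolding cofactor_def by (rule prod.remove[OF fin assms, symmetric])
  also have "\<dots> = smult ((-1) ^ l) (symb l)" by (subst (2) symb_factorization(3)) (simp flip: power_mult_distrib)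
  finally show "[:- \<rho>, 1:] * cofactor l \<rho> = smult ((-1) ^ l) (symb l)" .
  show "poly (cofactor l \<rho>) \<rho> \<noteq> 0" unfolding cofactor_def poly_prod using fin by (auto simp: prod_zero_iff)
  show "\<mu> \<in> symb_roots l \<Longrightarrow> \<mu> \<noteq> \<rho> \<Longrightarrow> poly (cofactor l \<rho>) \<mu> = 0"
    unfolding cofactor_def poly_prod using fin by (auto simp: prod_zero_iff)
qed

text \<open>Lagrange interpolation: both sides have degree below 2l and agree at the 2l roots. It
  writes each derivative of P of order below 2l as a combination of functions that solve first order
  equations.\<close>

lemma lagrange_monomial:
  assumes "i < 2 * l"
  shows "monom 1 i = (\<Sum>\<rho>\<in>symb_roots l. smult (\<rho> ^ i / poly (cofactor l \<rho>) \<rho>) (cofactor l \<rho>))" (is "_ = ?S")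
proof -
  note fin = symb_factorization(1)[of l]
  let ?d = "monom 1 i - ?S"
  have z: "poly ?d \<mu> = 0" if "\<mu> \<in> symb_roots l" for \<mu>
  proof -
    have "poly ?S \<mu> = (\<Sum>\<rho>\<in>symb_roots l. \<rho> ^ i / poly (cofactor l \<rho>) \<rho> * poly (cofactor l \<rho>) \<mu>)"
      by (simp add: poly_sum)
    also have "\<dots> = (\<Sum>\<rho>\<in>{\<mu>}. \<rho> ^ i / poly (cofactor l \<rho>) \<rho> * poly (cofactor l \<rho>) \<mu>)"
      by (rule sum.mono_neutral_right) (use fin that cofactor(4) in auto)
    also have "\<dots> = \<mu> ^ i" using cofactor(3)[OF that] by simp
    finally show ?thesis by (simp add: poly_monom)
  qed
  have deg: "degree ?d < 2 * l"
  proof -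
    have "degree ?S \<le> 2 * l - 1"
      by (rule degree_sum_le) (use fin cofactor(1) degree_smult_le in \<open>auto intro: order_trans[OF degree_smult_le]\<close>)
    then have "degree ?d \<le> 2 * l - 1" using assms by (intro degree_diff_le) (auto intro: order_trans[OF degree_monom_le])
    then show ?thesis using assms by simp
  qed
  have "?d = 0"
  proof (rule ccontr)
    assume nz: "?d \<noteq> 0"
    have "symb_roots l \<subseteq> {x. poly ?d x = 0}" using z by auto
    then have "card (symb_roots l) \<le> card {x. poly ?d x = 0}" by (rule card_mono[OF poly_roots_finite[OF nz]])
    also have "\<dots> \<le> degree ?d" by (rule card_poly_roots_bound[OF nz])
    finally show False using deg symb_factorization(2)[of l] by simp
  qed
  then show ?thesis by simp
qed

definition polyop :: "nat \<Rightarrow> (nat \<Rightarrow> real \<Rightarrow> complex) \<Rightarrow> complex poly \<Rightarrow> real \<Rightarrow> complex" where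
  "polyop N Y q x = (\<Sum>k\<le>N. coeff q k * Y k x)"

lemma polyop_add: "polyop N Y (p + q) x = polyop N Y p x + polyop N Y q x"
  by (simp add: polyop_def sum.distrib distrib_right)

lemma polyop_smult: "polyop N Y (smult a q) x = a * polyop N Y q x"
  by (simp add: polyop_def sum_distrib_left mult.assoc)

lemma polyop_sum: "polyop N Y (\<Sum>i\<in>A. f i) x = (\<Sum>i\<in>A. polyop N Y (f i) x)"
  by (induction A rule: infinite_finite_induct) (auto simp: polyop_add, simp_all add: polyop_def)

lemma polyop_monom: "i \<le> N \<Longrightarrow> polyop N Y (monom 1 i) x = Y i x"
  by (simp add: polyop_def if_distrib[of "\<lambda>c. c * _"] sum.delta cong: if_cong)

lemma polyop_symb: "polyop (2 * l) Y (symb l) x = (\<Sum>j\<le>l. (-1) ^ j * Y (2 * j) x)"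
proof -
  have "polyop (2 * l) Y (symb l) x = (\<Sum>k\<in>(\<lambda>j. 2 * j) ` {..l}. coeff (symb l) k * Y k x)"
    unfolding polyop_def
  proof (rule sum.mono_neutral_right)
    show "\<forall>k\<in>{..2 * l} - (\<lambda>j. 2 * j) ` {..l}. coeff (symb l) k * Y k x = 0"
    proof
      fix k assume "k \<in> {..2 * l} - (\<lambda>j. 2 * j) ` {..l}"
      then have "odd k" by (auto elim!: evenE)
      then show "coeff (symb l) k * Y k x = 0" by (simp add: coeff_symb)
    qed
  qed auto
  also have "\<dots> = (\<Sum>j\<le>l. (-1) ^ j * Y (2 * j) x)"
    by (subst sum.reindex) (auto simp: inj_on_def coeff_symb)
  finally show ?thesis .
qed

text \<open>Multiplication of the symbol by z is differentiation. The factor J comes from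
  differentiating a composition with the flow.\<close>

lemma ac_polyop:
  assumes "\<And>k. k < N \<Longrightarrow> ac (Y k) (\<lambda>x. J x * Y (Suc k) x)" "degree q < N"
  shows "ac (polyop N Y q) (\<lambda>x. J x * polyop N Y (pCons 0 q) x)"
proof -
  have "polyop N Y q = (\<lambda>x. \<Sum>k<N. coeff q k * Y k x)"
  proof
    fix x show "polyop N Y q x = (\<Sum>k<N. coeff q k * Y k x)"
      using assms(2) by (simp add: polyop_def lessThan_Suc_atMost[symmetric] coeff_eq_0)
  qed
  moreover have "(\<lambda>x. J x * polyop N Y (pCons 0 q) x) = (\<lambda>x. \<Sum>k<N. coeff q k * (J x * Y (Suc k) x))"
  proof
    fix x
    have "polyop N Y (pCons 0 q) x = (\<Sum>k<Suc N. coeff (pCons 0 q) k * Y k x)"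
      by (simp add: polyop_def lessThan_Suc_atMost)
    also have "\<dots> = (\<Sum>k<N. coeff q k * Y (Suc k) x)" by (subst sum.lessThan_Suc_shift) simp
    finally show "J x * polyop N Y (pCons 0 q) x = (\<Sum>k<N. coeff q k * (J x * Y (Suc k) x))"
      by (simp add: sum_distrib_left mult_ac)
  qed
  ultimately show ?thesis using assms(1) by (auto intro!: ac_sum ac_cmult)
qed

text \<open>The first order equation \<open>Q' = J (\<rho> Q + \<Phi>)\<close> with periodic boundary values, solved by
  variation of constants.\<close>

definition resolvent :: "complex \<Rightarrow> linf \<Rightarrow> linf" where
  "resolvent lam G = cL (pint 1 G / (exp (- lam) - 1)) + I0 G"

lemma bounded_linear_resolvent: "bounded_linear (resolvent lam)"
  unfolding resolvent_def
  by (intro bounded_linear_add bounded_linear_I0 bounded_linear_compose[OF bounded_linear_cL]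
      bounded_linear_compose[OF bounded_linear_divide bounded_linear_pint])

text \<open>E is an integrating factor: (Q E)' = J \<Phi> E. Over one period Q returns to its value
  while E gains the factor exp (- lam); this determines Q E at 0, which is the constant in
  \<open>resolvent\<close>.\<close>

lemma periodic_resolvent:
  assumes Q: "ac Q (\<lambda>x. J x * (lam * Q x + \<Phi> x))" and E: "ac E (\<lambda>x. - lam * J x * E x)"
    and l: "lbb J" "lbb \<Phi>" "lbb Ei" and per: "Q 1 = Q 0" "E 1 = exp (- lam) * E 0" and lam: "exp (- lam) \<noteq> 1"
    and inv: "\<And>x. E x * Ei x = 1"
  shows "cls Q = cls Ei * resolvent lam (cls (\<lambda>x. J x * \<Phi> x * E x))"
proof -
  have lE: "lbb E" and lQ: "lbb Q" by (rule ac_lbb_fun[OF E], rule ac_lbb_fun[OF Q])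
  define g where "g x = J x * \<Phi> x * E x" for x
  have lg: "lbb g" unfolding g_def by (intro lbb_mult l lE)
  have "ac (\<lambda>x. Q x * E x) (\<lambda>x. J x * (lam * Q x + \<Phi> x) * E x + Q x * (- lam * J x * E x))"
    by (intro ac_mult Q E lbb_mult lbb_const l lE)
  then have QE: "ac (\<lambda>x. Q x * E x) g" unfolding g_def by (simp add: algebra_simps)
  have "Q 0 * E 0 * (exp (- lam) - 1) = pint 1 (cls g)"
    using acD[OF QE, of 0 1] per pint_cls[OF lg, of 1] by (simp add: algebra_simps)
  then have Q0: "Q 0 * E 0 = pint 1 (cls g) / (exp (- lam) - 1)" using lam by (simp add: field_simps)
  have "cls (\<lambda>x. Q x * E x) = resolvent lam (cls g)" unfolding resolvent_def cls_ac[OF QE lg] Q0 ..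
  then have "cls Ei * resolvent lam (cls g) = cls (\<lambda>x. Ei x * (Q x * E x))"
    by (simp add: cls_simps lbb_mult l lQ lE)
  also have "(\<lambda>x. Ei x * (Q x * E x)) = Q" using inv by (auto simp: mult_ac)
  finally show ?thesis unfolding g_def ..
qed

section \<open>Curves of functions as curves in the Banach algebra\<close>

abbreviation rcls :: "(real \<Rightarrow> real) \<Rightarrow> linf" where "rcls f \<equiv> cls (\<lambda>x. complex_of_real (f x))"

lemma rcls_simps:
  "lbb f \<Longrightarrow> lbb g \<Longrightarrow> rcls (\<lambda>x. f x + g x) = rcls f + rcls g"
  "lbb f \<Longrightarrow> lbb g \<Longrightarrow> rcls (\<lambda>x. f x - g x) = rcls f - rcls g"
  "lbb f \<Longrightarrow> lbb g \<Longrightarrow> rcls (\<lambda>x. f x * g x) = rcls f * rcls g"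
  "lbb f \<Longrightarrow> rcls (\<lambda>x. - f x) = - rcls f"
  "lbb f \<Longrightarrow> rcls (\<lambda>x. r * f x) = r *\<^sub>R rcls f"
proof -
  show "lbb f \<Longrightarrow> rcls (\<lambda>x. r * f x) = r *\<^sub>R rcls f"
    using cls_simps(7)[OF lbb_complex_of_real[of f], of r] by (simp add: scaleR_conv_of_real)
qed (simp_all add: cls_simps lbb_complex_of_real)

lemma norm_rcls_le: "lbb f \<Longrightarrow> 0 \<le> B \<Longrightarrow> norm (rcls f) \<le> B \<longleftrightarrow> ae01 (\<lambda>x. \<bar>f x\<bar> \<le> B)"
  by (simp add: norm_cls_le_iff lbb_complex_of_real)

lemma norm_rcls_ae: "lbb f \<Longrightarrow> ae01 (\<lambda>x. \<bar>f x\<bar> \<le> norm (rcls f))"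
  using norm_cls_ae[OF lbb_complex_of_real] by simp

lemma weak_deriv_lincomb:
  assumes "weak_deriv j f F" "weak_deriv j g G" "weak_deriv j h H"
  shows "weak_deriv j (\<lambda>x. (f x - g x) / d - h x) (\<lambda>x. (F x - G x) / d - H x)"
proof -
  have z: "weak_deriv j (\<lambda>x. 0) (\<lambda>x. 0)" by (rule weak_derivI) (auto simp: periodic1_def)
  from weak_deriv_add_scale[OF weak_deriv_add_scale[OF weak_deriv_add_scale[OF z assms(1), of "1/d"] assms(2), of "-1/d"] assms(3), of "-1"]
  show ?thesis by (simp add: diff_divide_distrib)
qed

lemma Wnorm_continuous:
  assumes c: "C0_in I (Winf k) (Wnorm k) f" and j: "j \<le> k"
    and F: "\<And>t i. t \<in> I \<Longrightarrow> i \<le> k \<Longrightarrow> weak_deriv i (f t) (F i t)" "\<And>t i. t \<in> I \<Longrightarrow> i \<le> k \<Longrightarrow> lbb (F i t)"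
  shows "continuous_on I (\<lambda>t. rcls (F j t))"
  unfolding continuous_on_def
proof
  fix t assume t: "t \<in> I"
  have lim: "((\<lambda>s. Wnorm k (\<lambda>x. f s x - f t x)) \<longlongrightarrow> 0) (at t within I)" using c t by (simp add: C0_in_def)
  have le: "norm (rcls (F j s) - rcls (F j t)) \<le> Wnorm k (\<lambda>x. f s x - f t x)" if s: "s \<in> I" for s
  proof -
    have w: "weak_deriv i (\<lambda>x. f s x - f t x) (\<lambda>x. F i s x - F i t x)" if "i \<le> k" for i
      using weak_deriv_add_scale[OF F(1)[OF s that] F(1)[OF t that], of "-1"] by simp
    have l: "lbb (\<lambda>x. F i s x - F i t x)" if "i \<le> k" for i using F(2) s t that by (intro lbb_diff) auto
    have b: "ae01 (\<lambda>x. \<bar>F i s x - F i t x\<bar> \<le> norm (rcls (\<lambda>x. F i s x - F i t x)))" if "i \<le> k" for i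
      by (rule norm_rcls_ae[OF l[OF that]])
    have "0 \<le> Wnorm k (\<lambda>x. f s x - f t x)" using w b by (rule Wnorm_bounds(1))
    moreover have "ae01 (\<lambda>x. \<bar>F j s x - F j t x\<bar> \<le> Wnorm k (\<lambda>x. f s x - f t x))" using w b j by (rule Wnorm_bounds(3))
    ultimately have "norm (rcls (\<lambda>x. F j s x - F j t x)) \<le> Wnorm k (\<lambda>x. f s x - f t x)"
      by (subst norm_rcls_le[OF l[OF j]])
    then show ?thesis by (simp only: rcls_simps(2)[OF F(2)[OF s j] F(2)[OF t j]])
  qed
  have "((\<lambda>s. rcls (F j s) - rcls (F j t)) \<longlongrightarrow> 0) (at t within I)"
    by (rule Lim_null_comparison[OF _ lim]) (use le in \<open>auto simp: eventually_at_filter\<close>)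
  then show "((\<lambda>s. rcls (F j s)) \<longlongrightarrow> rcls (F j t)) (at t within I)" by (rule LIM_zero_cancel)
qed

lemma Wnorm_derivative:
  assumes d: "has_deriv_in I (Winf k) (Wnorm k) f v t" and I: "open I" "t \<in> I" and j: "j \<le> k"
    and F: "\<And>t i. t \<in> I \<Longrightarrow> i \<le> k \<Longrightarrow> weak_deriv i (f t) (F i t)" "\<And>t i. t \<in> I \<Longrightarrow> i \<le> k \<Longrightarrow> lbb (F i t)"
    and G: "\<And>i. i \<le> k \<Longrightarrow> weak_deriv i v (G i)" "\<And>i. i \<le> k \<Longrightarrow> lbb (G i)"
  shows "((\<lambda>t. rcls (F j t)) has_vector_derivative rcls (G j)) (at t)"
    "((\<lambda>s. norm ((rcls (F j s) - rcls (F j t)) /\<^sub>R (s - t) - rcls (G j))) \<longlongrightarrow> 0) (at t)"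
proof -
  let ?f = "\<lambda>s x. (f s x - f t x) / (s - t) - v x"
  have tI: "at t within I = at t" by (rule at_within_open[OF I(2,1)])
  have lim: "((\<lambda>s. Wnorm k (?f s)) \<longlongrightarrow> 0) (at t)" using d tI by (simp add: has_deriv_in_def)
  have le: "norm ((rcls (F j s) - rcls (F j t)) /\<^sub>R (s - t) - rcls (G j)) \<le> Wnorm k (?f s)" if s: "s \<in> I" "s \<noteq> t" for s
  proof -
    have w: "weak_deriv i (?f s) (\<lambda>x. (F i s x - F i t x) / (s - t) - G i x)" if "i \<le> k" for i
      by (intro weak_deriv_lincomb F(1) G(1) s(1) I(2) that)
    have l': "lbb (\<lambda>x. inverse (s - t) * (F i s x - F i t x) - G i x)" if "i \<le> k" for i
      by (intro lbb_diff lbb_mult lbb_const F(2) G(2) s(1) I(2) that)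
    then have l: "lbb (\<lambda>x. (F i s x - F i t x) / (s - t) - G i x)" if "i \<le> k" for i
      using that by (simp add: divide_inverse mult.commute)
    have b: "ae01 (\<lambda>x. \<bar>(F i s x - F i t x) / (s - t) - G i x\<bar> \<le> norm (rcls (\<lambda>x. (F i s x - F i t x) / (s - t) - G i x)))" if "i \<le> k" for i
      by (rule norm_rcls_ae[OF l[OF that]])
    have "0 \<le> Wnorm k (?f s)" using w b by (rule Wnorm_bounds(1))
    moreover have "ae01 (\<lambda>x. \<bar>(F j s x - F j t x) / (s - t) - G j x\<bar> \<le> Wnorm k (?f s))" using w b j by (rule Wnorm_bounds(3))
    ultimately have "norm (rcls (\<lambda>x. (F j s x - F j t x) / (s - t) - G j x)) \<le> Wnorm k (?f s)"
      by (subst norm_rcls_le[OF l[OF j]])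
    moreover have "rcls (\<lambda>x. inverse (s - t) * (F j s x - F j t x) - G j x) = (rcls (F j s) - rcls (F j t)) /\<^sub>R (s - t) - rcls (G j)"
      by (simp only: rcls_simps(2)[OF lbb_mult[OF lbb_const lbb_diff[OF F(2)[OF s(1) j] F(2)[OF I(2) j]]] G(2)[OF j]]
          rcls_simps(5)[OF lbb_diff[OF F(2)[OF s(1) j] F(2)[OF I(2) j]]] rcls_simps(2)[OF F(2)[OF s(1) j] F(2)[OF I(2) j]])
    ultimately show ?thesis by (simp add: divide_inverse mult.commute)
  qed
  have ev: "\<forall>\<^sub>F s in at t. s \<in> I \<and> s \<noteq> t"
    using eventually_at_in_open[OF I] by (auto elim: eventually_mono)
  show lim2: "((\<lambda>s. norm ((rcls (F j s) - rcls (F j t)) /\<^sub>R (s - t) - rcls (G j))) \<longlongrightarrow> 0) (at t)"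
    by (rule Lim_null_comparison[OF _ lim]) (use ev le in \<open>auto elim!: eventually_mono\<close>)
  then show "((\<lambda>t. rcls (F j t)) has_vector_derivative rcls (G j)) (at t)"
    unfolding has_vector_derivative_def has_derivative_within_alt2
  proof (intro conjI allI impI)
    show "bounded_linear (\<lambda>x. x *\<^sub>R rcls (G j))" by (rule bounded_linear_scaleR_left)
    fix e :: real assume "e > 0"
    then have "\<forall>\<^sub>F s in at t. norm ((rcls (F j s) - rcls (F j t)) /\<^sub>R (s - t) - rcls (G j)) < e"
      using order_tendstoD(2)[OF lim2] by simp
    with ev show "\<forall>\<^sub>F s in at t. norm (rcls (F j s) - rcls (F j t) - (s - t) *\<^sub>R rcls (G j)) \<le> e * norm (s - t)"
    proof eventually_elim
      case (elim s)
      have "rcls (F j s) - rcls (F j t) - (s - t) *\<^sub>R rcls (G j) = (s - t) *\<^sub>R ((rcls (F j s) - rcls (F j t)) /\<^sub>R (s - t) - rcls (G j))"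
        using elim by (simp add: scaleR_diff_right)
      then show ?case using elim by (simp add: mult.commute mult_left_mono)
    qed
  qed
qed

lemma Hnorm_L2_bound:
  assumes F: "\<And>i. i \<le> k \<Longrightarrow> weak_deriv i f (F i)" "lbb (F j)" and j: "j \<le> k"
  shows "integral {0..1} (\<lambda>x. \<bar>F j x\<bar>) \<le> Hnorm k f" "integral {0..1} (\<lambda>x. (F j x)\<^sup>2) \<le> (Hnorm k f)\<^sup>2" "0 \<le> Hnorm k f"
proof -
  show H: "0 \<le> Hnorm k f" "integral {0..1} (\<lambda>x. (F j x)\<^sup>2) \<le> (Hnorm k f)\<^sup>2"
    by (rule Hnorm_bound[where g = F and j = j]; use F j in simp)+
  show "integral {0..1} (\<lambda>x. \<bar>F j x\<bar>) \<le> Hnorm k f" by (rule integral_abs_le_sqrt[OF F(2) H(2,1)])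
qed

text \<open>One-dimensional Sobolev inequality: |F x| exceeds |F y| by at most the integral of |G|,
  and averaging over y gives the bound.\<close>

lemma sup_bound_periodic:
  fixes F G :: "real \<Rightarrow> real"
  assumes F: "ac F G" "periodic1 F" and l: "lbb G" and A: "integral {0..1} (\<lambda>x. \<bar>F x\<bar>) \<le> A" "integral {0..1} (\<lambda>x. \<bar>G x\<bar>) \<le> B"
  shows "\<bar>F x\<bar> \<le> A + B"
proof -
  have lF: "lbb F" by (rule ac_lbb_fun[OF F(1)])
  have abs: "lbb (\<lambda>x. \<bar>h x\<bar>)" if "lbb h" for h :: "real \<Rightarrow> real"
  proof -
    have "(\<lambda>x. \<bar>h x\<bar>) \<in> borel_measurable borel" by (intro borel_measurable_abs lbb_measurable that)
    then show ?thesis using that by (auto simp: lbb_def)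
  qed
  have d: "\<bar>F x - F y\<bar> \<le> B" if xy: "y \<in> {0..1}" "x \<in> {0..1}" "y \<le> x" for x y
  proof -
    have "\<bar>F x - F y\<bar> = norm (integral {y..x} G)" using acD[OF F(1) xy(3)] by simp
    also have "\<dots> \<le> integral {y..x} (\<lambda>x. \<bar>G x\<bar>)"
      by (intro Henstock_Kurzweil_Integration.integral_norm_bound_integral lbb_integrable l abs) auto
    also have "\<dots> \<le> integral {0..1} (\<lambda>x. \<bar>G x\<bar>)" by (intro integral_subset_le lbb_integrable abs l) (use xy in auto)
    finally show ?thesis using A by linarith
  qed
  have *: "\<bar>F x\<bar> \<le> A + B" if x: "x \<in> {0..1}" for x
  proof -
    have "integral {0..1::real} (\<lambda>y. \<bar>F x\<bar>) \<le> integral {0..1} (\<lambda>y. \<bar>F y\<bar> + B)"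
    proof (rule Henstock_Kurzweil_Integration.integral_le)
      fix y :: real assume y: "y \<in> {0..1}"
      have "\<bar>F x - F y\<bar> \<le> B" using d[OF x y] d[OF y x] by (cases "x \<le> y") (auto simp: abs_minus_commute)
      then show "\<bar>F x\<bar> \<le> \<bar>F y\<bar> + B" by linarith
    qed (intro lbb_integrable lbb_const lbb_add abs lF)+
    also have "\<dots> = integral {0..1} (\<lambda>y. \<bar>F y\<bar>) + B"
      by (subst Henstock_Kurzweil_Integration.integral_add) (auto intro: lbb_integrable abs lF)
    finally show ?thesis using A by simp
  qed
  show ?thesis using *[of "frac x"] periodic1_frac[OF F(2), of x] by (simp add: frac_lt_1 less_imp_le)
qed

lemma has_vector_derivative_iff_quotient:
  fixes f :: "real \<Rightarrow> 'a::real_normed_vector"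
  shows "(f has_vector_derivative D) (at t) \<longleftrightarrow> ((\<lambda>s. (f s - f t) /\<^sub>R (s - t)) \<longlongrightarrow> D) (at t)"
proof -
  have e: "norm (f s - f t - (s - t) *\<^sub>R D) / norm (s - t) = norm ((f s - f t) /\<^sub>R (s - t) - D)" if "s \<noteq> t" for s
  proof -
    have "(f s - f t) /\<^sub>R (s - t) - D = (f s - f t - (s - t) *\<^sub>R D) /\<^sub>R (s - t)"
      using that by (simp add: scaleR_diff_right)
    then show ?thesis by (simp add: divide_inverse mult.commute)
  qed
  have "(f has_vector_derivative D) (at t) \<longleftrightarrow> ((\<lambda>s. norm (f s - f t - (s - t) *\<^sub>R D) / norm (s - t)) \<longlongrightarrow> 0) (at t)"
    by (simp add: has_vector_derivative_def has_derivative_iff_norm bounded_linear_scaleR_left)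
  also have "\<dots> \<longleftrightarrow> ((\<lambda>s. norm ((f s - f t) /\<^sub>R (s - t) - D)) \<longlongrightarrow> 0) (at t)"
    by (rule Lim_cong_within) (use e in auto)
  also have "\<dots> \<longleftrightarrow> ((\<lambda>s. (f s - f t) /\<^sub>R (s - t)) \<longlongrightarrow> D) (at t)"
    by (simp add: tendsto_norm_zero_iff LIM_zero_iff)
  finally show ?thesis .
qed

text \<open>The identity g s - g t = - g s g t (f s - f t) and the bound on g give continuity of g
  at t; used once more, the identity gives the limit of the difference quotient.\<close>

lemma has_vector_derivative_inverse:
  fixes f g :: "real \<Rightarrow> 'a::{real_normed_algebra_1, comm_ring_1}"
  assumes "open I" "t \<in> I" and inv: "\<And>s. s \<in> I \<Longrightarrow> f s * g s = 1" and b: "\<And>s. s \<in> I \<Longrightarrow> norm (g s) \<le> M"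
    and f: "(f has_vector_derivative f') (at t)"
  shows "(g has_vector_derivative - (g t * g t) * f') (at t)"
  unfolding has_vector_derivative_iff_quotient
proof -
  have ev: "\<forall>\<^sub>F s in at t. s \<in> I" using eventually_at_in_open'[OF assms(1,2)] .
  have eq: "g s - g t = - (g s * g t * (f s - f t))" if "s \<in> I" for s
  proof -
    have "g s * g t * (f s - f t) = (f s * g s) * g t - (f t * g t) * g s" by (simp add: algebra_simps)
    then show ?thesis using inv[OF that] inv[OF assms(2)] by simp
  qed
  have lf: "((\<lambda>s. f s - f t) \<longlongrightarrow> 0) (at t)"
    using has_vector_derivative_continuous[OF f] by (simp add: isCont_def LIM_zero_iff)
  have lim: "((\<lambda>s. M * M * norm (f s - f t)) \<longlongrightarrow> 0) (at t)"
    using tendsto_mult[OF tendsto_const[of "M * M"] tendsto_norm_zero[OF lf]] by simp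
  have "((\<lambda>s. g s - g t) \<longlongrightarrow> 0) (at t)"
  proof (rule Lim_null_comparison[OF _ lim])
    show "\<forall>\<^sub>F s in at t. norm (g s - g t) \<le> M * M * norm (f s - f t)"
      using ev
    proof eventually_elim
      case (elim s)
      have M: "0 \<le> M" using b[OF elim] by (rule order_trans[OF norm_ge_zero])
      have "norm (g s - g t) = norm (g s * g t * (f s - f t))" unfolding eq[OF elim] by (rule norm_minus_cancel)
      also have "\<dots> \<le> norm (g s) * norm (g t) * norm (f s - f t)"
        by (meson norm_mult_ineq mult_right_mono norm_ge_zero order_trans)
      also have "\<dots> \<le> M * M * norm (f s - f t)"
        using b[OF elim] b[OF assms(2)] M by (intro mult_right_mono mult_mono) auto
      finally show ?case .
    qed
  qed
  then have "(g \<longlongrightarrow> g t) (at t)" by (rule LIM_zero_cancel)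
  then have "((\<lambda>s. - (g s * g t) * ((f s - f t) /\<^sub>R (s - t))) \<longlongrightarrow> - (g t * g t) * f') (at t)"
    by (intro tendsto_mult tendsto_minus tendsto_const) (use f in \<open>simp_all add: has_vector_derivative_iff_quotient\<close>)
  then show "((\<lambda>s. (g s - g t) /\<^sub>R (s - t)) \<longlongrightarrow> - (g t * g t) * f') (at t)"
    by (rule Lim_transform_eventually) (use ev in \<open>eventually_elim, simp add: eq\<close>)
qed

lemma norm_exp_le: "norm (exp z - 1 - z) \<le> exp (norm z) * (norm z)\<^sup>2" for z :: complex
proof -
  have "norm (exp z - (\<Sum>k\<le>1. z ^ k / fact k)) \<le> exp \<bar>Re z\<bar> * norm z ^ Suc 1 / fact 1" by (rule Taylor_exp)
  also have "exp \<bar>Re z\<bar> * norm z ^ Suc 1 / fact 1 \<le> exp (norm z) * (norm z)\<^sup>2"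
    using abs_Re_le_cmod[of z] by (simp add: power2_eq_square mult_right_mono)
  finally show ?thesis by (simp add: algebra_simps)
qed

text \<open>Second order Taylor estimate of the exponential at almost every y, uniform because the
  increments of x are small in the essential norm.\<close>

lemma has_vector_derivative_cls_exp:
  fixes x :: "real \<Rightarrow> real \<Rightarrow> real"
  assumes I: "open I" "t \<in> I" and x: "\<And>s. s \<in> I \<Longrightarrow> lbb (x s)" "\<And>s. s \<in> I \<Longrightarrow> lbb (\<lambda>y. exp (\<rho> * complex_of_real (y + x s y)))" "lbb v"
    and d: "((\<lambda>s. rcls (x s)) has_vector_derivative rcls v) (at t)" and \<rho>: "norm \<rho> \<le> 1"
  shows "((\<lambda>s. cls (\<lambda>y. exp (\<rho> * complex_of_real (y + x s y)))) has_vector_derivative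
     cL \<rho> * rcls v * cls (\<lambda>y. exp (\<rho> * complex_of_real (y + x t y)))) (at t)"
  unfolding has_vector_derivative_iff_quotient
proof (rule LIM_zero_cancel)
  let ?E = "\<lambda>s y. exp (\<rho> * complex_of_real (y + x s y))"
  let ?D = "\<lambda>s. rcls (x s) - rcls (x t)"
  let ?q = "\<lambda>s. ?D s /\<^sub>R (s - t)"
  have q: "(?q \<longlongrightarrow> rcls v) (at t)" using d by (simp add: has_vector_derivative_iff_quotient)
  have D: "(?D \<longlongrightarrow> 0) (at t)"
    using has_vector_derivative_continuous[OF d] by (simp add: isCont_def LIM_zero_iff)
  let ?b = "\<lambda>s. norm (cls (?E t)) * (exp (norm (?D s)) * norm (?D s) * norm (?q s) + norm (?q s - rcls v))"
  have "(?b \<longlongrightarrow> norm (cls (?E t)) * (exp 0 * 0 * norm (rcls v) + 0)) (at t)"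
    by (intro tendsto_mult tendsto_const tendsto_add tendsto_exp tendsto_norm_zero D tendsto_norm q LIM_zero)
  then have lim: "(?b \<longlongrightarrow> 0) (at t)" by simp
  have ev: "\<forall>\<^sub>F s in at t. s \<in> I \<and> s \<noteq> t"
    using eventually_at_in_open[OF I] by (auto elim: eventually_mono)
  show "((\<lambda>s. (cls (?E s) - cls (?E t)) /\<^sub>R (s - t) - cL \<rho> * rcls v * cls (?E t)) \<longlongrightarrow> 0) (at t)"
  proof (rule Lim_null_comparison[OF _ lim])
    show "\<forall>\<^sub>F s in at t. norm ((cls (?E s) - cls (?E t)) /\<^sub>R (s - t) - cL \<rho> * rcls v * cls (?E t)) \<le> ?b s"
      using ev
    proof eventually_elim
      case (elim s)
      define \<delta> where "\<delta> y = x s y - x t y" for y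
      have l\<delta>: "lbb \<delta>" unfolding \<delta>_def using elim I by (intro lbb_diff x) auto
      have c\<delta>: "rcls \<delta> = ?D s" unfolding \<delta>_def using elim I by (intro rcls_simps x) auto
      define R where "R y = ?E s y - ?E t y - \<rho> * complex_of_real (\<delta> y) * ?E t y" for y
      have lR: "lbb R" unfolding R_def using elim I
        by (intro lbb_diff lbb_mult lbb_const x lbb_complex_of_real l\<delta>) auto
      have lE: "lbb (?E s)" "lbb (?E t)" using x(2) elim I by blast+
      have Req: "cls R = cls (?E s) - cls (?E t) - cL \<rho> * ?D s * cls (?E t)"
        unfolding R_def c\<delta>[symmetric] cL_def
        by (simp only: cls_simps(4)[OF lbb_diff[OF lE(1) lE(2)] lbb_mult[OF lbb_mult[OF lbb_const lbb_complex_of_real[OF l\<delta>]] lE(2)]]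
            cls_simps(4)[OF lE(1) lE(2)] cls_simps(5)[OF lbb_mult[OF lbb_const lbb_complex_of_real[OF l\<delta>]] lE(2)]
            cls_simps(5)[OF lbb_const lbb_complex_of_real[OF l\<delta>]])
      have R: "norm (cls R) \<le> norm (cls (?E t)) * (exp (norm (?D s)) * (norm (?D s))\<^sup>2)"
      proof (subst norm_cls_le_iff[OF lR])
        have a1: "ae01 (\<lambda>y. norm (?E t y) \<le> norm (cls (?E t)))" by (rule norm_cls_ae[OF x(2)[OF I(2)]])
        have a2: "ae01 (\<lambda>y. \<bar>\<delta> y\<bar> \<le> norm (?D s))" using norm_rcls_ae[OF l\<delta>] by (simp only: c\<delta>)
        show "ae01 (\<lambda>y. norm (R y) \<le> norm (cls (?E t)) * (exp (norm (?D s)) * (norm (?D s))\<^sup>2))"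
        proof (rule ae01_mp2[OF a1 a2])
          fix y assume 1: "norm (?E t y) \<le> norm (cls (?E t))" and 2: "\<bar>\<delta> y\<bar> \<le> norm (?D s)"
          define z where "z = \<rho> * complex_of_real (\<delta> y)"
          have "\<rho> * complex_of_real (y + x s y) = \<rho> * complex_of_real (y + x t y) + z"
            unfolding z_def \<delta>_def by (simp add: algebra_simps)
          then have "?E s y = ?E t y * exp z" by (simp only: exp_add)
          then have "R y = ?E t y * exp z - ?E t y - z * ?E t y" unfolding R_def z_def by (simp only:)
          also have "a * b - a - z * a = a * (b - 1 - z)" for a b :: complex by (simp add: algebra_simps)
          finally have "R y = ?E t y * (exp z - 1 - z)" .
          then have nR: "norm (R y) = norm (?E t y) * norm (exp z - 1 - z)" by (simp only: norm_mult)
          have nz: "norm z \<le> norm (?D s)"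
            using 2 mult_mono[OF \<rho> 2] by (simp add: z_def norm_mult)
          have "norm (exp z - 1 - z) \<le> exp (norm (?D s)) * (norm (?D s))\<^sup>2"
            by (rule order_trans[OF norm_exp_le]) (use nz in \<open>auto intro!: mult_mono power_mono\<close>)
          then show "norm (R y) \<le> norm (cls (?E t)) * (exp (norm (?D s)) * (norm (?D s))\<^sup>2)"
            unfolding nR using 1 by (intro mult_mono norm_ge_zero)
        qed
      qed (auto intro!: mult_nonneg_nonneg)
      have nc: "norm (cL \<rho>) \<le> 1" unfolding cL_def using \<rho> by (subst norm_cls_le_iff) (auto intro: ae01_always)
      \<comment> \<open>Remainder of the exponential plus the error of the difference quotient of
        the exponent.\<close>
      have dec: "(cls (?E s) - cls (?E t)) /\<^sub>R (s - t) - cL \<rho> * rcls v * cls (?E t)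
          = cls R /\<^sub>R (s - t) + cL \<rho> * ((?q s - rcls v) * cls (?E t))"
        unfolding Req by (simp add: algebra_simps)
      have "norm ((cls (?E s) - cls (?E t)) /\<^sub>R (s - t) - cL \<rho> * rcls v * cls (?E t)) \<le> norm (cls R) / \<bar>s - t\<bar> + norm (cL \<rho>) * (norm (?q s - rcls v) * norm (cls (?E t)))"
        proof -
        have 1: "norm (cls R /\<^sub>R (s - t)) = norm (cls R) / \<bar>s - t\<bar>"
          unfolding norm_scaleR abs_inverse divide_inverse by (rule mult.commute)
        have 2: "norm (cL \<rho> * ((?q s - rcls v) * cls (?E t))) \<le> norm (cL \<rho>) * (norm (?q s - rcls v) * norm (cls (?E t)))"
          by (rule order_trans[OF norm_mult_ineq mult_left_mono[OF norm_mult_ineq norm_ge_zero]])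
        show ?thesis unfolding dec by (rule order_trans[OF norm_triangle_ineq add_mono[OF eq_refl[OF 1] 2]])
      qed
      also have "\<dots> \<le> norm (cls (?E t)) * (exp (norm (?D s)) * (norm (?D s))\<^sup>2) / \<bar>s - t\<bar> + 1 * (norm (?q s - rcls v) * norm (cls (?E t)))"
        by (rule add_mono[OF divide_right_mono[OF R] mult_right_mono[OF nc]]) simp_all
      also have "\<dots> = ?b s"
      proof -
        have nq: "norm (?q s) = norm (?D s) / \<bar>s - t\<bar>" unfolding norm_scaleR abs_inverse divide_inverse by (rule mult.commute)
        have "a * (e * d\<^sup>2) / h + 1 * (w * a) = a * (e * d * (d / h) + w)" for a e d h w :: real
          by (simp add: power2_eq_square distrib_left)
        then show ?thesis unfolding nq .
      qed
      finally show ?case .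
    qed
  qed
qed

lemma jet_chain:
  assumes "\<And>i t. i \<le> k \<Longrightarrow> t \<in> I \<Longrightarrow> lbb (F i t)" "\<And>i t. i < k \<Longrightarrow> t \<in> I \<Longrightarrow> ac (F i t) (F (Suc i) t)"
    "\<And>i. i \<le> k \<Longrightarrow> tame I C S (\<lambda>t. cls (F i t))"
  shows "jet I C S k (F 0)"
  using assms
proof (induction k arbitrary: F)
  case (Suc k)
  have "jet I C S k (F (Suc 0))" by (rule Suc.IH[of "\<lambda>i. F (Suc i)"]) (use Suc.prems in auto)
  then show ?case using Suc.prems(1)[of 0] Suc.prems(2)[of 0] Suc.prems(3)[of 0] by (intro jet_Suc[of _ _ _ _ "F (Suc 0)"]) auto
qed auto

text \<open>The difference of the two derivatives has a primitive of class 0, so its integrals over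
  all [0, x] vanish by \<open>norm_pint_le_primitive\<close>.\<close>

lemma ac_ae_unique:
  assumes "ac f h" "ac f2 h2" "lbb h" "lbb h2" "ae01 (\<lambda>x. f x = f2 x)" shows "ae01 (\<lambda>x. h x = (h2 x :: complex))"
proof -
  have "cls f = cls f2" using assms by (simp add: cls_eq_iff ac_lbb_fun)
  then have e: "cL (f 0) + I0 (cls h) = cL (f2 0) + I0 (cls h2)" using cls_ac assms by metis
  have "cls h = cls h2"
  proof (rule pint_eqD)
    fix x :: real assume x: "x \<in> {0..1}"
    have "cL (f 0 - f2 0) + I0 (cls h - cls h2) = 0"
      using e by (simp add: linear_diff[OF bounded_linear.linear[OF bounded_linear_I0]] linear_diff[OF bounded_linear.linear[OF bounded_linear_cL]] algebra_simps)
    then have "pint x (cls h - cls h2) = 0" using norm_pint_le_primitive[OF x, of "cls h - cls h2" "f 0 - f2 0"] by simp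
    then show "pint x (cls h) = pint x (cls h2)" by (simp add: linear_diff[OF bounded_linear.linear[OF bounded_linear_pint]])
  qed
  then show ?thesis using assms by (simp add: cls_eq_iff)
qed

lemma ac_exp_real: "ac (\<lambda>s. exp (\<rho> * complex_of_real s)) (\<lambda>s. \<rho> * exp (\<rho> * complex_of_real s))"
proof (rule ac_lbb)
  show "lbb (\<lambda>s. \<rho> * exp (\<rho> * complex_of_real s))" by (intro lbb_continuous continuous_intros)
  fix x y :: real assume "x \<le> y"
  have "((\<lambda>s. exp (\<rho> * complex_of_real s)) has_vector_derivative \<rho> * exp (\<rho> * complex_of_real s)) (at s within {x..y})" for s
  proof -
    have "((\<lambda>z. exp (\<rho> * z)) has_field_derivative \<rho> * exp (\<rho> * complex_of_real s)) (at (complex_of_real s))"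
      by (auto intro!: derivative_eq_intros)
    from has_vector_derivative_real_field[OF this] show ?thesis by (rule has_vector_derivative_at_within)
  qed
  then have "((\<lambda>s. \<rho> * exp (\<rho> * complex_of_real s)) has_integral exp (\<rho> * complex_of_real y) - exp (\<rho> * complex_of_real x)) {x..y}"
    using \<open>x \<le> y\<close> by (intro fundamental_theorem_of_calculus) auto
  then show "exp (\<rho> * complex_of_real y) - exp (\<rho> * complex_of_real x) = integral {x..y} (\<lambda>s. \<rho> * exp (\<rho> * complex_of_real s))"
    by (rule integral_unique[symmetric])
qed

section \<open>The Lagrangian system\<close>

definition flux_sum :: "nat \<Rightarrow> (nat \<Rightarrow> nat \<Rightarrow> real) \<Rightarrow> (nat \<Rightarrow> real) \<Rightarrow> real" where
  "flux_sum l c w = (\<Sum>(m, n)\<in>{(m, n). m \<le> 2 * l - 1 \<and> n \<le> 2 * l - 1 \<and> m + n \<le> 2 * l}. c m n * w m * w n)"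

text \<open>\<open>X\<close>, \<open>V\<close>, \<open>U\<close> and \<open>P\<close> are the successive space derivatives of the displacement, of its time
  derivative, of the velocity and of the pressure.\<close>

locale lagrangian_data =
  fixes l n :: nat and c :: "nat \<Rightarrow> nat \<Rightarrow> real" and I :: "real set" and X V U P :: "nat \<Rightarrow> real \<Rightarrow> real \<Rightarrow> real"
  assumes l: "l \<ge> 1" and n: "n = 2 * l - 1" and I: "open I"
    and X: "\<And>t j. t \<in> I \<Longrightarrow> j \<le> n \<Longrightarrow> lbb (X j t)" "\<And>t j. t \<in> I \<Longrightarrow> j \<le> n \<Longrightarrow> periodic1 (X j t)"
      "\<And>t j. t \<in> I \<Longrightarrow> j < n \<Longrightarrow> ac (X j t) (X (Suc j) t)"
    and V: "\<And>t j. t \<in> I \<Longrightarrow> j \<le> n \<Longrightarrow> lbb (V j t)" "\<And>t j. t \<in> I \<Longrightarrow> j < n \<Longrightarrow> ac (V j t) (V (Suc j) t)"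
    and U: "\<And>t j. t \<in> I \<Longrightarrow> j \<le> n \<Longrightarrow> lbb (U j t)" "\<And>t j. t \<in> I \<Longrightarrow> j \<le> n \<Longrightarrow> periodic1 (U j t)"
      "\<And>t j. t \<in> I \<Longrightarrow> j < n \<Longrightarrow> ac (U j t) (U (Suc j) t)"
    and P: "\<And>t j. t \<in> I \<Longrightarrow> j \<le> 2 * l \<Longrightarrow> lbb (P j t)" "\<And>t j. t \<in> I \<Longrightarrow> j \<le> 2 * l \<Longrightarrow> periodic1 (P j t)"
      "\<And>t j. t \<in> I \<Longrightarrow> j < 2 * l \<Longrightarrow> ac (P j t) (P (Suc j) t)"
    and XV: "\<And>t j. t \<in> I \<Longrightarrow> j \<le> n \<Longrightarrow> ((\<lambda>s. rcls (X j s)) has_vector_derivative rcls (V j t)) (at t)"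
    and Vc: "\<And>j. j \<le> n \<Longrightarrow> continuous_on I (\<lambda>t. rcls (V j t))"
    and Uder: "\<And>t a b. t \<in> I \<Longrightarrow> a \<le> b \<Longrightarrow> b \<le> a + 1 \<Longrightarrow>
      ((\<lambda>s. integral {a..b} (U 0 s)) has_real_derivative - integral {a..b} (\<lambda>y. U 0 t y * U 1 t y + P 1 t y)) (at t)"
    and UL2: "\<And>t j. t \<in> I \<Longrightarrow> j \<le> n \<Longrightarrow> ((\<lambda>s. integral {0..1} (\<lambda>y. (U j s y - U j t y)\<^sup>2)) \<longlongrightarrow> 0) (at t)"
    and PF: "\<And>t. t \<in> I \<Longrightarrow> AE y in lborel. (\<Sum>j\<le>l. (-1) ^ j * P (2 * j) t y) = flux_sum l c (\<lambda>m. U m t y)"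
begin

lemma n1: "1 \<le> n" "0 < n" "Suc 0 \<le> n" using l n by auto

definition xi :: "real \<Rightarrow> real \<Rightarrow> real" where "xi t x = x + X 0 t x"

lemma X_continuous: "j \<le> n \<Longrightarrow> continuous_on I (\<lambda>t. rcls (X j t))"
  using XV by (meson continuous_at_imp_continuous_on has_vector_derivative_continuous)

lemma U_sup_bound:
  assumes "t \<in> I" "s \<in> I" "j < n"
  shows "\<bar>U j s y - U j t y\<bar> \<le> sqrt (integral {0..1} (\<lambda>y. (U j s y - U j t y)\<^sup>2)) + sqrt (integral {0..1} (\<lambda>y. (U (Suc j) s y - U (Suc j) t y)\<^sup>2))"
proof (rule sup_bound_periodic[where F = "\<lambda>y. U j s y - U j t y" and G = "\<lambda>y. U (Suc j) s y - U (Suc j) t y" and x = y])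
  have l: "lbb (\<lambda>y. U i s y - U i t y)" if "i \<le> n" for i by (intro lbb_diff U(1) assms that)
  have nn: "0 \<le> integral {0..1} (\<lambda>y. (U i s y - U i t y)\<^sup>2)" if "i \<le> n" for i
    by (rule Henstock_Kurzweil_Integration.integral_nonneg[OF lbb_integrable[OF lbb_power[OF l[OF that]]]]) simp
  show "ac (\<lambda>y. U j s y - U j t y) (\<lambda>y. U (Suc j) s y - U (Suc j) t y)" using assms by (intro ac_diff U)
  show "periodic1 (\<lambda>y. U j s y - U j t y)"
    using U(2)[of s j] U(2)[of t j] assms by (simp add: periodic1_def)
  show "lbb (\<lambda>y. U (Suc j) s y - U (Suc j) t y)" using assms by (intro l) simp
  have a: "integral {0..1} (\<lambda>y. \<bar>U i s y - U i t y\<bar>) \<le> sqrt (integral {0..1} (\<lambda>y. (U i s y - U i t y)\<^sup>2))" if "i \<le> n" for i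
    by (rule integral_abs_le_sqrt[OF l[OF that]]) (use nn[OF that] in simp_all)
  show "integral {0..1} (\<lambda>y. \<bar>U j s y - U j t y\<bar>) \<le> sqrt (integral {0..1} (\<lambda>y. (U j s y - U j t y)\<^sup>2))"
    "integral {0..1} (\<lambda>y. \<bar>U (Suc j) s y - U (Suc j) t y\<bar>) \<le> sqrt (integral {0..1} (\<lambda>y. (U (Suc j) s y - U (Suc j) t y)\<^sup>2))"
    using a assms by auto
qed

text \<open>Below the top order the Sobolev inequality turns L2 continuity in time into continuity
  uniform in space. For l = 1 this covers \<open>U 0\<close> but not \<open>U 1\<close>, whence the
  separate argument for that case.\<close>

lemma U_uniform:
  assumes "t \<in> I" "j < n" "e > 0" shows "\<forall>\<^sub>F s in at t. s \<in> I \<and> (\<forall>y. \<bar>U j s y - U j t y\<bar> < e)"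
proof -
  have "((\<lambda>s. sqrt (integral {0..1} (\<lambda>y. (U j s y - U j t y)\<^sup>2)) + sqrt (integral {0..1} (\<lambda>y. (U (Suc j) s y - U (Suc j) t y)\<^sup>2))) \<longlongrightarrow> sqrt 0 + sqrt 0) (at t)"
    using assms by (intro tendsto_add tendsto_real_sqrt UL2) auto
  then have "((\<lambda>s. sqrt (integral {0..1} (\<lambda>y. (U j s y - U j t y)\<^sup>2)) + sqrt (integral {0..1} (\<lambda>y. (U (Suc j) s y - U (Suc j) t y)\<^sup>2))) \<longlongrightarrow> 0) (at t)" by simp
  from order_tendstoD(2)[OF this \<open>e > 0\<close>]
  show ?thesis using eventually_at_in_open'[OF I assms(1)]
  proof eventually_elim
    case (elim s) then show ?case using U_sup_bound[OF assms(1) _ assms(2)] by (meson le_less_trans)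
  qed
qed

lemma xi_ac: "t \<in> I \<Longrightarrow> ac (xi t) (\<lambda>x. 1 + X 1 t x)"
  unfolding xi_def using ac_add[OF ac_ident X(3)[of t 0]] n1 by simp

lemma X0_sup: "t \<in> I \<Longrightarrow> s \<in> I \<Longrightarrow> x \<in> {0..1} \<Longrightarrow> \<bar>X 0 s x - X 0 t x - d * V 0 t x\<bar> \<le> norm (rcls (X 0 s) - rcls (X 0 t) - d *\<^sub>R rcls (V 0 t))"
proof -
  assume *: "t \<in> I" "s \<in> I" "x \<in> {0..1}"
  have ll: "lbb (X 0 s)" "lbb (X 0 t)" "lbb (V 0 t)" using * X V by auto
  have c: "continuous_on UNIV (X 0 s)" "continuous_on UNIV (X 0 t)" "continuous_on UNIV (V 0 t)"
    using * n1 ac_continuous[OF X(3)[of s 0]] ac_continuous[OF X(3)[of t 0]] ac_continuous[OF V(2)[of t 0]] by auto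
  have "continuous_on UNIV (\<lambda>x. complex_of_real (X 0 s x - X 0 t x - d * V 0 t x))" by (intro continuous_intros c)
  from norm_le_norm_cls[OF this *(3)]
  have "\<bar>X 0 s x - X 0 t x - d * V 0 t x\<bar> \<le> norm (rcls (\<lambda>x. X 0 s x - X 0 t x - d * V 0 t x))" by (simp only: norm_of_real)
  also have "rcls (\<lambda>x. X 0 s x - X 0 t x - d * V 0 t x) = rcls (X 0 s) - rcls (X 0 t) - d *\<^sub>R rcls (V 0 t)"
    by (simp only: rcls_simps(2)[OF lbb_diff[OF ll(1,2)] lbb_mult[OF lbb_const ll(3)]] rcls_simps(2)[OF ll(1,2)] rcls_simps(5)[OF ll(3)])
  finally show ?thesis .
qed

lemma X0_derivative:
  assumes "t \<in> I" "x \<in> {0..1}" shows "((\<lambda>s. X 0 s x) has_real_derivative V 0 t x) (at t)"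
  unfolding has_real_derivative_iff_has_vector_derivative has_vector_derivative_def has_derivative_within_alt2
proof (intro conjI allI impI)
  show "bounded_linear (\<lambda>r. r *\<^sub>R V 0 t x)" by (rule bounded_linear_scaleR_left)
  fix e :: real assume "e > 0"
  then have "\<forall>\<^sub>F s in at t. norm (rcls (X 0 s) - rcls (X 0 t) - (s - t) *\<^sub>R rcls (V 0 t)) \<le> e * norm (s - t)"
    using XV[OF assms(1), of 0] unfolding has_vector_derivative_def has_derivative_within_alt2 by blast
  then show "\<forall>\<^sub>F s in at t. norm (X 0 s x - X 0 t x - (s - t) *\<^sub>R V 0 t x) \<le> e * norm (s - t)"
    using eventually_at_in_open'[OF I assms(1)]
  proof eventually_elim
    case (elim s)
    then show ?case using X0_sup[OF assms(1) elim(2) assms(2), of "s - t"] by simp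
  qed
qed

end

text \<open>Kept apart from \<open>lagrangian_data\<close> because \<open>VU\<close> is itself
  derived from the flow equation with the uniform continuity proved there.\<close>

locale lagrangian = lagrangian_data +
  assumes VU: "\<And>t x. t \<in> I \<Longrightarrow> V 0 t x = U 0 t (x + X 0 t x)"

lemma ac_increment_bound:
  fixes F G :: "real \<Rightarrow> real"
  assumes F: "ac F G" and b: "\<And>y. y \<in> closed_segment p q \<Longrightarrow> \<bar>G y\<bar> \<le> e"
  shows "\<bar>F q - F p\<bar> \<le> e * \<bar>q - p\<bar>"
proof -
  have *: "\<bar>F y - F x\<bar> \<le> e * (y - x)" if xy: "x \<le> y" "\<And>z. z \<in> {x..y} \<Longrightarrow> \<bar>G z\<bar> \<le> e" for x y
  proof -
    have "\<bar>F y - F x\<bar> = norm (integral {x..y} G)" using acD[OF F xy(1)] by simp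
    also have "\<dots> \<le> integral {x..y} (\<lambda>_. e)"
      by (rule Henstock_Kurzweil_Integration.integral_norm_bound_integral[OF absint_integrable[OF ac_integrable[OF F]] integrable_const_ivl])
         (simp add: xy)
    finally show ?thesis using xy(1) by (simp add: mult.commute)
  qed
  show ?thesis
  proof (cases "p \<le> q")
    case True
    then show ?thesis using *[of p q] b by (simp add: closed_segment_eq_real_ivl)
  next
    case False
    then have "\<bar>F p - F q\<bar> \<le> e * (p - q)" using b by (intro *) (auto simp: closed_segment_eq_real_ivl)
    then show ?thesis using False by (simp add: abs_minus_commute)
  qed
qed

context lagrangian
begin

text \<open>The increment divided by p s - p t is the mean of \<open>U 0 s\<close> between p t and p
  s and tends to \<open>U 0 t (p t)\<close>, as \<open>U 0\<close> is continuous in time uniformly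
  in space. Both values are taken at the same time s, since the primitives W s carry unrelated
  constants of integration.\<close>

lemma moving_primitive:
  fixes W :: "real \<Rightarrow> real \<Rightarrow> real" and p :: "real \<Rightarrow> real"
  assumes t: "t \<in> I" and W: "\<And>s. s \<in> I \<Longrightarrow> ac (W s) (U 0 s)" and p: "(p has_real_derivative p') (at t)"
  shows "((\<lambda>s. W s (p s) - W s (p t)) has_real_derivative U 0 t (p t) * p') (at t)"
proof -
  define u where "u = U 0 t (p t)"
  \<comment> \<open>The value u in the degenerate case keeps the increment equal to g s (p s - p t)
    and does not disturb the limit of g.\<close>
  define g where "g s = (if p s = p t then u else (W s (p s) - W s (p t)) / (p s - p t))" for s
  have cp: "(p \<longlongrightarrow> p t) (at t)" using DERIV_isCont[OF p] by (simp add: isCont_def)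
  have "(g \<longlongrightarrow> u) (at t)"
  proof (rule tendstoI)
    fix e :: real assume "e > 0"
    have "isCont (U 0 t) (p t)" using ac_continuous[OF U(3)[OF t n1(2)]] continuous_on_eq_continuous_at open_UNIV by blast
    then obtain r where r: "r > 0" "\<And>y. dist y (p t) < r \<Longrightarrow> dist (U 0 t y) u < e / 3"
      unfolding continuous_at_eps_delta u_def using \<open>e > 0\<close> by (metis divide_pos_pos zero_less_numeral dist_real_def)
    have "\<forall>\<^sub>F s in at t. dist (p s) (p t) < r" by (rule tendstoD[OF cp r(1)])
    moreover have "\<forall>\<^sub>F s in at t. s \<in> I \<and> (\<forall>y. \<bar>U 0 s y - U 0 t y\<bar> < e / 3)"
      by (rule U_uniform[OF t n1(2)]) (use \<open>e > 0\<close> in simp)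
    ultimately show "\<forall>\<^sub>F s in at t. dist (g s) u < e"
    proof eventually_elim
      case (elim s)
      have A: "ac (\<lambda>y. W s y - u * y) (\<lambda>y. U 0 s y - u * 1)"
        by (intro ac_diff ac_cmult ac_ident W) (use elim in blast)
      have "\<bar>(W s (p s) - u * p s) - (W s (p t) - u * p t)\<bar> \<le> (2 * e / 3) * \<bar>p s - p t\<bar>"
      proof (rule ac_increment_bound[OF A])
        fix y assume "y \<in> closed_segment (p t) (p s)"
        then have "dist y (p t) < r" using elim(1) by (auto simp: closed_segment_eq_real_ivl dist_real_def split: if_splits)
        then have "\<bar>U 0 t y - u\<bar> < e / 3" using r(2)[of y] by (simp add: dist_real_def)
        moreover have "\<bar>U 0 s y - U 0 t y\<bar> < e / 3" using elim(2) by blast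
        ultimately show "\<bar>U 0 s y - u * 1\<bar> \<le> 2 * e / 3" by linarith
      qed
      moreover have "(W s (p s) - u * p s) - (W s (p t) - u * p t) = (g s - u) * (p s - p t)"
      proof (cases "p s = p t")
        case False
        have "((a - b) / h - u) * h = (a - b) - u * h" if "h \<noteq> 0" for a b h :: real
          using that by (subst left_diff_distrib) simp
        from this[of "p s - p t" "W s (p s)" "W s (p t)"] show ?thesis using False by (simp add: g_def right_diff_distrib)
      qed simp
      ultimately have "p s \<noteq> p t \<Longrightarrow> \<bar>g s - u\<bar> \<le> 2 * e / 3" by (simp add: abs_mult)
      moreover have "p s = p t \<Longrightarrow> g s = u" by (simp add: g_def)
      ultimately show ?case using \<open>e > 0\<close> by (cases "p s = p t") (auto simp: dist_real_def)
    qed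
  qed
  moreover have "((\<lambda>s. (p s - p t) / (s - t)) \<longlongrightarrow> p') (at t)" using p by (simp add: has_field_derivative_iff)
  ultimately have "((\<lambda>s. g s * ((p s - p t) / (s - t))) \<longlongrightarrow> u * p') (at t)" by (rule tendsto_mult)
  moreover have "g s * ((p s - p t) / (s - t)) = (W s (p s) - W s (p t) - (W t (p t) - W t (p t))) / (s - t)" for s
    by (simp add: g_def)
  ultimately have "((\<lambda>s. (W s (p s) - W s (p t) - (W t (p t) - W t (p t))) / (s - t)) \<longlongrightarrow> u * p') (at t)"
    by (simp only:)
  then show ?thesis unfolding has_field_derivative_iff u_def .
qed

end

text \<open>A time interval with a uniform lower bound for the Jacobian and uniform bounds for the
  unknowns; on it the abstract result on autonomous systems applies.\<close>

locale lag_local = lagrangian +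
  fixes I1 :: "real set" and d B :: real
  assumes I1: "open I1" "is_interval I1" "I1 \<subseteq> I" and d: "d > 0"
    and Jd: "\<And>t. t \<in> I1 \<Longrightarrow> ae01 (\<lambda>x. d \<le> 1 + X 1 t x)"
    and Bd: "\<And>t j. t \<in> I1 \<Longrightarrow> j \<le> n \<Longrightarrow> norm (rcls (X j t)) \<le> B \<and> norm (rcls (V j t)) \<le> B"
begin

text \<open>The bound d \<le> 1 + X 1 holds only almost everywhere. The maximum is a representative
  of the Jacobian that satisfies it everywhere, as the change of variables requires.\<close>

definition J :: "real \<Rightarrow> real \<Rightarrow> real" where "J t x = max d (1 + X 1 t x)"
definition K :: "real \<Rightarrow> real \<Rightarrow> real" where "K t x = 1 / J t x"
definition w :: "nat \<Rightarrow> real \<Rightarrow> real \<Rightarrow> real" where "w m t x = U m t (xi t x)"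
definition Y :: "nat \<Rightarrow> real \<Rightarrow> real \<Rightarrow> real" where "Y k t x = P k t (xi t x)"
definition Ex :: "complex \<Rightarrow> real \<Rightarrow> real \<Rightarrow> complex" where "Ex \<rho> t x = exp (\<rho> * complex_of_real (x + X 0 t x))"
definition Phi :: "real \<Rightarrow> real \<Rightarrow> real" where "Phi t x = flux_sum l c (\<lambda>m. w m t x)"
definition states :: "(real \<Rightarrow> linf) set" where
  "states = (\<lambda>j t. rcls (X j t)) ` {..n} \<union> (\<lambda>j t. rcls (V j t)) ` {..n} \<union> {\<lambda>t. rcls (K t)} \<union> (\<lambda>\<rho> t. cls (Ex \<rho> t)) ` symb_roots l"
text \<open>The summand 1 / d bounds K, and exp (1 + |B|) bounds the exponentials since |\<rho>| = 1
  and |x + X 0| \<le> 1 + |B| on one period; one constant serves all unknowns.\<close>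

definition C :: real where "C = 1 + \<bar>B\<bar> + 1 / d + exp (1 + \<bar>B\<bar>)"

abbreviation "tm \<equiv> tame I1 C states"
abbreviation "jt \<equiv> jet I1 C states"

section \<open>Elementary facts about the flow and compositions with it\<close>

lemma inI: "t \<in> I1 \<Longrightarrow> t \<in> I" using I1 by blast

lemma J_ge: "d \<le> J t x" "0 < J t x" using d by (auto simp: J_def)

lemma J_lbb: "t \<in> I1 \<Longrightarrow> lbb (J t)"
proof -
  assume t: "t \<in> I1"
  have "lbb (X 1 t)" using X(1)[OF inI[OF t], of 1] n1 by simp
  then have l: "lbb (\<lambda>x. 1 + X 1 t x)" by (intro lbb_add lbb_const)
  show ?thesis unfolding lbb_def
  proof (intro conjI allI)
    show "J t \<in> borel_measurable borel" unfolding J_def by (intro borel_measurable_max borel_measurable_const lbb_measurable[OF l])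
    fix a b
    obtain A where "A > 0" "\<And>x. x \<in> {a..b} \<Longrightarrow> norm (1 + X 1 t x) \<le> A" using lbb_boundE[OF l] by metis
    then have "norm (J t x) \<le> A + d" if "x \<in> {a..b}" for x using that d unfolding J_def by force
    then show "\<exists>A. \<forall>x\<in>{a..b}. norm (J t x) \<le> A" by blast
  qed
qed

lemma J_ae: "t \<in> I1 \<Longrightarrow> AE x in lborel. 1 + X 1 t x = J t x"
proof (rule AE_lborel_if_periodic)
  assume t: "t \<in> I1"
  show "ae01 (\<lambda>x. 1 + X 1 t x = J t x)" using Jd[OF t] by (rule ae01_mono) (simp add: J_def)
  fix x assume "1 + X 1 t (frac x) = J t (frac x)"
  then show "1 + X 1 t x = J t x" using periodic1_frac[OF X(2)[OF inI[OF t], of 1]] n1 by (simp add: J_def)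
qed

lemma J_ae01: assumes "t \<in> I1" shows "ae01 (\<lambda>x. 1 + X 1 t x = J t x)"
  unfolding ae01_def using J_ae[OF assms] by eventually_elim simp

text \<open>For n > 1 the function \<open>X 1\<close> is continuous, so its essential lower bound
  holds at every point. In the case n = 1 the equality is that of \<open>J_ae\<close>.\<close>

lemma J_eq: assumes "t \<in> I1" "1 < n" shows "J t = (\<lambda>x. 1 + X 1 t x)"
proof
  fix x
  have c: "continuous_on UNIV (\<lambda>x. 1 + X 1 t x)"
    using ac_continuous[OF X(3)[OF inI[OF assms(1)] assms(2)]] by (intro continuous_intros)
  have "1 + X 1 t y \<in> {d..}" if "y \<in> {0..1}" for y
    by (rule ae01_continuous_closed[OF _ c _ that]) (use Jd[OF assms(1)] in simp_all)
  then have "d \<le> 1 + X 1 t (frac x)" by (simp add: frac_lt_1 less_imp_le)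
  then show "J t x = 1 + X 1 t x"
    using periodic1_frac[OF X(2)[OF inI[OF assms(1)], of 1]] n1 by (simp add: J_def)
qed

lemma xi_J: "t \<in> I1 \<Longrightarrow> ac (xi t) (J t)"
  by (rule ac_transfer[OF xi_ac[OF inI] J_ae])

lemma xi_continuous: "t \<in> I1 \<Longrightarrow> continuous_on UNIV (xi t)"
  by (rule ac_continuous[OF xi_J])

lemma ac_comp: "t \<in> I1 \<Longrightarrow> ac f g \<Longrightarrow> lbb g \<Longrightarrow> ac (\<lambda>x. f (xi t x)) (\<lambda>x. J t x * g (xi t x))" for f g :: "real \<Rightarrow> real"
  using ac_compose_bilipschitz(1)[OF xi_J J_lbb d J_ge(1), of t f g] by simp

lemma xi_1: assumes "t \<in> I1" shows "xi t 1 = xi t 0 + 1" "X 0 t 1 = X 0 t 0"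
proof -
  have "\<forall>x. X 0 t (x + 1) = X 0 t x" using X(2)[OF inI[OF assms] le0] unfolding periodic1_def .
  from spec[OF this, of 0] have e: "X 0 t 1 = X 0 t 0" unfolding add_0 .
  then show "X 0 t 1 = X 0 t 0" .
  show "xi t 1 = xi t 0 + 1" unfolding xi_def e by linarith
qed

lemma w_facts:
  assumes "t \<in> I1" "m \<le> n" shows "lbb (w m t)" "m < n \<Longrightarrow> ac (w m t) (\<lambda>x. J t x * w (Suc m) t x)" "w 0 t = V 0 t"
proof -
  note t = inI[OF assms(1)]
  show "lbb (w m t)" unfolding w_def by (rule lbb_compose[OF U(1)[OF t assms(2)] xi_continuous[OF assms(1)]])
  show "ac (w m t) (\<lambda>x. J t x * w (Suc m) t x)" if "m < n"
    unfolding w_def by (rule ac_comp[OF assms(1) U(3)[OF t that] U(1)[OF t]]) (use that in simp)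
  show "w 0 t = V 0 t" using VU[OF inI[OF assms(1)]] by (auto simp: w_def xi_def)
qed

lemma Y_facts:
  assumes "t \<in> I1" "k \<le> 2 * l"
  shows "lbb (Y k t)" "k < 2 * l \<Longrightarrow> ac (Y k t) (\<lambda>x. J t x * Y (Suc k) t x)" "Y k t 1 = Y k t 0"
proof -
  note t = inI[OF assms(1)]
  show "lbb (Y k t)" unfolding Y_def by (rule lbb_compose[OF P(1)[OF t assms(2)] xi_continuous[OF assms(1)]])
  show "ac (Y k t) (\<lambda>x. J t x * Y (Suc k) t x)" if "k < 2 * l"
    unfolding Y_def by (rule ac_comp[OF assms(1) P(3)[OF t that] P(1)[OF t]]) (use that in simp)
  show "Y k t 1 = Y k t 0" using P(2)[OF inI[OF assms(1)] assms(2)] xi_1(1)[OF assms(1)] by (simp add: Y_def periodic1_def)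
qed

lemma Ex_facts:
  assumes "t \<in> I1"
  shows "ac (Ex \<rho> t) (\<lambda>x. \<rho> * complex_of_real (J t x) * Ex \<rho> t x)" "lbb (Ex \<rho> t)" "Ex \<rho> t 1 = exp \<rho> * Ex \<rho> t 0"
    "Ex (- \<rho>) t x * Ex \<rho> t x = 1"
proof -
  have "ac (\<lambda>x. exp (\<rho> * complex_of_real (xi t x))) (\<lambda>x. J t x *\<^sub>R (\<rho> * exp (\<rho> * complex_of_real (xi t x))))"
    by (rule ac_compose_bilipschitz(1)[OF xi_J[OF assms] J_lbb[OF assms] d J_ge(1) ac_exp_real]) (intro lbb_continuous continuous_intros)
  then show a: "ac (Ex \<rho> t) (\<lambda>x. \<rho> * complex_of_real (J t x) * Ex \<rho> t x)"
    unfolding Ex_def xi_def by (simp add: scaleR_conv_of_real mult_ac)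
  show "lbb (Ex \<rho> t)" by (rule ac_lbb_fun[OF a])
  have "\<rho> * complex_of_real (1 + X 0 t 1) = \<rho> + \<rho> * complex_of_real (0 + X 0 t 0)"
    unfolding xi_1(2)[OF assms] by (simp add: distrib_left)
  then show "Ex \<rho> t 1 = exp \<rho> * Ex \<rho> t 0" unfolding Ex_def by (simp only: exp_add)
  show "Ex (- \<rho>) t x * Ex \<rho> t x = 1" unfolding Ex_def exp_add[symmetric] by simp
qed

lemma K_lbb: "t \<in> I1 \<Longrightarrow> lbb (K t)"
  unfolding K_def[abs_def] by (rule lbb_inverse[OF J_lbb d J_ge(1)])

lemma KJ: "K t x * J t x = 1" "J t x * K t x = 1" using J_ge(2)[of t x] by (auto simp: K_def)

lemma rcls_J: "t \<in> I1 \<Longrightarrow> rcls (J t) = 1 + rcls (X 1 t)"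
proof -
  assume t: "t \<in> I1"
  have lX: "lbb (X 1 t)" using X(1)[OF inI[OF t], of 1] n1 by simp
  have "rcls (\<lambda>x. 1 + X 1 t x) = rcls (J t)"
    by (subst cls_eq_iff[OF lbb_complex_of_real[OF lbb_add[OF lbb_const lX]] lbb_complex_of_real[OF J_lbb[OF t]]])
       (rule ae01_mono[OF J_ae01[OF t]], simp only:)
  then have "rcls (J t) = rcls (\<lambda>x. 1 + X 1 t x)" ..
  also have "\<dots> = rcls (\<lambda>x. 1) + rcls (X 1 t)" by (rule rcls_simps(1)[OF lbb_const lX])
  also have "rcls (\<lambda>x. 1) = 1" using cls_simps(2) by simp
  finally show ?thesis .
qed

lemma rcls_JK: "t \<in> I1 \<Longrightarrow> rcls (J t) * rcls (K t) = 1"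
proof -
  assume t: "t \<in> I1"
  have "rcls (J t) * rcls (K t) = rcls (\<lambda>x. J t x * K t x)" by (rule rcls_simps(3)[OF J_lbb[OF t] K_lbb[OF t], symmetric])
  also have "\<dots> = 1" unfolding KJ using cls_simps(2) by simp
  finally show ?thesis .
qed

lemma norm_K: "t \<in> I1 \<Longrightarrow> norm (rcls (K t)) \<le> 1 / d"
proof -
  assume t: "t \<in> I1"
  have "\<bar>K t x\<bar> \<le> 1 / d" for x using J_ge[of t x] d by (auto simp: K_def intro: frac_le)
  then show ?thesis using d by (subst norm_rcls_le[OF K_lbb[OF t]]) (auto intro: ae01_always)
qed

lemma C_pos: "C > 0" "1 / d \<le> C" "\<bar>B\<bar> \<le> C" "exp (1 + \<bar>B\<bar>) \<le> C"
proof -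
  have "0 < 1 / d" "0 < exp (1 + \<bar>B\<bar>)" using d by auto
  then show "C > 0" "1 / d \<le> C" "\<bar>B\<bar> \<le> C" "exp (1 + \<bar>B\<bar>) \<le> C" unfolding C_def by linarith+
qed

lemma states_bounded: "F \<in> states \<Longrightarrow> t \<in> I1 \<Longrightarrow> norm (F t) \<le> C"
proof -
  assume F: "F \<in> states" and t: "t \<in> I1"
  have "norm (cls (Ex \<rho> t)) \<le> C" if \<rho>: "\<rho> \<in> symb_roots l" for \<rho>
  proof -
    have lX: "lbb (X 0 t)" using X(1)[OF inI[OF t], of 0] by simp
    have nB: "norm (rcls (X 0 t)) \<le> \<bar>B\<bar>" using Bd[OF t, of 0] by linarith
    have "ae01 (\<lambda>x. norm (Ex \<rho> t x) \<le> exp (1 + \<bar>B\<bar>))"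
    proof (rule ae01_mp2[OF norm_rcls_ae[OF lX] ae01_always[of "\<lambda>x. x \<in> {0..<1}"]])
      fix x :: real assume x: "\<bar>X 0 t x\<bar> \<le> norm (rcls (X 0 t))" "x \<in> {0..<1}"
      have "norm (Ex \<rho> t x) \<le> exp (norm (\<rho> * complex_of_real (x + X 0 t x)))" unfolding Ex_def by (rule norm_exp)
      also have "norm (\<rho> * complex_of_real (x + X 0 t x)) = \<bar>x + X 0 t x\<bar>"
        using symb_roots_properties(1)[OF \<rho>] by (simp only: norm_mult norm_of_real mult_1 real_norm_def)
      also have "exp \<bar>x + X 0 t x\<bar> \<le> exp (1 + \<bar>B\<bar>)" using x nB by auto
      finally show "norm (Ex \<rho> t x) \<le> exp (1 + \<bar>B\<bar>)" .
    qed simp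
    then have "norm (cls (Ex \<rho> t)) \<le> exp (1 + \<bar>B\<bar>)" by (subst norm_cls_le_iff[OF Ex_facts(2)[OF t]]) auto
    then show ?thesis using C_pos by linarith
  qed
  then show ?thesis using F Bd[OF t] norm_K[OF t] C_pos unfolding states_def by force
qed

section \<open>Tameness of the Jacobian and of the velocity derivatives\<close>

lemma state_tame:
  "j \<le> n \<Longrightarrow> tm (\<lambda>t. rcls (X j t))" "j \<le> n \<Longrightarrow> tm (\<lambda>t. rcls (V j t))" "tm (\<lambda>t. rcls (K t))"
  "\<rho> \<in> symb_roots l \<Longrightarrow> tm (\<lambda>t. cls (Ex \<rho> t))"
  by (rule tameI_member; use C_pos in \<open>auto simp: states_def\<close>)+

lemma tame_J: "tm (\<lambda>t. rcls (J t))"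
  by (rule tame_cong[OF tame_add[OF tame_const state_tame(1)[OF n1(1)]]]) (simp add: rcls_J)

lemma jet_X: "i \<le> n \<Longrightarrow> k \<le> n - i \<Longrightarrow> jt k (\<lambda>t x. complex_of_real (X i t x))"
  by (rule jet_chain[where F = "\<lambda>j t x. complex_of_real (X (i + j) t x)", simplified])
     (auto intro!: lbb_complex_of_real ac_complex_of_real X inI state_tame)

lemma jet_V: "jt n (\<lambda>t x. complex_of_real (V 0 t x))"
  by (rule jet_chain[where F = "\<lambda>j t x. complex_of_real (V j t x)"])
     (auto intro!: lbb_complex_of_real ac_complex_of_real V inI state_tame)

lemma J_ac: "t \<in> I1 \<Longrightarrow> 1 < n \<Longrightarrow> ac (J t) (X 2 t)"
  using ac_add[OF ac_const[of 1] X(3)[of t 1]] inI[of t] by (simp add: J_eq numeral_2_eq_2)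

lemma jet_J: "k \<le> n - 1 \<Longrightarrow> jt k (\<lambda>t x. complex_of_real (J t x))"
proof (cases k)
  case 0 then show ?thesis using tame_J by (simp add: lbb_complex_of_real J_lbb)
next
  case (Suc i)
  assume k: "k \<le> n - 1"
  show ?thesis unfolding Suc
  proof (rule jet_Suc)
    show "jt 0 (\<lambda>t x. complex_of_real (J t x))" using tame_J by (simp add: lbb_complex_of_real J_lbb)
    show "ac (\<lambda>x. complex_of_real (J t x)) (\<lambda>x. complex_of_real (X 2 t x))" if "t \<in> I1" for t
      using that k Suc by (intro ac_complex_of_real J_ac) auto
    show "jt i (\<lambda>t x. complex_of_real (X 2 t x))" using k Suc by (intro jet_X) auto
  qed
qed

text \<open>The derivative of K is - K^2 X 2, so tameness propagates by induction, K itself being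
  one of the unknowns.\<close>

lemma jet_K: "k \<le> n - 1 \<Longrightarrow> jt k (\<lambda>t x. complex_of_real (K t x))"
proof (induction k)
  case 0 then show ?case using state_tame(3) by (simp add: lbb_complex_of_real K_lbb)
next
  case (Suc i)
  let ?g = "\<lambda>t x. - 1 * (complex_of_real (K t x) * complex_of_real (K t x)) * complex_of_real (X 2 t x)"
  show ?case
  proof (rule jet_Suc)
    show "jt 0 (\<lambda>t x. complex_of_real (K t x))" using state_tame(3) by (simp add: lbb_complex_of_real K_lbb)
    fix t assume t: "t \<in> I1"
    have "ac (\<lambda>x. 1 / J t x) (\<lambda>x. - (1 / J t x * (1 / J t x)) * X 2 t x)"
      using Suc.prems t by (intro ac_reciprocal[OF J_ac _ d J_ge(1)] X inI) auto
    then have "ac (K t) (\<lambda>x. - (K t x * K t x) * X 2 t x)" unfolding K_def .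
    from ac_complex_of_real[OF this] show "ac (\<lambda>x. complex_of_real (K t x)) (?g t)" by simp
  next
    have "jt i (\<lambda>t x. complex_of_real (K t x))" using Suc by simp
    moreover have "jt i (\<lambda>t x. complex_of_real (X 2 t x))" using Suc.prems by (intro jet_X) auto
    ultimately show "jt i ?g" by (intro jet_mult jet_const)
  qed
qed

text \<open>The derivative of \<open>w m\<close> is J times \<open>w (m + 1)\<close>, so
  multiplication by the unknown K recovers the next order. Agreement is only almost everywhere, as
  the derivative provided by \<open>jet\<close> need not be the composition with the flow.\<close>

lemma jet_w: "m \<le> n \<Longrightarrow> \<exists>g. jt (n - m) g \<and> (\<forall>t\<in>I1. ae01 (\<lambda>x. g t x = complex_of_real (w m t x)))"
proof (induction m)
  case 0
  show ?case using jet_V w_facts(3)[of _ 0] by (intro exI[of _ "\<lambda>t x. complex_of_real (V 0 t x)"]) (auto intro: ae01_always)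
next
  case (Suc m)
  then obtain g where g: "jt (n - m) g" "\<And>t. t \<in> I1 \<Longrightarrow> ae01 (\<lambda>x. g t x = complex_of_real (w m t x))" by auto
  have "n - m = Suc (n - Suc m)" using Suc.prems by simp
  with g(1) obtain h where h: "\<And>t. t \<in> I1 \<Longrightarrow> ac (g t) (h t)" "jt (n - Suc m) h" by auto
  show ?case
  proof (intro exI[of _ "\<lambda>t x. complex_of_real (K t x) * h t x"] conjI ballI)
    show "jt (n - Suc m) (\<lambda>t x. complex_of_real (K t x) * h t x)" by (intro jet_mult jet_K h) simp
    fix t assume t: "t \<in> I1"
    have "ac (\<lambda>x. complex_of_real (w m t x)) (\<lambda>x. complex_of_real (J t x * w (Suc m) t x))"
      using Suc.prems t by (intro ac_complex_of_real w_facts) auto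
    then have "ae01 (\<lambda>x. h t x = complex_of_real (J t x * w (Suc m) t x))"
      by (rule ac_ae_unique[OF h(1)[OF t] _ jetD(1)[OF h(2) t] _ g(2)[OF t]])
         (intro lbb_complex_of_real lbb_mult J_lbb t w_facts Suc.prems)
    then show "ae01 (\<lambda>x. complex_of_real (K t x) * h t x = complex_of_real (w (Suc m) t x))"
    proof (rule ae01_mono)
      fix x assume "h t x = complex_of_real (J t x * w (Suc m) t x)"
      then have "complex_of_real (K t x) * h t x = complex_of_real ((K t x * J t x) * w (Suc m) t x)" by simp
      then show "complex_of_real (K t x) * h t x = complex_of_real (w (Suc m) t x)" by (simp only: KJ mult_1)
    qed
  qed
qed

lemma tame_w: "m \<le> n \<Longrightarrow> tm (\<lambda>t. rcls (w m t))"
proof -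
  assume m: "m \<le> n"
  from jet_w[OF this] obtain g where g: "jt (n - m) g" "\<And>t. t \<in> I1 \<Longrightarrow> ae01 (\<lambda>x. g t x = complex_of_real (w m t x))" by auto
  show ?thesis
  proof (rule tame_cong[OF jetD(2)[OF g(1)]])
    fix t assume t: "t \<in> I1"
    show "cls (g t) = rcls (w m t)"
      by (subst cls_eq_iff[OF jetD(1)[OF g(1) t] lbb_complex_of_real[OF w_facts(1)[OF t m]]]) (rule g(2)[OF t])
  qed
qed

end

section \<open>The pressure along the flow\<close>

context lag_local
begin

lemma rcls_sum: "(\<And>i. i \<in> A \<Longrightarrow> lbb (f i)) \<Longrightarrow> rcls (\<lambda>x. \<Sum>i\<in>A. f i x) = (\<Sum>i\<in>A. rcls (f i))"
  using cls_sum[of A "\<lambda>i x. complex_of_real (f i x)"] by (simp add: lbb_complex_of_real)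

lemma Phi_facts: "t \<in> I1 \<Longrightarrow> lbb (Phi t)" "tm (\<lambda>t. rcls (Phi t))"
proof -
  let ?S = "{(m, k). m \<le> 2 * l - 1 \<and> k \<le> 2 * l - 1 \<and> m + k \<le> 2 * l}"
  have e: "Phi t = (\<lambda>x. \<Sum>p\<in>?S. c (fst p) (snd p) * (w (fst p) t x * w (snd p) t x))" for t
    by (rule ext) (simp add: Phi_def flux_sum_def case_prod_beta' mult.assoc)
  have lw: "lbb (w (fst p) t)" "lbb (w (snd p) t)" if "p \<in> ?S" "t \<in> I1" for p t
    using that w_facts(1)[OF that(2)] n by auto
  have lp: "lbb (\<lambda>x. c (fst p) (snd p) * (w (fst p) t x * w (snd p) t x))" if "p \<in> ?S" "t \<in> I1" for p t
    by (intro lbb_mult[OF lbb_const] lbb_mult lw that)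
  show "t \<in> I1 \<Longrightarrow> lbb (Phi t)" unfolding e by (rule lbb_sum[OF lp])
  have tp: "tm (\<lambda>t. c (fst p) (snd p) *\<^sub>R (rcls (w (fst p) t) * rcls (w (snd p) t)))" if "p \<in> ?S" for p
    by (rule tame_linear[OF tame_mult[OF tame_w tame_w] bounded_linear_scaleR_right]) (use that n in auto)
  have "tm (\<lambda>t. \<Sum>p\<in>?S. c (fst p) (snd p) *\<^sub>R (rcls (w (fst p) t) * rcls (w (snd p) t)))"
    by (rule tame_sum[OF tp])
  then show "tm (\<lambda>t. rcls (Phi t))"
  proof (rule tame_cong)
    fix t assume t: "t \<in> I1"
    have "rcls (Phi t) = (\<Sum>p\<in>?S. rcls (\<lambda>x. c (fst p) (snd p) * (w (fst p) t x * w (snd p) t x)))"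
      unfolding e by (rule rcls_sum[OF lp[OF _ t]])
    also have "\<dots> = (\<Sum>p\<in>?S. c (fst p) (snd p) *\<^sub>R (rcls (w (fst p) t) * rcls (w (snd p) t)))"
      by (rule sum.cong[OF refl]) (simp only: rcls_simps(5)[OF lbb_mult[OF lw[OF _ t]]] rcls_simps(3)[OF lw[OF _ t]])
    finally show "(\<Sum>p\<in>?S. c (fst p) (snd p) *\<^sub>R (rcls (w (fst p) t) * rcls (w (snd p) t))) = rcls (Phi t)" ..
  qed
qed

text \<open>A P evaluated along the flow. The pressure equation, pulled back by the flow, identifies
  it almost everywhere with the flux \<open>Phi\<close>.\<close>

definition Psi :: "real \<Rightarrow> real \<Rightarrow> real" where "Psi t x = (\<Sum>j\<le>l. (-1) ^ j * Y (2 * j) t x)"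

lemma Psi_facts: assumes t: "t \<in> I1" shows "lbb (Psi t)" "rcls (Psi t) = rcls (Phi t)"
proof -
  show lP: "lbb (Psi t)" unfolding Psi_def[abs_def] by (intro lbb_sum lbb_mult[OF lbb_const] Y_facts(1)[OF t]) simp
  have "AE x in lborel. Psi t x = Phi t x"
    using AE_compose_bilipschitz[OF xi_J[OF t] J_lbb[OF t] d J_ge(1) PF[OF inI[OF t]]]
    by (simp add: Psi_def Phi_def Y_def w_def)
  then have "ae01 (\<lambda>x. complex_of_real (Psi t x) = complex_of_real (Phi t x))"
    unfolding ae01_def by eventually_elim simp
  then show "rcls (Psi t) = rcls (Phi t)"
    using cls_eq_iff[OF lbb_complex_of_real[OF lP] lbb_complex_of_real[OF Phi_facts(1)[OF t]]] by simp
qed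

definition Yc :: "real \<Rightarrow> nat \<Rightarrow> real \<Rightarrow> complex" where "Yc t k x = complex_of_real (Y k t x)"

text \<open>Applying the operator with symbol \<open>cofactor l \<rho>\<close> to P gives Q with Q'
  - \<rho> Q = (-1)^l A P, where A P is the flux. Along the flow this is the equation of
  \<open>periodic_resolvent\<close> with E = exp (- \<rho> \<xi>).\<close>

lemma polyop_resolvent:
  assumes t: "t \<in> I1" and \<rho>: "\<rho> \<in> symb_roots l"
  shows "cls (polyop (2 * l) (Yc t) (cofactor l \<rho>)) = cls (Ex \<rho> t) * resolvent \<rho> (rcls (J t) * (((-1) ^ l) *\<^sub>R rcls (Phi t)) * cls (Ex (- \<rho>) t))"
    "lbb (polyop (2 * l) (Yc t) (cofactor l \<rho>))"
proof -
  let ?Q = "polyop (2 * l) (Yc t) (cofactor l \<rho>)"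
  let ?J = "\<lambda>x. complex_of_real (J t x)"
  let ?F = "\<lambda>x. complex_of_real ((-1) ^ l * Psi t x)"
  have Yac: "ac (Yc t k) (\<lambda>x. ?J x * Yc t (Suc k) x)" if "k < 2 * l" for k
    using ac_complex_of_real[OF Y_facts(2)[OF t _ that]] that by (simp add: Yc_def[abs_def])
  have deg: "degree (cofactor l \<rho>) < 2 * l" using cofactor(1)[OF \<rho>] l by simp
  have ac0: "ac ?Q (\<lambda>x. ?J x * polyop (2 * l) (Yc t) (pCons 0 (cofactor l \<rho>)) x)"
    by (rule ac_polyop[where Y = "Yc t" and J = ?J and N = "2 * l"]) (use Yac deg in auto)
  have "pCons 0 (cofactor l \<rho>) = [:- \<rho>, 1:] * cofactor l \<rho> + smult \<rho> (cofactor l \<rho>)" by simp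
  then have pc: "pCons 0 (cofactor l \<rho>) = smult ((-1) ^ l) (symb l) + smult \<rho> (cofactor l \<rho>)"
    unfolding cofactor(2)[OF \<rho>] .
  have "polyop (2 * l) (Yc t) (pCons 0 (cofactor l \<rho>)) x = \<rho> * ?Q x + ?F x" for x
    unfolding pc polyop_add polyop_smult polyop_symb by (simp add: Yc_def Psi_def)
  with ac0 have acQ: "ac ?Q (\<lambda>x. ?J x * (\<rho> * ?Q x + ?F x))" by simp
  have acE: "ac (Ex (- \<rho>) t) (\<lambda>x. - \<rho> * ?J x * Ex (- \<rho>) t x)" by (rule Ex_facts(1)[OF t])
  have lF: "lbb (\<lambda>x. (-1) ^ l * Psi t x)" by (rule lbb_mult[OF lbb_const Psi_facts(1)[OF t]])
  have lJ: "lbb ?J" by (rule lbb_complex_of_real[OF J_lbb[OF t]])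
  have per: "?Q 1 = ?Q 0" unfolding polyop_def by (rule sum.cong[OF refl]) (simp add: Yc_def Y_facts(3)[OF t])
  have ne: "exp (- \<rho>) \<noteq> 1" using symb_roots_properties(2)[OF symb_roots_properties(3)[OF \<rho>]] .
  have "cls ?Q = cls (Ex \<rho> t) * resolvent \<rho> (cls (\<lambda>x. ?J x * ?F x * Ex (- \<rho>) t x))"
    by (rule periodic_resolvent[OF acQ acE lJ lbb_complex_of_real[OF lF] Ex_facts(2)[OF t] per Ex_facts(3)[OF t] ne Ex_facts(4)[OF t]])
  also have "cls (\<lambda>x. ?J x * ?F x * Ex (- \<rho>) t x) = rcls (J t) * cls ?F * cls (Ex (- \<rho>) t)"
    by (simp only: cls_simps(5)[OF lbb_mult[OF lJ lbb_complex_of_real[OF lF]] Ex_facts(2)[OF t]] cls_simps(5)[OF lJ lbb_complex_of_real[OF lF]])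
  also have "cls ?F = ((-1) ^ l) *\<^sub>R rcls (Phi t)"
    unfolding rcls_simps(5)[OF Psi_facts(1)[OF t]] Psi_facts(2)[OF t] ..
  finally show "cls ?Q = cls (Ex \<rho> t) * resolvent \<rho> (rcls (J t) * (((-1) ^ l) *\<^sub>R rcls (Phi t)) * cls (Ex (- \<rho>) t))" .
  show "lbb ?Q" by (rule ac_lbb_fun[OF acQ])
qed

lemma tame_polyop: "\<rho> \<in> symb_roots l \<Longrightarrow> tm (\<lambda>t. cls (polyop (2 * l) (Yc t) (cofactor l \<rho>)))"
proof -
  assume \<rho>: "\<rho> \<in> symb_roots l"
  have "tm (\<lambda>t. cls (Ex \<rho> t) * resolvent \<rho> (rcls (J t) * (((-1) ^ l) *\<^sub>R rcls (Phi t)) * cls (Ex (- \<rho>) t)))"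
    by (rule tame_mult[OF state_tame(4)[OF \<rho>] tame_linear[OF tame_mult[OF tame_mult[OF tame_J
        tame_linear[OF Phi_facts(2) bounded_linear_scaleR_right]] state_tame(4)[OF symb_roots_properties(3)[OF \<rho>]]] bounded_linear_resolvent]])
  then show ?thesis by (rule tame_cong) (simp only: polyop_resolvent(1)[OF _ \<rho>])
qed

lemma tame_Y_lower: assumes k: "k < 2 * l" shows "tm (\<lambda>t. rcls (Y k t))"
proof -
  let ?a = "\<lambda>\<rho>. \<rho> ^ k / poly (cofactor l \<rho>) \<rho>"
  let ?Q = "\<lambda>\<rho> t. polyop (2 * l) (Yc t) (cofactor l \<rho>)"
  have "tm (\<lambda>t. \<Sum>\<rho>\<in>symb_roots l. cL (?a \<rho>) * cls (?Q \<rho> t))"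
    by (rule tame_sum) (rule tame_mult[OF tame_const tame_polyop])
  then show ?thesis
  proof (rule tame_cong)
    fix t assume t: "t \<in> I1"
    have "complex_of_real (Y k t x) = (\<Sum>\<rho>\<in>symb_roots l. ?a \<rho> * ?Q \<rho> t x)" for x
    proof -
      have "complex_of_real (Y k t x) = polyop (2 * l) (Yc t) (monom 1 k) x" using k by (simp add: polyop_monom Yc_def)
      also have "\<dots> = (\<Sum>\<rho>\<in>symb_roots l. ?a \<rho> * ?Q \<rho> t x)"
        unfolding lagrange_monomial[OF k] polyop_sum polyop_smult ..
      finally show ?thesis .
    qed
    then have "rcls (Y k t) = cls (\<lambda>x. \<Sum>\<rho>\<in>symb_roots l. ?a \<rho> * ?Q \<rho> t x)" by simp
    also have "\<dots> = (\<Sum>\<rho>\<in>symb_roots l. cls (\<lambda>x. ?a \<rho> * ?Q \<rho> t x))"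
      by (rule cls_sum) (rule lbb_mult[OF lbb_const polyop_resolvent(2)[OF t]])
    also have "\<dots> = (\<Sum>\<rho>\<in>symb_roots l. cL (?a \<rho>) * cls (?Q \<rho> t))"
      by (rule sum.cong[OF refl]) (simp only: cL_def cls_simps(5)[OF lbb_const polyop_resolvent(2)[OF t]])
    finally show "(\<Sum>\<rho>\<in>symb_roots l. cL (?a \<rho>) * cls (?Q \<rho> t)) = rcls (Y k t)" ..
  qed
qed

text \<open>Order 2l is out of reach of the interpolation, but the equation A P = F expresses it
  through the flux and the lower even orders.\<close>

lemma tame_Y_top: "tm (\<lambda>t. rcls (Y (2 * l) t))"
proof -
  have "tm (\<lambda>t. ((-1) ^ l) *\<^sub>R (rcls (Phi t) + - (\<Sum>j<l. ((-1) ^ j) *\<^sub>R rcls (Y (2 * j) t))))"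
    by (intro tame_linear[OF _ bounded_linear_scaleR_right] tame_add Phi_facts(2) tame_uminus tame_sum tame_Y_lower) simp
  then show ?thesis
  proof (rule tame_cong)
    fix t assume t: "t \<in> I1"
    have lY: "lbb (Y (2 * j) t)" if "j \<le> l" for j using Y_facts(1)[OF t, of "2 * j"] that by simp
    have "rcls (Phi t) = rcls (\<lambda>x. \<Sum>j\<le>l. (-1) ^ j * Y (2 * j) t x)"
      unfolding Psi_facts(2)[OF t, symmetric] Psi_def[abs_def] ..
    also have "\<dots> = (\<Sum>j\<le>l. rcls (\<lambda>x. (-1) ^ j * Y (2 * j) t x))"
      by (rule rcls_sum) (rule lbb_mult[OF lbb_const lY], simp)
    also have "\<dots> = (\<Sum>j\<le>l. ((-1) ^ j) *\<^sub>R rcls (Y (2 * j) t))"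
      by (rule sum.cong[OF refl]) (simp add: rcls_simps(5)[OF lY] del: of_real_mult)
    also have "\<dots> = (\<Sum>j<l. ((-1) ^ j) *\<^sub>R rcls (Y (2 * j) t)) + ((-1) ^ l) *\<^sub>R rcls (Y (2 * l) t)"
      by (simp only: lessThan_Suc_atMost[symmetric] sum.lessThan_Suc)
    finally have "rcls (Phi t) + - (\<Sum>j<l. ((-1) ^ j) *\<^sub>R rcls (Y (2 * j) t)) = ((-1) ^ l) *\<^sub>R rcls (Y (2 * l) t)" by simp
    then show "((-1) ^ l) *\<^sub>R (rcls (Phi t) + - (\<Sum>j<l. ((-1) ^ j) *\<^sub>R rcls (Y (2 * j) t))) = rcls (Y (2 * l) t)"
      by (simp flip: power_mult_distrib)
  qed
qed

text \<open>Starting from order 2l, which is merely tame, each step down gains one space derivative,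
  at the price of one more derivative of the Jacobian.\<close>

lemma jet_Y: "i \<le> n \<Longrightarrow> jt i (\<lambda>t x. complex_of_real (Y (2 * l - i) t x))"
proof (induction i)
  case 0 then show ?case using tame_Y_top Y_facts(1)[of _ "2 * l"] by (simp add: lbb_complex_of_real)
next
  case (Suc i)
  have k: "2 * l - i = Suc (2 * l - Suc i)" "2 * l - Suc i < 2 * l" using Suc.prems n by auto
  show ?case
  proof (rule jet_Suc)
    show "jt 0 (\<lambda>t x. complex_of_real (Y (2 * l - Suc i) t x))"
      using tame_Y_lower[OF k(2)] Y_facts(1)[of _ "2 * l - Suc i"] by (simp add: lbb_complex_of_real)
    fix t assume t: "t \<in> I1"
    have "ac (Y (2 * l - Suc i) t) (\<lambda>x. J t x * Y (2 * l - i) t x)"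
      unfolding k(1) by (rule Y_facts(2)[OF t _ k(2)]) simp
    from ac_complex_of_real[OF this]
    show "ac (\<lambda>x. complex_of_real (Y (2 * l - Suc i) t x)) (\<lambda>x. complex_of_real (J t x) * complex_of_real (Y (2 * l - i) t x))" by simp
  next
    show "jt i (\<lambda>t x. complex_of_real (J t x) * complex_of_real (Y (2 * l - i) t x))"
      using Suc by (intro jet_mult jet_J) auto
  qed
qed

text \<open>Here 2l - n = 1: the pressure gradient has as many tame space derivatives as the
  velocity, which is the absence of derivative loss.\<close>

lemma jet_Y1: "jt n (\<lambda>t x. complex_of_real (Y 1 t x))"
  using jet_Y[of n] n l by (simp add: Suc_diff_Suc numeral_2_eq_2)

section \<open>Time derivatives of the unknowns\<close>

lemma J_derivative: assumes t: "t \<in> I1" shows "((\<lambda>s. rcls (J s)) has_vector_derivative rcls (V 1 t)) (at t)"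
proof -
  have "((\<lambda>s. 1 + rcls (X 1 s)) has_vector_derivative 0 + rcls (V 1 t)) (at t)"
    by (rule has_vector_derivative_add[OF has_vector_derivative_const XV[OF inI[OF t] n1(1)]])
  then have "((\<lambda>s. rcls (J s)) has_vector_derivative 0 + rcls (V 1 t)) (at t)"
    by (rule has_vector_derivative_transform_within_open[OF _ I1(1) t]) (rule rcls_J[symmetric])
  then show ?thesis by simp
qed

lemma K_derivative: assumes t: "t \<in> I1"
  shows "((\<lambda>s. rcls (K s)) has_vector_derivative - (rcls (K t) * rcls (K t)) * rcls (V 1 t)) (at t)"
  by (rule has_vector_derivative_inverse[OF I1(1) t rcls_JK norm_K J_derivative[OF t]])

lemma Ex_derivative: assumes t: "t \<in> I1" and \<rho>: "\<rho> \<in> symb_roots l"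
  shows "((\<lambda>s. cls (Ex \<rho> s)) has_vector_derivative cL \<rho> * rcls (V 0 t) * cls (Ex \<rho> t)) (at t)"
  unfolding Ex_def[abs_def]
  by (rule has_vector_derivative_cls_exp[OF I1(1) t X(1)[OF inI le0] Ex_facts(2)[unfolded Ex_def[abs_def]] V(1)[OF inI[OF t] le0] XV[OF inI[OF t] le0]])
     (use symb_roots_properties(1)[OF \<rho>] in simp_all)

lemma states_continuous: "F \<in> states \<Longrightarrow> continuous_on I1 F"
proof -
  have c: "continuous_on I1 F" if "\<And>t. t \<in> I1 \<Longrightarrow> (F has_vector_derivative F' t) (at t)" for F :: "real \<Rightarrow> linf" and F'
    using that by (meson continuous_at_imp_continuous_on has_vector_derivative_continuous)
  assume "F \<in> states"
  then consider j where "j \<le> n" "F = (\<lambda>t. rcls (X j t))" | j where "j \<le> n" "F = (\<lambda>t. rcls (V j t))"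
    | "F = (\<lambda>t. rcls (K t))" | \<rho> where "\<rho> \<in> symb_roots l" "F = (\<lambda>t. cls (Ex \<rho> t))"
    unfolding states_def by blast
  then show ?thesis
  proof cases
    case (1 j) then show ?thesis using continuous_on_subset[OF X_continuous I1(3)] by simp
  next
    case (2 j) then show ?thesis using continuous_on_subset[OF Vc I1(3)] by simp
  next
    case 3 then show ?thesis using c[OF K_derivative] by simp
  next
    case (4 \<rho>) then show ?thesis using c[OF Ex_derivative] by simp
  qed
qed

lemma tame_continuous: "tm f \<Longrightarrow> continuous_on I1 f"
  by (rule tame_continuous_bounded(1)[where S = states and I = I1 and C = C]) (use states_continuous states_bounded in auto)

lemma xi_mono: "t \<in> I1 \<Longrightarrow> x \<le> y \<Longrightarrow> xi t x \<le> xi t y"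
  using bilipschitz_bij(1)[OF xi_J d J_ge(1)] by (simp add: strict_mono_less_eq)

lemma integral_xi: "t \<in> I1 \<Longrightarrow> x \<le> y \<Longrightarrow> lbb g \<Longrightarrow> integral {xi t x..xi t y} g = integral {x..y} (\<lambda>z. J t z * g (xi t z))" for g :: "real \<Rightarrow> real"
  using integral_bilipschitz[OF xi_J J_lbb d J_ge(1), of t g x y] by simp

text \<open>The integral of V J over [0, x] is that of u between the images of 0 and x. Its time
  derivative combines the equation on a fixed interval, \<open>Uder\<close>, with the motion of the
  endpoints, \<open>moving_primitive\<close>.\<close>

lemma momentum_derivative:
  assumes t: "t \<in> I1" and x: "x \<in> {0..1}"
  shows "((\<lambda>s. integral {0..x} (\<lambda>z. V 0 s z * J s z)) has_real_derivative
     integral {0..x} (\<lambda>z. V 0 t z * V 1 t z - Y 1 t z * J t z)) (at t)"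
proof -
  note tI = inI[OF t]
  obtain W where W: "\<And>s. s \<in> I \<Longrightarrow> ac (W s) (U 0 s)"
  proof -
    have "\<exists>W. ac W (U 0 s)" if "s \<in> I" for s
      using ac_primitive_exists[OF lbb_absolutely_integrable[OF U(1)[OF that le0]]] by blast
    then show thesis using that by metis
  qed
  have p: "((\<lambda>s. xi s y) has_real_derivative V 0 t y) (at t)" if "y \<in> {0..1}" for y
    unfolding xi_def using DERIV_add[OF DERIV_const X0_derivative[OF tI that], of y] by simp
  have x0: "(0::real) \<in> {0..1}" "0 \<le> x" "x \<le> 1" using x by auto
  let ?a = "xi t 0" and ?b = "xi t x"
  have ab: "?a \<le> ?b" "?b \<le> ?a + 1" using xi_mono[OF t x0(2)] xi_mono[OF t x0(3)] xi_1(1)[OF t] by auto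
  have D: "((\<lambda>s. integral {?a..?b} (U 0 s) + (W s (xi s x) - W s (xi t x)) - (W s (xi s 0) - W s (xi t 0))) has_real_derivative
      - integral {?a..?b} (\<lambda>y. U 0 t y * U 1 t y + P 1 t y) + U 0 t ?b * V 0 t x - U 0 t ?a * V 0 t 0) (at t)"
    by (intro DERIV_diff DERIV_add Uder[OF tI ab] moving_primitive[OF tI W p[OF x]] moving_primitive[OF tI W p[OF x0(1)]])
  have eq: "integral {?a..?b} (U 0 s) + (W s (xi s x) - W s (xi t x)) - (W s (xi s 0) - W s (xi t 0)) = integral {0..x} (\<lambda>z. V 0 s z * J s z)"
    if s: "s \<in> I1" for s
  proof -
    have "integral {0..x} (\<lambda>z. V 0 s z * J s z) = integral {0..x} (\<lambda>z. J s z * U 0 s (xi s z))"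
      using w_facts(3)[OF s, of 0] by (simp add: w_def[abs_def] fun_eq_iff mult.commute)
    also have "\<dots> = integral {xi s 0..xi s x} (U 0 s)" by (rule integral_xi[OF s x0(2) U(1)[OF inI[OF s] le0], symmetric])
    also have "\<dots> = W s (xi s x) - W s (xi s 0)" by (rule acD[OF W[OF inI[OF s]] xi_mono[OF s x0(2)], symmetric])
    finally show ?thesis using acD[OF W[OF inI[OF s]] ab(1)] by simp
  qed
  have lw: "lbb (w 0 t)" "lbb (w 1 t)" "lbb (V 0 t)" "lbb (V 1 t)" "lbb (J t)" "lbb (Y 1 t)"
    using w_facts(1)[OF t] n1 V(1)[OF tI] J_lbb[OF t] Y_facts(1)[OF t, of 1] l by auto
  have acV: "ac (V 0 t) (V 1 t)" using V(2)[OF tI n1(2)] by simp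
  have acw: "ac (V 0 t) (\<lambda>z. J t z * w 1 t z)" using w_facts(2)[OF t le0 n1(2)] w_facts(3)[OF t, of 0] by simp
  \<comment> \<open>The increment of V^2 is written with both derivatives of V 0: half of the
    endpoint terms cancels the convection term, the other half becomes the integral of V 0 V
    1.\<close>
  have "ac (\<lambda>z. V 0 t z * V 0 t z) (\<lambda>z. V 1 t z * V 0 t z + V 0 t z * V 1 t z)" by (rule ac_mult[OF acV acV lw(4)])
  from acD[OF this x0(2)] have i1: "V 0 t x * V 0 t x - V 0 t 0 * V 0 t 0 = 2 * integral {0..x} (\<lambda>z. V 0 t z * V 1 t z)"
    by (simp add: mult.commute flip: mult_2)
  have "ac (\<lambda>z. V 0 t z * V 0 t z) (\<lambda>z. J t z * w 1 t z * V 0 t z + V 0 t z * (J t z * w 1 t z))"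
    by (rule ac_mult[OF acw acw lbb_mult[OF lw(5,2)]])
  from acD[OF this x0(2)] have i2: "V 0 t x * V 0 t x - V 0 t 0 * V 0 t 0 = 2 * integral {0..x} (\<lambda>z. V 0 t z * (J t z * w 1 t z))"
    by (simp add: mult.commute flip: mult_2)
  have lUP: "lbb (\<lambda>y. U 0 t y * U 1 t y + P 1 t y)"
    using n1 l by (intro lbb_add lbb_mult U(1)[OF tI] P(1)[OF tI]) auto
  have "integral {?a..?b} (\<lambda>y. U 0 t y * U 1 t y + P 1 t y) = integral {0..x} (\<lambda>z. J t z * (U 0 t (xi t z) * U 1 t (xi t z) + P 1 t (xi t z)))"
    by (rule integral_xi[OF t x0(2) lUP])
  also have "(\<lambda>z. J t z * (U 0 t (xi t z) * U 1 t (xi t z) + P 1 t (xi t z))) = (\<lambda>z. V 0 t z * (J t z * w 1 t z) + Y 1 t z * J t z)"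
    using w_facts(3)[OF t, of 0] by (simp add: w_def[abs_def] Y_def[abs_def] fun_eq_iff algebra_simps)
  also have "integral {0..x} \<dots> = integral {0..x} (\<lambda>z. V 0 t z * (J t z * w 1 t z)) + integral {0..x} (\<lambda>z. Y 1 t z * J t z)"
    by (intro Henstock_Kurzweil_Integration.integral_add lbb_integrable lbb_mult lw)
  finally have i3: "integral {?a..?b} (\<lambda>y. U 0 t y * U 1 t y + P 1 t y) = integral {0..x} (\<lambda>z. V 0 t z * (J t z * w 1 t z)) + integral {0..x} (\<lambda>z. Y 1 t z * J t z)" .
  have i4: "integral {0..x} (\<lambda>z. V 0 t z * V 1 t z - Y 1 t z * J t z) = integral {0..x} (\<lambda>z. V 0 t z * V 1 t z) - integral {0..x} (\<lambda>z. Y 1 t z * J t z)"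
    by (intro Henstock_Kurzweil_Integration.integral_diff lbb_integrable lbb_mult lw)
  have UV: "U 0 t ?b = V 0 t x" "U 0 t ?a = V 0 t 0" using VU[OF tI] by (simp_all add: xi_def)
  have val: "- integral {?a..?b} (\<lambda>y. U 0 t y * U 1 t y + P 1 t y) + U 0 t ?b * V 0 t x - U 0 t ?a * V 0 t 0
     = integral {0..x} (\<lambda>z. V 0 t z * V 1 t z - Y 1 t z * J t z)"
    using i1 i2 unfolding i3 i4 UV by linarith
  show ?thesis using D unfolding val has_real_derivative_iff_has_vector_derivative
    by (rule has_vector_derivative_transform_within_open[OF _ I1(1) t]) (rule eq)
qed

text \<open>The change of variables gives access to the density V J only; it is differentiated
  first, and multiplication by K removes J. The terms containing V 1 then cancel.\<close>

lemma V0_derivative: assumes t: "t \<in> I1" shows "((\<lambda>s. rcls (V 0 s)) has_vector_derivative - rcls (Y 1 t)) (at t)"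
proof -
  let ?f = "\<lambda>s. rcls (V 0 s) * rcls (J s)"
  let ?Z = "\<lambda>s. rcls (V 0 s) * rcls (V 1 s) + - (rcls (Y 1 s) * rcls (J s))"
  have tY: "tm (\<lambda>t. rcls (Y 1 t))" by (rule jetD(2)[OF jet_Y1])
  \<comment> \<open>Tameness supplies the continuity of the candidate derivative that
    \<open>has_vector_derivative_if_pint\<close> requires.\<close>
  have cZ: "continuous_on I1 ?Z"
    by (rule tame_continuous) (intro tame_add tame_mult tame_uminus state_tame(2) tY tame_J le0 n1(1))
  have f: "(?f has_vector_derivative ?Z t) (at t)"
  proof (rule has_vector_derivative_if_pint[OF I1(1) t cZ])
    fix x s :: real assume x: "x \<in> {0..1}" and s: "s \<in> I1"
    have lw: "lbb (V 0 r)" "lbb (V 1 r)" "lbb (J r)" "lbb (Y 1 r)" if "r \<in> I1" for r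
      using n1 V(1)[OF inI[OF that]] J_lbb[OF that] Y_facts(1)[OF that, of 1] l by auto
    have of_real_int: "integral {0..x} (\<lambda>z. complex_of_real (g z)) = complex_of_real (integral {0..x} g)" if "lbb g" for g
      using integral_linear[OF lbb_integrable[OF that] bounded_linear_of_real] by (simp add: o_def)
    have e1: "pint x (?f r) = complex_of_real (integral {0..x} (\<lambda>z. V 0 r z * J r z))" if "r \<in> I1" for r
      unfolding rcls_simps(3)[OF lw(1,3)[OF that], symmetric]
      by (subst pint_cls[OF lbb_complex_of_real[OF lbb_mult[OF lw(1,3)[OF that]]] x]) (rule of_real_int[OF lbb_mult[OF lw(1,3)[OF that]]])
    have e2: "?Z s = rcls (\<lambda>z. V 0 s z * V 1 s z - Y 1 s z * J s z)"
      using rcls_simps(2)[OF lbb_mult[OF lw(1,2)[OF s]] lbb_mult[OF lw(4,3)[OF s]]]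
      unfolding rcls_simps(3)[OF lw(1,2)[OF s]] rcls_simps(3)[OF lw(4,3)[OF s]] by simp
    have lz: "lbb (\<lambda>z. V 0 s z * V 1 s z - Y 1 s z * J s z)" by (intro lbb_diff lbb_mult lw s)
    have e3: "pint x (?Z s) = complex_of_real (integral {0..x} (\<lambda>z. V 0 s z * V 1 s z - Y 1 s z * J s z))"
      unfolding e2 by (subst pint_cls[OF lbb_complex_of_real[OF lz] x]) (rule of_real_int[OF lz])
    have "((\<lambda>r. complex_of_real (integral {0..x} (\<lambda>z. V 0 r z * J r z))) has_vector_derivative pint x (?Z s)) (at s)"
      unfolding e3 using momentum_derivative[OF s x] unfolding has_real_derivative_iff_has_vector_derivative
      by (rule bounded_linear.has_vector_derivative[OF bounded_linear_of_real])
    then show "((\<lambda>r. pint x (?f r)) has_vector_derivative pint x (?Z s)) (at s)"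
      by (rule has_vector_derivative_transform_within_open[OF _ I1(1) s]) (rule e1[symmetric])
  qed
  have fK: "?f s * rcls (K s) = rcls (V 0 s)" if "s \<in> I1" for s
    using rcls_JK[OF that] by (simp add: mult.assoc)
  have "((\<lambda>s. ?f s * rcls (K s)) has_vector_derivative ?f t * (- (rcls (K t) * rcls (K t)) * rcls (V 1 t)) + ?Z t * rcls (K t)) (at t)"
    by (rule has_vector_derivative_mult[OF f K_derivative[OF t]])
  also have "?f t * (- (rcls (K t) * rcls (K t)) * rcls (V 1 t)) + ?Z t * rcls (K t) = - rcls (Y 1 t)"
  proof -
    have "(v * j) * (- (k * k) * v1) + (v * v1 + - (y * j)) * k = - y" if "j * k = 1" for v j k v1 y :: linf
    proof -
      have "(v * j) * (- (k * k) * v1) + (v * v1 + - (y * j)) * k = - (v * v1 * k * (j * k)) + v * v1 * k - y * (j * k)"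
        by (simp add: algebra_simps)
      then show ?thesis using that by simp
    qed
    from this[OF rcls_JK[OF t]] show ?thesis .
  qed
  finally have "((\<lambda>s. ?f s * rcls (K s)) has_vector_derivative - rcls (Y 1 t)) (at t)" .
  then show ?thesis by (rule has_vector_derivative_transform_within_open[OF _ I1(1) t]) (rule fK)
qed

text \<open>The equation for \<open>V 0\<close> is passed to its space derivatives one after the
  other; the right-hand sides are the tame space derivatives of \<open>- Y 1\<close>.\<close>

lemma V_derivative:
  obtains Z where "\<And>i. i \<le> n \<Longrightarrow> tm (Z i)" "\<And>i t. i \<le> n \<Longrightarrow> t \<in> I1 \<Longrightarrow> ((\<lambda>s. rcls (V i s)) has_vector_derivative Z i t) (at t)"
    "\<And>t. Z 0 t = - rcls (Y 1 t)"
proof -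
  obtain F where F: "\<And>t x. F 0 t x = complex_of_real (Y 1 t x)" "\<And>i t. i < n \<Longrightarrow> t \<in> I1 \<Longrightarrow> ac (F i t) (F (Suc i) t)"
    "\<And>i t. i \<le> n \<Longrightarrow> t \<in> I1 \<Longrightarrow> lbb (F i t)" "\<And>i. i \<le> n \<Longrightarrow> tm (\<lambda>t. cls (F i t))"
    using jet_sequence[OF jet_Y1] by metis
  define Z where "Z i t = - cls (F i t)" for i t
  have tZ: "tm (Z i)" if "i \<le> n" for i unfolding Z_def[abs_def] by (rule tame_uminus[OF F(4)[OF that]])
  have Z0: "Z 0 t = - rcls (Y 1 t)" for t unfolding Z_def F(1)[abs_def] ..
  have "((\<lambda>s. rcls (V i s)) has_vector_derivative Z i t) (at t)" if "i \<le> n" "t \<in> I1" for i t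
    using that
  proof (induction i arbitrary: t)
    case 0 show ?case unfolding Z0 by (rule V0_derivative[OF 0(2)])
  next
    case (Suc i)
    have i: "i < n" "i \<le> n" using Suc.prems by auto
    show ?case
    proof (rule has_vector_derivative_primitive[OF I1(1) Suc.prems(2) tame_continuous[OF tZ[OF Suc.prems(1)]]])
      fix s assume s: "s \<in> I1"
      show "((\<lambda>s. rcls (V i s)) has_vector_derivative Z i s) (at s)" by (rule Suc.IH[OF i(2) s])
      show "rcls (V i s) = cL (complex_of_real (V i s 0)) + I0 (rcls (V (Suc i) s))"
        by (rule cls_ac[OF ac_complex_of_real[OF V(2)[OF inI[OF s] i(1)]] lbb_complex_of_real[OF V(1)[OF inI[OF s] Suc.prems(1)]]])
      have "cls (F i s) = cL (F i s 0) + I0 (cls (F (Suc i) s))" by (rule cls_ac[OF F(2)[OF i(1) s] F(3)[OF Suc.prems(1) s]])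
      then show "Z i s = cL (- F i s 0) + I0 (Z (Suc i) s)"
        unfolding Z_def linear_neg[OF bounded_linear.linear[OF bounded_linear_cL]] linear_neg[OF bounded_linear.linear[OF bounded_linear_I0]] by simp
    qed
  qed
  with tZ Z0 show thesis by (intro that[of Z])
qed

lemma local_analytic: "\<exists>R>0. \<forall>N. \<forall>j\<le>n. curve_bounded I1 N C R (\<lambda>t. rcls (X j t))"
proof -
  obtain Z where Z: "\<And>i. i \<le> n \<Longrightarrow> tm (Z i)" "\<And>i t. i \<le> n \<Longrightarrow> t \<in> I1 \<Longrightarrow> ((\<lambda>s. rcls (V i s)) has_vector_derivative Z i t) (at t)"
    using V_derivative by metis
  have fin: "finite states" unfolding states_def using symb_factorization(1) by simp
  have ex: "\<exists>F'. tm F' \<and> (\<forall>t\<in>I1. (F has_vector_derivative F' t) (at t))" if F: "F \<in> states" for F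
  proof -
    from F consider j where "j \<le> n" "F = (\<lambda>t. rcls (X j t))" | j where "j \<le> n" "F = (\<lambda>t. rcls (V j t))"
      | "F = (\<lambda>t. rcls (K t))" | \<rho> where "\<rho> \<in> symb_roots l" "F = (\<lambda>t. cls (Ex \<rho> t))"
      unfolding states_def by blast
    then show ?thesis
    proof cases
      case (1 j) then show ?thesis using XV inI state_tame(2)[OF 1(1)] by blast
    next
      case (2 j) then show ?thesis using Z by blast
    next
      case 3
      have "tm (\<lambda>t. - (rcls (K t) * rcls (K t)) * rcls (V 1 t))"
        by (intro tame_mult tame_uminus state_tame n1(1))
      then show ?thesis using K_derivative 3 by blast
    next
      case (4 \<rho>)
      have "tm (\<lambda>t. cL \<rho> * rcls (V 0 t) * cls (Ex \<rho> t))"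
        by (intro tame_mult tame_const state_tame le0 4(1))
      then show ?thesis using Ex_derivative[OF _ 4(1)] 4(2) by blast
    qed
  qed
  then obtain F' where F': "\<And>F. F \<in> states \<Longrightarrow> tm (F' F)" "\<And>F t. F \<in> states \<Longrightarrow> t \<in> I1 \<Longrightarrow> (F has_vector_derivative F' F t) (at t)"
    by metis
  have "\<exists>R>0. \<forall>N. \<forall>F\<in>states. curve_bounded I1 N C R F"
    by (rule autonomous_curve_bounded[where X' = F' and I = I1 and S = states and C = C, OF fin C_pos(1) I1(1)])
       (use states_bounded F' in auto)
  then obtain R where R: "R > 0" "\<And>N F. F \<in> states \<Longrightarrow> curve_bounded I1 N C R F" by blast
  have "(\<lambda>t. rcls (X j t)) \<in> states" if "j \<le> n" for j using that by (auto simp: states_def)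
  with R show ?thesis by blast
qed

end

section \<open>The flow stays bi-Lipschitz\<close>

lemma islimpt_eventually:
  assumes "t islimpt S" "\<forall>\<^sub>F s in at t. P s" shows "\<exists>s\<in>S. P s"
  using assms unfolding islimpt_def eventually_at_topological by (meson UNIV_I)

lemma rcls_diff_ae: "lbb f \<Longrightarrow> lbb g \<Longrightarrow> ae01 (\<lambda>x. \<bar>f x - g x\<bar> \<le> norm (rcls f - rcls g))"
  using norm_rcls_ae[OF lbb_diff, of f g] rcls_simps(2)[of f g] by simp

lemma integral_nonneg_ae01:
  fixes f :: "real \<Rightarrow> real"
  assumes "ae01 (\<lambda>x. 0 \<le> f x)" "0 \<le> a" "b \<le> 1" shows "0 \<le> integral {a..b} f"
proof -
  have "integral {a..b} f = integral {a..b} (\<lambda>x. \<bar>f x\<bar>)"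
    by (rule ae01_integral_eq[OF ae01_mono[OF assms(1)] assms(2,3)]) simp
  also have "\<dots> \<ge> 0"
    by (cases "(\<lambda>x. \<bar>f x\<bar>) integrable_on {a..b}")
       (auto simp: not_integrable_integral intro: Henstock_Kurzweil_Integration.integral_nonneg)
  finally show ?thesis .
qed

text \<open>The hypothesis makes exp (L r) p r nondecreasing and exp (- L r) p r nonincreasing; the
  sign of t - s decides which of the two is used.\<close>

lemma scalar_gronwall:
  fixes p p' :: "real \<Rightarrow> real"
  assumes S: "is_interval S" "s \<in> S" "t \<in> S"
    and d: "\<And>r. r \<in> S \<Longrightarrow> (p has_real_derivative p' r) (at r)" and b: "\<And>r. r \<in> S \<Longrightarrow> \<bar>p' r\<bar> \<le> L * p r"
  shows "exp (- (L * \<bar>t - s\<bar>)) * p s \<le> p t"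
proof -
  have S': "r \<in> S" if "s \<le> r \<and> r \<le> t \<or> t \<le> r \<and> r \<le> s" for r
    using S that unfolding is_interval_1 by blast
  have D: "((\<lambda>r. exp (k * r) * p r) has_real_derivative exp (k * r) * (k * p r + p' r)) (at r)" if "r \<in> S" for r k
  proof -
    have "((\<lambda>r. exp (k * r)) has_real_derivative exp (k * r) * k) (at r)" by (auto intro!: derivative_eq_intros)
    from DERIV_mult[OF this d[OF that]] show ?thesis by (simp add: algebra_simps)
  qed
  show ?thesis
  proof (cases "s \<le> t")
    case True
    have "exp (L * s) * p s \<le> exp (L * t) * p t"
    proof (rule DERIV_nonneg_imp_nondecreasing[OF True])
      fix r assume "s \<le> r" "r \<le> t"
      then have r: "r \<in> S" using S' by blast
      have "0 \<le> L * p r + p' r" using b[OF r] by linarith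
      then show "\<exists>y. ((\<lambda>r. exp (L * r) * p r) has_real_derivative y) (at r) \<and> 0 \<le> y"
        by (intro exI[of _ "exp (L * r) * (L * p r + p' r)"] conjI D[OF r] mult_nonneg_nonneg) simp_all
    qed
    then have "exp (- (L * t)) * (exp (L * s) * p s) \<le> exp (- (L * t)) * (exp (L * t) * p t)" by (intro mult_left_mono) simp_all
    then have "exp (- (L * t) + L * s) * p s \<le> exp (- (L * t) + L * t) * p t" unfolding exp_add by (simp only: mult.assoc)
    moreover have "- (L * \<bar>t - s\<bar>) = - (L * t) + L * s" using True by (simp add: algebra_simps)
    ultimately show ?thesis by simp
  next
    case False
    have "- (exp (- L * t) * p t) \<le> - (exp (- L * s) * p s)"
    proof (rule DERIV_nonneg_imp_nondecreasing[of t s "\<lambda>r. - (exp (- L * r) * p r)"])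
      show "t \<le> s" using False by simp
      fix r assume "t \<le> r" "r \<le> s"
      then have r: "r \<in> S" using S' by blast
      have "0 \<le> - (- L * p r + p' r)" using b[OF r] by simp
      then have "0 \<le> exp (- L * r) * (- (- L * p r + p' r))" by (intro mult_nonneg_nonneg) simp_all
      then have "0 \<le> - (exp (- L * r) * (- L * p r + p' r))" by (simp only: mult_minus_right)
      then show "\<exists>y. ((\<lambda>r. - (exp (- L * r) * p r)) has_real_derivative y) (at r) \<and> 0 \<le> y"
        using DERIV_minus[OF D[OF r, of "- L"]] by blast
    qed
    then have "exp (L * t) * (exp (- L * s) * p s) \<le> exp (L * t) * (exp (- L * t) * p t)" by (intro mult_left_mono) simp_all
    then have "exp (L * t + - L * s) * p s \<le> exp (L * t + - L * t) * p t" unfolding exp_add by (simp only: mult.assoc)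
    moreover have "- (L * \<bar>t - s\<bar>) = L * t + - L * s" using False by (simp add: algebra_simps)
    ultimately show ?thesis by simp
  qed
qed

text \<open>The integrals over each interval [x, y] satisfy the scalar inequality with the same
  constant, and nonnegativity of all these integrals gives the inequality almost everywhere.\<close>

lemma gronwall_ae:
  fixes G H :: "real \<Rightarrow> real \<Rightarrow> real"
  assumes S: "is_interval S" "s \<in> S" "t \<in> S" and l: "\<And>r. r \<in> S \<Longrightarrow> lbb (G r)" "\<And>r. r \<in> S \<Longrightarrow> lbb (H r)"
    and d: "\<And>r. r \<in> S \<Longrightarrow> ((\<lambda>r. rcls (G r)) has_vector_derivative rcls (H r)) (at r)"
    and b: "\<And>r. r \<in> S \<Longrightarrow> ae01 (\<lambda>x. \<bar>H r x\<bar> \<le> L * G r x)" and S0: "open S"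
  shows "ae01 (\<lambda>x. exp (- (L * \<bar>t - s\<bar>)) * G s x \<le> G t x)"
proof -
  let ?e = "exp (- (L * \<bar>t - s\<bar>))"
  have "ae01 (\<lambda>x. 0 \<le> G t x - ?e * G s x)"
  proof (rule ae01_nonneg_if_integrals)
    show "lbb (\<lambda>x. G t x - ?e * G s x)" by (intro lbb_diff lbb_mult[OF lbb_const] l S)
    fix x y :: real assume xy: "0 \<le> x" "x \<le> y" "y \<le> 1"
    let ?A = "\<lambda>F. Re (pint y F - pint x F)"
    have e: "?A (rcls f) = integral {x..y} f" if "lbb f" for f
    proof -
      have "integral {x..y} (\<lambda>z. complex_of_real (f z)) = complex_of_real (integral {x..y} f)"
        using integral_linear[OF lbb_integrable[OF that] bounded_linear_of_real] by (simp add: o_def)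
      then show ?thesis using pint_diff_cls[OF lbb_complex_of_real[OF that] xy] by simp
    qed
    have bl: "bounded_linear ?A"
      by (rule bounded_linear_compose[OF bounded_linear_Re bounded_linear_sub[OF bounded_linear_pint bounded_linear_pint]])
    have "?e * integral {x..y} (G s) \<le> integral {x..y} (G t)"
    proof (rule scalar_gronwall[OF S, where p' = "\<lambda>r. integral {x..y} (H r)"])
      fix r assume r: "r \<in> S"
      have "((\<lambda>r. ?A (rcls (G r))) has_vector_derivative ?A (rcls (H r))) (at r)"
        by (rule bounded_linear.has_vector_derivative[OF bl d[OF r]])
      then have "((\<lambda>r. ?A (rcls (G r))) has_vector_derivative integral {x..y} (H r)) (at r)" unfolding e[OF l(2)[OF r]] .
      then have "((\<lambda>r. integral {x..y} (G r)) has_vector_derivative integral {x..y} (H r)) (at r)"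
        by (rule has_vector_derivative_transform_within_open[OF _ S0 r]) (rule e[OF l(1)])
      then show "((\<lambda>r. integral {x..y} (G r)) has_real_derivative integral {x..y} (H r)) (at r)"
        unfolding has_real_derivative_iff_has_vector_derivative .
      have iG: "(\<lambda>z. L * G r z) integrable_on {x..y}" and iH: "H r integrable_on {x..y}"
        by (intro lbb_integrable lbb_mult[OF lbb_const] l r)+
      have "0 \<le> integral {x..y} (\<lambda>z. L * G r z - H r z)" "0 \<le> integral {x..y} (\<lambda>z. L * G r z + H r z)"
        by (rule integral_nonneg_ae01[OF ae01_mono[OF b[OF r]] xy(1,3)]; linarith)+
      then show "\<bar>integral {x..y} (H r)\<bar> \<le> L * integral {x..y} (G r)"
        unfolding Henstock_Kurzweil_Integration.integral_diff[OF iG iH] Henstock_Kurzweil_Integration.integral_add[OF iG iH] by simp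
    qed
    moreover have "integral {x..y} (\<lambda>z. G t z - ?e * G s z) = integral {x..y} (G t) - ?e * integral {x..y} (G s)"
      by (subst Henstock_Kurzweil_Integration.integral_diff) (auto intro!: lbb_integrable lbb_mult[OF lbb_const] l S)
    ultimately show "0 \<le> integral {x..y} (\<lambda>z. G t z - ?e * G s z)" by simp
  qed
  then show ?thesis by (rule ae01_mono) simp
qed

text \<open>The point of I outside S that is nearest to t0 on one side would be an endpoint of an
  open interval contained in S. Openness of S makes such a nearest point exist.\<close>

lemma interval_exhaustion:
  fixes S I :: "real set"
  assumes o: "open S" and I: "is_interval I" and S: "S \<subseteq> I" "t0 \<in> S"
    and e: "\<And>a b t. a < b \<Longrightarrow> {a<..<b} \<subseteq> S \<Longrightarrow> t = a \<or> t = b \<Longrightarrow> t \<in> I \<Longrightarrow> t \<in> S"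
  shows "S = I"
proof (rule ccontr)
  assume "S \<noteq> I"
  then obtain t where t: "t \<in> I" "t \<notin> S" using S by blast
  show False
  proof (cases "t0 \<le> t")
    case True
    let ?K = "{t0..t} - S"
    have "t \<in> ?K" using True t by simp
    then have K: "closed ?K" "?K \<noteq> {}" "bdd_below ?K" using o by (auto intro: closed_Diff bdd_belowI[of _ t0])
    have "Inf ?K \<in> ?K" by (rule closed_contains_Inf[OF K(2,3,1)])
    moreover have "{t0<..<Inf ?K} \<subseteq> S"
    proof
      fix r assume r: "r \<in> {t0<..<Inf ?K}"
      then have "r \<notin> ?K" using cInf_lower[OF _ K(3), of r] by force
      then show "r \<in> S" using r calculation by auto
    qed
    moreover have "t0 < Inf ?K" "Inf ?K \<in> I" using calculation(1) S(2) t(1) I S(1) unfolding is_interval_1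
      by (metis DiffD2 DiffD1 atLeastAtMost_iff order_le_less, metis DiffD1 atLeastAtMost_iff subsetD)
    ultimately show False using e[of t0 "Inf ?K" "Inf ?K"] by blast
  next
    case False
    let ?K = "{t..t0} - S"
    have "t \<in> ?K" using False t by simp
    then have K: "closed ?K" "?K \<noteq> {}" "bdd_above ?K" using o by (auto intro: closed_Diff bdd_aboveI[of _ t0])
    have "Sup ?K \<in> ?K" by (rule closed_contains_Sup[OF K(2,3,1)])
    moreover have "{Sup ?K<..<t0} \<subseteq> S"
    proof
      fix r assume r: "r \<in> {Sup ?K<..<t0}"
      then have "r \<notin> ?K" using cSup_upper[OF _ K(3), of r] by force
      then show "r \<in> S" using r calculation by auto
    qed
    moreover have "Sup ?K < t0" "Sup ?K \<in> I" using calculation(1) S(2) t(1) I S(1) unfolding is_interval_1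
      by (metis DiffD2 DiffD1 atLeastAtMost_iff order_le_less, metis DiffD1 atLeastAtMost_iff subsetD)
    ultimately show False using e[of "Sup ?K" t0 "Sup ?K"] by blast
  qed
qed

section \<open>Times at which the Jacobian is bounded below\<close>

context lagrangian
begin

abbreviation jac :: "real \<Rightarrow> real \<Rightarrow> real" where "jac t x \<equiv> 1 + X 1 t x"

lemma jac_lbb: "t \<in> I \<Longrightarrow> lbb (\<lambda>x. jac t x)"
  using n1 by (intro lbb_add lbb_const X)

lemma rcls_jac: "t \<in> I \<Longrightarrow> rcls (\<lambda>x. jac t x) = 1 + rcls (X 1 t)"
  using rcls_simps(1)[OF lbb_const[of 1] X(1)[of t 1]] cls_simps(2) n1 by simp

lemma jac_derivative: assumes "t \<in> I" shows "((\<lambda>s. rcls (\<lambda>x. jac s x)) has_vector_derivative rcls (V 1 t)) (at t)"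
proof (rule has_vector_derivative_transform_within_open[OF _ I assms])
  show "((\<lambda>s. 1 + rcls (X 1 s)) has_vector_derivative rcls (V 1 t)) (at t)"
    using has_vector_derivative_add[OF has_vector_derivative_const XV[OF assms n1(1)]] by simp
qed (simp only: rcls_jac)

lemma coordinate_near:
  assumes "t \<in> I" "j \<le> n" "e > 0" shows "\<forall>\<^sub>F s in at t. s \<in> I \<and> ae01 (\<lambda>x. \<bar>X j s x - X j t x\<bar> \<le> e)"
proof -
  have "isCont (\<lambda>t. rcls (X j t)) t" using X_continuous[OF assms(2)] I assms(1) by (simp add: continuous_on_eq_continuous_at)
  then have "\<forall>\<^sub>F s in at t. dist (rcls (X j s)) (rcls (X j t)) < e"
    unfolding isCont_def by (rule tendstoD) fact
  then show ?thesis using eventually_at_in_open'[OF I assms(1)]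
  proof eventually_elim
    case (elim s)
    have "ae01 (\<lambda>x. \<bar>X j s x - X j t x\<bar> \<le> norm (rcls (X j s) - rcls (X j t)))"
      by (rule rcls_diff_ae) (use X elim assms in auto)
    then have "ae01 (\<lambda>x. \<bar>X j s x - X j t x\<bar> \<le> e)" by (rule ae01_mono) (use elim(1) in \<open>simp add: dist_norm\<close>)
    then show ?case using elim by blast
  qed
qed

text \<open>The Jacobian is continuous in time in the essential norm, so the bound passes to t up to
  1/(k+1) for every k, and countably many null sets are discarded.\<close>

lemma jac_limit:
  assumes t: "t \<in> I" "t islimpt S" and S: "\<forall>\<^sub>F s in at t. s \<in> S \<longrightarrow> ae01 (\<lambda>x. \<delta> \<le> jac s x)"
  shows "ae01 (\<lambda>x. \<delta> \<le> jac t x)"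
proof -
  have "ae01 (\<lambda>x. \<delta> - inverse (real (Suc k)) \<le> jac t x)" for k
  proof -
    have "\<forall>\<^sub>F s in at t. (s \<in> S \<longrightarrow> ae01 (\<lambda>x. \<delta> \<le> jac s x)) \<and> s \<in> I \<and> ae01 (\<lambda>x. \<bar>X 1 s x - X 1 t x\<bar> \<le> inverse (real (Suc k)))"
      by (rule eventually_conj[OF S coordinate_near[OF t(1) n1(1)]]) simp
    from islimpt_eventually[OF t(2) this] obtain s where "ae01 (\<lambda>x. \<delta> \<le> jac s x)"
      "ae01 (\<lambda>x. \<bar>X 1 s x - X 1 t x\<bar> \<le> inverse (real (Suc k)))" by blast
    then show ?thesis by (rule ae01_mp2) linarith
  qed
  then have "ae01 (\<lambda>x. \<forall>k. \<delta> - inverse (real (Suc k)) \<le> jac t x)" by (rule ae01_all_nat)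
  then show ?thesis
  proof (rule ae01_mono)
    fix x assume *: "\<forall>k. \<delta> - inverse (real (Suc k)) \<le> jac t x"
    show "\<delta> \<le> jac t x"
    proof (rule ccontr)
      assume "\<not> \<delta> \<le> jac t x"
      then obtain k where "inverse (real (Suc k)) < \<delta> - jac t x" using reals_Archimedean[of "\<delta> - jac t x"] by auto
      then show False using spec[OF *, of k] by linarith
    qed
  qed
qed

lemma V1_le:
  assumes t: "t \<in> I" and J0: "ae01 (\<lambda>x. 0 \<le> jac t x)" and L: "\<And>y. \<bar>U 1 t y\<bar> \<le> L"
  shows "ae01 (\<lambda>x. \<bar>V 1 t x\<bar> \<le> L * jac t x)"
proof -
  have lV: "lbb (V 1 t)" using V(1)[OF t n1(1)] .
  have acV: "ac (V 0 t) (V 1 t)" using V(2)[OF t n1(2)] by simp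
  have acU: "ac (U 0 t) (U 1 t)" using U(3)[OF t n1(2)] by simp
  have *: "ae01 (\<lambda>x. 0 \<le> L * jac t x + k * V 1 t x)" if k: "\<bar>k\<bar> = 1" for k
  proof (rule ae01_nonneg_if_integrals)
    show "lbb (\<lambda>x. L * jac t x + k * V 1 t x)" by (intro lbb_add lbb_mult[OF lbb_const] jac_lbb[OF t] lV)
    fix x y :: real assume xy: "0 \<le> x" "x \<le> y" "y \<le> 1"
    have i: "integral {x..y} (\<lambda>x. jac t x) = xi t y - xi t x" using acD[OF xi_ac[OF t] xy(2)] by simp
    have "0 \<le> xi t y - xi t x" unfolding i[symmetric] by (rule integral_nonneg_ae01[OF J0 xy(1,3)])
    moreover have "\<bar>U 0 t (xi t y) - U 0 t (xi t x)\<bar> \<le> L * \<bar>xi t y - xi t x\<bar>" by (rule ac_increment_bound[OF acU L])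
    moreover have "integral {x..y} (V 1 t) = U 0 t (xi t y) - U 0 t (xi t x)"
      using acD[OF acV xy(2)] VU[OF t] by (simp add: xi_def)
    moreover have "integral {x..y} (\<lambda>x. L * jac t x + k * V 1 t x) = L * integral {x..y} (\<lambda>x. jac t x) + k * integral {x..y} (V 1 t)"
      by (simp only: Henstock_Kurzweil_Integration.integral_add[OF lbb_integrable[OF lbb_mult[OF lbb_const jac_lbb[OF t]]] lbb_integrable[OF lbb_mult[OF lbb_const lV]]]
        Henstock_Kurzweil_Integration.integral_mult_right)
    moreover have "- \<bar>z\<bar> \<le> k * z" for z using k abs_mult[of k z] by (metis mult_1 abs_ge_minus_self minus_le_iff)
    ultimately show "0 \<le> integral {x..y} (\<lambda>x. L * jac t x + k * V 1 t x)"
      unfolding i by (smt (verit))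
  qed
  show ?thesis by (rule ae01_mp2[OF *[of 1] *[of "-1"]]) (simp_all add: abs_le_iff)
qed

text \<open>The times at which the flow is bi-Lipschitz; \<open>good_eq\<close> shows that this set
  is all of I.\<close>

definition good :: "real set" where "good = {t\<in>I. \<exists>\<delta>>0. ae01 (\<lambda>x. \<delta> \<le> jac t x)}"

lemma good_near:
  assumes "t \<in> good" obtains \<delta> G where "\<delta> > 0" "open G" "t \<in> G" "\<And>s. s \<in> G \<Longrightarrow> s \<in> I \<and> ae01 (\<lambda>x. \<delta> \<le> jac s x)"
proof -
  from assms obtain \<delta> where \<delta>: "\<delta> > 0" "t \<in> I" "ae01 (\<lambda>x. \<delta> \<le> jac t x)" unfolding good_def by blast
  have "\<forall>\<^sub>F s in at t. s \<in> I \<and> ae01 (\<lambda>x. \<delta> / 2 \<le> jac s x)"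
    using coordinate_near[OF \<delta>(2) n1(1) half_gt_zero[OF \<delta>(1)]]
  proof eventually_elim
    case (elim s)
    then have *: "s \<in> I" "ae01 (\<lambda>x. \<bar>X 1 s x - X 1 t x\<bar> \<le> \<delta> / 2)" by blast+
    from *(2) \<delta>(3) have "ae01 (\<lambda>x. \<delta> / 2 \<le> jac s x)" by (rule ae01_mp2) linarith
    then show ?case using * by blast
  qed
  moreover have "ae01 (\<lambda>x. \<delta> / 2 \<le> jac t x)" by (rule ae01_mono[OF \<delta>(3)]) (use \<delta>(1) in simp)
  then have tt: "t \<in> I \<and> ae01 (\<lambda>x. \<delta> / 2 \<le> jac t x)" using \<delta>(2) by blast
  ultimately obtain G where G: "open G" "t \<in> G" "\<forall>s\<in>G. s \<noteq> t \<longrightarrow> s \<in> I \<and> ae01 (\<lambda>x. \<delta> / 2 \<le> jac s x)"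
    unfolding eventually_at_topological by blast
  show thesis
  proof (rule that[OF half_gt_zero[OF \<delta>(1)] G(1,2)])
    fix s assume "s \<in> G"
    then show "s \<in> I \<and> ae01 (\<lambda>x. \<delta> / 2 \<le> jac s x)" using G(3) tt by (cases "s = t") blast+
  qed
qed

lemma open_good: "open good"
proof (subst open_subopen, intro ballI)
  fix t assume "t \<in> good"
  from good_near[OF this] obtain \<delta> G where "\<delta> > 0" "open G" "t \<in> G" "\<And>s. s \<in> G \<Longrightarrow> s \<in> I \<and> ae01 (\<lambda>x. \<delta> \<le> jac s x)" by metis
  then show "\<exists>G. open G \<and> t \<in> G \<and> G \<subseteq> good" unfolding good_def by blast
qed

text \<open>Compactness makes the lower bounds near single times and the norms of the unknowns
  uniform on the interval.\<close>

lemma exists_lag_local: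
  assumes "{p..q} \<subseteq> good" shows "\<exists>d B. lag_local l n c I X V U P {p<..<q} d B"
proof -
  have "\<exists>\<delta> G. \<delta> > 0 \<and> open G \<and> t \<in> G \<and> (\<forall>s\<in>G. s \<in> I \<and> ae01 (\<lambda>x. \<delta> \<le> jac s x))" if "t \<in> {p..q}" for t
    using good_near[of t] assms that by (metis subsetD)
  then obtain \<delta> G where G: "\<And>t. t \<in> {p..q} \<Longrightarrow> \<delta> t > 0 \<and> open (G t) \<and> t \<in> G t \<and> (\<forall>s\<in>G t. s \<in> I \<and> ae01 (\<lambda>x. \<delta> t \<le> jac s x))"
    by metis
  obtain D where D: "D \<subseteq> {p..q}" "finite D" "{p..q} \<subseteq> (\<Union>t\<in>D. G t)"
    by (rule compactE_image[of "{p..q}" "{p..q}" G]) (use G in auto)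
  \<comment> \<open>The element 1 keeps the minimum meaningful when the interval, and with it the
    finite cover, is empty.\<close>
  define d where "d = Min (insert 1 (\<delta> ` D))"
  have d0: "d > 0" unfolding d_def using D G by (subst Min_gr_iff) auto
  have dJ: "ae01 (\<lambda>x. d \<le> jac s x)" if "s \<in> {p..q}" for s
  proof -
    from that D(3) obtain t where t: "t \<in> D" "s \<in> G t" by blast
    have "d \<le> \<delta> t" unfolding d_def using D(2) t(1) by (intro Min_le) auto
    moreover have j: "ae01 (\<lambda>x. \<delta> t \<le> jac s x)" using G[of t] t D(1) by blast
    ultimately show ?thesis by (intro ae01_mono[OF j]) linarith
  qed
  have sub: "{p..q} \<subseteq> I" using assms unfolding good_def by blast
  have "\<exists>B. \<forall>t\<in>{p..q}. norm (f t) \<le> B" if "continuous_on I f" for f :: "real \<Rightarrow> linf"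
  proof -
    have "bounded (f ` {p..q})"
      by (rule compact_imp_bounded[OF compact_continuous_image[OF continuous_on_subset[OF that sub] compact_Icc]])
    then show ?thesis unfolding bounded_iff by blast
  qed
  then have "\<exists>B. j \<le> n \<longrightarrow> (\<forall>t\<in>{p..q}. norm (rcls (X j t)) \<le> B)" "\<exists>B. j \<le> n \<longrightarrow> (\<forall>t\<in>{p..q}. norm (rcls (V j t)) \<le> B)" for j
    using X_continuous[of j] Vc[of j] by blast+
  then obtain Bx Bv where Bx: "\<And>j t. j \<le> n \<Longrightarrow> t \<in> {p..q} \<Longrightarrow> norm (rcls (X j t)) \<le> Bx j"
    and Bv: "\<And>j t. j \<le> n \<Longrightarrow> t \<in> {p..q} \<Longrightarrow> norm (rcls (V j t)) \<le> Bv j" by metis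
  define B where "B = (\<Sum>j\<le>n. \<bar>Bx j\<bar> + \<bar>Bv j\<bar>)"
  have B: "\<bar>Bx j\<bar> + \<bar>Bv j\<bar> \<le> B" if "j \<le> n" for j
    unfolding B_def using that by (intro member_le_sum[of j _ "\<lambda>j. \<bar>Bx j\<bar> + \<bar>Bv j\<bar>"]) auto
  have "lag_local l n c I X V U P {p<..<q} d B"
  proof (unfold_locales)
    fix t j assume t: "t \<in> {p<..<q}" and j: "j \<le> n"
    then have t': "t \<in> {p..q}" by simp
    show "norm (rcls (X j t)) \<le> B \<and> norm (rcls (V j t)) \<le> B"
      using Bx[OF j t'] Bv[OF j t'] B[OF j] by linarith
  qed (use d0 dJ sub in auto)
  then show ?thesis by blast
qed

end

section \<open>The modified energy in the case l = 1\<close>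

context lag_local
begin

lemma V1_eq: assumes t: "t \<in> I1" shows "ae01 (\<lambda>x. V 1 t x = J t x * w 1 t x)"
proof -
  have lw: "lbb (\<lambda>x. J t x * w 1 t x)" by (rule lbb_mult[OF J_lbb[OF t] w_facts(1)[OF t n1(1)]])
  have a1: "ac (V 0 t) (V 1 t)" using V(2)[OF inI[OF t] n1(2)] by simp
  have a2: "ac (w 0 t) (\<lambda>x. J t x * w 1 t x)" using w_facts(2)[OF t le0 n1(2)] by simp
  have "ae01 (\<lambda>x. complex_of_real (V 1 t x) = complex_of_real (J t x * w 1 t x))"
    by (rule ac_ae_unique[OF ac_complex_of_real[OF a1] ac_complex_of_real[OF a2] lbb_complex_of_real[OF V(1)[OF inI[OF t] n1(1)]] lbb_complex_of_real[OF lw]])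
       (simp add: w_facts(3)[OF t le0] ae01_always)
  then show ?thesis by (rule ae01_mono) (simp only: of_real_eq_iff)
qed

text \<open>In the time derivative of E the pressure equation replaces \<open>Y 2\<close>; with the
  coefficient 1/4 the terms quadratic in \<open>w 1\<close> cancel, and \<open>H\<close> is what
  remains, a bounded factor times \<open>V 1\<close>.\<close>

definition E :: "real \<Rightarrow> real \<Rightarrow> real" where "E t x = J t x + 1 / 4 * (V 1 t x * V 1 t x * K t x)"
definition H :: "real \<Rightarrow> real \<Rightarrow> real" where "H t x = V 1 t x * (1 - 1 / 2 * (Y 0 t x - V 0 t x * V 0 t x))"

lemma EH_lbb: assumes t: "t \<in> I1" shows "lbb (E t)" "lbb (H t)"
  unfolding E_def[abs_def] H_def[abs_def]
  by (intro lbb_add lbb_diff lbb_mult lbb_const J_lbb K_lbb V(1) Y_facts(1) inI[OF t] t le0 n1(1))+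

text \<open>Unlike \<open>V_derivative\<close>, this identifies the time derivative of
  \<open>V 1\<close>, which the energy identity needs in terms of the pressure.\<close>

lemma V1_derivative:
  assumes l1: "l = 1" and t: "t \<in> I1"
  shows "((\<lambda>s. rcls (V 1 s)) has_vector_derivative - (rcls (J t) * rcls (Y 2 t))) (at t)"
proof (rule has_vector_derivative_primitive[where ?v0.0 = "\<lambda>s. rcls (V 0 s)" and ?z0.0 = "\<lambda>s. - rcls (Y 1 s)" and ?z1.0 = "\<lambda>s. - (rcls (J s) * rcls (Y 2 s))"
      and c = "\<lambda>s. complex_of_real (V 0 s 0)" and d = "\<lambda>s. - complex_of_real (Y 1 s 0)", OF I1(1) t])
  show "continuous_on I1 (\<lambda>s. - (rcls (J s) * rcls (Y 2 s)))"
    using tame_continuous[OF tame_uminus[OF tame_mult[OF tame_J tame_Y_top]]] l1 by simp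
  fix s assume s: "s \<in> I1"
  show "((\<lambda>s. rcls (V 0 s)) has_vector_derivative - rcls (Y 1 s)) (at s)" by (rule V0_derivative[OF s])
  have a1: "ac (V 0 s) (V 1 s)" using V(2)[OF inI[OF s] n1(2)] by simp
  show "rcls (V 0 s) = cL (complex_of_real (V 0 s 0)) + I0 (rcls (V 1 s))"
    by (rule cls_ac[OF ac_complex_of_real[OF a1] lbb_complex_of_real[OF V(1)[OF inI[OF s] n1(1)]]])
  have lY: "lbb (Y 2 s)" using Y_facts(1)[OF s, of 2] l1 by simp
  have a2: "ac (Y 1 s) (\<lambda>x. J s x * Y 2 s x)" using Y_facts(2)[OF s, of 1] l1 by (simp add: numeral_2_eq_2)
  have "rcls (Y 1 s) = cL (complex_of_real (Y 1 s 0)) + I0 (rcls (\<lambda>x. J s x * Y 2 s x))"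
    by (rule cls_ac[OF ac_complex_of_real[OF a2] lbb_complex_of_real[OF lbb_mult[OF J_lbb[OF s] lY]]])
  then show "- rcls (Y 1 s) = cL (- complex_of_real (Y 1 s 0)) + I0 (- (rcls (J s) * rcls (Y 2 s)))"
    unfolding rcls_simps(3)[OF J_lbb[OF s] lY] linear_neg[OF bounded_linear.linear[OF bounded_linear_cL]]
      linear_neg[OF bounded_linear.linear[OF bounded_linear_I0]] by simp
qed

lemma energy_derivative:
  assumes l1: "l = 1" and CH: "\<And>w. flux_sum 1 c w = (w 0)\<^sup>2 + (w 1)\<^sup>2 / 2" and t: "t \<in> I1"
  shows "((\<lambda>s. rcls (E s)) has_vector_derivative rcls (H t)) (at t)"
proof -
  have lY: "lbb (Y 2 t)" using Y_facts(1)[OF t, of 2] l1 by simp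
  note lV = V(1)[OF inI n1(1)]
  let ?E' = "rcls (V 1 t) + (1 / 4) *\<^sub>R (rcls (V 1 t) * rcls (V 1 t) * (- (rcls (K t) * rcls (K t)) * rcls (V 1 t))
     + (rcls (V 1 t) * - (rcls (J t) * rcls (Y 2 t)) + - (rcls (J t) * rcls (Y 2 t)) * rcls (V 1 t)) * rcls (K t))"
  have "((\<lambda>s. rcls (J s) + (1 / 4) *\<^sub>R (rcls (V 1 s) * rcls (V 1 s) * rcls (K s))) has_vector_derivative ?E') (at t)"
    by (intro has_vector_derivative_add bounded_linear.has_vector_derivative[OF bounded_linear_scaleR_right] has_vector_derivative_mult
        J_derivative K_derivative V1_derivative[OF l1] t)
  then have D: "((\<lambda>s. rcls (E s)) has_vector_derivative ?E') (at t)"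
  proof (rule has_vector_derivative_transform_within_open[OF _ I1(1) t])
    fix s assume s: "s \<in> I1"
    note l3 = lbb_mult[OF lV[OF s] lV[OF s]]
    show "rcls (J s) + (1 / 4) *\<^sub>R (rcls (V 1 s) * rcls (V 1 s) * rcls (K s)) = rcls (E s)"
      unfolding E_def
      by (simp only: rcls_simps(1)[OF J_lbb[OF s] lbb_mult[OF lbb_const lbb_mult[OF l3 K_lbb[OF s]]]]
        rcls_simps(5)[OF lbb_mult[OF l3 K_lbb[OF s]]] rcls_simps(3)[OF l3 K_lbb[OF s]] rcls_simps(3)[OF lV[OF s] lV[OF s]])
  qed
  define e where "e x = V 1 t x + 1 / 4 * (V 1 t x * V 1 t x * (- (K t x * K t x) * V 1 t x)
     + (V 1 t x * - (J t x * Y 2 t x) + - (J t x * Y 2 t x) * V 1 t x) * K t x)" for x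
  note b = lV[OF t] K_lbb[OF t] J_lbb[OF t] lY
  have lmin: "lbb (\<lambda>x. - f x)" if "lbb f" for f :: "real \<Rightarrow> real" using lbb_mult[OF lbb_const[of "- 1"] that] by simp
  have le: "lbb e" unfolding e_def[abs_def] by (intro lbb_add lbb_mult lbb_const lmin b)
  have c4: "rcls (\<lambda>x. 1 / 4) = (1 / 4) *\<^sub>R 1" using rcls_simps(5)[OF lbb_const[of 1], of "1 / 4"] cls_simps(2) by simp
  have "rcls e = ?E'"
    unfolding e_def
    by (simp only: rcls_simps(1-4) lbb_add lbb_mult lbb_const lmin b c4) (simp only: mult_scaleR_left mult_1)
  moreover have "rcls e = rcls (H t)"
  proof -
    have "ae01 (\<lambda>x. complex_of_real (Psi t x) = complex_of_real (Phi t x))"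
      using Psi_facts[OF t] Phi_facts(1)[OF t] by (subst cls_eq_iff[symmetric]) (auto intro: lbb_complex_of_real)
    then have a: "ae01 (\<lambda>x. Y 0 t x - Y 2 t x = V 0 t x * V 0 t x + w 1 t x * w 1 t x / 2)"
    proof (rule ae01_mono)
      fix x assume "complex_of_real (Psi t x) = complex_of_real (Phi t x)"
      then have "Psi t x = Phi t x" by (simp only: of_real_eq_iff)
      moreover have "Psi t x = Y 0 t x - Y 2 t x" unfolding Psi_def by (simp add: l1)
      moreover have "Phi t x = V 0 t x * V 0 t x + w 1 t x * w 1 t x / 2"
      proof -
        have "Phi t x = flux_sum 1 c (\<lambda>m. w m t x)" unfolding Phi_def using l1 by simp
        then show ?thesis unfolding CH w_facts(3)[OF t le0] by (simp only: power2_eq_square)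
      qed
      ultimately show "Y 0 t x - Y 2 t x = V 0 t x * V 0 t x + w 1 t x * w 1 t x / 2" by simp
    qed
    have "ae01 (\<lambda>x. e x = H t x)"
    proof (rule ae01_mp2[OF a V1_eq[OF t]])
      fix x assume y: "Y 0 t x - Y 2 t x = V 0 t x * V 0 t x + w 1 t x * w 1 t x / 2" and v: "V 1 t x = J t x * w 1 t x"
      have kj: "K t x * J t x = 1" by (rule KJ)
      have w1: "w 1 t x = K t x * V 1 t x" using kj unfolding v by (simp add: mult.assoc[symmetric])
      have "e x = V 1 t x - 1 / 4 * V 1 t x * (w 1 t x * w 1 t x) - 1 / 2 * V 1 t x * Y 2 t x * (K t x * J t x)"
        unfolding e_def w1 by (simp add: algebra_simps)
      also have "\<dots> = V 1 t x * (1 - 1 / 2 * (Y 2 t x + w 1 t x * w 1 t x / 2))" unfolding kj by (simp add: algebra_simps)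
      also have "Y 2 t x + w 1 t x * w 1 t x / 2 = Y 0 t x - V 0 t x * V 0 t x" using y by linarith
      finally show "e x = H t x" unfolding H_def .
    qed
    then have "ae01 (\<lambda>x. complex_of_real (e x) = complex_of_real (H t x))" by (rule ae01_mono) simp
    then show ?thesis by (subst cls_eq_iff[OF lbb_complex_of_real[OF le] lbb_complex_of_real[OF EH_lbb(2)[OF t]]])
  qed
  ultimately have "?E' = rcls (H t)" by simp
  with D show ?thesis by (simp only:)
qed

text \<open>As E - |V 1| = (J - |V 1| / 2)^2 / J, one has |V 1| \<le> E, so |H| is at most a
  constant times E and Gronwall bounds E from below at time t. To return from E = J (1 + w 1^2 / 4)
  to J, u_x at time t is compared with its values at a reference time r, which are bounded by b; the
  difference enters only through h, whose integral is an L2 distance squared.\<close>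

lemma energy_lower_bound:
  assumes l1: "l = 1" and CH: "\<And>w. flux_sum 1 c w = (w 0)\<^sup>2 + (w 1)\<^sup>2 / 2"
    and A: "\<And>s y. s \<in> I1 \<Longrightarrow> \<bar>U 0 s y\<bar> \<le> A" and M: "\<And>s y. s \<in> I1 \<Longrightarrow> \<bar>P 0 s y\<bar> \<le> M"
    and s: "s \<in> I1" and t: "t \<in> I1" and \<delta>: "ae01 (\<lambda>x. \<delta> \<le> jac s x)" and r: "r \<in> I" "\<And>y. \<bar>U 1 r y\<bar> \<le> b"
  obtains h where "lbb h" "\<And>x. 0 \<le> h x" "integral {0..1} h = integral {0..1} (\<lambda>y. (U 1 t y - U 1 r y)\<^sup>2)"
    "ae01 (\<lambda>x. exp (- ((1 + (M + A\<^sup>2) / 2) * \<bar>t - s\<bar>)) * \<delta> \<le> (1 + b\<^sup>2) * jac t x + h x)"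
proof -
  let ?L = "1 + (M + A\<^sup>2) / 2"
  have G: "ae01 (\<lambda>x. exp (- (?L * \<bar>t - s\<bar>)) * E s x \<le> E t x)"
  proof (rule gronwall_ae[OF I1(2) s t EH_lbb energy_derivative[OF l1 CH] _ I1(1)])
    fix q assume q: "q \<in> I1"
    have "\<bar>H q x\<bar> \<le> ?L * E q x" for x
    proof -
      have "E q x - \<bar>V 1 q x\<bar> = (J q x - \<bar>V 1 q x\<bar> / 2)\<^sup>2 * K q x"
      proof -
        have "(J q x - \<bar>V 1 q x\<bar> / 2)\<^sup>2 * K q x = J q x * (J q x * K q x) - \<bar>V 1 q x\<bar> * (J q x * K q x) + (\<bar>V 1 q x\<bar> * \<bar>V 1 q x\<bar>) * K q x / 4"
          by (simp add: power2_eq_square field_simps)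
        then show ?thesis unfolding KJ E_def abs_mult_self_eq by simp
      qed
      moreover have "0 \<le> (J q x - \<bar>V 1 q x\<bar> / 2)\<^sup>2 * K q x" using J_ge(2)[of q x] by (simp add: K_def)
      ultimately have VE: "\<bar>V 1 q x\<bar> \<le> E q x" by linarith
      have "\<bar>Y 0 q x\<bar> \<le> M" unfolding Y_def by (rule M[OF q])
      moreover have "\<bar>V 0 q x\<bar> \<le> A" using A[OF q] VU[OF inI[OF q]] by simp
      then have "V 0 q x * V 0 q x \<le> A\<^sup>2" by (simp add: abs_le_square_iff power2_eq_square[symmetric] abs_le_iff power2_le_iff_abs_le)
      moreover have "0 \<le> V 0 q x * V 0 q x" by simp
      ultimately have "\<bar>1 - 1 / 2 * (Y 0 q x - V 0 q x * V 0 q x)\<bar> \<le> ?L"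
      proof -
        have "\<bar>1 - 1 / 2 * (y - v)\<bar> \<le> 1 + (M + a) / 2" if "\<bar>y\<bar> \<le> M" "v \<le> a" "0 \<le> v" for y v a :: real
          using that by (simp add: abs_le_iff field_simps)
        then show ?thesis using \<open>\<bar>Y 0 q x\<bar> \<le> M\<close> \<open>V 0 q x * V 0 q x \<le> A\<^sup>2\<close> \<open>0 \<le> V 0 q x * V 0 q x\<close> by blast
      qed
      then have "\<bar>V 1 q x\<bar> * \<bar>1 - 1 / 2 * (Y 0 q x - V 0 q x * V 0 q x)\<bar> \<le> E q x * ?L"
        using VE by (intro mult_mono) auto
      then show ?thesis unfolding H_def abs_mult by (simp only: mult.commute)
    qed
    then show "ae01 (\<lambda>x. \<bar>H q x\<bar> \<le> ?L * E q x)" by (intro ae01_always)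
  qed
  define g where "g y = (U 1 t y - U 1 r y)\<^sup>2" for y
  define h where "h x = J t x * g (xi t x)" for x
  note tI = inI[OF t]
  have lg: "lbb g" unfolding g_def[abs_def] by (intro lbb_power lbb_diff U(1) tI r n1(1))
  have pg: "periodic1 g" using U(2)[OF tI n1(1)] U(2)[OF r(1) n1(1)] by (simp add: g_def periodic1_def)
  have "lbb h" unfolding h_def[abs_def] by (intro lbb_mult J_lbb[OF t] lbb_compose[OF lg xi_continuous[OF t]])
  moreover have "0 \<le> h x" for x using J_ge(2)[of t x] by (simp add: h_def g_def)
  moreover have "integral {0..1} h = integral {0..1} g"
  proof -
    obtain F where F: "ac F g" by (rule ac_primitive_exists[OF lbb_absolutely_integrable[OF lg], of 0])
    have "integral {0..1} h = integral {xi t 0..xi t 1} g" unfolding h_def[abs_def] by (rule integral_xi[OF t _ lg, symmetric]) simp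
    also have "\<dots> = F (xi t 0 + 1) - F (xi t 0)" unfolding xi_1(1)[OF t] by (rule acD[OF F, symmetric]) simp
    also have "\<dots> = F 1 - F 0" by (rule periodic_integral_shift[OF F pg])
    also have "\<dots> = integral {0..1} g" by (rule acD[OF F]) simp
    finally show ?thesis .
  qed
  moreover have "ae01 (\<lambda>x. exp (- (?L * \<bar>t - s\<bar>)) * \<delta> \<le> (1 + b\<^sup>2) * jac t x + h x)"
  proof -
    have a1: "ae01 (\<lambda>x. \<delta> \<le> E s x)"
    proof (rule ae01_mp2[OF \<delta> J_ae01[OF s]])
      fix x assume *: "\<delta> \<le> jac s x" "jac s x = J s x"
      have "0 \<le> K s x" using J_ge(2)[of s x] by (simp add: K_def)
      then have "0 \<le> V 1 s x * V 1 s x * K s x" by simp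
      then show "\<delta> \<le> E s x" using * unfolding E_def by linarith
    qed
    have a2: "ae01 (\<lambda>x. V 1 t x = J t x * w 1 t x \<and> jac t x = J t x)" by (rule ae01_conj[OF V1_eq[OF t] J_ae01[OF t]])
    have a3: "ae01 (\<lambda>x. exp (- (?L * \<bar>t - s\<bar>)) * \<delta> \<le> E t x)"
      by (rule ae01_mp2[OF a1 G]) (meson mult_left_mono exp_ge_zero order_trans)
    show ?thesis
    proof (rule ae01_mp2[OF a2 a3])
      fix x assume *: "V 1 t x = J t x * w 1 t x \<and> jac t x = J t x" and c: "exp (- (?L * \<bar>t - s\<bar>)) * \<delta> \<le> E t x"
      have "E t x = J t x + J t x * (w 1 t x)\<^sup>2 / 4 * (J t x * K t x)"
        unfolding E_def using * by (simp add: power2_eq_square mult_ac)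
      then have E: "E t x = J t x + J t x * (w 1 t x)\<^sup>2 / 4" unfolding KJ by simp
      define u where "u = U 1 r (xi t x)"
      have "u\<^sup>2 \<le> b\<^sup>2" using r(2)[of "xi t x"] unfolding u_def by (simp add: abs_le_square_iff[symmetric] power2_le_iff_abs_le)
      moreover have "(w 1 t x)\<^sup>2 \<le> 2 * (w 1 t x - u)\<^sup>2 + 2 * u\<^sup>2"
        using zero_le_power2[of "w 1 t x - 2 * u"] by (simp add: power2_eq_square algebra_simps)
      moreover have "0 \<le> (w 1 t x - u)\<^sup>2" "0 \<le> b\<^sup>2" by simp_all
      ultimately have "(w 1 t x)\<^sup>2 / 4 \<le> (w 1 t x - u)\<^sup>2 + b\<^sup>2" by linarith
      then have "J t x * ((w 1 t x)\<^sup>2 / 4) \<le> J t x * ((w 1 t x - u)\<^sup>2 + b\<^sup>2)"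
        using J_ge(2)[of t x] by (intro mult_left_mono) auto
      moreover have "h x = J t x * (w 1 t x - u)\<^sup>2" by (simp add: h_def g_def w_def u_def)
      ultimately have "E t x \<le> (1 + b\<^sup>2) * J t x + h x" unfolding E by (simp add: algebra_simps)
      then show "exp (- (?L * \<bar>t - s\<bar>)) * \<delta> \<le> (1 + b\<^sup>2) * jac t x + h x" using c * by simp
    qed
  qed
  ultimately show thesis using that[of h] unfolding g_def by blast
qed

end

context lagrangian
begin

text \<open>Testing P - P_xx = F with P bounds the squared H1 norm by M times the integral of F,
  where M is the supremum of |P|. The Sobolev inequality then gives M \<le> 2 sqrt (M times that
  integral), hence M is at most 4 times the integral.\<close>

lemma pressure_bound:
  assumes l1: "l = 1" and CH: "\<And>w. flux_sum 1 c w = (w 0)\<^sup>2 + (w 1)\<^sup>2 / 2" and t: "t \<in> I"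
  shows "\<bar>P 0 t y\<bar> \<le> 4 * integral {0..1} (\<lambda>y. (U 0 t y)\<^sup>2 + (U 1 t y)\<^sup>2 / 2)"
proof -
  define F where "F y = (U 0 t y)\<^sup>2 + (U 1 t y)\<^sup>2 / 2" for y
  have lp: "lbb (P 0 t)" "lbb (P 1 t)" "lbb (P 2 t)" using P(1)[OF t] l1 by auto
  have ap: "ac (P 0 t) (P 1 t)" "ac (P 1 t) (P 2 t)" using P(3)[OF t, of 0] P(3)[OF t, of 1] l1 by (auto simp: numeral_2_eq_2)
  have pp: "periodic1 (P 0 t)" "periodic1 (P 1 t)" using P(2)[OF t] l1 by auto
  have lU: "lbb (\<lambda>y. (U j t y)\<^sup>2)" if "j \<le> n" for j by (intro lbb_power U(1)[OF t that])
  have lF: "lbb F" unfolding F_def[abs_def] using lbb_add[OF lU[OF le0] lbb_mult[OF lbb_const[of "1/2"] lU[OF n1(1)]]] by simp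
  have F0: "0 \<le> F y" for y by (simp add: F_def)
  have PFt: "AE y in lborel. P 0 t y - P 2 t y = F y"
    using PF[OF t] unfolding l1 CH by (simp add: F_def)
  have "continuous_on UNIV (\<lambda>y. \<bar>P 0 t y\<bar>)" by (intro continuous_intros ac_continuous[OF ap(1)])
  then obtain y0 where y0: "y0 \<in> {0..1}" "\<And>y. y \<in> {0..1} \<Longrightarrow> \<bar>P 0 t y\<bar> \<le> \<bar>P 0 t y0\<bar>"
    using continuous_attains_sup[of "{0..1::real}" "\<lambda>y. \<bar>P 0 t y\<bar>"] continuous_on_subset by (metis atLeastatMost_empty_iff2 compact_Icc subset_UNIV zero_le_one not_le)
  define M where "M = \<bar>P 0 t y0\<bar>"
  have M: "\<bar>P 0 t y\<bar> \<le> M" for y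
    using y0(2)[of "frac y"] periodic1_frac[OF pp(1)] by (simp add: M_def frac_lt_1 less_imp_le)
  let ?F = "integral {0..1} F"
  have F1: "0 \<le> ?F" "0 \<le> M" using F0 by (auto simp: M_def intro!: Henstock_Kurzweil_Integration.integral_nonneg lbb_integrable lF)
  have i: "(\<lambda>y. P i t y * P j t y) integrable_on {0..1}" if "i \<le> 2" "j \<le> 2" for i j
    using P(1)[OF t] that l1 by (intro lbb_integrable lbb_mult) auto
  have "ac (\<lambda>y. P 0 t y * P 1 t y) (\<lambda>y. P 1 t y * P 1 t y + P 0 t y * P 2 t y)" by (rule ac_mult[OF ap lp(3)])
  from acD[OF this zero_le_one] have "integral {0..1} (\<lambda>y. P 1 t y * P 1 t y + P 0 t y * P 2 t y) = P 0 t 1 * P 1 t 1 - P 0 t 0 * P 1 t 0" by simp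
  also have "\<dots> = 0" using pp[unfolded periodic1_def, THEN spec, of 0] by simp
  finally have s1: "integral {0..1} (\<lambda>y. P 1 t y * P 1 t y) + integral {0..1} (\<lambda>y. P 0 t y * P 2 t y) = 0"
    using Henstock_Kurzweil_Integration.integral_add[OF i[of 1 1] i[of 0 2]] by simp
  have "integral {0..1} (\<lambda>y. P 0 t y * P 0 t y) - integral {0..1} (\<lambda>y. P 0 t y * P 2 t y) = integral {0..1} (\<lambda>y. P 0 t y * P 0 t y - P 0 t y * P 2 t y)"
    using Henstock_Kurzweil_Integration.integral_diff[OF i[of 0 0] i[of 0 2]] by simp
  also have "\<dots> = integral {0..1} (\<lambda>y. P 0 t y * F y)"
  proof (rule ae01_integral_eq)
    show "ae01 (\<lambda>y. P 0 t y * P 0 t y - P 0 t y * P 2 t y = P 0 t y * F y)"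
      unfolding ae01_def using PFt by eventually_elim (simp add: right_diff_distrib[symmetric])
  qed auto
  also have "\<dots> \<le> integral {0..1} (\<lambda>y. M * F y)"
  proof (rule Henstock_Kurzweil_Integration.integral_le)
    show "P 0 t y * F y \<le> M * F y" for y by (rule mult_right_mono[OF order_trans[OF abs_ge_self M] F0])
  qed (intro lbb_integrable lbb_mult lp lF lbb_const)+
  also have "\<dots> = M * ?F" by simp
  finally have s2: "integral {0..1} (\<lambda>y. P 0 t y * P 0 t y) + integral {0..1} (\<lambda>y. P 1 t y * P 1 t y) \<le> M * ?F" using s1 by linarith
  have nn: "0 \<le> integral {0..1} (\<lambda>y. P j t y * P j t y)" if "j \<le> 2" for j
    by (rule Henstock_Kurzweil_Integration.integral_nonneg[OF i[OF that that]]) simp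
  let ?h = "sqrt (M * ?F)"
  have h: "?h\<^sup>2 = M * ?F" "0 \<le> ?h" using F1 by simp_all
  have "M \<le> ?h + ?h" unfolding M_def
  proof (rule sup_bound_periodic[OF ap(1) pp(1) lp(2)])
    show "integral {0..1} (\<lambda>x. \<bar>P 0 t x\<bar>) \<le> sqrt (\<bar>P 0 t y0\<bar> * ?F)"
      using s2 nn[of 1] h unfolding M_def[symmetric] by (intro integral_abs_le_sqrt[OF lp(1)]) (auto simp: power2_eq_square)
    show "integral {0..1} (\<lambda>x. \<bar>P 1 t x\<bar>) \<le> sqrt (\<bar>P 0 t y0\<bar> * ?F)"
      using s2 nn[of 0] h unfolding M_def[symmetric] by (intro integral_abs_le_sqrt[OF lp(2)]) (auto simp: power2_eq_square)
  qed
  then have "M\<^sup>2 \<le> (2 * ?h)\<^sup>2" using F1(2) by (intro power_mono) auto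
  then have "M * M \<le> M * (4 * ?F)" unfolding power_mult_distrib h(1) by (simp add: power2_eq_square mult_ac)
  then have "M \<le> 4 * ?F" using F1 by (cases "M = 0") auto
  then show ?thesis using M[of y] unfolding F_def[abs_def] by linarith
qed

end

section \<open>Endpoints of intervals of good times\<close>

context lagrangian
begin

text \<open>Shrinks a neighbourhood of an endpoint to the side inside (a, b), where the Jacobian is
  already known to be bounded below at each time.\<close>

lemma one_sided_interval:
  fixes a b t :: real
  assumes "\<forall>\<^sub>F s in at t. Q s" "a < b" "t = a \<or> t = b"
  obtains a' b' where "a' < b'" "{a'<..<b'} \<subseteq> {a<..<b}" "t islimpt {a'<..<b'}" "\<And>s. s \<in> {a'<..<b'} \<Longrightarrow> Q s"
proof -
  from assms(1) obtain r where r: "r > 0" "\<And>s. s \<noteq> t \<Longrightarrow> dist s t < r \<Longrightarrow> Q s" unfolding eventually_at by auto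
  let ?a = "max a (t - r)" and ?b = "min b (t + r)"
  have ab: "?a < ?b" using assms r(1) by auto
  then have "?a islimpt {?a<..<?b}" "?b islimpt {?a<..<?b}"
    by (rule islimpt_greaterThanLessThan1, rule islimpt_greaterThanLessThan2)
  moreover have "t = ?a \<or> t = ?b" using assms(2,3) r(1) by auto
  ultimately have "t islimpt {?a<..<?b}" by (elim disjE) simp_all
  moreover have "Q s" if "s \<in> {?a<..<?b}" for s
    using that assms(2,3) by (intro r(2)) (auto simp: dist_real_def)
  ultimately show thesis using ab by (intro that[of ?a ?b]) auto
qed

lemma goodD: "t \<in> good \<Longrightarrow> t \<in> I" "t \<in> good \<Longrightarrow> ae01 (\<lambda>x. 0 \<le> jac t x)"
proof -
  assume "t \<in> good"
  then obtain \<delta> where d: "t \<in> I" "\<delta> > 0" "ae01 (\<lambda>x. \<delta> \<le> jac t x)" unfolding good_def by blast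
  show "t \<in> I" by fact
  show "ae01 (\<lambda>x. 0 \<le> jac t x)" by (rule ae01_mono[OF d(3)]) (use d(2) in linarith)
qed

text \<open>For n > 1 the derivative u_x is bounded uniformly near t. Gronwall from the midpoint m
  then bounds the Jacobian below by a constant independent of s, and the bound passes to the
  limit.\<close>

lemma good_endpoint_smooth:
  assumes n2: "1 < n" and ab: "a < b" "{a<..<b} \<subseteq> good" "t = a \<or> t = b" and t: "t \<in> I"
  shows "t \<in> good"
proof -
  obtain L where L: "L > 0" "\<And>y. \<bar>U 1 t y\<bar> \<le> L"
    using periodic_lbb_bounded[OF U(1)[OF t n1(1)] U(2)[OF t n1(1)]] by metis
  have "\<forall>\<^sub>F s in at t. \<forall>y. \<bar>U 1 s y\<bar> \<le> L + 1"
    using U_uniform[OF t n2 zero_less_one]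
  proof eventually_elim
    case (elim s)
    then have u: "\<bar>U 1 s y - U 1 t y\<bar> < 1" for y by blast
    show ?case
    proof
      fix y show "\<bar>U 1 s y\<bar> \<le> L + 1" using u[of y] L(2)[of y] by linarith
    qed
  qed
  from one_sided_interval[OF this ab(1,3)] obtain p q
    where pq: "p < q" "{p<..<q} \<subseteq> {a<..<b}" "t islimpt {p<..<q}" "\<And>s y. s \<in> {p<..<q} \<Longrightarrow> \<bar>U 1 s y\<bar> \<le> L + 1" by metis
  have g: "s \<in> good" if "s \<in> {p<..<q}" for s using that pq(2) ab(2) by blast
  define m where "m = (p + q) / 2"
  have m: "m \<in> {p<..<q}" using pq(1) by (simp add: m_def)
  from g[OF m] obtain \<delta> where \<delta>: "\<delta> > 0" "ae01 (\<lambda>x. \<delta> \<le> jac m x)" unfolding good_def by blast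
  let ?e = "exp (- ((L + 1) * (q - p))) * \<delta>"
  have "ae01 (\<lambda>x. ?e \<le> jac s x)" if s: "s \<in> {p<..<q}" for s
  proof -
    have "ae01 (\<lambda>x. exp (- ((L + 1) * \<bar>s - m\<bar>)) * jac m x \<le> jac s x)"
    proof (rule gronwall_ae[OF is_interval_oo m s])
      fix r assume r: "r \<in> {p<..<q}"
      note rI = goodD(1)[OF g[OF r]]
      show "lbb (\<lambda>x. jac r x)" by (rule jac_lbb[OF rI])
      show "lbb (V 1 r)" by (rule V(1)[OF rI n1(1)])
      show "((\<lambda>r. rcls (\<lambda>x. jac r x)) has_vector_derivative rcls (V 1 r)) (at r)" by (rule jac_derivative[OF rI])
      show "ae01 (\<lambda>x. \<bar>V 1 r x\<bar> \<le> (L + 1) * jac r x)" by (rule V1_le[OF rI goodD(2)[OF g[OF r]] pq(4)[OF r]])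
    qed simp
    with \<delta>(2) show ?thesis
    proof (rule ae01_mp2)
      fix x assume *: "\<delta> \<le> jac m x" "exp (- ((L + 1) * \<bar>s - m\<bar>)) * jac m x \<le> jac s x"
      have "\<bar>s - m\<bar> \<le> q - p" using m s by auto
      then have "?e \<le> exp (- ((L + 1) * \<bar>s - m\<bar>)) * jac m x"
        using * \<delta>(1) L(1) by (intro mult_mono) auto
      then show "?e \<le> jac s x" using * by linarith
    qed
  qed
  then have "ae01 (\<lambda>x. ?e \<le> jac t x)" by (intro jac_limit[OF t pq(3)] always_eventually) blast
  moreover have "0 < ?e" using \<delta>(1) by simp
  ultimately show ?thesis unfolding good_def using t by blast
qed

lemma U_L2_near:
  assumes t: "t \<in> I" and j: "j \<le> n"
  shows "\<forall>\<^sub>F s in at t. s \<in> I \<and> integral {0..1} (\<lambda>y. (U j s y)\<^sup>2) \<le> 2 + 2 * integral {0..1} (\<lambda>y. (U j t y)\<^sup>2)"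
  using order_tendstoD(2)[OF UL2[OF t j] zero_less_one] eventually_at_in_open'[OF I t]
proof eventually_elim
  case (elim s)
  have l: "lbb (U j s)" "lbb (U j t)" using U(1) elim t j by auto
  have "integral {0..1} (\<lambda>y. (U j s y)\<^sup>2) \<le> integral {0..1} (\<lambda>y. 2 * (U j s y - U j t y)\<^sup>2 + 2 * (U j t y)\<^sup>2)"
  proof (rule Henstock_Kurzweil_Integration.integral_le)
    show "(U j s y)\<^sup>2 \<le> 2 * (U j s y - U j t y)\<^sup>2 + 2 * (U j t y)\<^sup>2" for y
      using zero_le_power2[of "U j s y - 2 * U j t y"] by (simp add: power2_eq_square algebra_simps)
  qed (intro lbb_integrable lbb_add lbb_mult[OF lbb_const] lbb_power lbb_diff l)+
  also have "\<dots> = 2 * integral {0..1} (\<lambda>y. (U j s y - U j t y)\<^sup>2) + 2 * integral {0..1} (\<lambda>y. (U j t y)\<^sup>2)"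
    by (subst Henstock_Kurzweil_Integration.integral_add)
       (auto intro!: lbb_integrable lbb_mult[OF lbb_const] lbb_power lbb_diff l)
  finally show ?case using elim by linarith
qed

text \<open>At times s near t the energy gives a constant lower bound for (1 + L^2) times the
  Jacobian plus h, where h depends on s and its integral tends to 0 because u_x is continuous in L2.
  Letting s tend to t in integrals over intervals removes h and leaves a bound for the Jacobian at
  t.\<close>

lemma good_endpoint_CH:
  assumes l1: "l = 1" and CH: "\<And>w. flux_sum 1 c w = (w 0)\<^sup>2 + (w 1)\<^sup>2 / 2"
    and ab: "a < b" "{a<..<b} \<subseteq> good" "t = a \<or> t = b" and t: "t \<in> I"
  shows "t \<in> good"
proof -
  obtain A where A: "A > 0" "\<And>y. \<bar>U 0 t y\<bar> \<le> A"
    using periodic_lbb_bounded[OF U(1)[OF t le0] U(2)[OF t le0]] by metis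
  obtain L where L: "L > 0" "\<And>y. \<bar>U 1 t y\<bar> \<le> L"
    using periodic_lbb_bounded[OF U(1)[OF t n1(1)] U(2)[OF t n1(1)]] by metis
  \<comment> \<open>The bound of \<open>pressure_bound\<close>, with the L2 norms at nearby times
    estimated by \<open>U_L2_near\<close>.\<close>
  define M where "M = 4 * ((2 + 2 * integral {0..1} (\<lambda>y. (U 0 t y)\<^sup>2)) + (2 + 2 * integral {0..1} (\<lambda>y. (U 1 t y)\<^sup>2)) / 2)"
  have "\<forall>\<^sub>F s in at t. (\<forall>y. \<bar>U 0 s y\<bar> \<le> A + 1) \<and> (\<forall>y. \<bar>P 0 s y\<bar> \<le> M)"
    using U_uniform[OF t n1(2) zero_less_one] U_L2_near[OF t le0] U_L2_near[OF t n1(1)]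
  proof eventually_elim
    case (elim s)
    then have sI: "s \<in> I" and u: "\<And>y. \<bar>U 0 s y - U 0 t y\<bar> < 1" by blast+
    have U0: "\<bar>U 0 s y\<bar> \<le> A + 1" for y using u[of y] A(2)[of y] by linarith
    have lU: "lbb (\<lambda>y. (U 0 s y)\<^sup>2)" "lbb (\<lambda>y. 1 / 2 * (U 1 s y)\<^sup>2)"
      by (intro lbb_mult[OF lbb_const] lbb_power U(1)[OF sI] le0 n1(1))+
    have "integral {0..1} (\<lambda>y. (U 0 s y)\<^sup>2 + 1 / 2 * (U 1 s y)\<^sup>2) = integral {0..1} (\<lambda>y. (U 0 s y)\<^sup>2) + 1 / 2 * integral {0..1} (\<lambda>y. (U 1 s y)\<^sup>2)"
      by (simp only: Henstock_Kurzweil_Integration.integral_add[OF lbb_integrable[OF lU(1)] lbb_integrable[OF lU(2)]]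
        Henstock_Kurzweil_Integration.integral_mult_right)
    then have e: "4 * integral {0..1} (\<lambda>y. (U 0 s y)\<^sup>2 + (U 1 s y)\<^sup>2 / 2) = 4 * (integral {0..1} (\<lambda>y. (U 0 s y)\<^sup>2) + integral {0..1} (\<lambda>y. (U 1 s y)\<^sup>2) / 2)"
      by simp
    have "integral {0..1} (\<lambda>y. (U 0 s y)\<^sup>2) \<le> 2 + 2 * integral {0..1} (\<lambda>y. (U 0 t y)\<^sup>2)"
      "integral {0..1} (\<lambda>y. (U 1 s y)\<^sup>2) \<le> 2 + 2 * integral {0..1} (\<lambda>y. (U 1 t y)\<^sup>2)" using elim by blast+
    then have "4 * integral {0..1} (\<lambda>y. (U 0 s y)\<^sup>2 + (U 1 s y)\<^sup>2 / 2) \<le> M"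
      unfolding e M_def by (intro mult_left_mono add_mono divide_right_mono) simp_all
    then have "\<bar>P 0 s y\<bar> \<le> M" for y using pressure_bound[OF l1 CH sI, of y] by linarith
    with U0 show ?case by blast
  qed
  from one_sided_interval[OF this ab(1,3)] obtain p q
    where pq: "p < q" "{p<..<q} \<subseteq> {a<..<b}" "t islimpt {p<..<q}"
      "\<And>s y. s \<in> {p<..<q} \<Longrightarrow> \<bar>U 0 s y\<bar> \<le> A + 1" "\<And>s y. s \<in> {p<..<q} \<Longrightarrow> \<bar>P 0 s y\<bar> \<le> M" by metis
  have g: "s \<in> good" if "s \<in> {p<..<q}" for s using that pq(2) ab(2) by blast
  define m where "m = (p + q) / 2"
  have m: "m \<in> {p<..<q}" using pq(1) by (simp add: m_def)
  from g[OF m] obtain \<delta> where \<delta>: "\<delta> > 0" "ae01 (\<lambda>x. \<delta> \<le> jac m x)" unfolding good_def by blast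
  let ?K = "1 + (M + (A + 1)\<^sup>2) / 2"
  have "0 \<le> M" using pq(5)[OF m, of 0] by linarith
  then have K: "0 \<le> ?K" by simp
  let ?e = "exp (- (?K * (q - p))) * \<delta>"
  have h: "\<exists>h. lbb h \<and> (\<forall>x. 0 \<le> h x) \<and> integral {0..1} h = integral {0..1} (\<lambda>y. (U 1 s y - U 1 t y)\<^sup>2) \<and> ae01 (\<lambda>x. ?e \<le> (1 + L\<^sup>2) * jac s x + h x)"
    if s: "s \<in> {p<..<q}" for s
  proof -
    \<comment> \<open>The ends of a compact interval inside (p, q) with m and s in its interior, as
      \<open>exists_lag_local\<close> needs a compact part of \<open>good\<close>. The bound
      obtained does not depend on it.\<close>
    define p' q' where "p' = (p + min m s) / 2" and "q' = (q + max m s) / 2"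
    have pq': "p < p'" "p' < m" "p' < s" "m < q'" "s < q'" "q' < q" using m s by (auto simp: p'_def q'_def)
    then have "{p'..q'} \<subseteq> good" using g by auto
    from exists_lag_local[OF this] obtain d B where lag: "lag_local l n c I X V U P {p'<..<q'} d B" by blast
    have sub: "r \<in> {p<..<q}" if "r \<in> {p'<..<q'}" for r using that pq' by auto
    have ms: "m \<in> {p'<..<q'}" "s \<in> {p'<..<q'}" using pq' by auto
    obtain h where h: "lbb h" "\<And>x. 0 \<le> h x" "integral {0..1} h = integral {0..1} (\<lambda>y. (U 1 s y - U 1 t y)\<^sup>2)"
      "ae01 (\<lambda>x. exp (- (?K * \<bar>s - m\<bar>)) * \<delta> \<le> (1 + L\<^sup>2) * jac s x + h x)"
      using lag_local.energy_lower_bound[OF lag l1 CH pq(4)[OF sub] pq(5)[OF sub] ms \<delta>(2) t L(2)] by blast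
    have "\<bar>s - m\<bar> \<le> q - p" using m s by auto
    then have "?e \<le> exp (- (?K * \<bar>s - m\<bar>)) * \<delta>"
      using \<delta>(1) K by (intro mult_right_mono) (auto intro: mult_left_mono)
    then have "ae01 (\<lambda>x. ?e \<le> (1 + L\<^sup>2) * jac s x + h x)" by (intro ae01_mono[OF h(4)]) linarith
    with h(1,2,3) show ?thesis by blast
  qed
  let ?k = "1 + L\<^sup>2"
  have k: "0 < ?k" by (simp add: add_pos_nonneg)
  have lf: "lbb (\<lambda>x. ?k * jac t x - ?e)" by (intro lbb_diff lbb_mult[OF lbb_const] jac_lbb[OF t] lbb_const)
  have "ae01 (\<lambda>x. 0 \<le> ?k * jac t x - ?e)"
  proof (rule ae01_nonneg_if_integrals[OF lf])
    fix x y :: real assume xy: "0 \<le> x" "x \<le> y" "y \<le> 1"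
    show "0 \<le> integral {x..y} (\<lambda>x. ?k * jac t x - ?e)"
    proof (rule field_le_epsilon)
      fix \<epsilon> :: real assume \<epsilon>: "0 < \<epsilon>"
      have 1: "\<forall>\<^sub>F s in at t. s \<in> I \<and> ae01 (\<lambda>x. \<bar>X 1 s x - X 1 t x\<bar> \<le> \<epsilon> / (2 * ?k))"
        by (rule coordinate_near[OF t n1(1)]) (use \<epsilon> k in simp)
      have 2: "\<forall>\<^sub>F s in at t. integral {0..1} (\<lambda>y. (U 1 s y - U 1 t y)\<^sup>2) < \<epsilon> / 2"
        by (rule order_tendstoD(2)[OF UL2[OF t n1(1)]]) (use \<epsilon> in simp)
      from islimpt_eventually[OF pq(3) eventually_conj[OF 1 2]] obtain s where s: "s \<in> {p<..<q}"
        "ae01 (\<lambda>x. \<bar>X 1 s x - X 1 t x\<bar> \<le> \<epsilon> / (2 * ?k))" "integral {0..1} (\<lambda>y. (U 1 s y - U 1 t y)\<^sup>2) < \<epsilon> / 2" by blast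
      from h[OF s(1)] obtain h where h: "lbb h" "\<And>x. 0 \<le> h x" "integral {0..1} h = integral {0..1} (\<lambda>y. (U 1 s y - U 1 t y)\<^sup>2)"
        "ae01 (\<lambda>x. ?e \<le> ?k * jac s x + h x)" by blast
      have "ae01 (\<lambda>x. 0 \<le> (?k * jac t x - ?e) + (h x + \<epsilon> / 2))"
      proof (rule ae01_mp2[OF s(2) h(4)])
        fix x assume *: "\<bar>X 1 s x - X 1 t x\<bar> \<le> \<epsilon> / (2 * ?k)" "?e \<le> ?k * jac s x + h x"
        have "?k * jac s x \<le> ?k * (jac t x + \<epsilon> / (2 * ?k))" using * k by (intro mult_left_mono) linarith+
        also have "\<dots> = ?k * jac t x + \<epsilon> / 2" using k by (simp only: distrib_left) (simp add: field_simps)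
        finally show "0 \<le> (?k * jac t x - ?e) + (h x + \<epsilon> / 2)" using * by linarith
      qed
      then have "0 \<le> integral {x..y} (\<lambda>x. (?k * jac t x - ?e) + (h x + \<epsilon> / 2))" by (rule integral_nonneg_ae01[OF _ xy(1,3)])
      also have "\<dots> = integral {x..y} (\<lambda>x. ?k * jac t x - ?e) + (integral {x..y} h + integral {x..y} (\<lambda>_. \<epsilon> / 2))"
        by (simp only: Henstock_Kurzweil_Integration.integral_add[OF lbb_integrable[OF lf] lbb_integrable[OF lbb_add[OF h(1) lbb_const]]]
          Henstock_Kurzweil_Integration.integral_add[OF lbb_integrable[OF h(1)] lbb_integrable[OF lbb_const]])
      also have "integral {x..y} h \<le> integral {0..1} h"
        by (rule integral_subset_le) (use xy h(2) in \<open>auto intro: lbb_integrable[OF h(1)]\<close>)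
      also have "integral {x..y} (\<lambda>_. \<epsilon> / 2) \<le> \<epsilon> / 2" using xy \<epsilon> by (simp add: mult_left_le_one_le)
      finally show "0 \<le> integral {x..y} (\<lambda>x. ?k * jac t x - ?e) + \<epsilon>" using s(3) unfolding h(3) by linarith
    qed
  qed
  then have "ae01 (\<lambda>x. ?e / ?k \<le> jac t x)"
    by (rule ae01_mono) (subst pos_divide_le_eq[OF k], simp add: mult.commute)
  moreover have "0 < ?e / ?k" using \<delta>(1) k by simp
  ultimately show ?thesis unfolding good_def using t by blast
qed

lemma good_eq:
  assumes "l = 1 \<Longrightarrow> \<forall>w. flux_sum 1 c w = (w 0)\<^sup>2 + (w 1)\<^sup>2 / 2" and "is_interval I" "t0 \<in> good"
  shows "good = I"
proof (rule interval_exhaustion[OF open_good assms(2) _ assms(3)])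
  show "good \<subseteq> I" unfolding good_def by blast
  fix a b t assume *: "a < b" "{a<..<b} \<subseteq> good" "t = a \<or> t = b" "t \<in> I"
  show "t \<in> good"
  proof (cases "l = 1")
    case True
    then show ?thesis using good_endpoint_CH[OF True _ *] assms(1) by blast
  next
    case False
    then have "1 < n" using l n by linarith
    then show ?thesis by (rule good_endpoint_smooth[OF _ *])
  qed
qed

end

section \<open>From the solution to the Lagrangian system\<close>

lemma flux_sum_1:
  "flux_sum 1 c w = c 0 0 * (w 0 * w 0) + (c 0 1 + c 1 0) * (w 0 * w 1) + c 1 1 * (w 1 * w 1)"
proof -
  have "{(m, n). m \<le> 2 * 1 - (1::nat) \<and> n \<le> 2 * 1 - (1::nat) \<and> m + n \<le> 2 * 1} = {(0, 0), (0, 1), (1, 0), (1, 1)}" by auto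
  then show ?thesis unfolding flux_sum_def by (simp add: algebra_simps)
qed

lemma flux_eq: "flux D l c u x = flux_sum l c (\<lambda>m. D m u x)"
  by (simp add: flux_def flux_sum_def)

text \<open>The functions a + cos (2 pi x) determine the quadratic form. At x = 1/4, where the
  cosine vanishes and the sine is 1, a = 0 gives \<open>c 0 1 + c 1 0\<close> and a = 1 gives
  \<open>c 0 0\<close>; at x = 1/8, where neither vanishes, a = 0 gives
  \<open>c 1 1\<close>.\<close>

lemma camassa_holm_flux:
  assumes c: "flux_coeffs 1 c" shows "flux_sum 1 c w = (w 0)\<^sup>2 + (w 1)\<^sup>2 / 2"
proof -
  define k where "k = 2 * pi"
  define u where "u a x = a + cos (k * x)" for a x
  define u1 where "u1 x = - k * sin (k * x)" for x
  define u2 where "u2 x = - k\<^sup>2 * cos (k * x)" for x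
  define u3 where "u3 x = k ^ 3 * sin (k * x)" for x
  have d: "(u a has_real_derivative u1 x) (at x)" "(u1 has_real_derivative u2 x) (at x)" "(u2 has_real_derivative u3 x) (at x)" for a x
    unfolding u_def[abs_def] u1_def[abs_def] u2_def[abs_def] u3_def
    by (auto intro!: derivative_eq_intros simp: power2_eq_square power3_eq_cube)
  have s: "smooth_torus (u a)" for a
    unfolding u_def[abs_def] k_def
    by (rule smooth_testalg[of "\<lambda>x. 0" "\<lambda>x. 0"]) (auto simp: periodic1_def intro: testalg.intros)
  have D1: "deriv (u a) = u1" "deriv u1 = u2" "deriv u2 = u3" for a using d by (auto intro!: ext DERIV_imp_deriv)
  have D2: "deriv (\<lambda>y. u a y * u1 y) = (\<lambda>y. u1 y * u1 y + u2 y * u a y)" for a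
    by (rule ext, rule DERIV_imp_deriv, rule DERIV_mult[OF d(1,2)])
  have D3: "deriv (\<lambda>y. u1 y * u1 y + u2 y * u a y) = (\<lambda>y. (u2 y * u1 y + u2 y * u1 y) + (u3 y * u a y + u1 y * u2 y))" for a
    by (rule ext, rule DERIV_imp_deriv, intro DERIV_add DERIV_mult d)
  have A: "A_op cderiv 1 f x = f x - deriv (deriv f) x" for f x by (simp add: A_op_def numeral_2_eq_2)
  have C: "C_op 1 (u a) x = - 2 * u a x * u1 x - u1 x * u2 x" for a x
    unfolding C_op_def A D1 D2 D3 by (simp add: algebra_simps)
  have F: "flux cderiv 1 c (u a) = (\<lambda>x. c 0 0 * (u a x * u a x) + (c 0 1 + c 1 0) * (u a x * u1 x) + c 1 1 * (u1 x * u1 x))" for a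
    by (rule ext) (simp add: flux_eq flux_sum_1[simplified] D1)
  have "deriv (flux cderiv 1 c (u a)) x = c 0 0 * (u1 x * u a x + u1 x * u a x) + (c 0 1 + c 1 0) * (u1 x * u1 x + u2 x * u a x) + c 1 1 * (u2 x * u1 x + u2 x * u1 x)" for a x
    unfolding F by (rule DERIV_imp_deriv, intro DERIV_add DERIV_cmult DERIV_mult d)
  note D = this
  have eq: "2 * u a x * u1 x + u1 x * u2 x = c 0 0 * (u1 x * u a x + u1 x * u a x) + (c 0 1 + c 1 0) * (u1 x * u1 x + u2 x * u a x) + c 1 1 * (u2 x * u1 x + u2 x * u1 x)" for a x
  proof -
    have "C_op 1 (u a) x = - deriv (flux cderiv 1 c (u a)) x" using c s[of a] unfolding flux_coeffs_def by blast
    then show ?thesis unfolding C D by linarith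
  qed
  have kx: "k * (1 / 4) = pi / 2" "k * (1 / 8) = pi / 4" by (simp_all add: k_def)
  have k: "k > 0" by (simp add: k_def)
  have v: "u a (1 / 4) = a" "u1 (1 / 4) = - k" "u2 (1 / 4) = 0" for a unfolding u_def u1_def u2_def kx by simp_all
  have c1: "c 0 1 + c 1 0 = 0" using eq[of 0 "1 / 4"] k unfolding v by simp
  have c0: "c 0 0 = 1" using eq[of 1 "1 / 4"] k unfolding v c1 by simp
  have "sin (k * (1 / 8)) \<noteq> 0" "cos (k * (1 / 8)) \<noteq> 0" unfolding kx sin_45 cos_45 by simp_all
  then have "u1 (1 / 8) * u2 (1 / 8) \<noteq> 0" using k unfolding u1_def u2_def by simp
  moreover have "u1 (1 / 8) * u2 (1 / 8) * (1 - 2 * c 1 1) = 0"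
    using eq[of 0 "1 / 8"] unfolding c1 c0 by (simp add: algebra_simps)
  ultimately have "c 1 1 = 1 / 2" by simp
  with c0 c1 show ?thesis unfolding flux_sum_1 by (simp add: power2_eq_square)
qed

text \<open>Being an indefinite integral, g is continuous; by hypothesis the integrand is then
  continuous at t, and the fundamental theorem of calculus applies. The two signs of the integration
  limit are joined into one interval [- r, r].\<close>

lemma primitive_derivative:
  fixes f g :: "real \<Rightarrow> real"
  assumes t: "t \<in> {-T<..<T}"
    and g: "\<And>t. t \<in> {-T<..<T} \<Longrightarrow> interval_lebesgue_integrable lborel (ereal 0) (ereal t) f \<and> g t = x + (LBINT s=ereal 0..ereal t. f s)"
    and c: "isCont g t \<Longrightarrow> isCont f t"
  shows "(g has_real_derivative f t) (at t)"
proof -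
  define r where "r = (\<bar>t\<bar> + T) / 2"
  have r: "\<bar>t\<bar> < r" "r < T" "0 < r" using t by (auto simp: r_def)
  have p: "f integrable_on {0..s} \<and> g s = x + integral {0..s} f" if "0 \<le> s" "s \<le> r" for s
  proof -
    have "set_integrable lborel {0<..<s} f" "g s = x + (LBINT x:{0<..<s}. f x)"
      using g[of s] that r by (auto simp: interval_lebesgue_integrable_def interval_lebesgue_integral_def)
    then show ?thesis using set_borel_integral_eq_integral[of "{0<..<s}" f]
      by (simp add: integrable_on_open_interval_real integral_open_interval_real)
  qed
  have m: "f integrable_on {s..0} \<and> g s = x - integral {s..0} f" if "s < 0" "- r \<le> s" for s
  proof -
    have "set_integrable lborel {s<..<0} f" "g s = x - (LBINT x:{s<..<0}. f x)"
      using g[of s] that r by (auto simp: interval_lebesgue_integrable_def interval_lebesgue_integral_def)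
    then show ?thesis using set_borel_integral_eq_integral[of "{s<..<0}" f]
      by (simp add: integrable_on_open_interval_real integral_open_interval_real)
  qed
  have i: "f integrable_on {- r..r}"
    by (rule Henstock_Kurzweil_Integration.integrable_combine[of "- r" 0 r]) (use r p[of r] m[of "- r"] in auto)
  have g: "g s = x - integral {- r..0} f + integral {- r..s} f" if "s \<in> {- r..r}" for s
  proof (cases "0 \<le> s")
    case True
    have "integral {- r..0} f + integral {0..s} f = integral {- r..s} f"
      by (rule Henstock_Kurzweil_Integration.integral_combine) (use True that r in \<open>auto intro: integrable_on_subinterval[OF i]\<close>)
    then show ?thesis using p[of s] that True by simp
  next
    case False
    have "integral {- r..s} f + integral {s..0} f = integral {- r..0} f"
      by (rule Henstock_Kurzweil_Integration.integral_combine) (use False that r in \<open>auto intro: integrable_on_subinterval[OF i]\<close>)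
    then show ?thesis using m[of s] that False by simp
  qed
  have ti: "t \<in> {- r<..<r}" "t \<in> {- r..r}" using r by auto
  have "continuous_on {- r..r} (\<lambda>s. x - integral {- r..0} f + integral {- r..s} f)"
    by (intro continuous_intros indefinite_integral_continuous_1 i)
  then have "continuous_on {- r..r} g" by (rule continuous_on_eq) (simp add: g)
  then have "isCont g t"
    using ti by (intro continuous_on_interior[of "{- r..r}" g t]) auto
  from c[OF this] have "continuous (at t within {- r..r}) f" by (rule continuous_within_subset[OF _ subset_UNIV])
  with integral_has_vector_derivative_continuous_at[OF i, of t "{}"] ti(2)
  have "((\<lambda>s. integral {- r..s} f) has_real_derivative f t) (at t within {- r..r})"
    by (simp add: has_real_derivative_iff_has_vector_derivative)
  then have "((\<lambda>s. integral {- r..s} f) has_real_derivative f t) (at t)" using ti by (simp add: at_within_Icc_at)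
  then have "((\<lambda>s. x - integral {- r..0} f + integral {- r..s} f) has_real_derivative f t) (at t)"
    using DERIV_add[OF DERIV_const[of "x - integral {- r..0} f"]] by fastforce
  then show ?thesis
    by (rule has_field_derivative_transform_within_open[OF _ open_greaterThanLessThan ti(1)]) (simp add: g)
qed

section \<open>From the norms of the statement to integrals over intervals\<close>

lemma lbb_abs: "lbb f \<Longrightarrow> lbb (\<lambda>x. \<bar>f x\<bar>)" for f :: "real \<Rightarrow> real"
  unfolding lbb_def by auto

lemma periodic_integral_le:
  fixes g :: "real \<Rightarrow> real"
  assumes g: "lbb g" "periodic1 g" and ab: "a \<le> b" "b \<le> a + 1"
  shows "\<bar>integral {a..b} g\<bar> \<le> integral {0..1} (\<lambda>x. \<bar>g x\<bar>)"
proof -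
  let ?h = "\<lambda>x. \<bar>g x\<bar>"
  note l = lbb_abs[OF g(1)]
  have p: "periodic1 ?h" using g(2) by (simp add: periodic1_def)
  obtain F where F: "ac F ?h" by (rule ac_primitive_exists[OF lbb_absolutely_integrable[OF l], of 0])
  have "\<bar>integral {a..b} g\<bar> \<le> integral {a..b} ?h"
    using Henstock_Kurzweil_Integration.integral_norm_bound_integral[OF lbb_integrable[OF g(1)] lbb_integrable[OF l], of a b] by simp
  also have "\<dots> \<le> integral {a..a + 1} ?h"
    by (rule integral_subset_le) (use ab in \<open>auto intro: lbb_integrable[OF l]\<close>)
  also have "\<dots> = F (a + 1) - F a" by (rule acD[OF F, symmetric]) simp
  also have "\<dots> = F 1 - F 0" by (rule periodic_integral_shift[OF F p])
  also have "\<dots> = integral {0..1} ?h" by (rule acD[OF F]) simp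
  finally show ?thesis .
qed

definition reps :: "nat \<Rightarrow> (real \<Rightarrow> real) \<Rightarrow> (nat \<Rightarrow> real \<Rightarrow> real) \<Rightarrow> bool" where
  "reps k f F \<longleftrightarrow> (\<forall>j\<le>k. lbb (F j) \<and> periodic1 (F j) \<and> weak_deriv j f (F j)) \<and>
     (\<forall>j<k. ac (F j) (F (Suc j))) \<and> ae01 (\<lambda>x. f x = F 0 x)"

lemma Winf_reps: "f \<in> Winf k \<Longrightarrow> \<exists>F. reps k f F"
  unfolding reps_def by (rule Winf_representatives[of f k], assumption) blast

text \<open>An integral over at most one period is bounded by the L1 norm over a period, hence by
  the L2 norm contained in \<open>Hnorm\<close>; so the difference quotients of the integrals
  converge.\<close>

lemma integral_derivative_if_Hnorm:
  assumes hd: "has_deriv_in I (Winf k) (Hnorm k) u v t" and I: "open I" "t \<in> I"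
    and U: "\<And>s i. s \<in> I \<Longrightarrow> i \<le> k \<Longrightarrow> weak_deriv i (u s) (U s i) \<and> lbb (U s i) \<and> periodic1 (U s i)"
    and W: "lbb W" "periodic1 W" "ae01 (\<lambda>x. v x = W x)" and ab: "a \<le> b" "b \<le> a + 1"
  shows "((\<lambda>s. integral {a..b} (U s 0)) has_real_derivative integral {a..b} W) (at t)"
proof -
  have tI: "at t within I = at t" by (rule at_within_open[OF I(2,1)])
  from hd have lim: "((\<lambda>s. Hnorm k (\<lambda>x. (u s x - u t x) / (s - t) - v x)) \<longlongrightarrow> 0) (at t)" and "v \<in> Winf k"
    using tI by (auto simp: has_deriv_in_def)
  from Winf_reps[OF this(2)] obtain G where G: "reps k v G" ..
  then have Gl: "\<And>i. i \<le> k \<Longrightarrow> weak_deriv i v (G i) \<and> lbb (G i) \<and> periodic1 (G i)" and G0: "ae01 (\<lambda>x. v x = G 0 x)"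
    unfolding reps_def by auto
  have "integral {a..b} (\<lambda>x. G 0 x - W x) = 0"
  proof -
    have "\<bar>integral {a..b} (\<lambda>x. G 0 x - W x)\<bar> \<le> integral {0..1} (\<lambda>x. \<bar>G 0 x - W x\<bar>)"
      using Gl[of 0] W by (intro periodic_integral_le lbb_diff ab) (auto simp: periodic1_def)
    also have "\<dots> = integral {0..1::real} (\<lambda>x. 0)"
    proof (rule ae01_integral_eq)
      show "ae01 (\<lambda>x. \<bar>G 0 x - W x\<bar> = 0)" by (rule ae01_mp2[OF G0 W(3)]) simp
    qed auto
    finally show ?thesis by simp
  qed
  then have GW: "integral {a..b} (G 0) = integral {a..b} W"
    using Henstock_Kurzweil_Integration.integral_diff[OF lbb_integrable[of "G 0" a b] lbb_integrable[OF W(1)]] Gl[of 0] by simp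
  let ?q = "\<lambda>s. (integral {a..b} (U s 0) - integral {a..b} (U t 0)) / (s - t)"
  have le: "\<bar>?q s - integral {a..b} W\<bar> \<le> Hnorm k (\<lambda>x. (u s x - u t x) / (s - t) - v x)" if s: "s \<in> I" for s
  proof -
    let ?F = "\<lambda>i x. (U s i x - U t i x) / (s - t) - G i x"
    have l': "lbb (\<lambda>x. inverse (s - t) * (U s 0 x - U t 0 x) - G 0 x)"
      using U[OF s, of 0] U[OF I(2), of 0] Gl[of 0] by (intro lbb_diff lbb_mult lbb_const) auto
    then have l: "lbb (?F 0)" by (simp add: divide_inverse mult.commute)
    have p: "periodic1 (?F 0)" using U[OF s, of 0] U[OF I(2), of 0] Gl[of 0] by (simp add: periodic1_def)
    have "integral {a..b} (\<lambda>x. inverse (s - t) * (U s 0 x - U t 0 x) - G 0 x) = inverse (s - t) * (integral {a..b} (U s 0) - integral {a..b} (U t 0)) - integral {a..b} (G 0)"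
    proof -
      have i: "lbb (U s 0)" "lbb (U t 0)" "lbb (G 0)" using U[OF s, of 0] U[OF I(2), of 0] Gl[of 0] by auto
      show ?thesis
        by (simp only: Henstock_Kurzweil_Integration.integral_diff[OF lbb_integrable[OF lbb_mult[OF lbb_const lbb_diff[OF i(1,2)]]] lbb_integrable[OF i(3)]]
           Henstock_Kurzweil_Integration.integral_mult_right Henstock_Kurzweil_Integration.integral_diff[OF lbb_integrable[OF i(1)] lbb_integrable[OF i(2)]])
    qed
    then have "?q s - integral {a..b} W = integral {a..b} (?F 0)" unfolding GW by (simp add: divide_inverse mult.commute)
    also have "\<bar>\<dots>\<bar> \<le> integral {0..1} (\<lambda>x. \<bar>?F 0 x\<bar>)" by (rule periodic_integral_le[OF l p ab])
    also have "\<dots> \<le> Hnorm k (\<lambda>x. (u s x - u t x) / (s - t) - v x)"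
    proof (rule Hnorm_L2_bound(1)[where F = ?F and j = 0])
      show "weak_deriv i (\<lambda>x. (u s x - u t x) / (s - t) - v x) (?F i)" if "i \<le> k" for i
        using U[OF s that] U[OF I(2) that] Gl[OF that] by (intro weak_deriv_lincomb) auto
    qed (use l in simp_all)
    finally show ?thesis .
  qed
  have "((\<lambda>s. ?q s - integral {a..b} W) \<longlongrightarrow> 0) (at t)"
    by (rule Lim_null_comparison[OF _ lim]) (rule eventually_mono[OF eventually_at_in_open'[OF I]], use le in simp)
  then show ?thesis unfolding has_field_derivative_iff by (rule LIM_zero_cancel)
qed

lemma L2_continuity_if_Hnorm:
  assumes c: "C0_in I (Winf k) (Hnorm k) u" and I: "open I" "t \<in> I" and j: "j \<le> k"
    and U: "\<And>s i. s \<in> I \<Longrightarrow> i \<le> k \<Longrightarrow> weak_deriv i (u s) (U s i) \<and> lbb (U s i)"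
  shows "((\<lambda>s. integral {0..1} (\<lambda>y. (U s j y - U t j y)\<^sup>2)) \<longlongrightarrow> 0) (at t)"
proof -
  have tI: "at t within I = at t" by (rule at_within_open[OF I(2,1)])
  have "((\<lambda>s. Hnorm k (\<lambda>x. u s x - u t x)) \<longlongrightarrow> 0) (at t)" using c I(2) tI unfolding C0_in_def by metis
  from tendsto_power[OF this, of 2] have lim: "((\<lambda>s. (Hnorm k (\<lambda>x. u s x - u t x))\<^sup>2) \<longlongrightarrow> 0) (at t)" by simp
  have le: "norm (integral {0..1} (\<lambda>y. (U s j y - U t j y)\<^sup>2)) \<le> (Hnorm k (\<lambda>x. u s x - u t x))\<^sup>2" if s: "s \<in> I" for s
  proof -
    have l: "lbb (\<lambda>y. U s j y - U t j y)" using U[OF s j] U[OF I(2) j] by (intro lbb_diff) auto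
    have "integral {0..1} (\<lambda>y. (U s j y - U t j y)\<^sup>2) \<le> (Hnorm k (\<lambda>x. u s x - u t x))\<^sup>2"
    proof (rule Hnorm_L2_bound(2)[where F = "\<lambda>i y. U s i y - U t i y" and j = j, OF _ l j])
      show "weak_deriv i (\<lambda>x. u s x - u t x) (\<lambda>y. U s i y - U t i y)" if "i \<le> k" for i
        using weak_deriv_add_scale[of i "u s" "U s i" "u t" "U t i" "- 1"] U[OF s that] U[OF I(2) that] by simp
    qed
    moreover have "0 \<le> integral {0..1} (\<lambda>y. (U s j y - U t j y)\<^sup>2)"
      by (rule Henstock_Kurzweil_Integration.integral_nonneg[OF lbb_integrable[OF lbb_power[OF l]]]) simp
    ultimately show ?thesis by simp
  qed
  show ?thesis
    by (rule Lim_null_comparison[OF _ lim]) (rule eventually_mono[OF eventually_at_in_open'[OF I] le])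
qed

lemma flux_sum_cong: "(\<And>m. m \<le> 2 * l - 1 \<Longrightarrow> w m = w' m) \<Longrightarrow> flux_sum l c w = flux_sum l c w'"
  unfolding flux_sum_def by (rule sum.cong) auto

text \<open>Membership in \<open>Hk\<close> gives only square integrable derivatives. Those below
  the top order are bounded as primitives of integrable functions, and the equation A P = F then
  bounds the top one.\<close>

lemma pressure_representatives:
  assumes P: "P \<in> Hk (2 * l)" and l: "l \<ge> 1" and eq: "ae01 (\<lambda>x. A_op wderiv l P x = flux wderiv l c u x)"
    and U: "\<And>j. j \<le> 2 * l - 1 \<Longrightarrow> weak_deriv j u (U j) \<and> lbb (U j) \<and> periodic1 (U j)"
  obtains F where "\<And>j. j \<le> 2 * l \<Longrightarrow> lbb (F j)" "\<And>j. j \<le> 2 * l \<Longrightarrow> periodic1 (F j)" "\<And>j. j < 2 * l \<Longrightarrow> ac (F j) (F (Suc j))"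
    "ae01 (\<lambda>x. wderiv 1 P x = F 1 x)" "AE x in lborel. (\<Sum>j\<le>l. (-1) ^ j * F (2 * j) x) = flux_sum l c (\<lambda>m. U m x)"
proof -
  define g where "g j = wderiv j P" for j
  have w: "weak_deriv j P (g j)" if "j \<le> 2 * l" for j
    using P that unfolding Hk_def g_def by (auto intro: weak_deriv_wderiv)
  let ?f = "\<lambda>x. flux_sum l c (\<lambda>m. U m x)"
  have "ae01 (\<lambda>x. m \<le> 2 * l - 1 \<longrightarrow> wderiv m u x = U m x)" for m
    using wderiv_ae[of m u "U m"] U[of m] by (cases "m \<le> 2 * l - 1") (auto intro: ae01_always)
  then have "ae01 (\<lambda>x. \<forall>m. m \<le> 2 * l - 1 \<longrightarrow> wderiv m u x = U m x)" by (rule ae01_all_nat)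
  with eq have eq': "ae01 (\<lambda>x. (\<Sum>j\<le>l. (-1) ^ j * g (2 * j) x) = ?f x)"
  proof (rule ae01_mp2)
    fix x assume *: "A_op wderiv l P x = flux wderiv l c u x" and "\<forall>m. m \<le> 2 * l - 1 \<longrightarrow> wderiv m u x = U m x"
    then have "flux_sum l c (\<lambda>m. wderiv m u x) = ?f x" by (intro flux_sum_cong) auto
    with * show "(\<Sum>j\<le>l. (-1) ^ j * g (2 * j) x) = ?f x" by (simp add: A_op_def flux_eq g_def)
  qed
  have lf: "lbb ?f" unfolding flux_sum_def case_prod_beta'
    by (intro lbb_sum lbb_mult lbb_const) (use U in auto)
  have "U m (x + 1) = U m x" if "m \<le> 2 * l - 1" for m x using U[OF that] by (simp add: periodic1_def)
  then have pf: "periodic1 ?f" unfolding periodic1_def by (intro allI flux_sum_cong)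
  obtain Bf where Bf: "\<And>x. \<bar>?f x\<bar> \<le> Bf" using periodic_lbb_bounded[OF lf pf] by metis
  have lower: "\<exists>B. ae01 (\<lambda>x. \<bar>g j x\<bar> \<le> B)" if "j < 2 * l" for j
  proof -
    have w1: "weak_deriv 1 (g j) (g (Suc j))" using w that by (intro weak_deriv_step[OF w[of j] w[of "Suc j"]]) auto
    from weak_deriv_1_primitive(2)[OF this] obtain k where k: "ae01 (\<lambda>x. g j x = k + integral {0..x} (g (Suc j)))" ..
    note ai = weak_derivD(4)[OF w1]
    have i1: "(\<lambda>x. \<bar>g (Suc j) x\<bar>) integrable_on {0..1}" using iffD1[OF absolutely_integrable_on_def ai] by simp
    have "ae01 (\<lambda>x. \<bar>g j x\<bar> \<le> \<bar>k\<bar> + integral {0..1} (\<lambda>x. \<bar>g (Suc j) x\<bar>))"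
    proof (rule ae01_mp2[OF k ae01_always[of "\<lambda>x. x \<in> {0..<1}"]])
      fix x :: real assume *: "g j x = k + integral {0..x} (g (Suc j))" and x: "x \<in> {0..<1}"
      have "\<bar>integral {0..x} (g (Suc j))\<bar> \<le> integral {0..x} (\<lambda>x. \<bar>g (Suc j) x\<bar>)"
        using Henstock_Kurzweil_Integration.integral_norm_bound_integral[of "g (Suc j)" "{0..x}" "\<lambda>x. \<bar>g (Suc j) x\<bar>"]
          integrable_on_subinterval[OF absint_integrable[OF ai], of 0 x] integrable_on_subinterval[OF i1, of 0 x] x by auto
      also have "\<dots> \<le> integral {0..1} (\<lambda>x. \<bar>g (Suc j) x\<bar>)"
        by (rule integral_subset_le) (use x integrable_on_subinterval[OF i1, of 0 x] i1 in auto)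
      finally show "\<bar>g j x\<bar> \<le> \<bar>k\<bar> + integral {0..1} (\<lambda>x. \<bar>g (Suc j) x\<bar>)" unfolding * by linarith
    qed simp
    then show ?thesis ..
  qed
  have b: "\<exists>B. ae01 (\<lambda>x. \<bar>g j x\<bar> \<le> B)" if "j \<le> 2 * l" for j
  proof (cases "j < 2 * l")
    case True then show ?thesis by (rule lower)
  next
    case False
    from lower have "\<exists>B. i < l \<longrightarrow> ae01 (\<lambda>x. \<bar>g (2 * i) x\<bar> \<le> B)" for i by (cases "i < l") auto
    then obtain B where B: "\<And>i. i < l \<Longrightarrow> ae01 (\<lambda>x. \<bar>g (2 * i) x\<bar> \<le> B i)" by metis
    then have "ae01 (\<lambda>x. i < l \<longrightarrow> \<bar>g (2 * i) x\<bar> \<le> B i)" for i by (cases "i < l") (auto intro: ae01_always)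
    then have "ae01 (\<lambda>x. \<forall>i. i < l \<longrightarrow> \<bar>g (2 * i) x\<bar> \<le> B i)" by (rule ae01_all_nat)
    with eq' have "ae01 (\<lambda>x. \<bar>g (2 * l) x\<bar> \<le> Bf + (\<Sum>i<l. B i))"
    proof (rule ae01_mp2)
      fix x assume e: "(\<Sum>j\<le>l. (-1) ^ j * g (2 * j) x) = ?f x" and Bx: "\<forall>i. i < l \<longrightarrow> \<bar>g (2 * i) x\<bar> \<le> B i"
      have "\<bar>\<Sum>j<l. (-1) ^ j * g (2 * j) x\<bar> \<le> (\<Sum>j<l. \<bar>(-1) ^ j * g (2 * j) x\<bar>)" by (rule sum_abs)
      also have "\<dots> \<le> (\<Sum>i<l. B i)" by (rule sum_mono) (use Bx in \<open>simp add: abs_mult power_abs\<close>)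
      finally have "\<bar>(-1) ^ l * g (2 * l) x\<bar> \<le> Bf + (\<Sum>i<l. B i)"
        using e Bf[of x] by (simp add: lessThan_Suc_atMost[symmetric])
      then show "\<bar>g (2 * l) x\<bar> \<le> Bf + (\<Sum>i<l. B i)" by (simp add: abs_mult power_abs)
    qed
    moreover have "j = 2 * l" using False that by simp
    ultimately show ?thesis by blast
  qed
  show thesis
  proof (rule weak_deriv_chain_representatives[of "2 * l" P g, OF w b])
    fix F assume F: "\<And>j. j \<le> 2 * l \<Longrightarrow> lbb (F j)" "\<And>j. j \<le> 2 * l \<Longrightarrow> periodic1 (F j)"
      "\<And>j. j \<le> 2 * l \<Longrightarrow> ae01 (\<lambda>x. g j x = F j x)" "\<And>j. j < 2 * l \<Longrightarrow> ac (F j) (F (Suc j))"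
    have "ae01 (\<lambda>x. j \<le> 2 * l \<longrightarrow> g j x = F j x)" for j using F(3)[of j] by (cases "j \<le> 2 * l") (auto intro: ae01_always)
    then have "ae01 (\<lambda>x. \<forall>j. j \<le> 2 * l \<longrightarrow> g j x = F j x)" by (rule ae01_all_nat)
    with eq' have "ae01 (\<lambda>x. (\<Sum>j\<le>l. (-1) ^ j * F (2 * j) x) = ?f x)"
    proof (rule ae01_mp2)
      fix x assume e: "(\<Sum>j\<le>l. (-1) ^ j * g (2 * j) x) = ?f x" and *: "\<forall>j. j \<le> 2 * l \<longrightarrow> g j x = F j x"
      have "(\<Sum>j\<le>l. (-1) ^ j * F (2 * j) x) = (\<Sum>j\<le>l. (-1) ^ j * g (2 * j) x)" by (rule sum.cong) (use * in auto)
      with e show "(\<Sum>j\<le>l. (-1) ^ j * F (2 * j) x) = ?f x" by simp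
    qed
    then have "AE x in lborel. (\<Sum>j\<le>l. (-1) ^ j * F (2 * j) x) = ?f x"
    proof (rule AE_lborel_if_periodic)
      fix x assume e: "(\<Sum>j\<le>l. (-1) ^ j * F (2 * j) (frac x)) = ?f (frac x)"
      have "(\<Sum>j\<le>l. (-1) ^ j * F (2 * j) x) = (\<Sum>j\<le>l. (-1) ^ j * F (2 * j) (frac x))"
        by (rule sum.cong) (auto simp: periodic1_frac[OF F(2)])
      then show "(\<Sum>j\<le>l. (-1) ^ j * F (2 * j) x) = ?f x" using e periodic1_frac[OF pf, of x] by simp
    qed
    moreover have f1: "ae01 (\<lambda>x. wderiv 1 P x = F 1 x)" using F(3)[of 1] l by (simp add: g_def)
    ultimately show thesis by (intro that[OF F(1,2,4) f1])
  qed
qed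

section \<open>Velocity along trajectories\<close>

context lagrangian_data
begin

lemma velocity_continuous:
  assumes t: "t \<in> I" and g: "isCont g t" and f: "\<And>s. s \<in> I \<Longrightarrow> f s = U 0 s (g s)"
  shows "isCont f t"
  unfolding isCont_def
proof (rule tendstoI)
  fix e :: real assume e: "e > 0"
  have c: "isCont (U 0 t) (g t)" using ac_continuous[OF U(3)[OF t n1(2)]] continuous_on_eq_continuous_at open_UNIV by blast
  have "isCont (\<lambda>s. U 0 t (g s)) t" by (rule isCont_o2[OF g c])
  then have "\<forall>\<^sub>F s in at t. dist (U 0 t (g s)) (U 0 t (g t)) < e / 2" unfolding isCont_def by (rule tendstoD) (use e in simp)
  moreover have "\<forall>\<^sub>F s in at t. s \<in> I \<and> (\<forall>y. \<bar>U 0 s y - U 0 t y\<bar> < e / 2)" by (rule U_uniform[OF t n1(2)]) (use e in simp)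
  ultimately show "\<forall>\<^sub>F s in at t. dist (f s) (f t) < e"
  proof eventually_elim
    case (elim s)
    then have 1: "\<bar>U 0 s (g s) - U 0 t (g s)\<bar> < e / 2" and fs: "f s = U 0 s (g s)" using f by blast+
    have 2: "\<bar>U 0 t (g s) - U 0 t (g t)\<bar> < e / 2" using elim(1) by (simp only: dist_real_def)
    show ?case unfolding fs f[OF t] dist_real_def using 1 2 by linarith
  qed
qed

text \<open>\<open>X 0\<close> agrees with the displacement only for almost every x, with a null set
  that depends on the time. Along a sequence of times converging to t one null set suffices, and
  outside it both difference quotients have the same limit. Continuity in x removes the null
  set.\<close>

lemma velocity_along_flow:
  assumes t: "t \<in> I" and D: "\<And>t. t \<in> I \<Longrightarrow> ae01 (\<lambda>x. \<xi> t x - x = X 0 t x)"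
    and fl: "\<And>x. ((\<lambda>s. \<xi> s x) has_real_derivative U 0 t (\<xi> t x)) (at t)" and pV: "periodic1 (V 0 t)"
  shows "V 0 t x = U 0 t (x + X 0 t x)"
proof -
  obtain e where e: "e > 0" "ball t e \<subseteq> I" using I t open_contains_ball by blast
  \<comment> \<open>The shift k + 2 keeps s k within distance e of t, hence in I, and different from
    t.\<close>
  define s where "s k = t + e / real (k + 2)" for k :: nat
  have q: "0 < e / real (k + 2)" "e / real (k + 2) < e" for k using e(1) by (simp_all add: divide_less_eq)
  have sI: "s k \<in> I" "s k \<noteq> t" for k
  proof -
    have "s k \<in> ball t e" using q[of k] by (simp add: s_def dist_real_def)
    then show "s k \<in> I" using e(2) by blast
    show "s k \<noteq> t" using q[of k] by (simp add: s_def)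
  qed
  have "(\<lambda>k. e / real (k + 2)) \<longlonglongrightarrow> 0" by (rule LIMSEQ_ignore_initial_segment[OF lim_const_over_n])
  from tendsto_add[OF tendsto_const this, of t] have st: "s \<longlonglongrightarrow> t" unfolding s_def[abs_def] by simp
  have sl: "filterlim s (at t) sequentially" by (rule filterlim_atI[OF st]) (use sI in simp)
  have m: "ae01 (\<lambda>x. x \<in> {0..<1})" by (rule ae01_always)
  have a: "ae01 (\<lambda>x. \<forall>k. \<xi> (s k) x - x = X 0 (s k) x)" by (rule ae01_all_nat[OF D[OF sI(1)]])
  have "ae01 (\<lambda>x. V 0 t x - U 0 t (xi t x) \<in> {0})"
  proof (rule ae01_mp2[OF ae01_conj[OF a D[OF t]] m])
    fix x assume *: "(\<forall>k. \<xi> (s k) x - x = X 0 (s k) x) \<and> \<xi> t x - x = X 0 t x" and x: "x \<in> {0..<1::real}"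
    have q1: "((\<lambda>r. (X 0 r x - X 0 t x) / (r - t)) \<longlongrightarrow> V 0 t x) (at t)"
      using X0_derivative[OF t, of x] x by (simp add: has_field_derivative_iff)
    have q2: "((\<lambda>r. (\<xi> r x - \<xi> t x) / (r - t)) \<longlongrightarrow> U 0 t (\<xi> t x)) (at t)"
      using fl[of x] by (simp add: has_field_derivative_iff)
    have l1: "(\<lambda>k. (X 0 (s k) x - X 0 t x) / (s k - t)) \<longlonglongrightarrow> V 0 t x" by (rule filterlim_compose[OF q1 sl])
    have l2: "(\<lambda>k. (\<xi> (s k) x - \<xi> t x) / (s k - t)) \<longlonglongrightarrow> U 0 t (\<xi> t x)" by (rule filterlim_compose[OF q2 sl])
    have "X 0 (s k) x - X 0 t x = \<xi> (s k) x - \<xi> t x" for k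
      using spec[OF conjunct1[OF *], of k] conjunct2[OF *] by linarith
    with l1 have "(\<lambda>k. (\<xi> (s k) x - \<xi> t x) / (s k - t)) \<longlonglongrightarrow> V 0 t x" by (simp only:)
    from LIMSEQ_unique[OF this l2] have "V 0 t x = U 0 t (\<xi> t x)" .
    moreover have "\<xi> t x = xi t x" using conjunct2[OF *] unfolding xi_def by linarith
    ultimately show "V 0 t x - U 0 t (xi t x) \<in> {0}" by simp
  qed
  moreover have "continuous_on UNIV (\<lambda>x. V 0 t x - U 0 t (xi t x))"
    by (intro continuous_intros continuous_on_compose2[OF ac_continuous[OF U(3)[OF t n1(2)]] ac_continuous[OF xi_ac[OF t]]]
        ac_continuous[OF V(2)[OF t n1(2)]]) simp
  ultimately have "V 0 t (frac x) - U 0 t (xi t (frac x)) \<in> {0}"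
    by (rule ae01_continuous_closed) (auto simp: frac_lt_1 less_imp_le)
  then have "V 0 t x = U 0 t (frac x + X 0 t x)"
    using periodic1_frac[OF pV] periodic1_frac[OF X(2)[OF t le0]] by (simp add: xi_def)
  also have "\<dots> = U 0 t ((frac x + X 0 t x) + of_int \<lfloor>x\<rfloor>)" by (rule periodic1_shift[OF U(2)[OF t le0], symmetric])
  also have "(frac x + X 0 t x) + of_int \<lfloor>x\<rfloor> = x + X 0 t x" by (simp add: frac_def)
  finally show ?thesis .
qed

end

text \<open>The regularity of the flow contained in \<open>lwp_solution\<close> supplies X and V.
  Representatives are chosen at each time separately, since the regularity in time concerns only
  their classes.\<close>

lemma lagrangian_formulation:
  assumes l: "l \<ge> 1" and lwp: "lwp_solution l c T u0 u" and fl: "flow_map T u \<xi>"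
  shows "\<exists>X V U P. lagrangian l (2 * l - 1) c {-T<..<T} X V U P \<and>
     (\<forall>t\<in>{-T<..<T}. \<forall>j\<le>2 * l - 1. weak_deriv j (displacement \<xi> t) (X j t))"
proof -
  define I where "I = {-T<..<T}"
  define n where "n = 2 * l - 1"
  have I: "open I" by (simp add: I_def)
  have n1: "1 \<le> n" using l by (simp add: n_def)
  have sol: "solution l c T u0 u" and disp: "C1_in I (Winf n) (Wnorm n) (displacement \<xi>)"
    using lwp fl unfolding lwp_solution_def I_def n_def by blast+
  from disp obtain v where D0: "C0_in I (Winf n) (Wnorm n) (displacement \<xi>)"
    and hd: "\<forall>t\<in>I. has_deriv_in I (Winf n) (Wnorm n) (displacement \<xi>) (v t) t" and v0: "C0_in I (Winf n) (Wnorm n) v"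
    unfolding C1_in_def by blast
  have u0: "C0_in I (Winf n) (Hnorm n) u" using sol unfolding solution_def I_def n_def by blast
  have "\<exists>X. \<forall>t\<in>I. reps n (displacement \<xi> t) (X t)" "\<exists>X. \<forall>t\<in>I. reps n (v t) (X t)" "\<exists>X. \<forall>t\<in>I. reps n (u t) (X t)"
    using D0 v0 u0 Winf_reps unfolding C0_in_def by (intro bchoice; blast)+
  then obtain X' V' U' where X': "\<forall>t\<in>I. reps n (displacement \<xi> t) (X' t)" and V': "\<forall>t\<in>I. reps n (v t) (V' t)"
    and U': "\<forall>t\<in>I. reps n (u t) (U' t)" by blast
  have rD: "lbb (F j)" "periodic1 (F j)" "weak_deriv j f (F j)" if "reps n f F" "j \<le> n" for f F j
    using that unfolding reps_def by auto
  have rA: "ac (F j) (F (Suc j))" if "reps n f F" "j < n" for f F j using that unfolding reps_def by auto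
  have r0: "ae01 (\<lambda>x. f x = F 0 x)" if "reps n f F" for f F using that unfolding reps_def by auto
  have "\<exists>F. (\<forall>j\<le>2 * l. lbb (F j) \<and> periodic1 (F j)) \<and> (\<forall>j<2 * l. ac (F j) (F (Suc j))) \<and>
      (AE x in lborel. (\<Sum>j\<le>l. (-1) ^ j * F (2 * j) x) = flux_sum l c (\<lambda>m. U' t m x)) \<and>
      (\<forall>a b. a \<le> b \<longrightarrow> b \<le> a + 1 \<longrightarrow> ((\<lambda>s. integral {a..b} (U' s 0)) has_real_derivative - integral {a..b} (\<lambda>y. U' t 0 y * U' t 1 y + F 1 y)) (at t))"
    if t: "t \<in> I" for t
  proof -
    have "\<exists>w. \<exists>P\<in>Hk (2 * l). has_deriv_in I (Winf (2 * l - 2)) (Hnorm (2 * l - 2)) u w t \<and>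
        ae01 (\<lambda>x. A_op wderiv l P x = flux wderiv l c (u t) x) \<and> ae01 (\<lambda>x. w x + u t x * wderiv 1 (u t) x + wderiv 1 P x = 0)"
      using sol t unfolding solution_def I_def AE_torus_iff by blast
    then obtain w P where w: "P \<in> Hk (2 * l)" "has_deriv_in I (Winf (2 * l - 2)) (Hnorm (2 * l - 2)) u w t"
      "ae01 (\<lambda>x. A_op wderiv l P x = flux wderiv l c (u t) x)" "ae01 (\<lambda>x. w x + u t x * wderiv 1 (u t) x + wderiv 1 P x = 0)" by blast
    note Ut = U'[rule_format, OF t]
    have Un: "weak_deriv j (u t) (U' t j) \<and> lbb (U' t j) \<and> periodic1 (U' t j)" if "j \<le> 2 * l - 1" for j
      using rD[OF Ut, of j] that unfolding n_def by blast
    show ?thesis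
    proof (rule pressure_representatives[where U = "U' t" and u = "u t" and P = P and l = l and c = c, OF w(1) l w(3) Un])
      fix F assume F: "\<And>j. j \<le> 2 * l \<Longrightarrow> lbb (F j)" "\<And>j. j \<le> 2 * l \<Longrightarrow> periodic1 (F j)" "\<And>j. j < 2 * l \<Longrightarrow> ac (F j) (F (Suc j))"
        "ae01 (\<lambda>x. wderiv 1 P x = F 1 x)" "AE x in lborel. (\<Sum>j\<le>l. (-1) ^ j * F (2 * j) x) = flux_sum l c (\<lambda>m. U' t m x)"
      \<comment> \<open>The time derivative of u predicted by the equation, as a function with
        values everywhere; the derivative w in the sense of \<open>Hnorm\<close> equals it almost
        everywhere.\<close>
      define W where "W y = - (U' t 0 y * U' t 1 y + F 1 y)" for y
      have l2: "1 \<le> 2 * l" using l by simp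
      have lW: "lbb W" unfolding W_def[abs_def] by (intro lbb_uminus lbb_add lbb_mult rD(1)[OF Ut] le0 n1 F(1) l2)
      have pW: "periodic1 W" using rD(2)[OF Ut le0] rD(2)[OF Ut n1] F(2)[OF l2] unfolding W_def periodic1_def by simp
      have "ae01 (\<lambda>x. u t x = U' t 0 x \<and> wderiv 1 (u t) x = U' t 1 x)"
        by (rule ae01_conj[OF r0[OF Ut] wderiv_ae[OF rD(3)[OF Ut n1]]])
      then have wW: "ae01 (\<lambda>x. w x = W x)"
      proof (rule ae01_mp2[OF _ ae01_conj[OF w(4) F(4)]])
        fix x assume a: "u t x = U' t 0 x \<and> wderiv 1 (u t) x = U' t 1 x" and b: "w x + u t x * wderiv 1 (u t) x + wderiv 1 P x = 0 \<and> wderiv 1 P x = F 1 x"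
        have "w x + U' t 0 x * U' t 1 x + F 1 x = 0"
          using conjunct1[OF b] unfolding conjunct2[OF b] conjunct1[OF a] conjunct2[OF a] .
        then show "w x = W x" unfolding W_def by linarith
      qed
      have der: "((\<lambda>s. integral {a..b} (U' s 0)) has_real_derivative - integral {a..b} (\<lambda>y. U' t 0 y * U' t 1 y + F 1 y)) (at t)"
        if "a \<le> b" "b \<le> a + 1" for a b
      proof -
        have "((\<lambda>s. integral {a..b} (U' s 0)) has_real_derivative integral {a..b} W) (at t)"
        proof (rule integral_derivative_if_Hnorm[OF w(2) I t _ lW pW wW that])
          fix s i assume "s \<in> I" "i \<le> 2 * l - 2"
          then show "weak_deriv i (u s) (U' s i) \<and> lbb (U' s i) \<and> periodic1 (U' s i)"
            using rD[OF U'[rule_format], of s i] unfolding n_def by simp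
        qed
        also have "integral {a..b} W = - integral {a..b} (\<lambda>y. U' t 0 y * U' t 1 y + F 1 y)"
          unfolding W_def[abs_def] by (rule Henstock_Kurzweil_Integration.integral_neg)
        finally show ?thesis .
      qed
      show ?thesis using F der by (intro exI[of _ F]) blast
    qed
  qed
  then have "\<forall>t\<in>I. \<exists>F. (\<forall>j\<le>2 * l. lbb (F j) \<and> periodic1 (F j)) \<and> (\<forall>j<2 * l. ac (F j) (F (Suc j))) \<and>
      (AE x in lborel. (\<Sum>j\<le>l. (-1) ^ j * F (2 * j) x) = flux_sum l c (\<lambda>m. U' t m x)) \<and>
      (\<forall>a b. a \<le> b \<longrightarrow> b \<le> a + 1 \<longrightarrow> ((\<lambda>s. integral {a..b} (U' s 0)) has_real_derivative - integral {a..b} (\<lambda>y. U' t 0 y * U' t 1 y + F 1 y)) (at t))"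
    by blast
  from bchoice[OF this] obtain P' where P': "\<forall>t\<in>I. (\<forall>j\<le>2 * l. lbb (P' t j) \<and> periodic1 (P' t j)) \<and> (\<forall>j<2 * l. ac (P' t j) (P' t (Suc j))) \<and>
      (AE x in lborel. (\<Sum>j\<le>l. (-1) ^ j * P' t (2 * j) x) = flux_sum l c (\<lambda>m. U' t m x)) \<and>
      (\<forall>a b. a \<le> b \<longrightarrow> b \<le> a + 1 \<longrightarrow> ((\<lambda>s. integral {a..b} (U' s 0)) has_real_derivative - integral {a..b} (\<lambda>y. U' t 0 y * U' t 1 y + P' t 1 y)) (at t))"
    by blast
  note Xt = X'[rule_format] and Vt = V'[rule_format] and Ut = U'[rule_format]
  have base: "lagrangian_data l n c I (\<lambda>j t. X' t j) (\<lambda>j t. V' t j) (\<lambda>j t. U' t j) (\<lambda>j t. P' t j)"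
  proof unfold_locales
    show "1 \<le> l" by (rule l)
    show "n = 2 * l - 1" by (rule n_def)
    show "open I" by (rule I)
    fix t assume t: "t \<in> I"
    show "AE y in lborel. (\<Sum>j\<le>l. (- 1) ^ j * P' t (2 * j) y) = flux_sum l c (\<lambda>m. U' t m y)" using P' t by blast
    show "((\<lambda>s. integral {a..b} (U' s 0)) has_real_derivative - integral {a..b} (\<lambda>y. U' t 0 y * U' t 1 y + P' t 1 y)) (at t)"
      if "a \<le> b" "b \<le> a + 1" for a b using P' t that by blast
    show "lbb (P' t j)" "periodic1 (P' t j)" if "j \<le> 2 * l" for j using P' t that by blast+
    show "ac (P' t j) (P' t (Suc j))" if "j < 2 * l" for j using P' t that by blast
    show "ac (X' t j) (X' t (Suc j))" "ac (V' t j) (V' t (Suc j))" "ac (U' t j) (U' t (Suc j))" if "j < n" for j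
      by (rule rA[OF Xt[OF t] that], rule rA[OF Vt[OF t] that], rule rA[OF Ut[OF t] that])
    fix j assume j: "j \<le> n"
    show "lbb (X' t j)" "periodic1 (X' t j)" by (rule rD(1,2)[OF Xt[OF t] j])+
    show "lbb (V' t j)" by (rule rD(1)[OF Vt[OF t] j])
    show "lbb (U' t j)" "periodic1 (U' t j)" by (rule rD(1,2)[OF Ut[OF t] j])+
    show "((\<lambda>s. rcls (X' s j)) has_vector_derivative rcls (V' t j)) (at t)"
      by (rule Wnorm_derivative(1)[where F = "\<lambda>i s. X' s i" and G = "V' t", OF hd[rule_format, OF t] I t j rD(3)[OF Xt] rD(1)[OF Xt] rD(3)[OF Vt[OF t]] rD(1)[OF Vt[OF t]]])
    show "((\<lambda>s. integral {0..1} (\<lambda>y. (U' s j y - U' t j y)\<^sup>2)) \<longlongrightarrow> 0) (at t)"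
      by (rule L2_continuity_if_Hnorm[OF u0 I t j]) (use rD Ut in blast)
  next
    fix j assume j: "j \<le> n"
    show "continuous_on I (\<lambda>t. rcls (V' t j))"
      by (rule Wnorm_continuous[where F = "\<lambda>i s. V' s i", OF v0 j rD(3)[OF Vt] rD(1)[OF Vt]])
  qed
  from fl obtain Uf where Uf: "\<forall>t\<in>I. periodic1 (Uf t) \<and> continuous_on UNIV (Uf t) \<and> ae01 (\<lambda>x. Uf t x = u t x)"
    and xi: "\<forall>t\<in>I. \<forall>x. \<xi> t (x + 1) = \<xi> t x + 1 \<and> interval_lebesgue_integrable lborel (ereal 0) (ereal t) (\<lambda>s. Uf s (\<xi> s x)) \<and>
       \<xi> t x = x + (LBINT s=ereal 0..ereal t. Uf s (\<xi> s x))"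
    unfolding flow_map_def AE_torus_iff I_def by blast
  \<comment> \<open>Two continuous representatives of u t coincide at every point, so the flow
    equation can be read with either.\<close>
  have UfU: "Uf t y = U' t 0 y" if t: "t \<in> I" for t y
  proof -
    note U1 = Uf[rule_format, OF t]
    have "ae01 (\<lambda>x. Uf t x - U' t 0 x \<in> {0})"
      by (rule ae01_mp2[OF conjunct2[OF conjunct2[OF U1]] r0[OF Ut[OF t]]]) simp
    moreover have "continuous_on UNIV (\<lambda>x. Uf t x - U' t 0 x)"
      using U1 ac_continuous[OF rA[OF Ut[OF t], of 0]] n1 by (intro continuous_intros) auto
    ultimately have "Uf t (frac y) - U' t 0 (frac y) \<in> {0}" by (rule ae01_continuous_closed) (auto simp: frac_lt_1 less_imp_le)
    then show ?thesis using periodic1_frac[OF conjunct1[OF U1]] periodic1_frac[OF rD(2)[OF Ut[OF t] le0]] by simp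
  qed
  have flow: "((\<lambda>s. \<xi> s x) has_real_derivative U' t 0 (\<xi> t x)) (at t)" if t: "t \<in> I" for t x
  proof -
    have "((\<lambda>s. \<xi> s x) has_real_derivative (\<lambda>s. Uf s (\<xi> s x)) t) (at t)"
    proof (rule primitive_derivative[where T = T and x = x])
      show "t \<in> {-T<..<T}" using t by (simp add: I_def)
      show "interval_lebesgue_integrable lborel (ereal 0) (ereal r) (\<lambda>s. Uf s (\<xi> s x)) \<and> \<xi> r x = x + (LBINT s=ereal 0..ereal r. Uf s (\<xi> s x))"
        if "r \<in> {-T<..<T}" for r using xi that unfolding I_def by blast
      show "isCont (\<lambda>s. Uf s (\<xi> s x)) t" if "isCont (\<lambda>s. \<xi> s x) t"
        by (rule lagrangian_data.velocity_continuous[OF base t that]) (rule UfU)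
    qed
    then show ?thesis by (simp only: UfU[OF t])
  qed
  have "V' t 0 x = U' t 0 (x + X' t 0 x)" if t: "t \<in> I" for t x
  proof (rule lagrangian_data.velocity_along_flow[OF base t, where \<xi> = \<xi>])
    show "ae01 (\<lambda>x. \<xi> r x - x = X' r 0 x)" if "r \<in> I" for r using r0[OF Xt[OF that]] by (simp add: displacement_def)
  qed (use flow[OF t] rD(2)[OF Vt[OF t] le0] in auto)
  then have "lagrangian l n c I (\<lambda>j t. X' t j) (\<lambda>j t. V' t j) (\<lambda>j t. U' t j) (\<lambda>j t. P' t j)"
    by (intro lagrangian.intro base lagrangian_axioms.intro)
  then show ?thesis using rD(3)[OF Xt] unfolding I_def n_def by blast
qed

section \<open>Taylor coefficients of the displacement\<close>

text \<open>Real parts of the classes are realized by periodic functions linked by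
  \<open>ac\<close>. The vanishing mean of a derivative makes its primitive periodic, and at the top
  order any representative serves.\<close>

lemma linf_chain_representatives:
  fixes e :: "nat \<Rightarrow> linf"
  assumes e: "\<And>j. j < n \<Longrightarrow> \<exists>c. e j = cL c + I0 (e (Suc j))" and z: "\<And>j. j < n \<Longrightarrow> pint 1 (e (Suc j)) = 0"
  shows "\<exists>A. (\<forall>j\<le>n. lbb (A j) \<and> periodic1 (A j) \<and> (\<exists>f. e j = cls f \<and> lbb f \<and> ae01 (\<lambda>x. A j x = Re (f x)))) \<and>
     (\<forall>j<n. ac (A j) (A (Suc j)))"
proof -
  have "\<exists>f. e j = cls f \<and> lbb f" for j using linf_cases[of "e j"] by metis
  then obtain f where f: "\<And>j. e j = cls (f j)" "\<And>j. lbb (f j)" by metis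
  from e have "\<exists>c. j < n \<longrightarrow> e j = cL c + I0 (e (Suc j))" for j by blast
  then obtain c where c: "\<And>j. j < n \<Longrightarrow> e j = cL (c j) + I0 (e (Suc j))" by metis
  \<comment> \<open>Below the top order the representative is the primitive of the next class
    itself, so that its periodic extension is exactly a primitive and not only almost
    everywhere.\<close>
  define G where "G j = (if j < n then (\<lambda>x. Re (c j + pint (clamp01 x) (e (Suc j)))) else (\<lambda>x. Re (f j x)))" for j
  define A where "A j x = G j (frac x)" for j x
  have lG: "lbb (G j)" for j
  proof (cases "j < n")
    case True
    have "lbb (\<lambda>x. Re (c j + pint (clamp01 x) (e (Suc j))))" by (intro lbb_bounded_linear[OF _ bounded_linear_Re] lbb_add lbb_const lbb_pint)
    then show ?thesis using True by (simp add: G_def)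
  next
    case False then show ?thesis using lbb_bounded_linear[OF f(2) bounded_linear_Re] by (simp add: G_def)
  qed
  have aG: "ae01 (\<lambda>x. G j x = Re (f j x))" for j
  proof (cases "j < n")
    case True
    have l: "lbb (\<lambda>x. c j + pint (clamp01 x) (e (Suc j)))" by (intro lbb_add lbb_const lbb_pint)
    have "cls (\<lambda>x. c j + pint (clamp01 x) (e (Suc j))) = cls (f j)"
      unfolding f(1)[symmetric] c[OF True] cL_def I0_def by (rule cls_simps(3)[OF lbb_const lbb_pint])
    then have "ae01 (\<lambda>x. c j + pint (clamp01 x) (e (Suc j)) = f j x)" using cls_eq_iff[OF l f(2)] by simp
    then show ?thesis by (rule ae01_mono) (use True in \<open>simp add: G_def flip: plus_complex.sel(1)\<close>)
  qed (simp add: G_def ae01_always)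
  have aA: "ae01 (\<lambda>x. A j x = Re (f j x))" for j
  proof (rule ae01_mp2[OF aG ae01_always[of "\<lambda>x. x \<in> {0..<1}"]])
    fix x assume "G j x = Re (f j x)" "x \<in> {0..<1::real}"
    then show "A j x = Re (f j x)" by (simp add: A_def frac_eq[THEN iffD2])
  qed simp
  have lA: "lbb (A j)" and pA: "periodic1 (A j)" for j
    unfolding A_def[abs_def] by (rule lbb_frac[OF lG], rule periodic1_frac_comp)
  have iA: "integral {0..x} (A j) = Re (pint x (e j))" if x: "x \<in> {0..1}" for x j
  proof -
    have "integral {0..x} (A j) = integral {0..x} (\<lambda>x. Re (f j x))" by (rule ae01_integral_eq[OF aA]) (use x in auto)
    also have "\<dots> = Re (integral {0..x} (f j))"
      using integral_linear[OF lbb_integrable[OF f(2)] bounded_linear_Re] by (simp add: o_def)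
    also have "integral {0..x} (f j) = pint x (e j)" unfolding f(1) by (rule pint_cls[OF f(2) x, symmetric])
    finally show ?thesis .
  qed
  have "ac (A j) (A (Suc j))" if j: "j < n" for j
  proof -
    obtain H where H: "ac H (A (Suc j))" "H 0 = G j 0" by (rule ac_primitive_exists[OF lbb_absolutely_integrable[OF lA], where c = "G j 0"])
    have "integral {0..1} (A (Suc j)) = 0" using iA[of 1 "Suc j"] z[OF j] by simp
    then have "H 1 - H 0 = 0" using acD[OF H(1) zero_le_one] by simp
    then have pH: "periodic1 H" using periodic_integral_shift[OF H(1) pA] unfolding periodic1_def by (metis eq_iff_diff_eq_0)
    have "H x = A j x" for x
    proof -
      have fx: "frac x \<in> {0..1}" "0 \<le> frac x" by (auto simp: frac_lt_1 less_imp_le)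
      have G0: "G j 0 = Re (c j)" using j by (simp add: G_def)
      have "H x = H (frac x)" using periodic1_frac[OF pH] by simp
      also have "H (frac x) = G j 0 + Re (pint (frac x) (e (Suc j)))"
        using acD[OF H(1) fx(2)] H(2) iA[OF fx(1), of "Suc j"] by simp
      also have "\<dots> = G j (frac x)" unfolding G0 using j fx(1) by (simp add: G_def)
      finally show ?thesis unfolding A_def .
    qed
    then have "H = A j" by (rule ext)
    with H(1) show ?thesis by simp
  qed
  then show ?thesis using lA pA f aA by (intro exI[of _ A]) blast
qed

section \<open>Space structure of the Taylor coefficients and convergence of the expansion\<close>

context lag_local
begin

text \<open>Being linked by a primitive and having mean zero are closed linear relations; they hold
  for the classes of \<open>X j t\<close> at all times and are inherited by every time
  derivative.\<close>

lemma taylor_coefficients: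
  obtains R e where "R > 0"
    "\<And>j N s t. j \<le> n \<Longrightarrow> s \<in> I1 \<Longrightarrow> t \<in> I1 \<Longrightarrow> norm (rcls (X j s) - (\<Sum>k<N. (s - t) ^ k *\<^sub>R e j k t)) \<le> C * (R * \<bar>s - t\<bar>) ^ N"
    "\<And>j k t. j < n \<Longrightarrow> t \<in> I1 \<Longrightarrow> \<exists>c. e j k t = cL c + I0 (e (Suc j) k t)"
    "\<And>j k t. j < n \<Longrightarrow> t \<in> I1 \<Longrightarrow> pint 1 (e (Suc j) k t) = 0"
proof -
  obtain R where R: "R > 0" "\<And>N j. j \<le> n \<Longrightarrow> curve_bounded I1 N C R (\<lambda>t. rcls (X j t))" using local_analytic by blast
  have "\<exists>e. j \<le> n \<longrightarrow> (\<forall>N. curve_bd I1 N C R (\<lambda>t. rcls (X j t)) e)" for j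
    using curve_bounded_imp_smooth[OF I1(1), of C R "\<lambda>t. rcls (X j t)"] R(2)[of j] by blast
  then obtain e where e: "\<And>j N. j \<le> n \<Longrightarrow> curve_bd I1 N C R (\<lambda>t. rcls (X j t)) (e j)" by metis
  have e0: "e j 0 t = rcls (X j t)" if "j \<le> n" "t \<in> I1" for j t using e[OF that(1), of 0] that(2) unfolding curve_bd_def by blast
  have e1: "(e j k has_vector_derivative real (Suc k) *\<^sub>R e j (Suc k) t) (at t)" if "j \<le> n" "t \<in> I1" for j k t
    using e[OF that(1), of "Suc k"] that(2) unfolding curve_bd_def by blast
  have A: "\<exists>c. e j k t = cL c + I0 (e (Suc j) k t)" if j: "j < n" and t: "t \<in> I1" for j k t
    using t
  proof (induction k arbitrary: t)
    case 0
    have "rcls (X j t) = cL (complex_of_real (X j t 0)) + I0 (rcls (X (Suc j) t))"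
      using j by (intro cls_ac ac_complex_of_real lbb_complex_of_real X inI[OF 0]) auto
    then show ?case using e0[of j t] e0[of "Suc j" t] j 0 by auto
  next
    case (Suc k)
    have "\<exists>c. real (Suc k) *\<^sub>R e j (Suc k) t = cL c + I0 (real (Suc k) *\<^sub>R e (Suc j) (Suc k) t)"
      by (rule has_vector_derivative_wdl[OF I1(1) Suc.prems e1 e1 Suc.IH]) (use j Suc.prems in auto)
    then obtain c where c: "real (Suc k) *\<^sub>R e j (Suc k) t = cL c + I0 (real (Suc k) *\<^sub>R e (Suc j) (Suc k) t)" ..
    have "e j (Suc k) t = (1 / real (Suc k)) *\<^sub>R (real (Suc k) *\<^sub>R e j (Suc k) t)" by simp
    also have "\<dots> = cL ((1 / real (Suc k)) *\<^sub>R c) + I0 ((1 / real (Suc k)) *\<^sub>R (real (Suc k) *\<^sub>R e (Suc j) (Suc k) t))"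
      unfolding c scaleR_add_right linear_scale[OF bounded_linear.linear[OF bounded_linear_cL]] linear_scale[OF bounded_linear.linear[OF bounded_linear_I0]] ..
    finally show ?case by auto
  qed
  have B: "pint 1 (e (Suc j) k t) = 0" if j: "j < n" and t: "t \<in> I1" for j k t
    using t
  proof (induction k arbitrary: t)
    case 0
    have lX: "lbb (X (Suc j) t)" using X(1)[OF inI[OF 0], of "Suc j"] j by simp
    have "integral {0..1} (X (Suc j) t) = X j t 1 - X j t 0" using acD[OF X(3)[OF inI[OF 0] j] zero_le_one] by simp
    also have "\<dots> = 0" using X(2)[OF inI[OF 0], of j] j unfolding periodic1_def by (metis add_0 diff_self less_imp_le)
    finally have z: "integral {0..1} (X (Suc j) t) = 0" .
    have "integral {0..1} (\<lambda>x. complex_of_real (X (Suc j) t x)) = complex_of_real (integral {0..1} (X (Suc j) t))"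
      using integral_linear[OF lbb_integrable[OF lX] bounded_linear_of_real] by (simp add: o_def)
    then have "pint 1 (rcls (X (Suc j) t)) = 0" using pint_cls[OF lbb_complex_of_real[OF lX], of 1] z by simp
    then show ?case using e0[of "Suc j" t] j 0 by simp
  next
    case (Suc k)
    have "((\<lambda>s. pint 1 (e (Suc j) k s)) has_vector_derivative pint 1 (real (Suc k) *\<^sub>R e (Suc j) (Suc k) t)) (at t)"
      by (rule bounded_linear.has_vector_derivative[OF bounded_linear_pint e1]) (use j Suc.prems in auto)
    moreover have "((\<lambda>s. pint 1 (e (Suc j) k s)) has_vector_derivative 0) (at t)"
      by (rule has_vector_derivative_transform_within_open[OF has_vector_derivative_const[of 0] I1(1) Suc.prems]) (simp add: Suc.IH)
    ultimately have "pint 1 (real (Suc k) *\<^sub>R e (Suc j) (Suc k) t) = 0" by (rule vector_derivative_unique_at)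
    then show ?case unfolding linear_scale[OF bounded_linear.linear[OF bounded_linear_pint]] by simp
  qed
  have T: "norm (rcls (X j s) - (\<Sum>k<N. (s - t) ^ k *\<^sub>R e j k t)) \<le> C * (R * \<bar>s - t\<bar>) ^ N" if "j \<le> n" "s \<in> I1" "t \<in> I1" for j N s t
    by (rule curve_bd_taylor[OF I1(2) e[OF that(1)] less_imp_le[OF C_pos(1)] R(1) that(2,3)])
  show thesis by (rule that[of R e]) (fact R(1), fact T, fact A, fact B)
qed

text \<open>The Taylor error C (R |s - t|)^N holds for all space derivatives up to order n at once,
  so the sum in \<open>Wnorm\<close> tends to 0 for R |s - t| < 1.\<close>

lemma local_expansion:
  assumes t: "t \<in> I1" and f: "\<And>s j. s \<in> I1 \<Longrightarrow> j \<le> n \<Longrightarrow> weak_deriv j (f s) (X j s)"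
  shows "\<exists>R a. R > 0 \<and> (\<forall>k. a k \<in> Winf n) \<and>
    (\<forall>s\<in>I1. R * \<bar>s - t\<bar> < 1 \<longrightarrow> (\<lambda>N. Wnorm n (\<lambda>x. f s x - (\<Sum>k<N. (s - t) ^ k * a k x))) \<longlonglongrightarrow> 0)"
proof (rule taylor_coefficients)
  fix R e assume R: "R > 0"
    and T: "\<And>j N s t. j \<le> n \<Longrightarrow> s \<in> I1 \<Longrightarrow> t \<in> I1 \<Longrightarrow> norm (rcls (X j s) - (\<Sum>k<N. (s - t) ^ k *\<^sub>R e j k t)) \<le> C * (R * \<bar>s - t\<bar>) ^ N"
    and A: "\<And>j k t. j < n \<Longrightarrow> t \<in> I1 \<Longrightarrow> \<exists>c. e j k t = cL c + I0 (e (Suc j) k t)"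
    and B: "\<And>j k t. j < n \<Longrightarrow> t \<in> I1 \<Longrightarrow> pint 1 (e (Suc j) k t) = 0"
  have "\<forall>k. \<exists>A. (\<forall>j\<le>n. lbb (A j) \<and> periodic1 (A j) \<and> (\<exists>f. e j k t = cls f \<and> lbb f \<and> ae01 (\<lambda>x. A j x = Re (f x)))) \<and>
     (\<forall>j<n. ac (A j) (A (Suc j)))"
    by (rule allI, rule linf_chain_representatives) (use A B t in auto)
  from choice[OF this] obtain a where a: "\<And>k j. j \<le> n \<Longrightarrow> lbb (a k j) \<and> periodic1 (a k j) \<and> (\<exists>f. e j k t = cls f \<and> lbb f \<and> ae01 (\<lambda>x. a k j x = Re (f x)))"
    "\<And>k j. j < n \<Longrightarrow> ac (a k j) (a k (Suc j))" by blast
  have aW: "a k 0 \<in> Winf n" for k by (rule Winf_if_chain) (use a in auto)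
  have wa: "weak_deriv j (a k 0) (a k j)" if "j \<le> n" for k j by (rule weak_deriv_if_chain[of n "a k"]) (use a that in auto)
  have lim: "(\<lambda>N. Wnorm n (\<lambda>x. f s x - (\<Sum>k<N. (s - t) ^ k * a k 0 x))) \<longlonglongrightarrow> 0" if s: "s \<in> I1" and Rs: "R * \<bar>s - t\<bar> < 1" for s
  proof -
    have w: "weak_deriv j (\<lambda>x. f s x - (\<Sum>k<N. (s - t) ^ k * a k 0 x)) (\<lambda>x. X j s x - (\<Sum>k<N. (s - t) ^ k * a k j x))" if "j \<le> n" for j N
    proof (induction N)
      case 0 then show ?case using f[OF s that] by simp
    next
      case (Suc N)
      from weak_deriv_add_scale[OF Suc wa[OF that], where c = "- ((s - t) ^ N)"] show ?case by (simp add: algebra_simps)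
    qed
    have b: "ae01 (\<lambda>x. \<bar>X j s x - (\<Sum>k<N. (s - t) ^ k * a k j x)\<bar> \<le> C * (R * \<bar>s - t\<bar>) ^ N)" if j: "j \<le> n" for j N
    proof -
      have "\<forall>k. \<exists>f. e j k t = cls f \<and> lbb f \<and> ae01 (\<lambda>x. a k j x = Re (f x))" using a(1)[OF j] by blast
      from choice[OF this] obtain g where g: "\<And>k. e j k t = cls (g k)" "\<And>k. lbb (g k)" "\<And>k. ae01 (\<lambda>x. a k j x = Re (g k x))" by blast
      have lX: "lbb (\<lambda>x. complex_of_real (X j s x))" by (rule lbb_complex_of_real[OF X(1)[OF inI[OF s] j]])
      have ls: "lbb (\<lambda>x. \<Sum>k<N. (s - t) ^ k *\<^sub>R g k x)" by (intro lbb_sum lbb_scaleR g)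
      have l: "lbb (\<lambda>x. complex_of_real (X j s x) - (\<Sum>k<N. (s - t) ^ k *\<^sub>R g k x))" by (rule lbb_diff[OF lX ls])
      have "cls (\<lambda>x. complex_of_real (X j s x) - (\<Sum>k<N. (s - t) ^ k *\<^sub>R g k x)) = rcls (X j s) - (\<Sum>k<N. (s - t) ^ k *\<^sub>R e j k t)"
        unfolding cls_simps(4)[OF lX ls] g(1) by (simp add: cls_sum lbb_scaleR g(2) cls_simps(7))
      with T[OF j s t, of N] have "norm (cls (\<lambda>x. complex_of_real (X j s x) - (\<Sum>k<N. (s - t) ^ k *\<^sub>R g k x))) \<le> C * (R * \<bar>s - t\<bar>) ^ N" by simp
      moreover have "0 \<le> C * (R * \<bar>s - t\<bar>) ^ N" using C_pos(1) R by simp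
      ultimately have "ae01 (\<lambda>x. norm (complex_of_real (X j s x) - (\<Sum>k<N. (s - t) ^ k *\<^sub>R g k x)) \<le> C * (R * \<bar>s - t\<bar>) ^ N)"
        using norm_cls_le_iff[OF l] by blast
      then show ?thesis
      proof (rule ae01_mp2[OF _ ae01_all_nat[OF g(3)]])
        fix x assume n: "norm (complex_of_real (X j s x) - (\<Sum>k<N. (s - t) ^ k *\<^sub>R g k x)) \<le> C * (R * \<bar>s - t\<bar>) ^ N"
          and r: "\<forall>k. a k j x = Re (g k x)"
        have "X j s x - (\<Sum>k<N. (s - t) ^ k * a k j x) = Re (complex_of_real (X j s x) - (\<Sum>k<N. (s - t) ^ k *\<^sub>R g k x))" using r by simp
        then show "\<bar>X j s x - (\<Sum>k<N. (s - t) ^ k * a k j x)\<bar> \<le> C * (R * \<bar>s - t\<bar>) ^ N"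
          using abs_Re_le_cmod order_trans[OF _ n] by metis
      qed
    qed
    have W0: "norm (Wnorm n (\<lambda>x. f s x - (\<Sum>k<N. (s - t) ^ k * a k 0 x))) \<le> (\<Sum>j\<le>n. C * (R * \<bar>s - t\<bar>) ^ N)" for N
      using Wnorm_bounds(1)[OF w b, of n N] Wnorm_bounds(2)[OF w b, of n N] by simp
    have "(\<lambda>N. \<Sum>j\<le>n. C * (R * \<bar>s - t\<bar>) ^ N) \<longlonglongrightarrow> (\<Sum>j\<le>n. C * 0)"
      by (intro tendsto_sum tendsto_mult tendsto_const LIMSEQ_power_zero) (use R Rs in simp)
    then have z: "(\<lambda>N. \<Sum>j\<le>n. C * (R * \<bar>s - t\<bar>) ^ N) \<longlonglongrightarrow> 0" by simp
    show ?thesis by (rule Lim_null_comparison[OF always_eventually z]) (use W0 in blast)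
  qed
  show ?thesis using R aW lim by (intro exI[of _ R] exI[of _ "\<lambda>k. a k 0"]) blast
qed

end
theorem theorem4:
  fixes l :: nat and c :: "nat \<Rightarrow> nat \<Rightarrow> real" and T :: real
    and u0 :: "real \<Rightarrow> real" and u \<xi> :: "real \<Rightarrow> real \<Rightarrow> real"
  assumes "l \<ge> 1"
    and "flux_coeffs l c"
    and "u0 \<in> Winf (2 * l - 1)"
    and "lwp_solution l c T u0 u"
    and "flow_map T u \<xi>"
  shows "analytic_in {-T<..<T} (Winf (2 * l - 1)) (Wnorm (2 * l - 1)) (displacement \<xi>)"
proof -
  define n where "n = 2 * l - 1"
  have n_pos: "1 \<le> n" using assms(1) by (simp add: n_def)
  let ?I = "{-T<..<T}"
  from lagrangian_formulation[OF assms(1,4,5)] obtain X V U P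
    where lag: "lagrangian l n c ?I X V U P"
      and w: "\<And>t j. t \<in> ?I \<Longrightarrow> j \<le> n \<Longrightarrow> weak_deriv j (displacement \<xi> t) (X j t)"
    unfolding n_def by blast
  interpret lagrangian l n c ?I X V U P by (rule lag)
  have T: "T > 0" and disp: "\<forall>t\<in>?I. displacement \<xi> t \<in> Winf n"
    using assms(4,5) unfolding lwp_solution_def C1_in_def C0_in_def n_def by blast+
  have "0 \<in> ?I" using T by simp
  have "displacement \<xi> 0 = (\<lambda>x. 0)"
  proof
    fix x
    \<comment> \<open>The choice operator only names a velocity field that satisfies the integral
      equation; over the degenerate interval from 0 to 0 the integral vanishes, so the flow starts
      at the identity and has Jacobian 1.\<close>
    have "\<xi> 0 x = x + (LBINT s=ereal 0..ereal 0. (SOME U. (\<forall>t\<in>?I. \<forall>x. \<xi> t x = x + (LBINT s=ereal 0..ereal t. U s (\<xi> s x)))) s (\<xi> s x))"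
      using someI_ex[of "\<lambda>U. \<forall>t\<in>?I. \<forall>x. \<xi> t x = x + (LBINT s=ereal 0..ereal t. U s (\<xi> s x))"] assms(5) \<open>0 \<in> ?I\<close>
      unfolding flow_map_def by blast
    then show "displacement \<xi> 0 x = 0" by (simp add: displacement_def)
  qed
  with w[OF \<open>0 \<in> ?I\<close> n_pos] have "weak_deriv 1 (\<lambda>x. 0) (X 1 0)" by simp
  moreover have "weak_deriv 1 (\<lambda>x. 0) (\<lambda>x. 0)" by (rule weak_deriv_if_ac[OF ac_const]) (simp_all add: periodic1_def)
  ultimately have "ae01 (\<lambda>x. X 1 0 x = 0)" by (rule weak_deriv_unique)
  then have "ae01 (\<lambda>x. 1 \<le> jac 0 x)" by (rule ae01_mono) simp
  then have g0: "0 \<in> good" unfolding good_def using \<open>0 \<in> ?I\<close> zero_less_one by blast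
  have good: "good = ?I"
  proof (rule good_eq[OF _ is_interval_oo g0])
    assume "l = 1"
    then show "\<forall>w. flux_sum 1 c w = (w 0)\<^sup>2 + (w 1)\<^sup>2 / 2" using camassa_holm_flux assms(2) by blast
  qed
  have "\<exists>r>0. \<exists>a. (\<forall>k. a k \<in> Winf n) \<and>
      (\<forall>s\<in>?I. \<bar>s - t\<bar> < r \<longrightarrow> (\<lambda>N. Wnorm n (\<lambda>x. displacement \<xi> s x - (\<Sum>k<N. (s - t) ^ k * a k x))) \<longlonglongrightarrow> 0)"
    if t: "t \<in> ?I" for t
  proof -
    \<comment> \<open>Half the distance from t to the nearer end of (-T, T), so that the closed
      interval of radius \<delta> around t stays inside.\<close>
    define \<delta> where "\<delta> = (T - \<bar>t\<bar>) / 2"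
    have \<delta>: "\<delta> > 0" using t by (auto simp: \<delta>_def)
    have "{t - \<delta>..t + \<delta>} \<subseteq> good" unfolding good
    proof
      fix x assume "x \<in> {t - \<delta>..t + \<delta>}"
      then have "t - \<delta> \<le> x" "x \<le> t + \<delta>" by auto
      moreover have "2 * \<delta> = T - \<bar>t\<bar>" by (simp add: \<delta>_def)
      ultimately have "- T < x" "x < T" using \<delta> by linarith+
      then show "x \<in> ?I" by simp
    qed
    from exists_lag_local[OF this] obtain d B where L: "lag_local l n c ?I X V U P {t - \<delta><..<t + \<delta>} d B" by blast
    have "t \<in> {t - \<delta><..<t + \<delta>}" using \<delta> by simp
    then have "\<exists>R a. R > 0 \<and> (\<forall>k. a k \<in> Winf n) \<and>
      (\<forall>s\<in>{t - \<delta><..<t + \<delta>}. R * \<bar>s - t\<bar> < 1 \<longrightarrow> (\<lambda>N. Wnorm n (\<lambda>x. displacement \<xi> s x - (\<Sum>k<N. (s - t) ^ k * a k x))) \<longlonglongrightarrow> 0)"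
    proof (rule lag_local.local_expansion[OF L])
      fix s j assume s: "s \<in> {t - \<delta><..<t + \<delta>}" and j: "j \<le> n"
      have "s \<in> ?I" by (rule lag_local.inI[OF L s])
      then show "weak_deriv j (displacement \<xi> s) (X j s)" by (rule w[OF _ j])
    qed
    then obtain R a where R: "R > 0" and a: "\<forall>k. a k \<in> Winf n"
      and lim: "\<And>s. s \<in> {t - \<delta><..<t + \<delta>} \<Longrightarrow> R * \<bar>s - t\<bar> < 1 \<Longrightarrow> (\<lambda>N. Wnorm n (\<lambda>x. displacement \<xi> s x - (\<Sum>k<N. (s - t) ^ k * a k x))) \<longlonglongrightarrow> 0"
      by blast
    have "(\<lambda>N. Wnorm n (\<lambda>x. displacement \<xi> s x - (\<Sum>k<N. (s - t) ^ k * a k x))) \<longlonglongrightarrow> 0" if "\<bar>s - t\<bar> < min \<delta> (1 / R)" for s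
    proof (rule lim)
      show "s \<in> {t - \<delta><..<t + \<delta>}" using that by (auto simp: abs_if split: if_splits)
      show "R * \<bar>s - t\<bar> < 1" using that R by (simp add: less_divide_eq mult.commute)
    qed
    moreover have "0 < min \<delta> (1 / R)" using \<delta> R by simp
    ultimately show ?thesis using a by (intro exI[of _ "min \<delta> (1 / R)"]) blast
  qed
  then show ?thesis using disp unfolding analytic_in_def n_def by blast
qed

end
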